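(* If $\mathrm{ZFC}$ is consistent, then so is the theory $\mathrm{ZFC}$ + "there exist a MAD family $\mathcal A_0$ of cardinality $\omega_1$ and a MAD family $\mathcal A_1$ of cardinality $\mathfrak c>\omega_1$ such that $\operatorname{CL}(\Psi(\mathcal A_0))$ is pseudocompact but $\operatorname{CL}(\Psi(\mathcal A_1))$ is not pseudocompact".
   Context: An almost disjoint family is an infinite collection of infinite subsets of $\omega$ whose pairwise intersections are finite; it is MAD if it is maximal under inclusion among almost disjoint families. For an almost disjoint family $\mathcal A$, the Isbell-Mrówka space $\Psi(\mathcal A)$ is the set $\mathcal A\cup\omega$ topologized so that $\omega$ is open and discrete and $\{\{A\}\cup(A\setminus n): n\in\omega\}$ is a local base at $A\in\mathcal A$. For a topological space $X$, $\operatorname{CL}(X)$ is the set of nonempty closed subsets of $X$ with the Vietoris topology, whose base consists of the sets $\langle U_0,\dots,U_n\rangle=\{F\in \operatorname{CL}(X): F\subseteq\bigcup_{i\le n}U_i \text{ and } F\cap U_i\ne\emptyset \text{ for all } i\le n\}$, with $U_0,\dots,U_n$ open in $X$. A space is pseudocompact if every continuous function from it to $\mathbb R$ is bounded. $\mathfrak c$ denotes the cardinality of the continuum. *)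

theory Defs
  imports Main
begin

section \<open>First-order logic in the language of set theory\<close>

text \<open>Formulas over the signature with equality and one binary relation symbol. The only terms are
  variables, written as de Bruijn indices.\<close>

datatype fm = Bot | Mem nat nat | Eq nat nat | Imp fm fm | All fm

fun lift :: "(nat \<Rightarrow> nat) \<Rightarrow> nat \<Rightarrow> nat" where
  "lift r 0 = 0"
| "lift r (Suc i) = Suc (r i)"

primrec ren :: "(nat \<Rightarrow> nat) \<Rightarrow> fm \<Rightarrow> fm" where
  "ren r Bot = Bot"
| "ren r (Mem i j) = Mem (r i) (r j)"
| "ren r (Eq i j) = Eq (r i) (r j)"
| "ren r (Imp p q) = Imp (ren r p) (ren r q)"
| "ren r (All p) = All (ren (lift r) p)"

primrec fv :: "fm \<Rightarrow> nat set" where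
  "fv Bot = {}"
| "fv (Mem i j) = {i, j}"
| "fv (Eq i j) = {i, j}"
| "fv (Imp p q) = fv p \<union> fv q"
| "fv (All p) = {i. Suc i \<in> fv p}"

text \<open>Instantiates variable 0 by variable \<open>t\<close> and lowers the other indices.\<close>

definition inst :: "nat \<Rightarrow> fm \<Rightarrow> fm" where
  "inst t p = ren (case_nat t id) p"

text \<open>A Hilbert calculus for classical first-order logic with equality. The theories used below
  consist of sentences, so that generalization needs no side condition.\<close>

inductive provable :: "fm set \<Rightarrow> fm \<Rightarrow> bool" (infix "\<turnstile>" 40) for T where
  hyp:  "p \<in> T \<Longrightarrow> T \<turnstile> p"
| K:    "T \<turnstile> Imp p (Imp q p)"
| S:    "T \<turnstile> Imp (Imp p (Imp q r)) (Imp (Imp p q) (Imp p r))"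
| DN:   "T \<turnstile> Imp (Imp (Imp p Bot) Bot) p"
| spec: "T \<turnstile> Imp (All p) (inst t p)"
| dist: "T \<turnstile> Imp (All (Imp (ren Suc p) q)) (Imp p (All q))"
| refl: "T \<turnstile> Eq i i"
| repl: "T \<turnstile> Imp (Eq i j) (Imp (inst i p) (inst j p))"
| MP:   "T \<turnstile> Imp p q \<Longrightarrow> T \<turnstile> p \<Longrightarrow> T \<turnstile> q"
| gen:  "T \<turnstile> p \<Longrightarrow> T \<turnstile> All p"

definition consistent :: "fm set \<Rightarrow> bool" where
  "consistent T \<longleftrightarrow> \<not> (T \<turnstile> Bot)"


section \<open>Writing formulas with named variables\<close>

text \<open>
  A \<open>form\<close> is a formula depending on the number \<open>n\<close> of binders above it. A variable is represented
  by its level, the number of binders above the one that binds it (so the outermost bound variable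
  is \<open>0\<close>); under \<open>n\<close> binders the variable of level \<open>x < n\<close> has de Bruijn index \<open>n - Suc x\<close>.
  Object-level binders can thus be written with HOL abstractions, without capture.
\<close>

type_synonym form = "nat \<Rightarrow> fm"

definition fmem :: "nat \<Rightarrow> nat \<Rightarrow> form" (infix "\<^bold>\<in>" 50) where
  "(x \<^bold>\<in> y) n = Mem (n - Suc x) (n - Suc y)"

definition feq :: "nat \<Rightarrow> nat \<Rightarrow> form" (infix "\<^bold>=" 50) where
  "(x \<^bold>= y) n = Eq (n - Suc x) (n - Suc y)"

definition fimp :: "form \<Rightarrow> form \<Rightarrow> form" (infixr "\<^bold>\<longrightarrow>" 25) where
  "(P \<^bold>\<longrightarrow> Q) n = Imp (P n) (Q n)"

definition fnot :: "form \<Rightarrow> form" ("\<^bold>\<not> _" [40] 40) where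
  "(\<^bold>\<not> P) n = Imp (P n) Bot"

definition fall :: "(nat \<Rightarrow> form) \<Rightarrow> form" (binder "\<^bold>\<forall>" 10) where
  "fall P n = All (P n (Suc n))"

definition fconj :: "form \<Rightarrow> form \<Rightarrow> form" (infixr "\<^bold>\<and>" 35) where
  "(P \<^bold>\<and> Q) = (\<^bold>\<not> (P \<^bold>\<longrightarrow> \<^bold>\<not> Q))"

definition fdisj :: "form \<Rightarrow> form \<Rightarrow> form" (infixr "\<^bold>\<or>" 30) where
  "(P \<^bold>\<or> Q) = (\<^bold>\<not> P \<^bold>\<longrightarrow> Q)"

definition fiff :: "form \<Rightarrow> form \<Rightarrow> form" (infixr "\<^bold>\<longleftrightarrow>" 25) where
  "(P \<^bold>\<longleftrightarrow> Q) = ((P \<^bold>\<longrightarrow> Q) \<^bold>\<and> (Q \<^bold>\<longrightarrow> P))"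

definition fex :: "(nat \<Rightarrow> form) \<Rightarrow> form" (binder "\<^bold>\<exists>" 10) where
  "(\<^bold>\<exists>x. P x) = (\<^bold>\<not> (\<^bold>\<forall>x. \<^bold>\<not> P x))"

definition fex1 :: "(nat \<Rightarrow> form) \<Rightarrow> form" (binder "\<^bold>\<exists>\<^bold>!" 10) where
  "(\<^bold>\<exists>\<^bold>!x. P x) = (\<^bold>\<exists>x. P x \<^bold>\<and> (\<^bold>\<forall>y. P y \<^bold>\<longrightarrow> y \<^bold>= x))"

definition fball :: "nat \<Rightarrow> (nat \<Rightarrow> form) \<Rightarrow> form" where
  "fball a P = (\<^bold>\<forall>x. x \<^bold>\<in> a \<^bold>\<longrightarrow> P x)"

definition fbex :: "nat \<Rightarrow> (nat \<Rightarrow> form) \<Rightarrow> form" where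
  "fbex a P = (\<^bold>\<exists>x. x \<^bold>\<in> a \<^bold>\<and> P x)"

syntax
  "_fball" :: "pttrn \<Rightarrow> nat \<Rightarrow> form \<Rightarrow> form" ("(3\<^bold>\<forall>_\<^bold>\<in>_./ _)" [0, 0, 10] 10)
  "_fbex" :: "pttrn \<Rightarrow> nat \<Rightarrow> form \<Rightarrow> form" ("(3\<^bold>\<exists>_\<^bold>\<in>_./ _)" [0, 0, 10] 10)
translations
  "\<^bold>\<forall>x\<^bold>\<in>a. P" \<rightleftharpoons> "CONST fball a (\<lambda>x. P)"
  "\<^bold>\<exists>x\<^bold>\<in>a. P" \<rightleftharpoons> "CONST fbex a (\<lambda>x. P)"

definition sentence :: "form \<Rightarrow> fm" where
  "sentence P = P 0"

text \<open>Sentence obtained by quantifying universally over \<open>k\<close> parameters, which get levels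
  \<open>0, \<dots>, k - 1\<close>.\<close>

definition closure :: "nat \<Rightarrow> form \<Rightarrow> fm" where
  "closure k P = (All ^^ k) (P k)"

text \<open>The formula \<open>p\<close> with the variable of level \<open>s i\<close> put in place of its free variable \<open>i\<close>.\<close>

definition plug :: "fm \<Rightarrow> (nat \<Rightarrow> nat) \<Rightarrow> form" where
  "plug p s n = ren (\<lambda>i. n - Suc (s i)) p"


section \<open>Basic set-theoretic notions\<close>

definition fsub :: "nat \<Rightarrow> nat \<Rightarrow> form" (infix "\<^bold>\<subseteq>" 50) where
  "(x \<^bold>\<subseteq> y) = (\<^bold>\<forall>z. z \<^bold>\<in> x \<^bold>\<longrightarrow> z \<^bold>\<in> y)"

definition is_empty :: "nat \<Rightarrow> form" where
  "is_empty x = (\<^bold>\<forall>z. \<^bold>\<not> z \<^bold>\<in> x)"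

definition is_upair :: "nat \<Rightarrow> nat \<Rightarrow> nat \<Rightarrow> form" where
  "is_upair p x y = (\<^bold>\<forall>z. z \<^bold>\<in> p \<^bold>\<longleftrightarrow> z \<^bold>= x \<^bold>\<or> z \<^bold>= y)"

definition is_un :: "nat \<Rightarrow> nat \<Rightarrow> nat \<Rightarrow> form" where
  "is_un u x y = (\<^bold>\<forall>z. z \<^bold>\<in> u \<^bold>\<longleftrightarrow> z \<^bold>\<in> x \<^bold>\<or> z \<^bold>\<in> y)"

definition is_int :: "nat \<Rightarrow> nat \<Rightarrow> nat \<Rightarrow> form" where
  "is_int u x y = (\<^bold>\<forall>z. z \<^bold>\<in> u \<^bold>\<longleftrightarrow> z \<^bold>\<in> x \<^bold>\<and> z \<^bold>\<in> y)"

definition is_diff :: "nat \<Rightarrow> nat \<Rightarrow> nat \<Rightarrow> form" where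
  "is_diff u x y = (\<^bold>\<forall>z. z \<^bold>\<in> u \<^bold>\<longleftrightarrow> z \<^bold>\<in> x \<^bold>\<and> \<^bold>\<not> z \<^bold>\<in> y)"

definition is_Union :: "nat \<Rightarrow> nat \<Rightarrow> form" where
  "is_Union u x = (\<^bold>\<forall>z. z \<^bold>\<in> u \<^bold>\<longleftrightarrow> (\<^bold>\<exists>y\<^bold>\<in>x. z \<^bold>\<in> y))"

definition is_Pow :: "nat \<Rightarrow> nat \<Rightarrow> form" where
  "is_Pow u x = (\<^bold>\<forall>z. z \<^bold>\<in> u \<^bold>\<longleftrightarrow> z \<^bold>\<subseteq> x)"

definition is_succ :: "nat \<Rightarrow> nat \<Rightarrow> form" where
  "is_succ s x = (\<^bold>\<forall>z. z \<^bold>\<in> s \<^bold>\<longleftrightarrow> z \<^bold>\<in> x \<^bold>\<or> z \<^bold>= x)"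

definition is_inductive :: "nat \<Rightarrow> form" where
  "is_inductive w =
    ((\<^bold>\<exists>e\<^bold>\<in>w. is_empty e) \<^bold>\<and> (\<^bold>\<forall>x\<^bold>\<in>w. \<^bold>\<exists>s\<^bold>\<in>w. is_succ s x))"


section \<open>The axioms of ZFC\<close>

definition extensionality :: form where
  "extensionality = (\<^bold>\<forall>x y. (\<^bold>\<forall>z. z \<^bold>\<in> x \<^bold>\<longleftrightarrow> z \<^bold>\<in> y) \<^bold>\<longrightarrow> x \<^bold>= y)"

definition foundation :: form where
  "foundation = (\<^bold>\<forall>x. \<^bold>\<not> is_empty x \<^bold>\<longrightarrow> (\<^bold>\<exists>y\<^bold>\<in>x. \<^bold>\<forall>z\<^bold>\<in>x. \<^bold>\<not> z \<^bold>\<in> y))"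

definition pairing :: form where
  "pairing = (\<^bold>\<forall>x y. \<^bold>\<exists>p. is_upair p x y)"

definition union :: form where
  "union = (\<^bold>\<forall>x. \<^bold>\<exists>u. is_Union u x)"

definition powerset :: form where
  "powerset = (\<^bold>\<forall>x. \<^bold>\<exists>u. is_Pow u x)"

definition infinity :: form where
  "infinity = (\<^bold>\<exists>w. is_inductive w)"

definition choice :: form where
  "choice = (\<^bold>\<forall>a. (\<^bold>\<forall>x\<^bold>\<in>a. \<^bold>\<not> is_empty x)
      \<^bold>\<and> (\<^bold>\<forall>x\<^bold>\<in>a. \<^bold>\<forall>y\<^bold>\<in>a. \<^bold>\<not> x \<^bold>= y \<^bold>\<longrightarrow> \<^bold>\<not> (\<^bold>\<exists>z. z \<^bold>\<in> x \<^bold>\<and> z \<^bold>\<in> y))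
    \<^bold>\<longrightarrow> (\<^bold>\<exists>c. \<^bold>\<forall>x\<^bold>\<in>a. \<^bold>\<exists>\<^bold>!z. z \<^bold>\<in> x \<^bold>\<and> z \<^bold>\<in> c))"

text \<open>In the two schemata the free variables of \<open>p\<close> other than the distinguished ones (\<open>0\<close>, resp.
  \<open>0\<close> and \<open>1\<close>) are parameters, standing for the variables of levels \<open>0, \<dots>, k - 1\<close>.\<close>

definition separation :: "fm \<Rightarrow> form" where
  "separation p = (\<^bold>\<forall>a. \<^bold>\<exists>b. \<^bold>\<forall>x. x \<^bold>\<in> b \<^bold>\<longleftrightarrow> x \<^bold>\<in> a \<^bold>\<and> plug p (case_nat x id))"

definition replacement :: "fm \<Rightarrow> form" where
  "replacement p = (let P = (\<lambda>x y. plug p (case_nat x (case_nat y id))) in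
     \<^bold>\<forall>a. (\<^bold>\<forall>x\<^bold>\<in>a. \<^bold>\<exists>\<^bold>!y. P x y) \<^bold>\<longrightarrow> (\<^bold>\<exists>b. \<^bold>\<forall>y. y \<^bold>\<in> b \<^bold>\<longleftrightarrow> (\<^bold>\<exists>x\<^bold>\<in>a. P x y)))"

definition ZFC :: "fm set" where
  "ZFC = sentence ` {extensionality, foundation, pairing, union, powerset, infinity, choice}
     \<union> {closure k (separation p) | k p. fv p \<subseteq> {..<k + 1}}
     \<union> {closure k (replacement p) | k p. fv p \<subseteq> {..<k + 2}}"


section \<open>Functions and cardinality\<close>

definition is_omega :: "nat \<Rightarrow> form" where
  "is_omega w = (is_inductive w \<^bold>\<and> (\<^bold>\<forall>v. is_inductive v \<^bold>\<longrightarrow> w \<^bold>\<subseteq> v))"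

definition is_pair :: "nat \<Rightarrow> nat \<Rightarrow> nat \<Rightarrow> form" where
  "is_pair p x y = (\<^bold>\<exists>a b. is_upair a x x \<^bold>\<and> is_upair b x y \<^bold>\<and> is_upair p a b)"

text \<open>\<open>related r x y\<close>: the pair of \<open>x\<close> and \<open>y\<close> is in \<open>r\<close>; for a function \<open>r\<close>, its value at \<open>x\<close>
  is \<open>y\<close>.\<close>

definition related :: "nat \<Rightarrow> nat \<Rightarrow> nat \<Rightarrow> form" where
  "related r x y = (\<^bold>\<exists>p\<^bold>\<in>r. is_pair p x y)"

definition is_prod :: "nat \<Rightarrow> nat \<Rightarrow> nat \<Rightarrow> form" where
  "is_prod u x y = (\<^bold>\<forall>p. p \<^bold>\<in> u \<^bold>\<longleftrightarrow> (\<^bold>\<exists>a\<^bold>\<in>x. \<^bold>\<exists>b\<^bold>\<in>y. is_pair p a b))"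

definition is_rel :: "nat \<Rightarrow> nat \<Rightarrow> nat \<Rightarrow> form" where
  "is_rel r x y = (\<^bold>\<forall>p\<^bold>\<in>r. \<^bold>\<exists>a\<^bold>\<in>x. \<^bold>\<exists>b\<^bold>\<in>y. is_pair p a b)"

definition is_fun :: "nat \<Rightarrow> nat \<Rightarrow> nat \<Rightarrow> form" where
  "is_fun f x y = (is_rel f x y \<^bold>\<and> (\<^bold>\<forall>a\<^bold>\<in>x. \<^bold>\<exists>\<^bold>!b. related f a b))"

definition is_bij :: "nat \<Rightarrow> nat \<Rightarrow> nat \<Rightarrow> form" where
  "is_bij f x y = (is_fun f x y \<^bold>\<and> (\<^bold>\<forall>b\<^bold>\<in>y. \<^bold>\<exists>\<^bold>!a. related f a b))"

definition equipotent :: "nat \<Rightarrow> nat \<Rightarrow> form" where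
  "equipotent x y = (\<^bold>\<exists>f. is_bij f x y)"

definition is_finite :: "nat \<Rightarrow> form" where
  "is_finite x = (\<^bold>\<exists>w. is_omega w \<^bold>\<and> (\<^bold>\<exists>n\<^bold>\<in>w. equipotent n x))"

text \<open>By Foundation, a set linearly ordered by membership is well-ordered by it.\<close>

definition is_ordinal :: "nat \<Rightarrow> form" where
  "is_ordinal a = ((\<^bold>\<forall>x\<^bold>\<in>a. x \<^bold>\<subseteq> a)
    \<^bold>\<and> (\<^bold>\<forall>x\<^bold>\<in>a. \<^bold>\<forall>y\<^bold>\<in>a. x \<^bold>\<in> y \<^bold>\<or> x \<^bold>= y \<^bold>\<or> y \<^bold>\<in> x))"

definition is_cardinal :: "nat \<Rightarrow> form" where
  "is_cardinal k = (is_ordinal k \<^bold>\<and> (\<^bold>\<forall>a\<^bold>\<in>k. \<^bold>\<not> equipotent a k))"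

definition has_card :: "nat \<Rightarrow> nat \<Rightarrow> form" where
  "has_card x k = (is_cardinal k \<^bold>\<and> equipotent x k)"

definition is_omega1 :: "nat \<Rightarrow> form" where
  "is_omega1 k = (\<^bold>\<exists>w. is_omega w \<^bold>\<and> is_cardinal k \<^bold>\<and> w \<^bold>\<in> k
    \<^bold>\<and> (\<^bold>\<forall>l. is_cardinal l \<^bold>\<and> w \<^bold>\<in> l \<^bold>\<longrightarrow> k \<^bold>\<subseteq> l))"

definition is_continuum :: "nat \<Rightarrow> form" where
  "is_continuum c = (\<^bold>\<exists>w u. is_omega w \<^bold>\<and> is_Pow u w \<^bold>\<and> has_card u c)"


section \<open>Topology and the real line\<close>

definition is_topology :: "nat \<Rightarrow> nat \<Rightarrow> form" where
  "is_topology T X = ((\<^bold>\<forall>U\<^bold>\<in>T. U \<^bold>\<subseteq> X)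
    \<^bold>\<and> (\<^bold>\<exists>E\<^bold>\<in>T. is_empty E) \<^bold>\<and> X \<^bold>\<in> T
    \<^bold>\<and> (\<^bold>\<forall>U\<^bold>\<in>T. \<^bold>\<forall>V\<^bold>\<in>T. \<^bold>\<exists>W\<^bold>\<in>T. is_int W U V)
    \<^bold>\<and> (\<^bold>\<forall>S. S \<^bold>\<subseteq> T \<^bold>\<longrightarrow> (\<^bold>\<exists>W\<^bold>\<in>T. is_Union W S)))"

definition is_continuous :: "nat \<Rightarrow> nat \<Rightarrow> nat \<Rightarrow> nat \<Rightarrow> nat \<Rightarrow> form" where
  "is_continuous f X T Y S = (is_fun f X Y
    \<^bold>\<and> (\<^bold>\<forall>V\<^bold>\<in>S. \<^bold>\<exists>U\<^bold>\<in>T. \<^bold>\<forall>x. x \<^bold>\<in> U \<^bold>\<longleftrightarrow> x \<^bold>\<in> X \<^bold>\<and> (\<^bold>\<exists>y\<^bold>\<in>V. related f x y)))"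

definition is_binop :: "nat \<Rightarrow> nat \<Rightarrow> form" where
  "is_binop f K = (\<^bold>\<exists>u. is_prod u K K \<^bold>\<and> is_fun f u K)"

definition is_app2 :: "nat \<Rightarrow> nat \<Rightarrow> nat \<Rightarrow> nat \<Rightarrow> form" where
  "is_app2 f x y z = (\<^bold>\<exists>p. is_pair p x y \<^bold>\<and> related f p z)"

definition is_abelian_monoid :: "nat \<Rightarrow> nat \<Rightarrow> nat \<Rightarrow> form" where
  "is_abelian_monoid K f e = (is_binop f K \<^bold>\<and> e \<^bold>\<in> K
    \<^bold>\<and> (\<^bold>\<forall>x\<^bold>\<in>K. is_app2 f x e x)
    \<^bold>\<and> (\<^bold>\<forall>x\<^bold>\<in>K. \<^bold>\<forall>y\<^bold>\<in>K. \<^bold>\<forall>z\<^bold>\<in>K. is_app2 f x y z \<^bold>\<longrightarrow> is_app2 f y x z)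
    \<^bold>\<and> (\<^bold>\<forall>x\<^bold>\<in>K. \<^bold>\<forall>y\<^bold>\<in>K. \<^bold>\<forall>z\<^bold>\<in>K. \<^bold>\<forall>u\<^bold>\<in>K. \<^bold>\<forall>v\<^bold>\<in>K. \<^bold>\<forall>r\<^bold>\<in>K.
          is_app2 f x y u \<^bold>\<and> is_app2 f y z v \<^bold>\<and> is_app2 f u z r \<^bold>\<longrightarrow> is_app2 f x v r))"

definition is_field :: "nat \<Rightarrow> nat \<Rightarrow> nat \<Rightarrow> nat \<Rightarrow> nat \<Rightarrow> form" where
  "is_field K add mul zer one =
    (is_abelian_monoid K add zer \<^bold>\<and> is_abelian_monoid K mul one \<^bold>\<and> \<^bold>\<not> zer \<^bold>= one
    \<^bold>\<and> (\<^bold>\<forall>x\<^bold>\<in>K. \<^bold>\<exists>y\<^bold>\<in>K. is_app2 add x y zer)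
    \<^bold>\<and> (\<^bold>\<forall>x\<^bold>\<in>K. \<^bold>\<not> x \<^bold>= zer \<^bold>\<longrightarrow> (\<^bold>\<exists>y\<^bold>\<in>K. is_app2 mul x y one))
    \<^bold>\<and> (\<^bold>\<forall>x\<^bold>\<in>K. \<^bold>\<forall>y\<^bold>\<in>K. \<^bold>\<forall>z\<^bold>\<in>K. \<^bold>\<forall>s\<^bold>\<in>K. \<^bold>\<forall>u\<^bold>\<in>K. \<^bold>\<forall>v\<^bold>\<in>K. \<^bold>\<forall>r\<^bold>\<in>K.
          is_app2 add y z s \<^bold>\<and> is_app2 mul x y u \<^bold>\<and> is_app2 mul x z v \<^bold>\<and> is_app2 mul x s r
          \<^bold>\<longrightarrow> is_app2 add u v r))"

text \<open>\<open>lt\<close> is the strict order.\<close>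

definition is_ordered_field :: "nat \<Rightarrow> nat \<Rightarrow> nat \<Rightarrow> nat \<Rightarrow> form" where
  "is_ordered_field K add mul lt = (\<^bold>\<exists>zer one. is_field K add mul zer one
    \<^bold>\<and> is_rel lt K K
    \<^bold>\<and> (\<^bold>\<forall>x\<^bold>\<in>K. \<^bold>\<not> related lt x x)
    \<^bold>\<and> (\<^bold>\<forall>x\<^bold>\<in>K. \<^bold>\<forall>y\<^bold>\<in>K. \<^bold>\<forall>z\<^bold>\<in>K. related lt x y \<^bold>\<and> related lt y z \<^bold>\<longrightarrow> related lt x z)
    \<^bold>\<and> (\<^bold>\<forall>x\<^bold>\<in>K. \<^bold>\<forall>y\<^bold>\<in>K. related lt x y \<^bold>\<or> x \<^bold>= y \<^bold>\<or> related lt y x)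
    \<^bold>\<and> (\<^bold>\<forall>x\<^bold>\<in>K. \<^bold>\<forall>y\<^bold>\<in>K. \<^bold>\<forall>z\<^bold>\<in>K. \<^bold>\<forall>u\<^bold>\<in>K. \<^bold>\<forall>v\<^bold>\<in>K.
          related lt x y \<^bold>\<and> is_app2 add x z u \<^bold>\<and> is_app2 add y z v \<^bold>\<longrightarrow> related lt u v)
    \<^bold>\<and> (\<^bold>\<forall>x\<^bold>\<in>K. \<^bold>\<forall>y\<^bold>\<in>K. \<^bold>\<forall>z\<^bold>\<in>K.
          related lt zer x \<^bold>\<and> related lt zer y \<^bold>\<and> is_app2 mul x y z \<^bold>\<longrightarrow> related lt zer z))"

definition is_upper_bound :: "nat \<Rightarrow> nat \<Rightarrow> nat \<Rightarrow> nat \<Rightarrow> form" where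
  "is_upper_bound b S K lt = (b \<^bold>\<in> K \<^bold>\<and> (\<^bold>\<forall>x\<^bold>\<in>S. related lt x b \<^bold>\<or> x \<^bold>= b))"

text \<open>The reals are characterized, up to isomorphism, as the complete ordered field.\<close>

definition is_reals :: "nat \<Rightarrow> nat \<Rightarrow> nat \<Rightarrow> nat \<Rightarrow> form" where
  "is_reals K add mul lt = (is_ordered_field K add mul lt
    \<^bold>\<and> (\<^bold>\<forall>S. S \<^bold>\<subseteq> K \<^bold>\<and> \<^bold>\<not> is_empty S \<^bold>\<and> (\<^bold>\<exists>b. is_upper_bound b S K lt)
        \<^bold>\<longrightarrow> (\<^bold>\<exists>b. is_upper_bound b S K lt
              \<^bold>\<and> (\<^bold>\<forall>c. is_upper_bound c S K lt \<^bold>\<longrightarrow> related lt b c \<^bold>\<or> b \<^bold>= c))))"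

text \<open>The topology whose base consists of the bounded open intervals.\<close>

definition is_interval_topology :: "nat \<Rightarrow> nat \<Rightarrow> nat \<Rightarrow> form" where
  "is_interval_topology S K lt = (\<^bold>\<forall>V. V \<^bold>\<in> S \<^bold>\<longleftrightarrow> V \<^bold>\<subseteq> K
    \<^bold>\<and> (\<^bold>\<forall>x\<^bold>\<in>V. \<^bold>\<exists>a\<^bold>\<in>K. \<^bold>\<exists>b\<^bold>\<in>K. related lt a x \<^bold>\<and> related lt x b
          \<^bold>\<and> (\<^bold>\<forall>y\<^bold>\<in>K. related lt a y \<^bold>\<and> related lt y b \<^bold>\<longrightarrow> y \<^bold>\<in> V)))"

definition is_pseudocompact :: "nat \<Rightarrow> nat \<Rightarrow> form" where
  "is_pseudocompact X T = (\<^bold>\<forall>K add mul lt S f.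
     is_reals K add mul lt \<^bold>\<and> is_interval_topology S K lt \<^bold>\<and> is_continuous f X T K S
     \<^bold>\<longrightarrow> (\<^bold>\<exists>a\<^bold>\<in>K. \<^bold>\<exists>b\<^bold>\<in>K. \<^bold>\<forall>x\<^bold>\<in>X. \<^bold>\<forall>y\<^bold>\<in>K. related f x y
            \<^bold>\<longrightarrow> related lt a y \<^bold>\<and> related lt y b))"


section \<open>Almost disjoint families, Isbell-Mrowka spaces and hyperspaces\<close>

definition is_AD :: "nat \<Rightarrow> form" where
  "is_AD A = (\<^bold>\<not> is_finite A
    \<^bold>\<and> (\<^bold>\<exists>w. is_omega w \<^bold>\<and> (\<^bold>\<forall>x\<^bold>\<in>A. x \<^bold>\<subseteq> w \<^bold>\<and> \<^bold>\<not> is_finite x))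
    \<^bold>\<and> (\<^bold>\<forall>x\<^bold>\<in>A. \<^bold>\<forall>y\<^bold>\<in>A. \<^bold>\<not> x \<^bold>= y \<^bold>\<longrightarrow> (\<^bold>\<exists>z. is_int z x y \<^bold>\<and> is_finite z)))"

definition is_MAD :: "nat \<Rightarrow> form" where
  "is_MAD A = (is_AD A \<^bold>\<and> (\<^bold>\<forall>B. is_AD B \<^bold>\<and> A \<^bold>\<subseteq> B \<^bold>\<longrightarrow> B \<^bold>= A))"

definition is_Psi_nhd :: "nat \<Rightarrow> nat \<Rightarrow> nat \<Rightarrow> form" where
  "is_Psi_nhd N x n = (\<^bold>\<exists>s d. is_upair s x x \<^bold>\<and> is_diff d x n \<^bold>\<and> is_un N s d)"

text \<open>\<open>X\<close> with topology \<open>T\<close> is the Isbell-Mrowka space of \<open>A\<close>. The union below is disjoint, as the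
  elements of \<open>A\<close> are infinite sets and those of \<open>\<omega>\<close> are finite.\<close>

definition is_Psi :: "nat \<Rightarrow> nat \<Rightarrow> nat \<Rightarrow> form" where
  "is_Psi X T A = (\<^bold>\<exists>w. is_omega w \<^bold>\<and> is_un X A w \<^bold>\<and> is_topology T X
    \<^bold>\<and> w \<^bold>\<in> T \<^bold>\<and> (\<^bold>\<forall>n\<^bold>\<in>w. \<^bold>\<exists>s\<^bold>\<in>T. is_upair s n n)
    \<^bold>\<and> (\<^bold>\<forall>x\<^bold>\<in>A. (\<^bold>\<forall>n\<^bold>\<in>w. \<^bold>\<exists>N\<^bold>\<in>T. is_Psi_nhd N x n)
          \<^bold>\<and> (\<^bold>\<forall>U\<^bold>\<in>T. x \<^bold>\<in> U \<^bold>\<longrightarrow> (\<^bold>\<exists>n\<^bold>\<in>w. \<^bold>\<exists>N. is_Psi_nhd N x n \<^bold>\<and> N \<^bold>\<subseteq> U))))"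

definition is_CL :: "nat \<Rightarrow> nat \<Rightarrow> nat \<Rightarrow> form" where
  "is_CL Y X T = (\<^bold>\<forall>F. F \<^bold>\<in> Y \<^bold>\<longleftrightarrow>
     F \<^bold>\<subseteq> X \<^bold>\<and> \<^bold>\<not> is_empty F \<^bold>\<and> (\<^bold>\<exists>U\<^bold>\<in>T. is_diff U X F))"

text \<open>\<open>B\<close> is the subset of \<open>Y\<close> determined by the open sets \<open>U\<^sub>0, \<dots>, U\<^sub>n\<close>, the members of \<open>C\<close>; it
  depends on the set of these only, not on their order or repetitions.\<close>

definition is_Vietoris_basic :: "nat \<Rightarrow> nat \<Rightarrow> nat \<Rightarrow> form" where
  "is_Vietoris_basic B Y C = (\<^bold>\<forall>F. F \<^bold>\<in> B \<^bold>\<longleftrightarrow> F \<^bold>\<in> Y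
    \<^bold>\<and> (\<^bold>\<exists>u. is_Union u C \<^bold>\<and> F \<^bold>\<subseteq> u)
    \<^bold>\<and> (\<^bold>\<forall>U\<^bold>\<in>C. \<^bold>\<exists>x. x \<^bold>\<in> F \<^bold>\<and> x \<^bold>\<in> U))"

definition is_Vietoris :: "nat \<Rightarrow> nat \<Rightarrow> nat \<Rightarrow> form" where
  "is_Vietoris S Y T = (\<^bold>\<forall>W. W \<^bold>\<in> S \<^bold>\<longleftrightarrow> W \<^bold>\<subseteq> Y
    \<^bold>\<and> (\<^bold>\<forall>F\<^bold>\<in>W. \<^bold>\<exists>C B. C \<^bold>\<subseteq> T \<^bold>\<and> \<^bold>\<not> is_empty C \<^bold>\<and> is_finite C
          \<^bold>\<and> is_Vietoris_basic B Y C \<^bold>\<and> F \<^bold>\<in> B \<^bold>\<and> B \<^bold>\<subseteq> W))"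

definition CL_Psi_pseudocompact :: "nat \<Rightarrow> form" where
  "CL_Psi_pseudocompact A = (\<^bold>\<exists>X T Y S. is_Psi X T A \<^bold>\<and> is_CL Y X T \<^bold>\<and> is_Vietoris S Y T
     \<^bold>\<and> is_pseudocompact Y S)"

end

theory Submission
 imports Defs "HOL-Library.Countable_Set" "HOL-Computational_Algebra.Fraction_Field"
begin

text \<open>Start from a model of ZFC on the natural numbers, which exists by the completeness theorem, and force with
 finite conditions over it. The generic sets \<open>a c\<close> are almost disjoint for the \<open>\<omega>\<^sub>1\<close> many indices \<open>c\<close> in \<open>J\<close>, and
 Cohen generic for the other indices, of which there are more than \<open>\<omega>\<^sub>1\<close>. The countable chain condition
 preserves \<open>\<omega>\<^sub>1\<close>, and all but countably many of the generic sets meet a given dense set in the extension.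

 Hence \<open>{a c | c \<in> J}\<close> is MAD of size \<open>\<omega>\<^sub>1\<close>. Given infinitely many finite sets, a maximal \<open>K\<close> such that any finitely
 many neighbourhoods of points of \<open>K\<close> are met by infinitely many of them at once is an accumulation point in the
 hyperspace, by genericity; so the hyperspace is pseudocompact.

 The second family is a maximal almost disjoint family of sets of nodes of the binary tree, chosen such that every member
 lying on a branch is guessed by one of \<open>\<omega>\<^sub>1\<close> many Cohen generic sets. An accumulation point of the sequence of
 the levels would assign a Cohen set to every branch injectively, which is impossible as the continuum exceeds
 \<open>\<omega>\<^sub>1\<close>; so mapping the \<open>n\<close>-th level to \<open>n\<close> and everything else to \<open>0\<close> is continuous.\<close>

text \<open>The model \<open>E\<close> need not be well-founded, and its natural numbers may be
  nonstandard. Names can therefore not be evaluated by recursion from outside: the extension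
  consists of all names modulo what the filter forces. Whatever has to be a set of the model is
  carried by the predicates \<open>dfn\<close> and \<open>dff\<close>, which make HOL predicates and
  functions accessible to Separation and Replacement.

  The Cohen indices form a power set large enough to survive in the extension as more than
  \<open>\<omega>\<^sub>1\<close> many, but only \<open>\<omega>\<^sub>1\<close> of them are used
  for guessing branches. Genericity is proved for both kinds of indices together: a countable set of
  indices controls a given dense set of the extension, and at any other index a condition can still
  be prolonged freely.

  Pseudocompactness speaks of all complete ordered fields and would hold vacuously in a model
  without any. So one has to be built from the natural numbers of the model: differences, fractions,
  and classes of those Cauchy sequences that belong to the model.\<close>

abbreviation (input) iff_ascii :: "bool => bool => bool" (infixr "<->" 25) where "A <-> B \<equiv> A = B"

section \<open>Soundness and completeness of the calculus\<close>

instance fm :: countable by countable_datatype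

text \<open>Equality is interpreted by a relation \<open>Q\<close>: both the Henkin model and the
  names of a forcing extension come with a congruence, which is divided out only afterwards.\<close>

primrec satq :: "('m => 'm => bool) => ('m => 'm => bool) => fm => (nat => 'm) => bool" where
 "satq E Q Bot e = False"
| "satq E Q (Mem i j) e = E (e i) (e j)"
| "satq E Q (Eq i j) e = Q (e i) (e j)"
| "satq E Q (Imp p q) e = (satq E Q p e --> satq E Q q e)"
| "satq E Q (All p) e = (ALL x. satq E Q p (case_nat x e))"

abbreviation sat :: "('m => 'm => bool) => fm => (nat => 'm) => bool" where
 "sat E \<equiv> satq E (=)"

lemma lift_comp: "lift (r o s) = lift r o lift s"
proof
 show "lift (r o s) i = (lift r o lift s) i" for i by (cases i) auto
qed

lemma lift_id: "lift id = id"
proof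
 show "lift id i = id i" for i by (cases i) auto
qed

lemma case_nat_lift: "case_nat x e o lift r = case_nat x (e o r)"
proof
 show "(case_nat x e o lift r) i = case_nat x (e o r) i" for i by (cases i) auto
qed

lemma case_nat_Suc: "case_nat x e o Suc = e"
 by auto

lemma lift_Suc: "lift r o Suc = Suc o r"
 by auto

lemma comp_case_nat: "e o case_nat t r = case_nat (e t) (e o r)"
proof
 show "(e o case_nat t r) i = case_nat (e t) (e o r) i" for i by (cases i) auto
qed

lemma satq_ren: "satq E Q (ren r p) e = satq E Q p (e o r)"
 by (induction p arbitrary: r e) (auto simp: case_nat_lift)

lemma satq_inst: "satq E Q (inst t p) e = satq E Q p (case_nat (e t) e)"
 by (simp add: inst_def satq_ren comp_case_nat)

lemma soundness:
 assumes "T \<turnstile> p" and T: "!!q e. q:T ==> sat E q e"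
 shows "sat E p e"
 using assms(1)
proof (induction arbitrary: e)
 case (dist p q)
 then show ?case by (auto simp: satq_ren case_nat_Suc)
qed (auto simp: satq_inst T)

lemma consistentI: "(!!q e. q:T ==> sat E q e) ==> consistent T"
 using soundness[of T Bot E] by (fastforce simp: consistent_def)

lemma ren_ren: "ren r (ren s p) = ren (r o s) p"
 by (induction p arbitrary: r s) (auto simp: lift_comp)

lemma ren_cong: "(!!i. i:fv p ==> r i = s i) ==> ren r p = ren s p"
proof (induction p arbitrary: r s)
 case (All p)
 have h: "lift r i = lift s i" if "i:fv p" for i
  using All.prems that by (cases i) auto
 show ?case using All.IH[OF h] by simp
next
 case (Imp p q)
 show ?case using Imp.IH[of r s] Imp.prems by (metis UnCI fv.simps(4) ren.simps(4))
qed simp_all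

lemma ren_id: "ren id p = p"
 by (induction p) (auto simp: lift_id[unfolded id_def])

lemma ren_closed: "fv p = {} ==> ren r p = p"
 using ren_cong[of p r id] by (simp add: ren_id)

lemma ren_inst: "ren r (inst t p) = inst (r t) (ren (lift r) p)"
proof -
 have "r o case_nat t id = case_nat (r t) id o lift r"
  by (simp add: comp_case_nat case_nat_lift)
 then show ?thesis by (simp add: inst_def ren_ren)
qed

lemma inst_ren_lift: "inst c (ren (lift e) p) = ren (case_nat c e) p"
 by (simp add: inst_def ren_ren case_nat_lift)

lemma finite_fv: "finite (fv p)"
proof (induction p)
 case (All p)
 have "{i. Suc i:fv p} = Suc -` fv p" by auto
 then show ?case using All by (simp add: finite_vimageI)
qed auto

text \<open>As the members of \<open>T\<close> are closed, renaming a derivation line by line leaves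
  its uses of \<open>hyp\<close> intact.\<close>

lemma provable_ren:
 assumes "T \<turnstile> p" and cl: "!!q. q:T ==> fv q = {}"
 shows "T \<turnstile> ren r p"
 using assms(1)
proof (induction arbitrary: r)
 case (hyp p)
 then show ?case by (simp add: cl ren_closed provable.hyp)
next
 case (spec p t)
 then show ?case by (simp add: ren_inst provable.spec)
next
 case (dist p q)
 then show ?case using provable.dist[of T "ren r p" "ren (lift r) q"]
  by (simp add: ren_ren lift_Suc)
next
 case (repl i j p)
 then show ?case by (simp add: ren_inst provable.repl)
next
 case (MP p q)
 then show ?case using provable.MP by fastforce
next
 case (gen p)
 then show ?case by (simp add: provable.gen)
qed (auto intro: provable.intros)

section \<open>Derivations from hypotheses and Henkin's completeness proof\<close>

inductive ded :: "fm set => fm set => fm => bool" for T D where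
 prv: "T \<turnstile> p ==> ded T D p"
| asm: "p:D ==> ded T D p"
| mpd: "ded T D (Imp p q) ==> ded T D p ==> ded T D q"

lemma provable_I: "T \<turnstile> Imp p p"
 using provable.MP[OF provable.MP[OF provable.S provable.K[of T p "Imp p p"]] provable.K[of T p p]] .

text \<open>Holds for \<open>p\<close> with free variables as well, because generalization occurs
  only inside derivations from \<open>T\<close> alone, never below a hypothesis from
  \<open>D\<close>.\<close>

lemma ded_imp: "ded T (insert p D) q ==> ded T D (Imp p q)"
proof (induction rule: ded.induct)
 case (prv q)
 then show ?case using ded.prv[OF provable.MP[OF provable.K]] by simp
next
 case (asm q)
 then show ?case
  by (metis ded.asm ded.mpd ded.prv insert_iff provable.K provable_I)
next
 case (mpd q r)
 then show ?case using ded.mpd[OF ded.mpd[OF ded.prv[OF provable.S]]] by simp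
qed

lemma ded_mono: "ded T D q ==> D <= D' ==> ded T D' q"
 by (induction rule: ded.induct) (auto intro: ded.intros)

lemma ded_finite: "ded T D q ==> EX D'<=D. finite D' & ded T D' q"
proof (induction rule: ded.induct)
 case (prv p)
 then show ?case using ded.prv by blast
next
 case (asm p)
 then show ?case using ded.asm[of p "{p}"] by blast
next
 case (mpd p q)
 then obtain A B where AB: "A <= D" "finite A" "ded T A (Imp p q)" "B <= D" "finite B" "ded T B p"
  by blast
 then have "ded T (A Un B) q" using ded.mpd ded_mono by (metis Un_upper1 Un_upper2)
 then show ?case using AB by (metis Un_least finite_UnI)
qed

lemma ded_empty: "ded T {} q ==> T \<turnstile> q"
 by (induction rule: ded.induct) (auto intro: provable.MP)

lemma ded_DN: "ded T D (Imp (Imp p Bot) Bot) ==> ded T D p"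
 by (rule ded.mpd[OF ded.prv[OF provable.DN]])

lemma ded_Bot: "ded T D Bot ==> ded T D p"
 by (rule ded_DN[OF ded.mpd[OF ded.prv[OF provable.K]]])

lemma provable_All_mp: "T \<turnstile> Imp (All (Imp p q)) (Imp (All p) (All q))"
proof -
 \<comment> \<open>Instantiating by variable 0 itself undoes the shift, so the body of a quantified
   premise is available under the outer \<open>All\<close>.\<close>
 have i: "inst 0 (ren (lift Suc) r) = r" for r
 proof -
  have "case_nat 0 Suc = id" by (rule ext) (simp split: nat.split)
  then show ?thesis by (simp add: inst_ren_lift ren_id)
 qed
 have s: "T \<turnstile> Imp (ren Suc (All r)) r" for r
  using provable.spec[of T "ren (lift Suc) r" 0] by (simp add: i)
 let ?A = "All (Imp p q)" and ?B = "All p"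
 have "ded T {ren Suc ?A, ren Suc ?B} q"
  by (rule ded.mpd[OF ded.mpd[OF ded.prv[OF s[of "Imp p q"]] ded.asm] ded.mpd[OF ded.prv[OF s[of p]] ded.asm]])
   simp_all
 then have "T \<turnstile> Imp (ren Suc ?A) (Imp (ren Suc ?B) q)"
  by (intro ded_empty ded_imp) (simp add: insert_commute)
 then have "T \<turnstile> All (Imp (ren Suc ?A) (Imp (ren Suc ?B) q))" by (rule provable.gen)
 then have 1: "T \<turnstile> Imp ?A (All (Imp (ren Suc ?B) q))" by (rule provable.MP[OF provable.dist])
 have "ded T {?A} (Imp ?B (All q))"
  by (rule ded.mpd[OF ded.prv[OF provable.dist] ded.mpd[OF ded.prv[OF 1] ded.asm]]) simp
 then show ?thesis by (rule ded_empty[OF ded_imp])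
qed

text \<open>The eigenvariable condition. The renaming \<open>r\<close> sends \<open>c\<close> to 0
  and shifts all other variables, so it turns \<open>inst c p\<close> into \<open>p\<close> and a
  hypothesis without \<open>c\<close> into a shifted formula, over which \<open>dist\<close> moves
  the quantifier.\<close>

lemma ded_gen:
 assumes "ded T D (inst c p)" and T: "!!q. q:T ==> fv q = {}"
  and c: "!!d. d:D ==> c~:fv d" "c~:fv (All p)"
 shows "ded T D (All p)"
proof -
 define r where "r = (%i. if i = c then 0 else Suc i)"
 have all: "ded T D (All (ren r q))" if "ded T D q" for q
  using that
 proof (induction rule: ded.induct)
  case (prv q)
  then show ?case by (intro ded.prv provable.gen provable_ren T)
 next
  case (asm q)
  then have "ren r q = ren Suc q" using c(1) by (intro ren_cong) (auto simp: r_def)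
  then have "T \<turnstile> Imp q (All (ren r q))"
   by (simp only:) (rule provable.MP[OF provable.dist provable.gen[OF provable_I]])
  then show ?case using asm by (intro ded.mpd[OF ded.prv ded.asm])
 next
  case (mpd p q)
  then show ?case
   using ded.mpd[OF ded.mpd[OF ded.prv[OF provable_All_mp]], of T D "ren r p" "ren r q"] by simp
 qed
 have "ren r (inst c p) = p"
 proof -
  have "ren (r o case_nat c id) p = ren id p"
   using c(2) by (intro ren_cong) (auto simp: r_def split: nat.split)
  then show ?thesis by (simp add: inst_def ren_ren ren_id)
 qed
 with all[OF assms(1)] show ?thesis by simp
qed

text \<open>The Henkin constants are variables: a finite set of formulas always leaves a fresh one,
  and the sentences of \<open>T\<close> contain none.\<close>

lemma henkin_step:
 assumes T: "!!q. q:T ==> fv q = {}" and D: "finite D" "~ ded T D Bot"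
 shows "EX D'. (finite D' & ~ ded T D' Bot) & D <= D' & (ded T (insert ph D) Bot | ph:D')
  & (ALL p. ph = Imp (All p) Bot --> ph:D' --> (EX c. Imp (inst c p) Bot:D'))"
proof (cases "ded T (insert ph D) Bot")
 case True
 then have "ph~:D" using D by (auto simp: insert_absorb)
 then show ?thesis using True D by blast
next
 case con: False
 show ?thesis
 proof (cases "EX p. ph = Imp (All p) Bot")
  case True
  then obtain p where p: "ph = Imp (All p) Bot" by blast
  have "finite (\<Union>(fv ` insert ph D))" using D finite_fv by auto
  then obtain c where c: "c~:\<Union>(fv ` insert ph D)" using ex_new_if_finite[OF infinite_UNIV_nat] by blast
  have "~ ded T (insert (Imp (inst c p) Bot) (insert ph D)) Bot"
  proof
   assume "ded T (insert (Imp (inst c p) Bot) (insert ph D)) Bot"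
   then have "ded T (insert ph D) (inst c p)" by (rule ded_DN[OF ded_imp])
   then have "ded T (insert ph D) (All p)" by (rule ded_gen) (use T c p in auto)
   then show False using con ded.mpd[OF ded.asm, of "All p" Bot] p by auto
  qed
  then show ?thesis using p D by (intro exI[of _ "insert (Imp (inst c p) Bot) (insert ph D)"]) auto
 next
  case False
  then show ?thesis using con D by (intro exI[of _ "insert ph D"]) auto
 qed
qed

lemma henkin_extension:
 assumes "consistent T" and T: "!!q. q:T ==> fv q = {}"
 obtains G where "~ ded T G Bot" "!!p. p:G | ded T (insert p G) Bot"
  "!!p. Imp (All p) Bot:G ==> EX c. Imp (inst c p) Bot:G"
proof -
 define P where "P D <-> finite D & ~ ded T D Bot" for D
 define R where "R n D D' <-> D <= D' & (ded T (insert (from_nat n) D) Bot | from_nat n:D')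
  & (ALL p. from_nat n = Imp (All p) Bot --> from_nat n:D' --> (EX c. Imp (inst c p) Bot:D'))" for n D D'
 have "EX D. P D" using assms(1) ded_empty by (auto simp: P_def consistent_def intro!: exI[of _ "{}"])
 moreover have "EX D'. P D' & R n D D'" if "P D" for D n
  using that unfolding P_def R_def by (intro henkin_step T) simp_all
 ultimately have "EX f. ALL n. P (f n) & R n (f n) (f (Suc n))"
  by (rule dependent_nat_choice)
 then obtain f where f0: "!!n. P (f n)" "!!n. R n (f n) (f (Suc n))" by blast
 have f: "finite (f n)" "~ ded T (f n) Bot" for n using f0(1) by (auto simp: P_def)
 note f2 = f0(2)[unfolded R_def]
 have mono: "f m <= f n" if "m <= n" for m n
  using that f0(2) by (induction rule: dec_induct) (auto simp: R_def)
 define G where "G = (\<Union>n. f n)"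
 have con: "~ ded T G Bot"
 proof
  assume "ded T G Bot"
  then have "EX D<=G. finite D & ded T D Bot" by (rule ded_finite)
  then obtain D where D: "D <= G" "finite D" "ded T D Bot" by blast
  from D(2,1) have "EX n. D <= f n"
  proof (induction rule: finite_induct)
   case (insert x F)
   then obtain m n where "F <= f m" "x:f n" unfolding G_def by blast
   then have "insert x F <= f (max m n)"
    using mono[of m "max m n"] mono[of n "max m n"] max.cobounded1 max.cobounded2 by blast
   then show ?case by blast
  qed auto
  then show False using D(3) f(2) ded_mono by blast
 qed
 moreover have "p:G | ded T (insert p G) Bot" for p
 proof -
  have "ded T (insert p (f (to_nat p))) Bot | p:f (Suc (to_nat p))"
   using f2[of "to_nat p", THEN conjunct2, THEN conjunct1] by simp
  moreover have "insert p (f (to_nat p)) <= insert p G" "f (Suc (to_nat p)) <= G"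
   unfolding G_def by blast+
  ultimately show ?thesis using ded_mono by blast
 qed
 moreover have "EX c. Imp (inst c p) Bot:G" if "Imp (All p) Bot:G" for p
 proof -
  let ?q = "Imp (All p) Bot"
  have "~ ded T (insert ?q (f (to_nat ?q))) Bot"
   using con ded_mono[of T _ Bot G] that by (metis G_def UN_upper UNIV_I insert_subset)
  then have "?q:f (Suc (to_nat ?q))"
   using f2[of "to_nat ?q", THEN conjunct2, THEN conjunct1] by simp
  then obtain c where "Imp (inst c p) Bot:f (Suc (to_nat ?q))"
   using f2[of "to_nat ?q", THEN conjunct2, THEN conjunct2] by (metis from_nat_to_nat)
  then show ?thesis unfolding G_def by blast
 qed
 ultimately show ?thesis using that by blast
qed

text \<open>The elements of the model are the variables, and an atomic formula is true if it belongs
  to the maximal consistent set \<open>G\<close>. This includes equations, which is why only a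
  congruence comes out.\<close>

lemma completeness:
 assumes "consistent T" and T: "!!q. q:T ==> fv q = {}"
 obtains E Q :: "nat => nat => bool" where "equivp Q"
  "!!x x' y y'. Q x x' ==> Q y y' ==> E x y = E x' y'" "!!q e. q:T ==> satq E Q q e"
proof -
 obtain G where G: "~ ded T G Bot" "!!p. p:G | ded T (insert p G) Bot"
  "!!p. Imp (All p) Bot:G ==> EX c. Imp (inst c p) Bot:G"
  using henkin_extension[OF assms] by blast
 have dd: "p:G" if "ded T G p" for p
  using G(1) G(2)[of p] ded.mpd[OF ded_imp that] by auto
 have neg: "p:G | Imp p Bot:G" for p
  using G(2)[of p] dd[OF ded_imp] by auto
 have imp: "Imp p q:G <-> (p:G --> q:G)" for p q
 proof
  show "Imp p q:G ==> p:G --> q:G" using dd ded.mpd[OF ded.asm ded.asm, of p q G T] by simp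
  assume "p:G --> q:G"
  then consider "q:G" | "Imp p Bot:G" using neg by blast
  then show "Imp p q:G"
  proof cases
   case 1
   then show ?thesis using dd ded.mpd[OF ded.prv[OF provable.K] ded.asm] by simp
  next
   case 2
   then have "ded T (insert p G) q"
    using ded_Bot ded.mpd[OF ded.asm ded.asm, of p Bot] by simp
   then show ?thesis using ded_imp dd by simp
  qed
 qed
 have prv: "T \<turnstile> p ==> p:G" for p using dd ded.prv by blast
 define E Q where "E = (%i j. Mem i j:G)" and "Q = (%i j. Eq i j:G)"
 have rep: "inst j p:G" if "Q i j" "inst i p:G" for i j p
  using prv[OF provable.repl[of T i j p]] that by (simp add: imp Q_def)
 have ref: "Q i i" for i using prv[OF provable.refl] by (simp add: Q_def)
 have sym: "Q j i" if "Q i j" for i j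
  using rep[OF that, of "Eq 0 (Suc i)"] ref by (simp add: inst_def Q_def)
 have tr: "Q i k" if "Q i j" "Q j k" for i j k
  using rep[OF that(2), of "Eq (Suc i) 0"] that(1) by (simp add: inst_def Q_def)
 have cong: "E x' y'" if "Q x x'" "Q y y'" "E x y" for x x' y y'
  using rep[OF that(1), of "Mem 0 (Suc y)"] rep[OF that(2), of "Mem (Suc x') 0"] that(3)
  by (simp add: inst_def E_def)
 have truth: "satq E Q p e <-> ren e p:G" for p e
 proof (induction p arbitrary: e)
  case Bot
  then show ?case using G(1) ded.asm by auto
 next
  case (All p)
  have "All (ren (lift e) p):G <-> (ALL c. inst c (ren (lift e) p):G)"
  proof
   show "ALL c. inst c (ren (lift e) p):G" if "All (ren (lift e) p):G"
    using that prv[OF provable.spec] by (simp add: imp)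
   assume a: "ALL c. inst c (ren (lift e) p):G"
   show "All (ren (lift e) p):G"
   proof (rule ccontr)
    assume "All (ren (lift e) p)~:G"
    then obtain c where "Imp (inst c (ren (lift e) p)) Bot:G" using neg G(3) by blast
    then show False using a imp G(1) ded.asm by blast
   qed
  qed
  then show ?case by (simp add: All.IH inst_ren_lift)
 qed (auto simp: E_def Q_def imp)
 have eq: "equivp Q" by (rule equivpI) (auto simp: reflp_def symp_def transp_def intro: ref sym tr)
 have co: "E x y = E x' y'" if "Q x x'" "Q y y'" for x x' y y' using cong sym that by blast
 have mod: "satq E Q q e" if "q:T" for q e
  using prv[OF provable.hyp[OF that]] ren_closed[OF T[OF that]] by (simp add: truth)
 show ?thesis by (rule that[OF eq co mod])
qed

text \<open>The classes, as predicates \<open>Q x\<close>, form a countably infinite set; numbering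
  them puts the quotient back on \<open>nat\<close>, where every later model is to live.\<close>

lemma nat_quotient:
 fixes Q :: "nat => nat => bool"
 assumes "equivp Q" "infinite (range Q)"
 obtains f :: "nat => nat" where "surj f" "!!x y. f x = f y <-> Q x y"
proof
 let ?f = "to_nat_on (range Q) o Q"
 have b: "bij_betw (to_nat_on (range Q)) (range Q) UNIV"
  using assms(2) by (intro to_nat_on_infinite) auto
 then show "surj ?f" by (metis bij_betw_imp_surj_on image_comp)
 show "?f x = ?f y <-> Q x y" for x y
  using b assms(1) by (auto simp: bij_betw_def inj_on_def equivp_def)
qed

lemma satq_quotient:
 assumes f: "surj f" "!!x y. f x = f y <-> Q x y" "!!x y. E' (f x) (f y) = E x y"
 shows "satq E Q p e = sat E' p (f o e)"
proof (induction p arbitrary: e)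
 case (All p)
 have "satq E Q p (case_nat x e) = sat E' p (case_nat (f x) (f o e))" for x
  unfolding All.IH comp_case_nat ..
 then have "satq E Q (All p) e <-> (ALL x. sat E' p (case_nat (f x) (f o e)))" by simp
 also have "... <-> (ALL y. sat E' p (case_nat y (f o e)))" using f(1) by (metis surjD)
 finally show ?case by (simp only: satq.simps)
qed (auto simp: f)

section \<open>Evaluating the axioms\<close>

lemma satq_cong: "(!!i. i:fv p ==> e i = e' i) ==> satq E Q p e = satq E Q p e'"
proof (induction p arbitrary: e e')
 case (All p)
 have "satq E Q p (case_nat x e) = satq E Q p (case_nat x e')" for x
  by (rule All.IH) (use All.prems in \<open>auto split: nat.split\<close>)
 then show ?case by simp
next
 case (Imp p q)
 show ?case using Imp.IH[of e e'] Imp.prems by (metis UnCI fv.simps(4) satq.simps(4))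
qed simp_all

text \<open>The truth value of a formula under \<open>n\<close> binders; \<open>v\<close> assigns values to levels, and \<open>d\<close> is the value of
 out-of-range indices.\<close>

definition hold :: "('m => 'm => bool) => ('m => 'm => bool) => 'm => form => nat => (nat => 'm) => bool" where
 "hold E Q d P n v = satq E Q (P n) (%i. if i < n then v (n - Suc i) else d)"

lemma hold_env: "case_nat a (%i. if i < n then v (n - Suc i) else d)
  = (%i. if i < Suc n then (v(n := a)) (Suc n - Suc i) else d)"
 by (rule ext) (auto split: nat.split)

lemma hold_simps [simp]:
 "x < n ==> y < n ==> hold E Q d (x \<^bold>\<in> y) n v = E (v x) (v y)"
 "x < n ==> y < n ==> hold E Q d (x \<^bold>= y) n v = Q (v x) (v y)"
 "hold E Q d (P \<^bold>\<longrightarrow> R) n v = (hold E Q d P n v --> hold E Q d R n v)"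
 "hold E Q d (\<^bold>\<not> P) n v = (~ hold E Q d P n v)"
 "hold E Q d (fall T) n v = (ALL a. hold E Q d (T n) (Suc n) (v(n := a)))"
 by (auto simp: hold_def fmem_def feq_def fimp_def fnot_def fall_def hold_env)

lemma hold_simps2 [simp]:
 "hold E Q d (P \<^bold>\<and> R) n v = (hold E Q d P n v & hold E Q d R n v)"
 "hold E Q d (P \<^bold>\<or> R) n v = (hold E Q d P n v | hold E Q d R n v)"
 "hold E Q d (P \<^bold>\<longleftrightarrow> R) n v = (hold E Q d P n v <-> hold E Q d R n v)"
 "hold E Q d (fex T) n v = (EX a. hold E Q d (T n) (Suc n) (v(n := a)))"
 by (auto simp: fconj_def fdisj_def fiff_def fex_def)

lemma hold_simps3 [simp]:
 "x < n ==> hold E Q d (fball x T) n v = (ALL a. E a (v x) --> hold E Q d (T n) (Suc n) (v(n := a)))"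
 "x < n ==> hold E Q d (fbex x T) n v = (EX a. E a (v x) & hold E Q d (T n) (Suc n) (v(n := a)))"
 by (auto simp: fball_def fbex_def)

lemma hold_sets [simp]:
 "x < n ==> y < n ==> hold E Q d (x \<^bold>\<subseteq> y) n v = (ALL z. E z (v x) --> E z (v y))"
 "x < n ==> hold E Q d (is_empty x) n v = (ALL z. ~ E z (v x))"
 "p < n ==> x < n ==> y < n ==> hold E Q d (is_upair p x y) n v = (ALL z. E z (v p) <-> Q z (v x) | Q z (v y))"
 "p < n ==> x < n ==> y < n ==> hold E Q d (is_un p x y) n v = (ALL z. E z (v p) <-> E z (v x) | E z (v y))"
 "p < n ==> x < n ==> y < n ==> hold E Q d (is_int p x y) n v = (ALL z. E z (v p) <-> E z (v x) & E z (v y))"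
 "p < n ==> x < n ==> y < n ==> hold E Q d (is_diff p x y) n v = (ALL z. E z (v p) <-> E z (v x) & ~ E z (v y))"
 "p < n ==> x < n ==> hold E Q d (is_Union p x) n v = (ALL z. E z (v p) <-> (EX y. E y (v x) & E z y))"
 "p < n ==> x < n ==> hold E Q d (is_Pow p x) n v = (ALL z. E z (v p) <-> (ALL u. E u z --> E u (v x)))"
 "p < n ==> x < n ==> hold E Q d (is_succ p x) n v = (ALL z. E z (v p) <-> E z (v x) | Q z (v x))"
 by (simp_all add: fsub_def is_empty_def is_upair_def is_un_def is_int_def is_diff_def is_Union_def
   is_Pow_def is_succ_def)

lemma hold_inductive [simp]: "w < n ==> hold E Q d (is_inductive w) n v =
 ((EX e. E e (v w) & (ALL z. ~ E z e)) & (ALL x. E x (v w) --> (EX s. E s (v w) & (ALL z. E z s <-> E z x | Q z x))))"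
 by (simp add: is_inductive_def)

lemma hold_plug:
 assumes "!!i. i:fv p ==> s i < n"
 shows "hold E Q d (plug p s) n v = satq E Q p (%i. v (s i))"
 unfolding hold_def plug_def satq_ren
proof (rule satq_cong)
 fix i assume "i:fv p"
 from assms[OF this]
 show "((%i. if i < n then v (n - Suc i) else d) o (%i. n - Suc (s i))) i = v (s i)" by simp
qed

lemma satq_sentence: "fv (sentence P) = {} ==> satq E Q (sentence P) e = hold E Q d P 0 v"
 unfolding hold_def sentence_def by (rule satq_cong) auto

lemma satq_All_pow: "satq E Q ((All ^^ k) p) (%_. d) <->
 (ALL v. satq E Q p (%i. if i < k then v (k - Suc i) else d))"
proof (induction k arbitrary: p)
 case (Suc k)
 have "satq E Q ((All ^^ Suc k) p) (%_. d) <-> satq E Q ((All ^^ k) (All p)) (%_. d)"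
  by (simp add: funpow_swap1)
 also have "... <-> (ALL v a. satq E Q p (%i. if i < Suc k then (v(k := a)) (Suc k - Suc i) else d))"
  unfolding Suc by (simp only: satq.simps hold_env)
 also have "... <-> (ALL v. satq E Q p (%i. if i < Suc k then v (Suc k - Suc i) else d))"
 proof
  assume a: "ALL v a. satq E Q p (%i. if i < Suc k then (v(k := a)) (Suc k - Suc i) else d)"
  show "ALL v. satq E Q p (%i. if i < Suc k then v (Suc k - Suc i) else d)"
  proof
   show "satq E Q p (%i. if i < Suc k then v (Suc k - Suc i) else d)" for v
    using a[THEN HOL.spec, THEN HOL.spec, of v "v k"] by (simp only: fun_upd_triv)
  qed
 qed blast
 finally show ?case .
qed simp

lemma satq_closure: "fv (closure k P) = {} ==> satq E Q (closure k P) e <-> (ALL v. hold E Q d P k v)"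
 unfolding hold_def satq_All_pow[symmetric] closure_def by (rule satq_cong) auto

section \<open>Closedness of the axioms\<close>

definition bd :: "nat => form => bool" where
 "bd n P <-> fv (P n) <= {..<n}"

text \<open>Under at least one binder, \<open>n - Suc x\<close> is below \<open>n\<close> for every
  \<open>x\<close>, by truncated subtraction; so only the number of binders has to be
  checked.\<close>

lemma bd_intros [intro]:
 "0 < n ==> bd n (x \<^bold>\<in> y)" "0 < n ==> bd n (x \<^bold>= y)"
 "bd n P ==> bd n R ==> bd n (P \<^bold>\<longrightarrow> R)" "bd n P ==> bd n (\<^bold>\<not> P)" "bd (Suc n) (T n) ==> bd n (fall T)"
 "0 < n ==> bd n (plug p s)"
proof -
 have "fv (ren r p) <= r ` fv p" for r
 proof (induction p arbitrary: r)
  case (All p)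
  show ?case
  proof
   fix i assume "i:fv (ren r (All p))"
   then have "Suc i:lift r ` fv p" using All[of "lift r"] by auto
   then obtain j where j: "j:fv p" "Suc i = lift r j" by auto
   then show "i:r ` fv (All p)" by (cases j) auto
  qed
 next
  case (Imp p q)
  show ?case using Imp[of r] by auto
 qed auto
 then show "0 < n ==> bd n (plug p s)" by (fastforce simp: bd_def plug_def)
 show "bd (Suc n) (T n) ==> bd n (fall T)" by (auto simp: bd_def fall_def)
qed (auto simp: bd_def fmem_def feq_def fimp_def fnot_def)

lemma bd_intros2 [intro]:
 "bd n P ==> bd n R ==> bd n (P \<^bold>\<and> R)" "bd n P ==> bd n R ==> bd n (P \<^bold>\<or> R)"
 "bd n P ==> bd n R ==> bd n (P \<^bold>\<longleftrightarrow> R)" "bd (Suc n) (T n) ==> bd n (fex T)"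
 unfolding fconj_def fdisj_def fiff_def fex_def by (intro bd_intros; assumption)+

lemma bd_intros3 [intro]:
 "0 < n ==> bd (Suc n) (T n) ==> bd n (fball x T)" "0 < n ==> bd (Suc n) (T n) ==> bd n (fbex x T)"
 unfolding fball_def fbex_def by (intro bd_intros bd_intros2; simp)+

lemma bd_sets [intro]:
 "0 < n ==> bd n (x \<^bold>\<subseteq> y)" "0 < n ==> bd n (is_empty x)" "0 < n ==> bd n (is_upair p x y)"
 "0 < n ==> bd n (is_Union p x)" "0 < n ==> bd n (is_Pow p x)" "0 < n ==> bd n (is_succ p x)"
 unfolding fsub_def is_empty_def is_upair_def is_Union_def is_Pow_def is_succ_def fbex_def
 by (intro bd_intros bd_intros2 bd_intros3; simp)+

lemma closure_closed: "bd k P ==> fv (closure k P) = {}"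
proof -
 have "fv p <= {..<k} ==> fv ((All ^^ k) p) = {}" for p
 proof (induction k arbitrary: p)
  case (Suc k)
  have "fv (All p) <= {..<k}" using Suc.prems by auto
  then show ?case by (simp add: Suc.IH funpow_Suc_right del: funpow.simps(2))
 qed simp
 then show "bd k P ==> fv (closure k P) = {}" by (auto simp: bd_def closure_def)
qed

lemma sentence_closed: "bd 0 P ==> fv (sentence P) = {}"
 by (auto simp: bd_def sentence_def)

lemma bd_axioms: "bd 0 extensionality" "bd 0 foundation" "bd 0 pairing" "bd 0 union" "bd 0 powerset"
  "bd 0 infinity" "bd 0 choice" "bd k (separation p)" "bd k (replacement p)"
 unfolding extensionality_def foundation_def pairing_def union_def powerset_def infinity_def choice_def
  separation_def replacement_def is_inductive_def fex1_def Let_def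
 by (intro bd_intros bd_intros2 bd_intros3 bd_sets; simp)+

lemma ZFC_closed: "q:ZFC ==> fv q = {}"
 unfolding ZFC_def
 by (elim UnE imageE insertE emptyE CollectE exE conjE; hypsubst; intro closure_closed sentence_closed bd_axioms)

section \<open>The axioms as statements about a relation\<close>

lemma satq_extensionality: "satq E Q (sentence extensionality) e <-> (ALL x y. (ALL z. E z x <-> E z y) --> Q x y)"
 unfolding bd_axioms(1)[THEN sentence_closed, THEN satq_sentence, where v = "%_. undefined" and d = undefined]
 by (simp add: extensionality_def fex1_def)

lemma satq_foundation: "satq E Q (sentence foundation) e <-> (ALL x. (EX z. E z x) --> (EX y. E y x & (ALL z. E z x --> ~ E z y)))"
 unfolding bd_axioms(2)[THEN sentence_closed, THEN satq_sentence, where v = "%_. undefined" and d = undefined]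
 by (simp add: foundation_def fex1_def)

lemma satq_pairing: "satq E Q (sentence pairing) e <-> (ALL x y. EX p. ALL z. E z p <-> Q z x | Q z y)"
 unfolding bd_axioms(3)[THEN sentence_closed, THEN satq_sentence, where v = "%_. undefined" and d = undefined]
 by (simp add: pairing_def fex1_def)

lemma satq_union: "satq E Q (sentence union) e <-> (ALL x. EX u. ALL z. E z u <-> (EX y. E y x & E z y))"
 unfolding bd_axioms(4)[THEN sentence_closed, THEN satq_sentence, where v = "%_. undefined" and d = undefined]
 by (simp add: Defs.union_def fex1_def)

lemma satq_powerset: "satq E Q (sentence powerset) e <-> (ALL x. EX u. ALL z. E z u <-> (ALL w. E w z --> E w x))"
 unfolding bd_axioms(5)[THEN sentence_closed, THEN satq_sentence, where v = "%_. undefined" and d = undefined]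
 by (simp add: powerset_def fex1_def)

lemma satq_infinity: "satq E Q (sentence infinity) e <-> (EX w. (EX e. E e w & (ALL z. ~ E z e)) &
   (ALL x. E x w --> (EX s. E s w & (ALL z. E z s <-> E z x | Q z x))))"
 unfolding bd_axioms(6)[THEN sentence_closed, THEN satq_sentence, where v = "%_. undefined" and d = undefined]
 by (simp add: infinity_def fex1_def)

lemma satq_choice: "satq E Q (sentence choice) e <-> (ALL a. (ALL x. E x a --> (EX z. E z x)) &
   (ALL x. E x a --> (ALL y. E y a --> ~ Q x y --> ~ (EX z. E z x & E z y))) -->
   (EX c. ALL x. E x a --> (EX z. (E z x & E z c) & (ALL y. E y x & E y c --> Q y z))))"
 unfolding bd_axioms(7)[THEN sentence_closed, THEN satq_sentence, where v = "%_. undefined" and d = undefined]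
 by (simp only: choice_def fex1_def hold_simps hold_simps2 hold_simps3 hold_sets zero_less_Suc Suc_less_eq
   lessI fun_upd_apply if_True if_False nat.inject nat.distinct simp_thms not_all not_ex)

lemma satq_separation:
 assumes "fv p <= {..<k + 1}"
 shows "satq E Q (closure k (separation p)) e <->
  (ALL v a. EX b. ALL x. E x b <-> E x a & satq E Q p (case_nat x v))"
proof -
 have *: "hold E Q undefined (plug p (case_nat (Suc (Suc k)) id)) (Suc (Suc (Suc k)))
   (v(k := a, Suc k := b, Suc (Suc k) := x)) = satq E Q p (case_nat x v)" for v a b x
 proof -
  have "i < k + 1" if "i:fv p" for i using assms that by auto
  then show ?thesis
   by (subst hold_plug) (force split: nat.split intro!: satq_cong)+
 qed
 have h: "hold E Q undefined (separation p) k v = (ALL a. EX b. ALL x. E x b <-> E x a & satq E Q p (case_nat x v))" for v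
  by (simp add: separation_def *)
 show ?thesis
  using satq_closure[OF closure_closed[OF bd_axioms(8)], of E Q k p e undefined] h by simp
qed

lemma satq_replacement:
 assumes "fv p <= {..<k + 2}"
 shows "satq E Q (closure k (replacement p)) e <-> (ALL v a.
  (ALL x. E x a --> (EX y. satq E Q p (case_nat x (case_nat y v)) &
    (ALL z. satq E Q p (case_nat x (case_nat z v)) --> Q z y))) -->
  (EX b. ALL y. E y b <-> (EX x. E x a & satq E Q p (case_nat x (case_nat y v)))))"
proof -
 have lt: "i < k + 2" if "i:fv p" for i using assms that by auto
 have *: "hold E Q undefined (plug p (case_nat x (case_nat y id))) n w
   = satq E Q p (case_nat (w x) (case_nat (w y) v))"
  if a: "x < n" "y < n" "k <= n" "!!i. i < k ==> w i = v i" for v w x y n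
 proof -
  have "case_nat x (case_nat y id) i < n" if "i:fv p" for i
   using lt[OF that] a(1-3) by (auto split: nat.split)
  then have "hold E Q undefined (plug p (case_nat x (case_nat y id))) n w
    = satq E Q p (%i. w (case_nat x (case_nat y id) i))"
   by (rule hold_plug)
  also have "... = satq E Q p (case_nat (w x) (case_nat (w y) v))"
   using lt a(4) by (intro satq_cong) (force split: nat.split)
  finally show ?thesis .
 qed
 have **: "hold E Q undefined (plug p (case_nat (Suc k) (case_nat (Suc (Suc k)) id))) (Suc (Suc (Suc k)))
   (v(k := a, Suc k := x, Suc (Suc k) := y)) = satq E Q p (case_nat x (case_nat y v))"
  "hold E Q undefined (plug p (case_nat (Suc k) (case_nat (Suc (Suc (Suc k))) id))) (Suc (Suc (Suc (Suc k))))
   (v(k := a, Suc k := x, Suc (Suc k) := z, Suc (Suc (Suc k)) := y)) = satq E Q p (case_nat x (case_nat y v))"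
  "hold E Q undefined (plug p (case_nat (Suc (Suc (Suc k))) (case_nat (Suc (Suc k)) id))) (Suc (Suc (Suc (Suc k))))
   (v(k := a, Suc k := z, Suc (Suc k) := y, Suc (Suc (Suc k)) := x)) = satq E Q p (case_nat x (case_nat y v))"
  for v a x y z
  by (subst *[where v = v]; simp)+
 have h: "hold E Q undefined (replacement p) k v = (ALL a.
  (ALL x. E x a --> (EX y. satq E Q p (case_nat x (case_nat y v)) &
    (ALL z. satq E Q p (case_nat x (case_nat z v)) --> Q z y))) -->
  (EX b. ALL y. E y b <-> (EX x. E x a & satq E Q p (case_nat x (case_nat y v)))))" for v
  by (simp add: replacement_def Let_def fex1_def **)
 show ?thesis
  using satq_closure[OF closure_closed[OF bd_axioms(9)], of E Q k p e undefined] h by simp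
qed

section \<open>Models of ZFC\<close>

locale zfc =
 fixes E :: "'m => 'm => bool"
 assumes ZFC: "q:ZFC ==> sat E q e"
begin

definition el :: "'m => 'm set" where
 "el a = {x. E x a}"

definition small :: "'m set => bool" where
 "small A <-> (EX a. el a = A)"

definition zero where "zero = (SOME a. el a = {})"

text \<open>Total, with default value \<open>zero\<close>, so that terms formed with
  \<open>set\<close> are definable before their smallness is known.\<close>

definition set :: "'m set => 'm" where
 "set A = (if small A then SOME a. el a = A else zero)"

lemma E_elts: "E x a <-> x:el a"
 by (simp add: el_def)

lemma el_ext: "el a = el b ==> a = b"
 using ZFC[of "sentence extensionality"] by (auto simp: ZFC_def satq_extensionality el_def)

lemma el_set: "small A ==> el (set A) = A"
 using someI_ex[of "%a. el a = A"] by (simp add: set_def small_def)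

lemma small_elts [simp]: "small (el a)"
 by (auto simp: small_def)

lemma set_elts [simp]: "set (el a) = a"
 by (simp add: el_set el_ext)

text \<open>A predicate on assignments is definable if it is given by a formula whose variables stand for
 coordinates of the assignment or for parameters. Functions are definable if their graphs are.\<close>

definition dfn :: "((nat => 'm) => bool) => bool" where
 "dfn P <-> (EX p s. ALL e. P e = sat E p (%i. case s i of Inl j => e j | Inr c => c))"

definition dff :: "((nat => 'm) => 'm) => bool" where
 "dff t <-> dfn (%e. e 0 = t (%i. e (Suc i)))"

named_theorems dfn

definition isvar :: "((nat => 'm) => 'm) => bool" where
 "isvar t <-> (EX s. ALL e. t e = (case s of Inl j => e j | Inr c => c))"

lemma isvar_var: "isvar (%e. e j)"
 unfolding isvar_def by (rule exI[of _ "Inl j"]) simp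

lemma isvar_const: "isvar (%e. c)"
 unfolding isvar_def by (rule exI[of _ "Inr c"]) simp

lemma dfn_subst:
 assumes "dfn P" and t: "!!i. isvar (t i)"
 shows "dfn (%e. P (%i. t i e))"
proof -
 obtain p s where p: "!!e. P e = sat E p (%i. case s i of Inl j => e j | Inr c => c)"
  using assms(1) unfolding dfn_def by blast
 obtain u where u: "!!i e. t i e = (case u i of Inl j => e j | Inr c => c)"
  using t unfolding isvar_def by metis
 have "P (%i. t i e) = sat E p (%i. case (case s i of Inl j => u j | Inr c => Inr c) of Inl j => e j | Inr c => c)" for e
  unfolding p u by (rule arg_cong[where f = "sat E p"]) (auto split: sum.split)
 then show ?thesis unfolding dfn_def
  by (intro exI[of _ p] exI[of _ "%i. case s i of Inl j => u j | Inr c => Inr c"]) blast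
qed

lemma dfn_shift: "dfn P ==> dfn (%e. P (%i. e (f i)))"
 by (rule dfn_subst[where t = "%i e. e (f i)", OF _ isvar_var])

lemma dfn_mem0: "isvar s ==> isvar t ==> dfn (%e. E (s e) (t e))"
 and dfn_eq0: "isvar s ==> isvar t ==> dfn (%e. s e = t e)"
proof -
 assume "isvar s" "isvar t"
 then obtain u v where "!!e. s e = (case u of Inl j => e j | Inr c => c)" "!!e. t e = (case v of Inl j => e j | Inr c => c)"
  unfolding isvar_def by auto
 then show "dfn (%e. E (s e) (t e))" "dfn (%e. s e = t e)"
  unfolding dfn_def
  by (intro exI[of _ "Mem 0 1"] exI[of _ "Eq 0 1"] exI[of _ "%i. if i = 0 then u else v"]; simp)+
qed

lemma dfn_imp [dfn]:
 assumes "dfn P" "dfn Q" shows "dfn (%e. P e --> Q e)"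
proof -
 obtain p s where p: "!!e. P e = sat E p (%i. case s i of Inl j => e j | Inr c => c)"
  using assms(1) unfolding dfn_def by blast
 obtain q t where q: "!!e. Q e = sat E q (%i. case t i of Inl j => e j | Inr c => c)"
  using assms(2) unfolding dfn_def by blast
 \<comment> \<open>Even variables serve \<open>p\<close> and odd ones \<open>q\<close>, so that the
   two assignments do not interfere.\<close>
 show ?thesis unfolding dfn_def
  by (rule exI[of _ "Imp (ren (%i. 2 * i) p) (ren (%i. 2 * i + 1) q)"],
   rule exI[of _ "%i. if even i then s (i div 2) else t (i div 2)"])
   (simp add: p q satq_ren o_def)
qed

lemma dfn_const [dfn]: "dfn (%e. b)"
proof (cases b)
 case True
 then show ?thesis unfolding dfn_def by (intro exI[of _ "Imp Bot Bot"]) simp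
next
 case False
 then show ?thesis unfolding dfn_def by (intro exI[of _ Bot]) simp
qed

lemma dfn_not [dfn]: "dfn P ==> dfn (%e. ~ P e)"
 using dfn_imp[OF _ dfn_const[of False]] by simp

lemma dfn_conj [dfn]: "dfn P ==> dfn Q ==> dfn (%e. P e & Q e)"
 using dfn_not[OF dfn_imp[OF _ dfn_not]] by simp

lemma dfn_disj [dfn]: "dfn P ==> dfn Q ==> dfn (%e. P e | Q e)"
 using dfn_imp[OF dfn_not] by (simp add: disj_imp)

lemma [dfn]: "dfn P ==> dfn Q ==> dfn (%e. P e <-> Q e)"
 using dfn_conj[OF dfn_imp dfn_imp] by (simp add: iff_conv_conj_imp)

lemma dfn_all [dfn]:
 assumes "dfn (%e. P (e 0) (%i. e (Suc i)))"
 shows "dfn (%e. ALL x. P x e)"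
proof -
 obtain p s where p: "!!e. P (e 0) (%i. e (Suc i)) = sat E p (%i. case s i of Inl j => e j | Inr c => c)"
  using assms unfolding dfn_def by blast
 \<comment> \<open>Several variables of \<open>p\<close> may stand for coordinate 0; all of them
   become the bound variable, and the others are shifted past it.\<close>
 define r where "r = (%i. if s i = Inl 0 then 0 else Suc i)"
 define t where "t = (%i. case s i of Inl (Suc j) => Inl j | Inl 0 => Inr zero | Inr c => Inr c)"
 have "P x e = sat E (ren r p) (case_nat x (%i. case t i of Inl j => e j | Inr c => c))" for x e
  using p[of "case_nat x e"] unfolding satq_ren
  by (simp, intro arg_cong[where f = "sat E p"] ext) (auto simp: r_def t_def split: sum.split nat.split)
 then show ?thesis unfolding dfn_def by (intro exI[of _ "All (ren r p)"] exI[of _ t]) simp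
qed

lemma [dfn]: "dfn (%e. P (e 0) (%i. e (Suc i))) ==> dfn (%e. EX x. P x e)"
 using dfn_not[OF dfn_all[OF dfn_not]] by simp

lemma dff_var [dfn]: "dff (%e. e n)"
 unfolding dff_def by (intro dfn_eq0 isvar_var)

lemma dff_const [dfn]: "dff (%e. c)"
 unfolding dff_def by (intro dfn_eq0 isvar_var isvar_const)

lemma dff_shift: "dff t ==> dff (%e. t (%i. e (f i)))"
 unfolding dff_def using dfn_shift[of _ "%i. case i of 0 => 0 | Suc i => Suc (f i)"] by fastforce

lemma dff_graph: "dff t ==> dfn (%e. e n = t (%i. e (f i)))"
 unfolding dff_def using dfn_shift[of _ "%i. case i of 0 => n | Suc i => f i"] by fastforce

text \<open>The language has no terms besides variables, so substituting a definable function means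
  quantifying over its value.\<close>

lemma dfn_let:
 assumes "dfn P" "dff t" shows "dfn (%e. P (case_nat (t e) e))"
proof -
 have "case_nat (e 0) (%i. e (Suc i)) = e" for e :: "nat => 'm" by (rule ext) (simp split: nat.split)
 then have "dfn (%e. EX x. x = t e & P (case_nat x e))"
  by (intro dfn dff_graph[OF assms(2), of 0 Suc]) (simp add: assms(1))
 then show ?thesis by simp
qed

lemma dfn_rel1:
 assumes "dfn (%e. R (e 0))" "dff s" shows "dfn (%e. R (s e))"
 using dfn_let[OF assms] by simp

lemma dfn_rel2:
 assumes "dfn (%e. R (e 0) (e (Suc 0)))" "dff s" "dff t" shows "dfn (%e. R (s e) (t e))"
proof -
 have "dfn (%e. R (e (Suc 0)) (e 0))"
  using dfn_shift[OF assms(1), of "%i. if i = 0 then Suc 0 else 0"] by simp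
 from dfn_let[OF this dff_shift[OF assms(3), of Suc]]
 have "dfn (%e. R (e 0) (t (%i. e (Suc i))))" by simp
 from dfn_let[OF this assms(2)] show ?thesis by simp
qed

lemma dfn_rel3:
 assumes "dfn (%e. R (e 0) (e (Suc 0)) (e (Suc (Suc 0))))" "dff s" "dff t" "dff u"
 shows "dfn (%e. R (s e) (t e) (u e))"
proof -
 have "dfn (%e. R (e (Suc (Suc 0))) (e (Suc 0)) (e 0))"
  using dfn_shift[OF assms(1), of "%i. if i = 0 then Suc (Suc 0) else if i = Suc 0 then Suc 0 else 0"] by simp
 from dfn_let[OF this dff_shift[OF assms(4), of "%i. Suc (Suc i)"]]
 have "dfn (%e. R (e (Suc 0)) (e 0) (u (%i. e (Suc (Suc i)))))" by simp
 from dfn_let[OF this dff_shift[OF assms(3), of Suc]]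
 have "dfn (%e. R (e 0) (t (%i. e (Suc i))) (u (%i. e (Suc i))))" by simp
 from dfn_let[OF this assms(2)] show ?thesis by simp
qed

lemma dfn_rel4:
 assumes "dfn (%e. R (e 0) (e (Suc 0)) (e (Suc (Suc 0))) (e (Suc (Suc (Suc 0)))))" "dff s" "dff t" "dff u" "dff w"
 shows "dfn (%e. R (s e) (t e) (u e) (w e))"
proof -
 have "dfn (%e. R (e (Suc (Suc (Suc 0)))) (e (Suc (Suc 0))) (e (Suc 0)) (e 0))"
  using dfn_shift[OF assms(1), of "%i. if i = 0 then Suc (Suc (Suc 0)) else if i = Suc 0 then Suc (Suc 0)
   else if i = Suc (Suc 0) then Suc 0 else 0"] by simp
 from dfn_let[OF this dff_shift[OF assms(5), of "%i. Suc (Suc (Suc i))"]]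
 have "dfn (%e. R (e (Suc (Suc 0))) (e (Suc 0)) (e 0) (w (%i. e (Suc (Suc (Suc i))))))" by simp
 from dfn_let[OF this dff_shift[OF assms(4), of "%i. Suc (Suc i)"]]
 have "dfn (%e. R (e (Suc 0)) (e 0) (u (%i. e (Suc (Suc i)))) (w (%i. e (Suc (Suc i)))))" by simp
 from dfn_let[OF this dff_shift[OF assms(3), of Suc]]
 have "dfn (%e. R (e 0) (t (%i. e (Suc i))) (u (%i. e (Suc i))) (w (%i. e (Suc i))))" by simp
 from dfn_let[OF this assms(2)] show ?thesis by simp
qed

lemma dff_fun1:
 assumes "dff (%e. f (e 0))" "dff s" shows "dff (%e. f (s e))"
proof -
 have "dfn (%e. e 0 = f (e (Suc 0)))"
  using dff_graph[OF assms(1), of 0 Suc] by simp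
 from dfn_rel2[of "%x y. x = f y" "%e. e 0" "%e. s (%i. e (Suc i))", OF this dff_var dff_shift[OF assms(2), of Suc]]
 show ?thesis unfolding dff_def .
qed

lemma dff_fun2:
 assumes "dff (%e. f (e 0) (e (Suc 0)))" "dff s" "dff t" shows "dff (%e. f (s e) (t e))"
proof -
 have "dfn (%e. e 0 = f (e (Suc 0)) (e (Suc (Suc 0))))"
  using dff_graph[OF assms(1), of 0 Suc] by simp
 from dfn_rel3[of "%x y z. x = f y z" "%e. e 0" "%e. s (%i. e (Suc i))" "%e. t (%i. e (Suc i))", OF this dff_var dff_shift[OF assms(2), of Suc] dff_shift[OF assms(3), of Suc]]
 show ?thesis unfolding dff_def .
qed

lemma dff_fun3:
 assumes "dff (%e. f (e 0) (e (Suc 0)) (e (Suc (Suc 0))))" "dff s" "dff t" "dff u" shows "dff (%e. f (s e) (t e) (u e))"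
proof -
 have "dfn (%e. e 0 = f (e (Suc 0)) (e (Suc (Suc 0))) (e (Suc (Suc (Suc 0)))))"
  using dff_graph[OF assms(1), of 0 Suc] by simp
 from dfn_rel4[of "%x y z w. x = f y z w" "%e. e 0" "%e. s (%i. e (Suc i))" "%e. t (%i. e (Suc i))" "%e. u (%i. e (Suc i))", OF this dff_var dff_shift[OF assms(2), of Suc] dff_shift[OF assms(3), of Suc] dff_shift[OF assms(4), of Suc]]
 show ?thesis unfolding dff_def .
qed

lemma [dfn]: "dff s ==> dff t ==> dfn (%e. s e:el (t e))"
 unfolding el_def mem_Collect_eq by (rule dfn_rel2[where R = E]) (intro dfn_mem0 isvar_var)

lemma [dfn]: "dff s ==> dff t ==> dfn (%e. s e = t e)"
 by (rule dfn_rel2[where R = "(=)"]) (intro dfn_eq0 isvar_var)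

lemma [dfn]: "dff a ==> dfn (%e. P (e 0) (%i. e (Suc i))) ==> dfn (%e. ALL x:el (a e). P x e)"
 unfolding Ball_def by (intro dfn dff_shift[of a Suc])

lemma [dfn]: "dff a ==> dfn (%e. P (e 0) (%i. e (Suc i))) ==> dfn (%e. EX x:el (a e). P x e)"
 unfolding Bex_def by (intro dfn dff_shift[of a Suc])

lemma [dfn]:
 assumes "dfn (%e. P (e 0) (%i. e (Suc i)))" shows "dfn (%e. EX! x. P x e)"
 unfolding Ex1_def
 using dfn_shift[OF assms, of "%i. case i of 0 => 0 | Suc i => Suc (Suc i)"]
 by (intro dfn assms) simp

lemma [dfn]: "dff a ==> dff b ==> dfn (%e. el (a e) <= el (b e))"
 unfolding subset_eq by (intro dfn dff_shift[of b Suc])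

lemma [dfn]: "dfn P ==> dff s ==> dff t ==> dff (%e. if P e then s e else t e)"
proof -
 assume a: "dfn P" "dff s" "dff t"
 have "dfn (%e. (P (%i. e (Suc i)) & e 0 = s (%i. e (Suc i))) | (~ P (%i. e (Suc i)) & e 0 = t (%i. e (Suc i))))"
  by (intro dfn dfn_shift[of P Suc] a dff_graph[of s 0 Suc] dff_graph[of t 0 Suc])
 then show ?thesis unfolding dff_def by (rule back_subst[of dfn]) auto
qed

text \<open>The graph also has to describe the default: the value is \<open>zero\<close> when no
  element has exactly the given members.\<close>

lemma [dfn]:
 assumes "dfn (%e. P (e 0) (%i. e (Suc i)))" shows "dff (%e. set {x. P x e})"
proof -
 have eq: "y = set {x. P x e} <->
   (ALL x. x:el y <-> P x e) | ~ (EX a. ALL x. x:el a <-> P x e) & y = zero" for y e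
 proof (cases "small {x. P x e}")
  case True
  then have "y = set {x. P x e} <-> el y = {x. P x e}" using el_set el_ext by metis
  then show ?thesis using True by (auto simp: small_def)
 next
  case False
  then have "~ (EX a. ALL x. x:el a <-> P x e)" by (auto simp: small_def)
  then show ?thesis using False by (auto simp: set_def)
 qed
 note s = dfn_shift[OF assms, of "%i. case i of 0 => 0 | Suc i => Suc (Suc i)", simplified]
  dfn_shift[OF assms, of "%i. case i of 0 => 0 | Suc i => Suc (Suc (Suc i))", simplified]
 show ?thesis unfolding dff_def eq by (intro dfn s)
qed

lemma [dfn]:
 assumes "dfn (%e. P (e 0) (%i. e (Suc i)))" shows "dff (%e. if EX! x. P x e then THE x. P x e else zero)"
proof -
 have eq: "y = (if EX! x. P x e then THE x. P x e else zero) <-> (EX! x. P x e) & P y e | ~ (EX! x. P x e) & y = zero" for y e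
 proof (cases "EX! x. P x e")
  case True
  then have "P y e <-> y = (THE x. P x e)" using theI'[OF True] the1_equality[OF True, of y] by auto
  then show ?thesis using True by simp
 qed simp
 note s = dfn_shift[OF assms, of "%i. case i of 0 => 0 | Suc i => Suc (Suc i)", simplified]
 show ?thesis unfolding dff_def eq by (intro dfn s assms)
qed

text \<open>The constants in the definition of \<open>P\<close> become the parameters
  \<open>v\<close> of an instance of Separation, and all variables standing for coordinate 0 become
  its distinguished variable; other coordinates are filled with \<open>zero\<close>.\<close>

lemma small_sep:
 assumes "dfn (%e. P (e 0))" shows "small {x:el a. P x}"
proof -
 obtain p and s :: "nat => nat + 'm" where p: "!!e :: nat => 'm. P (e 0) = sat E p (%i. case s i of Inl j => e j | Inr c => c)"
  using assms unfolding dfn_def by blast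
 define r where "r = (%i. case s i of Inl j => if j = 0 then 0 else Suc i | Inr c => Suc i)"
 define v where "v = (%i. case s i of Inl _ => zero | Inr c => c)"
 define k where "k = Max (insert 0 (fv (ren r p)))"
 have "fv (ren r p) <= {..<k + 1}" unfolding k_def using finite_fv[of "ren r p"] by (auto simp: less_Suc_eq_le)
 then have "closure k (separation (ren r p)):ZFC" "fv (ren r p) <= {..<k + 1}" by (auto simp: ZFC_def)
 then have "EX b. ALL x. E x b <-> E x a & sat E (ren r p) (case_nat x v)"
  using ZFC satq_separation by metis
 moreover have "sat E (ren r p) (case_nat x v) = P x" for x
  using p[of "case_nat x (%_. zero)"] unfolding satq_ren
  by (simp, intro arg_cong[where f = "sat E p"] ext) (auto simp: r_def v_def split: sum.split nat.split)
 ultimately show ?thesis unfolding small_def el_def by auto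
qed

lemma small_subset: "dfn (%e. P (e 0)) ==> (!!x. P x ==> x:el a) ==> small {x. P x}"
 using small_sep[of P a] by (metis (mono_tags, lifting) Collect_cong)

lemma small_repl:
 assumes "dff (%e. f (e 0))" shows "small (f ` el a)"
proof -
 have "dfn (%e. e (Suc 0) = f (e 0))"
  using dff_graph[OF assms, of "Suc 0" "%_. 0"] by simp
 then obtain p and s :: "nat => nat + 'm" where p: "!!e :: nat => 'm. (e (Suc 0) = f (e 0)) = sat E p (%i. case s i of Inl j => e j | Inr c => c)"
  unfolding dfn_def by blast
 define r where "r = (%i. case s i of Inl j => if j = 0 then 0 else if j = Suc 0 then 1 else Suc (Suc i) | Inr c => Suc (Suc i))"
 define v where "v = (%i. case s i of Inl _ => zero | Inr c => c)"
 define k where "k = Max (insert 0 (fv (ren r p)))"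
 have *: "fv (ren r p) <= {..<k + 2}" unfolding k_def using finite_fv[of "ren r p"] by (auto simp: less_Suc_eq_le le_SucI)
 have **: "sat E (ren r p) (case_nat x (case_nat y v)) = (y = f x)" for x y
  using p[of "case_nat x (case_nat y (%_. zero))"] unfolding satq_ren
  by (simp, intro arg_cong[where f = "sat E p"] ext) (auto simp: r_def v_def split: sum.split nat.split)
 have "closure k (replacement (ren r p)):ZFC" using * by (auto simp: ZFC_def)
 from ZFC[OF this, of undefined] have "EX b. ALL y. E y b <-> (EX x. E x a & y = f x)"
  unfolding satq_replacement[OF *] by (elim allE[of _ v] allE[of _ a]) (simp add: **)
 then obtain b where "ALL y. E y b <-> (EX x. E x a & y = f x)" ..
 then have "el b = f ` el a" unfolding el_def by auto
 then show ?thesis unfolding small_def by blast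
qed

section \<open>The remaining axioms as closure properties, and basic operations on sets\<close>

lemma small_empty [simp]: "small {}"
 using small_sep[OF dfn_const[of False]] by simp

lemma el_zero [simp]: "el zero = {}"
 using small_empty unfolding zero_def small_def by (rule someI_ex)

lemma foundation: "el x ~= {} ==> EX y:el x. el x Int el y = {}"
proof -
 have "sentence Defs.foundation:ZFC" by (simp add: ZFC_def)
 from ZFC[OF this] have "ALL x. (EX z. E z x) --> (EX y. E y x & (ALL z. E z x --> ~ E z y))"
  unfolding satq_foundation by blast
 then show "el x ~= {} ==> EX y:el x. el x Int el y = {}" unfolding el_def by blast
qed

lemma [simp]: "small {x, y}"
proof -
 have "sentence pairing:ZFC" by (simp add: ZFC_def)
 from ZFC[OF this] obtain p where "ALL z. E z p <-> z = x | z = y" unfolding satq_pairing by blast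
 then have "el p = {x, y}" unfolding el_def by auto
 then show ?thesis unfolding small_def by blast
qed

lemma [simp]: "small (\<Union>(el ` el x))"
proof -
 have "sentence Defs.union:ZFC" by (simp add: ZFC_def)
 from ZFC[OF this] obtain u where "ALL z. E z u <-> (EX y. E y x & E z y)" unfolding satq_union by blast
 then have "el u = \<Union>(el ` el x)" unfolding el_def by auto
 then show ?thesis unfolding small_def by blast
qed

lemma [simp]: "small {z. el z <= el x}"
proof -
 have "sentence powerset:ZFC" by (simp add: ZFC_def)
 from ZFC[OF this] obtain u where "ALL z. E z u <-> (ALL w. E w z --> E w x)" unfolding satq_powerset by blast
 then have "el u = {z. el z <= el x}" unfolding el_def by auto
 then show ?thesis unfolding small_def by blast
qed

definition "dbl x y = set {z. z = x | z = y}"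
definition "pr x y = dbl (dbl x x) (dbl x y)"
definition "un a b = set {z. z:el a | z:el b}"
definition "Uni a = set {z. EX y:el a. z:el y}"
definition "pw a = set {z. el z <= el a}"
definition "ins x a = set {z. z = x | z:el a}"
definition times where "times a b = set {p. EX x:el a. EX y:el b. p = pr x y}"
text \<open>The union of all \<open>y\<close> with \<open>pr x y\<close> in \<open>f\<close>: a
  total operation, which is the value at \<open>x\<close> as soon as there is exactly one such
  \<open>y\<close>.\<close>

definition app where "app f x = set {z. EX y. pr x y:el f & z:el y}"
definition lam :: "'m => ('m => 'm) => 'm" where "lam a F = set {p. EX x:el a. p = pr x (F x)}"
definition "vmin a b = set {z. z:el a & z~:el b}"
definition "vint a b = set {z. z:el a & z:el b}"

lemma [dfn]: "dff s ==> dff t ==> dff (%e. dbl (s e) (t e))"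
 by (rule dff_fun2) (unfold dbl_def, intro dfn)
lemma dff_pr [dfn]: "dff s ==> dff t ==> dff (%e. pr (s e) (t e))"
 unfolding pr_def by (intro dfn)
lemma [dfn]: "dff s ==> dff t ==> dff (%e. un (s e) (t e))"
 by (rule dff_fun2) (unfold un_def, intro dfn)
lemma [dfn]: "dff s ==> dff (%e. Uni (s e))"
 by (rule dff_fun1) (unfold Uni_def, intro dfn)
lemma dff_pw [dfn]: "dff s ==> dff (%e. pw (s e))"
 by (rule dff_fun1) (unfold pw_def, intro dfn)
lemma [dfn]:
 "dff s ==> dff t ==> dff (%e. ins (s e) (t e))"
 "dff s ==> dff t ==> dff (%e. times (s e) (t e))"
 "dff s ==> dff t ==> dff (%e. app (s e) (t e))"
 "dff s ==> dff t ==> dff (%e. vmin (s e) (t e))"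
 "dff s ==> dff t ==> dff (%e. vint (s e) (t e))"
 by (rule dff_fun2, (unfold ins_def times_def app_def vmin_def vint_def)[1], (intro dfn)[1], assumption+)+
lemma dff_lam [dfn]:
 assumes "dff a" "dff (%e. F (e 0) (%i. e (Suc i)))" shows "dff (%e. lam (a e) (%x. F x e))"
 using dff_shift[OF assms(2), of "%i. case i of 0 => 0 | Suc i => Suc (Suc i)"]
 unfolding lam_def by (intro dfn dff_shift[of a Suc] assms) simp

lemma el_dbl [simp]: "el (dbl x y) = {x, y}"
proof -
 have "{z. z = x | z = y} = {x, y}" by auto
 then show ?thesis unfolding dbl_def by (simp add: el_set)
qed

lemma pr_inject [simp]: "pr x y = pr x' y' <-> x = x' & y = y'"
proof
 assume "pr x y = pr x' y'"
 then have e: "{dbl x x, dbl x y} = {dbl x' x', dbl x' y'}" unfolding pr_def by (metis el_dbl)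
 have d: "dbl a b = dbl c f <-> {a, b} = {c, f}" for a b c f by (metis el_dbl el_ext)
 show "x = x' & y = y'" using e by (auto simp: doubleton_eq_iff d)
qed auto

lemma el_Uni [simp]: "el (Uni a) = \<Union>(el ` el a)"
proof -
 have "{z. EX y:el a. z:el y} = \<Union>(el ` el a)" by auto
 then show ?thesis unfolding Uni_def by (simp add: el_set)
qed

lemma el_un [simp]: "el (un a b) = el a Un el b"
proof -
 have "{z. z:el a | z:el b} = el (Uni (dbl a b))" by auto
 then show ?thesis unfolding un_def by (metis el_set small_elts Uni_def Collect_disj_eq Collect_mem_eq)
qed

lemma [simp]: "el (pw a) = {z. el z <= el a}"
 unfolding pw_def by (simp add: el_set)

lemma [simp]: "el (ins x a) = insert x (el a)"
proof -
 have "{z. z = x | z:el a} = el (un (dbl x x) a)" "insert x (el a) = el (un (dbl x x) a)" by auto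
 then show ?thesis unfolding ins_def by (metis set_elts)
qed

lemma el_vmin [simp]: "el (vmin a b) = el a - el b"
 and el_vint [simp]: "el (vint a b) = el a Int el b"
proof -
 have "small {z. z:el a & z~:el b}" "small {z. z:el a & z:el b}"
  by (rule small_subset[of _ a]; (intro dfn)?; blast)+
 then show "el (vmin a b) = el a - el b" "el (vint a b) = el a Int el b"
  unfolding vmin_def vint_def by (auto simp: el_set)
qed

lemma el_times [simp]: "el (times a b) = {pr x y |x y. x:el a & y:el b}"
proof -
 have "small {p. EX x:el a. EX y:el b. p = pr x y}"
  by (rule small_subset[of _ "pw (pw (un a b))"]) (intro dfn, auto simp: pr_def)
 then show ?thesis unfolding times_def by (auto simp: el_set)
qed

lemma pr_Uni:
 assumes "pr x y:el f" shows "x:el (Uni (Uni f)) & y:el (Uni (Uni f))"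
proof -
 have "dbl x y:el (pr x y)" by (simp add: pr_def)
 then have "dbl x y:el (Uni f)" using assms by (auto intro: bexI[of _ "pr x y"])
 then have "el (dbl x y) <= el (Uni (Uni f))" by (subst el_Uni) blast
 then show ?thesis by simp
qed

lemma el_app: "el (app f x) = \<Union>(el ` {y. pr x y:el f})"
proof -
 have "small {z. EX y. pr x y:el f & z:el y}"
  by (rule small_subset[of _ "Uni (Uni (Uni f))"]) (intro dfn, use pr_Uni in \<open>auto simp del: el_Uni simp: el_Uni[of "Uni (Uni f)"]\<close>)
 then show ?thesis unfolding app_def by (auto simp: el_set)
qed

lemma app_eq: "(!!z. pr x z:el f <-> z = y) ==> app f x = y"
 by (rule el_ext) (simp add: el_app)

lemma el_lam: "dff (%e. F (e 0)) ==> el (lam a F) = (%x. pr x (F x)) ` el a"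
proof -
 assume F: "dff (%e. F (e 0))"
 have "{p. EX x:el a. p = pr x (F x)} = (%x. pr x (F x)) ` el a" by auto
 then show ?thesis unfolding lam_def using small_repl[of "%x. pr x (F x)" a] F
  by (simp add: el_set dff_pr dff_var)
qed

lemma app_lam: "dff (%e. F (e 0)) ==> x:el a ==> app (lam a F) x = F x"
 by (rule app_eq) (auto simp: el_lam)

end

section \<open>Recursion and ordinals\<close>

context zfc
begin

lemma el_sep: "dfn (%e. P (e 0)) ==> el (set {x. x:el a & P x}) = {x:el a. P x}"
 using small_sep[of P a] by (simp add: el_set)

lemma sep_ex: "(!!X. el X = {x:el a. P x} ==> thesis) ==> dfn (%e. P (e 0)) ==> thesis"
 using el_sep[of P a] by blast

definition vUN :: "'m => ('m => 'm) => 'm" where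
 "vUN a F = set {z. EX x:el a. z:el (F x)}"

definition img :: "'m => ('m => 'm) => 'm" where
 "img a F = set {z. EX x:el a. z = F x}"

lemma [dfn]:
 "dff a ==> dff (%e. F (e 0) (%i. e (Suc i))) ==> dff (%e. vUN (a e) (%x. F x e))"
 and dff_img [dfn]:
 "dff a ==> dff (%e. F (e 0) (%i. e (Suc i))) ==> dff (%e. img (a e) (%x. F x e))"
 unfolding vUN_def img_def
 using dff_shift[of "%e. F (e 0) (%i. e (Suc i))" "%i. case i of 0 => 0 | Suc i => Suc (Suc i)"]
 by (simp_all; intro dfn dff_shift[of a Suc]; simp)+

lemma el_img: "dff (%e. F (e 0)) ==> el (img a F) = F ` el a"
proof -
 have "{z. EX x:el a. z = F x} = F ` el a" by auto
 then show "dff (%e. F (e 0)) ==> el (img a F) = F ` el a"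
  using small_repl[of F a] by (simp add: img_def el_set)
qed

lemma el_vUN: "dff (%e. F (e 0)) ==> el (vUN a F) = (UN x:el a. el (F x))"
proof -
 assume F: "dff (%e. F (e 0))"
 have "{z. EX x:el a. z:el (F x)} = el (Uni (img a F))" using F by (auto simp: el_img)
 then have "set {z. EX x:el a. z:el (F x)} = Uni (img a F)" by (metis set_elts)
 then show ?thesis unfolding vUN_def using F by (simp add: el_img)
qed

lemma lam_cong: "(!!x. x:el a ==> F x = G x) ==> lam a F = lam a G"
 unfolding lam_def by (metis (no_types, lifting))

lemma img_cong: "(!!x. x:el a ==> F x = G x) ==> img a F = img a G"
 unfolding img_def by (metis (no_types, lifting))

section \<open>Recursion on membership\<close>

definition trans where "trans t <-> (ALL x:el t. el x <= el t)"

lemma [dfn]: "dff t ==> dfn (%e. trans (t e))"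
 by (rule dfn_rel1) (unfold trans_def, intro dfn)

text \<open>Induction is available at once for members of transitive sets. That every set is one is
  shown only after transitive closures exist, and these come from recursion along \<open>om\<close>,
  whose members satisfy \<open>wf_set\<close> directly.\<close>

definition "wf_set x <-> (EX t. trans t & x:el t)"

lemma wf_set_induct:
 assumes "wf_set x" and P: "dfn (%e. P (e 0))"
  and step: "!!x. wf_set x ==> (!!y. y:el x ==> P y) ==> P x"
 shows "P x"
proof (rule ccontr)
 assume n: "~ P x"
 obtain t where t: "trans t" "x:el t" using assms(1) unfolding wf_set_def by blast
 let ?b = "set {z. z:el t & ~ P z}"
 have b: "el ?b = {z:el t. ~ P z}" by (rule el_sep) (intro dfn P)
 then have "el ?b ~= {}" using n t by auto
 then obtain y where y: "y:el ?b" "el ?b Int el y = {}" using foundation by blast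
 then have "wf_set y" using b t unfolding wf_set_def by auto
 moreover have "P z" if "z:el y" for z
  using that y b t unfolding trans_def by blast
 ultimately have "P y" by (rule step)
 then show False using y b by simp
qed

text \<open>An attempt: \<open>f\<close> satisfies the recursion equation on the transitive set
  \<open>t\<close>. In \<open>H p x f\<close> the argument \<open>p\<close> is a parameter and
  \<open>f\<close> the restriction of the function to \<open>x\<close>.\<close>

definition att :: "('m => 'm => 'm => 'm) => 'm => 'm => 'm => bool" where
 "att H p t f <-> trans t & (ALL x:el t. app f x = H p x (lam x (app f)))"

definition rec :: "('m => 'm => 'm => 'm) => 'm => 'm => 'm" where
 "rec H p x = (if EX! z. EX t f. att H p t f & x:el t & z = app f x then
  THE z. EX t f. att H p t f & x:el t & z = app f x else zero)"

lemma dfn_att: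
 assumes H: "dff (%e. H (e 0) (e (Suc 0)) (e (Suc (Suc 0))))" and "dff p" "dff t" "dff f"
 shows "dfn (%e. att H (p e) (t e) (f e))"
proof (rule dfn_rel3[OF _ assms(2-4)])
 have "dff (%e. lam (e 0) (app (e (Suc (Suc (Suc 0))))))"
  using dff_lam[of "%e. e 0" "%x e. app (e (Suc (Suc (Suc 0)))) x"] by (simp add: dfn)
 then show "dfn (%e. att H (e 0) (e (Suc 0)) (e (Suc (Suc 0))))"
  unfolding att_def by (intro dfn dff_fun3[OF H])
qed

lemma dff_rec:
 assumes H: "dff (%e. H (e 0) (e (Suc 0)) (e (Suc (Suc 0))))" and "dff p" "dff x"
 shows "dff (%e. rec H (p e) (x e))"
 by (rule dff_fun2[OF _ assms(2,3)]) (unfold rec_def, intro dfn dfn_att[OF H])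

lemma rec_wf:
 assumes H: "dff (%e. H (e 0) (e (Suc 0)) (e (Suc (Suc 0))))" and "wf_set x"
 shows "rec H p x = H p x (lam x (rec H p))"
proof -
 have da: "dff (%e. app f (e 0))" for f by (intro dfn)
 have dr: "dff (%e. rec H p (e 0))" by (intro dff_rec[OF H] dfn)
 have uniq: "app f x = app f' x" if "att H p t f" "att H p t' f'" "x:el t" "x:el t'" for f f' t t' x
 proof -
  have "wf_set x" using that unfolding att_def wf_set_def by blast
  then have "x:el t & x:el t' --> app f x = app f' x"
  proof (rule wf_set_induct)
   show "dfn (%e. e 0:el t & e 0:el t' --> app f (e 0) = app f' (e 0))" by (intro dfn)
   show "x:el t & x:el t' --> app f x = app f' x"
    if IH: "!!y. y:el x ==> y:el t & y:el t' --> app f y = app f' y" for x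
   proof
    assume x: "x:el t & x:el t'"
    have tr: "trans t" "trans t'" using \<open>att H p t f\<close> \<open>att H p t' f'\<close> unfolding att_def by simp_all
    have "lam x (app f) = lam x (app f')"
    proof (rule lam_cong)
     show "app f y = app f' y" if "y:el x" for y
      using IH[OF that] x tr that unfolding trans_def by auto
    qed
    then show "app f x = app f' x"
     using x \<open>att H p t f\<close> \<open>att H p t' f'\<close> unfolding att_def by metis
   qed
  qed
  then show ?thesis using that by blast
 qed
 have rec_eq: "rec H p x = app f x" if "att H p t f" "x:el t" for f t x
 proof -
  have "EX! z. EX t f. att H p t f & x:el t & z = app f x" using that uniq by blast
  moreover from this have "(THE z. EX t f. att H p t f & x:el t & z = app f x) = app f x"
   by (rule the1_equality) (use that in blast)
  ultimately show ?thesis unfolding rec_def by simp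
 qed
 let ?A = "%x. EX t f. att H p t f & x:el t"
 have dA: "dfn (%e. ?A (e 0))" by (intro dfn dfn_att[OF H])
 have "?A x" using assms(2)
 proof (rule wf_set_induct[OF _ dA])
  fix x assume x: "wf_set x" and IH: "!!y. y:el x ==> ?A y"
  obtain t where t: "trans t" "x:el t" using x unfolding wf_set_def by blast
  \<comment> \<open>The points of \<open>t\<close> at which an attempt exists; by the induction
    hypothesis they include all members of \<open>x\<close>. The values of \<open>rec\<close> on
    them, with one more value at \<open>x\<close>, make up an attempt at \<open>x\<close>.\<close>
  define T where "T = set {z. z:el t & ?A z}"
  have T: "el T = {z:el t. ?A z}" unfolding T_def by (rule el_sep[OF dA])
  have xT: "el x <= el T" using IH t unfolding T trans_def by blast
  have trT: "trans T" unfolding trans_def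
  proof (intro ballI subsetI)
   fix z y assume zy: "z:el T" "y:el z"
   then obtain s f where "att H p s f" "z:el s" "z:el t" unfolding T by blast
   then show "y:el T" using zy t unfolding T att_def trans_def by blast
  qed
  define f where "f = lam (ins x T) (%z. if z:el T then rec H p z else H p x (lam x (rec H p)))"
  have df: "dff (%e. if e 0:el T then rec H p (e 0) else H p x (lam x (rec H p)))" by (intro dfn dr)
  have f1: "app f z = rec H p z" if "z:el T" for z
   unfolding f_def using app_lam[OF df, of z "ins x T"] that by simp
  have lz: "lam z (app f) = lam z (rec H p)" if "el z <= el T" for z
   using that by (intro lam_cong f1) blast
  have req: "rec H p z = H p z (lam z (rec H p))" if h: "z:el T" for z
  proof -
   obtain s g where g: "att H p s g" "z:el s" using h unfolding T by blast
   then have "lam z (app g) = lam z (rec H p)"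
    unfolding att_def trans_def by (intro lam_cong rec_eq[symmetric, OF g(1)]) blast
   then show ?thesis using g rec_eq[OF g] unfolding att_def by simp
  qed
  have "app f z = H p z (lam z (app f))" if "z:el (ins x T)" for z
  proof (cases "z:el T")
   case True
   then have "el z <= el T" using trT unfolding trans_def by blast
   then show ?thesis using True by (simp add: f1 lz req)
  next
   case False
   then have "z = x" using that by simp
   then show ?thesis using False app_lam[OF df, of x "ins x T"] lz[OF xT] unfolding f_def[symmetric] by simp
  qed
  moreover have "trans (ins x T)" using trT xT unfolding trans_def by auto
  ultimately show "?A x" unfolding att_def by (intro exI[of _ "ins x T"] exI[of _ f]) auto
 qed
 then obtain s g where g: "att H p s g" "x:el s" by blast
 then have "lam x (app g) = lam x (rec H p)"
  unfolding att_def trans_def by (intro lam_cong rec_eq[symmetric, OF g(1)]) blast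
 then show ?thesis using g rec_eq[OF g] unfolding att_def by simp
qed

section \<open>Natural numbers and transitive closures\<close>

definition succ where "succ x = ins x x"

lemma el_succ [simp]: "el (succ x) = insert x (el x)"
 by (simp add: succ_def)

lemma [dfn]: "dff s ==> dff (%e. succ (s e))"
 unfolding succ_def by (intro dfn)

definition ind where "ind w <-> zero:el w & (ALL x:el w. succ x:el w)"

lemma [dfn]: "dff t ==> dfn (%e. ind (t e))"
 by (rule dfn_rel1) (unfold ind_def, intro dfn)

definition "om = set {n. ALL v. ind v --> n:el v}"

lemma zero_iff: "el x = {} <-> x = zero"
 using el_ext by fastforce

lemma ex_ind: "EX w. ind w"
proof -
 have "sentence infinity:ZFC" by (simp add: ZFC_def)
 from ZFC[OF this] obtain w where w: "EX e. E e w & (ALL z. ~ E z e)"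
  "ALL x. E x w --> (EX s. E s w & (ALL z. E z s <-> E z x | z = x))"
  unfolding satq_infinity by blast
 have "zero:el w" using w(1) zero_iff unfolding el_def by (metis Collect_empty_eq mem_Collect_eq)
 moreover have "succ x:el w" if h: "x:el w" for x
 proof -
  obtain s where s: "s:el w" "ALL z. E z s <-> E z x | z = x" using w(2) h unfolding el_def by auto
  have "el s = el (succ x)" using s(2) by (auto simp: E_elts)
  then show ?thesis using s(1) el_ext by blast
 qed
 ultimately show ?thesis unfolding ind_def by blast
qed

lemma el_omega: "el om = {n. ALL v. ind v --> n:el v}"
proof -
 obtain w where "ind w" using ex_ind by blast
 then have "small {n. ALL v. ind v --> n:el v}"
  by (intro small_subset[of _ w]) (intro dfn, blast)
 then show ?thesis unfolding om_def by (rule el_set)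
qed

lemma zero_omega [simp]: "zero:el om"
 and succ_omega [simp]: "n:el om ==> succ n:el om"
 unfolding el_omega ind_def by auto

lemma om_induct [consumes 1, case_names df zero succ]:
 assumes "n:el om" and P: "dfn (%e. P (e 0))" and "P zero"
  and step: "!!n. n:el om ==> P n ==> P (succ n)"
 shows "P n"
proof -
 have v: "el (set {x. x:el om & P x}) = {x:el om. P x}" by (rule el_sep[OF P])
 have "ind (set {x. x:el om & P x})" unfolding ind_def v using assms by auto
 then show ?thesis using assms(1) v unfolding el_omega by blast
qed

lemma trans_nat: "n:el om ==> trans n"
proof (induction rule: om_induct)
 case df show ?case by (intro dfn)
qed (auto simp: trans_def)

lemma trans_omega: "trans om"
proof -
 have "el n <= el om" if "n:el om" for n
  using that
 proof (induction rule: om_induct)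
  case df show ?case by (intro dfn)
 qed auto
 then show ?thesis unfolding trans_def by blast
qed

lemma nat_in_omega: "n:el om ==> m:el n ==> m:el om"
 using trans_omega unfolding trans_def by blast

lemma wf_nat: "n:el om ==> wf_set n"
 unfolding wf_set_def using trans_omega by blast

text \<open>The \<open>n\<close>-th stage consists of \<open>p\<close> and the members of members of
  earlier stages; the union of the stages is the transitive closure.\<close>

definition "tcH p n f = un p (vUN n (%m. Uni (app f m)))"

lemma dff_tcH: "dff (%e. tcH (e 0) (e (Suc 0)) (e (Suc (Suc 0))))"
 unfolding tcH_def by (intro dfn)

definition "tc x = vUN om (%n. rec tcH x n)"

lemma [dfn]: "dff s ==> dff (%e. tc (s e))"
 unfolding tc_def by (intro dfn dff_rec[OF dff_tcH] dff_shift[of s Suc])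

lemma el_tc: "el (tc x) = (UN n:el om. el (rec tcH x n))"
 unfolding tc_def by (rule el_vUN) (intro dff_rec[OF dff_tcH] dfn)

lemma rec_tcH: "n:el om ==> el (rec tcH x n) = el x Un (UN m:el n. \<Union>(el ` el (rec tcH x m)))"
proof -
 assume n: "n:el om"
 have d: "dff (%e. rec tcH x (e 0))" by (intro dff_rec[OF dff_tcH] dfn)
 have d2: "dff (%e. Uni (app f (e 0)))" for f by (intro dfn)
 show ?thesis
  unfolding rec_wf[OF dff_tcH wf_nat[OF n]] tcH_def[of x n] by (simp add: el_vUN[OF d2] app_lam[OF d])
qed

lemma subset_tc: "el x <= el (tc x)"
 unfolding el_tc using rec_tcH[OF zero_omega] zero_omega by blast

lemma trans_tc: "trans (tc x)"
proof -
 have "y:el (tc x)" if h: "z:el (tc x)" "y:el z" for y z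
 proof -
  obtain n where n: "n:el om" "z:el (rec tcH x n)" using h(1) unfolding el_tc by blast
  then have "y:el (rec tcH x (succ n))" using that(2) rec_tcH[OF succ_omega[OF n(1)], of x] by auto
  then show ?thesis unfolding el_tc using n succ_omega by blast
 qed
 then show ?thesis unfolding trans_def by blast
qed

lemma wf_set: "wf_set x"
 unfolding wf_set_def using trans_tc[of "dbl x x"] subset_tc[of "dbl x x"] by auto

lemma eps_induct [case_names df step]:
 assumes "dfn (%e. P (e 0))" "!!x. (!!y. y:el x ==> P y) ==> P x"
 shows "P x"
 using wf_set_induct[OF wf_set assms(1)] assms(2) by blast

lemma rec: "dff (%e. H (e 0) (e (Suc 0)) (e (Suc (Suc 0)))) ==> rec H p x = H p x (lam x (rec H p))"
 using rec_wf wf_set by blast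

lemma mem_irrefl: "x~:el x"
proof (induction x rule: eps_induct)
 case df show ?case by (intro dfn)
qed blast

lemma mem_asym: "x:el y ==> y~:el x"
proof (induction x arbitrary: y rule: eps_induct)
 case (step x)
 then show ?case by blast
next
 case df
 have "dfn (%e. ALL y. e 0:el y --> y~:el (e 0))" by (intro dfn)
 then show ?case by simp
qed

subsection \<open>Ordinals\<close>

definition "Ord a <-> trans a & (ALL x:el a. trans x)"

lemma [dfn]: "dff t ==> dfn (%e. Ord (t e))"
 by (rule dfn_rel1) (unfold Ord_def, intro dfn)

lemma Ord_mem: "Ord a ==> x:el a ==> Ord x"
 unfolding Ord_def trans_def by blast

lemma Ord_trans: "Ord a ==> x:el a ==> y:el x ==> y:el a"
 unfolding Ord_def trans_def by blast

lemma Ord_linear: "Ord a ==> Ord b ==> a:el b | a = b | b:el a"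
proof (induction a arbitrary: b rule: eps_induct)
 case df
 have "dfn (%e. ALL b. Ord (e 0) --> Ord b --> e 0:el b | e 0 = b | b:el (e 0))" by (intro dfn)
 then show ?case by (rule back_subst[of dfn]) blast
next
 case (step a)
 note IH = step(1)
 have "Ord b --> a:el b | a = b | b:el a" for b
 proof (induction b rule: eps_induct)
  case df show ?case by (intro dfn)
 next
  case (step b)
  show ?case
  proof (intro impI)
   assume b: "Ord b"
   show "a:el b | a = b | b:el a"
   proof (rule ccontr)
    assume n: "~ ?thesis"
    have "el a <= el b"
     using IH b n Ord_mem Ord_trans \<open>Ord a\<close> by (metis subsetI)
    moreover have "el b <= el a"
     using step b n Ord_mem Ord_trans \<open>Ord a\<close> by (metis subsetI)
    ultimately show False using n el_ext by blast
   qed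
  qed
 qed
 then show ?case using step by blast
qed

lemma Ord_omega: "Ord om"
 unfolding Ord_def using trans_omega trans_nat by blast

lemma Ord_nat: "n:el om ==> Ord n"
 using Ord_omega Ord_mem by blast

lemma Ord_subset: "Ord a ==> Ord b ==> el a <= el b <-> a:el b | a = b"
 using Ord_linear[of a b] Ord_trans mem_irrefl by blast

lemma Ord_least:
 assumes P: "dfn (%e. P (e 0))" and "Ord a" "P a"
 obtains b where "Ord b" "P b" "!!c. c:el b ==> ~ P c"
proof -
 have "Ord a --> P a --> (EX b. Ord b & P b & (ALL c:el b. ~ P c))"
 proof (induction a rule: eps_induct)
  case df show ?case by (intro dfn P)
 next
  case (step a)
  then show ?case using Ord_mem by blast
 qed
 then show ?thesis using assms that by blast
qed

text \<open>Burali-Forti: a set of all ordinals would be an ordinal, hence a member of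
  itself.\<close>

lemma not_all_Ord: "small A ==> EX a. Ord a & a~:A"
proof (rule ccontr)
 assume A: "small A" "~ (EX a. Ord a & a~:A)"
 obtain s where s: "el s = A" using A(1) unfolding small_def by blast
 have o: "el (set {x. x:el s & Ord x}) = {x:el s. Ord x}"
  by (rule el_sep) (intro dfn)
 define w where "w = set {x. x:el s & Ord x}"
 have w: "x:el w <-> Ord x" for x unfolding w_def o using A s by auto
 have "trans w" unfolding trans_def using w Ord_mem by blast
 moreover have "trans x" if "x:el w" for x using that w unfolding Ord_def by simp
 ultimately have "Ord w" unfolding Ord_def by simp
 then show False using w mem_irrefl[of w] by simp
qed

subsection \<open>Rank and collection\<close>

definition "rkH p x f = vUN x (%y. succ (app f y))"
definition "VH p x f = vUN x (%y. pw (app f y))"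

lemma dff_rkH: "dff (%e. rkH (e 0) (e (Suc 0)) (e (Suc (Suc 0))))"
 and dff_VH: "dff (%e. VH (e 0) (e (Suc 0)) (e (Suc (Suc 0))))"
 unfolding rkH_def VH_def by (intro dfn)+

abbreviation "rk \<equiv> rec rkH zero"
abbreviation "V \<equiv> rec VH zero"

lemma dff_rk [dfn]: "dff s ==> dff (%e. rk (s e))"
 and dff_V [dfn]: "dff s ==> dff (%e. V (s e))"
 by (intro dff_rec[OF dff_rkH] dff_rec[OF dff_VH] dfn; assumption)+

lemma el_rk: "el (rk x) = (UN y:el x. insert (rk y) (el (rk y)))"
proof -
 have d: "dff (%e. succ (app f (e 0)))" for f by (intro dfn)
 show ?thesis
  by (subst rec[OF dff_rkH], subst rkH_def) (simp add: el_vUN[OF d] app_lam dff_rk dff_var)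
qed

lemma el_V: "el (V x) = (UN y:el x. {z. el z <= el (V y)})"
proof -
 have d: "dff (%e. pw (app f (e 0)))" for f by (intro dfn)
 show ?thesis
  by (subst rec[OF dff_VH], subst VH_def) (simp add: el_vUN[OF d] app_lam dff_V dff_var)
qed

lemma Ord_rk: "Ord (rk x)"
proof (induction x rule: eps_induct)
 case df show ?case by (intro dfn)
next
 case (step x)
 then show ?case unfolding Ord_def trans_def el_rk[of x] by blast
qed

lemma subset_V_rk: "el x <= el (V (rk x))"
proof (induction x rule: eps_induct)
 case df show ?case by (intro dfn)
next
 case (step x)
 then show ?case unfolding el_V[of "rk x"] el_rk[of x] by blast
qed

text \<open>Each \<open>x\<close> is sent to the least ordinal \<open>u\<close> such that some
  \<open>y\<close> with \<open>R x y\<close> lies in \<open>V u\<close>. This function is definable,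
  so Replacement applies to it although \<open>y\<close> is not determined by
  \<open>x\<close>.\<close>

lemma collection:
 assumes R: "dfn (%e. R (e 0) (e (Suc 0)))"
 obtains b where "!!x y. x:el a ==> R x y ==> EX y:el b. R x y"
proof -
 let ?Q = "%x u. Ord u & (EX y:el (V u). R x y) & (ALL c:el u. ~ (EX y:el (V c). R x y))"
 define F where "F x = (if EX! u. ?Q x u then THE u. ?Q x u else zero)" for x
 have dR: "dff s ==> dff t ==> dfn (%e. R (s e) (t e))" for s t by (rule dfn_rel2[OF R])
 have dF: "dff (%e. V (F (e 0)))" unfolding F_def by (intro dfn dR)
 show ?thesis
 proof (rule that[of "vUN a (%x. V (F x))"])
  fix x y assume x: "x:el a" "R x y"
  have "y:el (V (rk (dbl y y)))" using subset_V_rk[of "dbl y y"] by simp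
  moreover have "dfn (%e. EX y:el (V (e 0)). R x y)" by (intro dfn dR)
  ultimately obtain u where u: "Ord u" "EX y:el (V u). R x y" "!!c. c:el u ==> ~ (EX y:el (V c). R x y)"
   using Ord_least[of "%u. EX y:el (V u). R x y" "rk (dbl y y)"] Ord_rk x(2) by blast
  then have "EX! u. ?Q x u" using Ord_linear by (intro ex1I[of _ u]) blast+
  then have Fx: "F x = (THE u. ?Q x u)" unfolding F_def by (rule if_P)
  have "?Q x (F x)" unfolding Fx by (rule theI'[OF \<open>EX! u. ?Q x u\<close>])
  then show "EX y:el (vUN a (%x. V (F x))). R x y" unfolding el_vUN[OF dF] using x by blast
 qed
qed

subsection \<open>Choice\<close>

lemma choice_set:
 assumes "!!x. x:el a ==> el x ~= {}"
  and "!!x y. x:el a ==> y:el a ==> x ~= y ==> el x Int el y = {}"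
 obtains c where "!!x. x:el a ==> EX z. el x Int el c = {z}"
proof -
 have "sentence Defs.choice:ZFC" by (simp add: ZFC_def)
 note ch = ZFC[OF this, unfolded satq_choice, THEN HOL.spec, of a]
 have 1: "ALL x. E x a --> (EX z. E z x)" using assms(1) unfolding el_def by blast
 have 2: "ALL x. E x a --> (ALL y. E y a --> x ~= y --> ~ (EX z. E z x & E z y))" using assms(2) unfolding el_def by blast
 obtain c where c: "ALL x. E x a --> (EX z. (E z x & E z c) & (ALL y. E y x & E y c --> y = z))"
  using ch[THEN HOL.mp, OF conjI[OF 1 2]] by blast
 show ?thesis
 proof (rule that[of c])
  fix x assume "x:el a"
  then obtain z where "E z x" "E z c" "ALL y. E y x & E y c --> y = z" using c unfolding el_def by blast
  then have "el x Int el c = {z}" unfolding el_def by blast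
  then show "EX z. el x Int el c = {z}" by blast
 qed
qed

text \<open>The axiom is about disjoint families, so \<open>x\<close> is replaced by
  \<open>T x\<close>, the set of its members tagged with \<open>x\<close>.\<close>

lemma choice_fun: "EX f. ALL x:el a. el x ~= {} --> app f x:el x"
proof -
 define T where "T x = times (dbl x x) x" for x
 have dT: "dff (%e. T (e 0))" unfolding T_def by (intro dfn)
 have eT: "el (T x) = pr x ` el x" for x unfolding T_def by auto
 obtain a' where a': "el a' = {x:el a. x ~= zero}" by (erule sep_ex) (intro dfn)
 have im: "el (img a' T) = T ` el a'" by (rule el_img[OF dT])
 have ne: "el x ~= {}" if "x:el a'" for x using that zero_iff a' by auto
 obtain c where c: "!!x. x:el (img a' T) ==> EX z. el x Int el c = {z}"
 proof (rule choice_set[of "img a' T"])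
  show "el x ~= {}" if "x:el (img a' T)" for x
   using that ne unfolding im by (auto simp: eT)
  show "el x Int el y = {}" if "x:el (img a' T)" "y:el (img a' T)" "x ~= y" for x y
   using that unfolding im by (auto simp: eT)
 qed blast
 obtain f where f: "el f = {p:el c. EX x:el a. p:el (T x)}" by (erule sep_ex) (intro dfn dff_fun1[OF dT])
 have "app f x:el x" if x: "x:el a" "el x ~= {}" for x
 proof -
  have "x:el a'" using x a' zero_iff by auto
  then have "T x:el (img a' T)" unfolding im by blast
  then obtain z where z: "el (T x) Int el c = {z}" using c by blast
  then have "z:pr x ` el x" "z:el c" unfolding eT by blast+
  then obtain y where y: "y:el x" "z = pr x y" "pr x y:el c" by blast
  have "pr x w:el f <-> w = y" for w
  proof
   assume "pr x w:el f"
   then obtain u where "pr x w:el c" "pr x w:el (T u)" unfolding f by blast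
   then have "pr x w:el (T x) Int el c" unfolding eT by auto
   then show "w = y" using z y(2) by simp
  next
   assume "w = y"
   then show "pr x w:el f" using y x(1) unfolding f eT by blast
  qed
  then have "app f x = y" by (rule app_eq)
  then show ?thesis using y by simp
 qed
 then show ?thesis by blast
qed

text \<open>Choosing elements of \<open>X\<close> one after the other as long as the next one is in relation \<open>R\<close> to the set
 of the previous ones.\<close>

lemma greedy:
 assumes R: "dfn (%e. R (e 0) (e (Suc 0)))"
 obtains k f where "Ord k" "!!a. a:el k ==> app f a:el X"
  "!!a. a:el k ==> app f a~:el (img a (app f)) & R (app f a) (img a (app f))"
  "!!x. x:el X ==> x:el (img k (app f)) | ~ R x (img k (app f))"
proof -
 obtain c where c: "!!x. el x <= el X ==> el x ~= {} ==> app c x:el x"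
  using choice_fun[of "pw X"] by auto
 define S where "S Y = set {x. x:el X & x~:el Y & R x Y}" for Y
 have dR: "dff s ==> dff t ==> dfn (%e. R (s e) (t e))" for s t by (rule dfn_rel2[OF R])
 have S: "el (S Y) = {x:el X. x~:el Y & R x Y}" for Y
  unfolding S_def by (rule el_sep) (intro dfn dR)
 have dS: "dff s ==> dff (%e. S (s e))" for s
  by (rule dff_fun1) (unfold S_def, intro dfn dR)
 \<comment> \<open>\<open>X\<close> is not a member of itself; as a value it signals that no
   candidate is left.\<close>
 define H where "H p a f = (if S (img a (app f)) = zero then X else app c (S (img a (app f))))" for p a f :: 'm
 have di: "dff (%e. img (e (Suc 0)) (app (e (Suc (Suc 0)))))"
  using dff_img[of "%e. e (Suc 0)" "%x e. app (e (Suc (Suc 0))) x"] by (simp add: dfn)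
 have dH: "dff (%e. H (e 0) (e (Suc 0)) (e (Suc (Suc 0))))"
  unfolding H_def by (intro dfn dS di)
 define F where "F = rec H zero"
 have dF: "dff s ==> dff (%e. F (s e))" for s unfolding F_def by (intro dff_rec[OF dH] dfn)
 have dF0: "dff (%e. F (e 0))" by (intro dF dfn)
 have F: "F a = (if S (img a F) = zero then X else app c (S (img a F)))" for a
 proof -
  have "img a (app (lam a F)) = img a F" by (rule img_cong) (rule app_lam[OF dF0])
  then show ?thesis using rec[OF dH, of zero a] unfolding F_def[symmetric] by (simp add: H_def)
 qed
 have cS: "app c (S Y):el (S Y)" if "S Y ~= zero" for Y
 proof (rule c)
  show "el (S Y) ~= {}" using that zero_iff by simp
  show "el (S Y) <= el X" unfolding S by blast
 qed
 have inS: "F a:el (S (img a F))" if "F a ~= X" for a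
  using that F[of a] cS[of "img a F"] by (simp split: if_splits)
 \<comment> \<open>Otherwise \<open>F\<close> would inject the ordinals into \<open>X\<close>, and
   Replacement along its inverse would collect all of them in a set.\<close>
 have "EX a. Ord a & F a = X"
 proof (rule ccontr)
  assume n: "~ ?thesis"
  have inj: "a = b" if "Ord a" "Ord b" "F a = F b" for a b
  proof -
   have "F a~:el (img a F)" "F b~:el (img b F)" using n inS that S by blast+
   then show ?thesis using that Ord_linear[of a b] unfolding el_img[OF dF0] by (metis imageI)
  qed
  let ?G = "%x. if EX! a. Ord a & F a = x then THE a. Ord a & F a = x else zero"
  have "small (?G ` el X)" by (rule small_repl) (intro dfn dF)
  then obtain a where a: "Ord a" "a~:?G ` el X" using not_all_Ord by blast
  have "EX! b. Ord b & F b = F a" using a inj by blast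
  moreover from this have "(THE b. Ord b & F b = F a) = a" using a by (intro the1_equality) auto
  ultimately have G: "?G (F a) = a" by simp
  have "F a:el X" using inS[of a] n a S by blast
  from imageI[OF this, of ?G] have "a:?G ` el X" by (simp only: G)
  with a(2) show False by (rule notE)
 qed
 then obtain a where a: "Ord a" "F a = X" by blast
 have "dfn (%e. F (e 0) = X)" by (intro dfn dF)
 from Ord_least[OF this a] obtain k where k: "Ord k" "F k = X" "!!b. b:el k ==> F b ~= X" by blast
 have ap: "app (lam k F) b = F b" if "b:el k" for b by (rule app_lam[OF dF0 that])
 have im: "img b (app (lam k F)) = img b F" if "el b <= el k" for b
  by (rule img_cong, rule ap) (use that in blast)
 have Sk: "S (img k F) = zero"
 proof (rule ccontr)
  assume n: "S (img k F) ~= zero"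
  then have "F k = app c (S (img k F))" using F[of k] by (simp only: if_False)
  then have "X:el (S (img k F))" using k(2) cS[OF n] by (simp only:)
  then have "X:el X" using S[of "img k F"] by simp
  with mem_irrefl show False by (rule notE)
 qed
 show ?thesis
 proof (rule that[of k "lam k F"])
  show "Ord k" by fact
  show "app (lam k F) b:el X" if "b:el k" for b
   using inS[OF k(3)[OF that]] that by (simp add: ap S)
  show "app (lam k F) b~:el (img b (app (lam k F))) & R (app (lam k F) b) (img b (app (lam k F)))" if "b:el k" for b
  proof -
   have "el b <= el k" using k(1) that Ord_trans by blast
   then show ?thesis using inS[OF k(3)[OF that]] that by (simp add: ap im S)
  qed
  show "x:el (img k (app (lam k F))) | ~ R x (img k (app (lam k F)))" if "x:el X" for x
  proof -
   have "x~:el (S (img k F))" using Sk by simp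
   then show ?thesis unfolding im[OF subset_refl] using that S by blast
  qed
 qed
qed

lemma enumeration:
 obtains k f where "Ord k" "app f ` el k = el X" "inj_on (app f) (el k)"
proof -
 obtain k f where k: "Ord k" "!!a. a:el k ==> app f a:el X"
  "!!a. a:el k ==> app f a~:el (img a (app f)) & True"
  "!!x. x:el X ==> x:el (img k (app f)) | ~ True"
  using greedy[of "%_ _. True" X, OF dfn_const] by blast
 have i: "el (img a (app f)) = app f ` el a" for a by (rule el_img) (intro dfn)
 have "a = b" if "a:el k" "b:el k" "app f a = app f b" for a b
  using k(3)[OF that(1)] k(3)[OF that(2)] that Ord_linear[of a b] Ord_mem[OF k(1)] unfolding i by (metis imageI)
 then show ?thesis using that[OF k(1)] k i unfolding inj_on_def by blast
qed

end

section \<open>Forcing\<close>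

context zfc
begin

definition "lq P le q p <-> q:el P & p:el P & pr q p:el le"

lemma [dfn]: "dff s ==> dff t ==> dfn (%e. lq P le (s e) (t e))"
 by (rule dfn_rel2) (unfold lq_def, intro dfn)

end

text \<open>Every element \<open>x\<close> of the model is a name; its members are the names \<open>u\<close> with \<open>(u, q) \<in> x\<close>, to the
 extent \<open>q\<close>. Forced equality of names is the largest bisimulation \<open>EQ\<close>.\<close>

locale forcing = zfc E for E :: "nat => nat => bool" +
 fixes P le :: nat and G :: "nat set"
 assumes le_refl: "p:el P ==> lq P le p p"
  and le_trans: "lq P le r q ==> lq P le q p ==> lq P le r p"
  and G_P: "G <= el P" and G_ne: "G ~= {}"
  and G_up: "p:G ==> lq P le p q ==> q:G"
  and G_dir: "p:G ==> q:G ==> EX r:G. lq P le r p & lq P le r q"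
  and G_gen: "(!!p. p:el P ==> EX q:el D. lq P le q p) ==> EX p:G. p:el D"
begin

abbreviation leq (infix "<<" 50) where "q << p \<equiv> lq P le q p"

lemma leq_P: "q << p ==> q:el P" "q << p ==> p:el P"
 by (auto simp: lq_def)

text \<open>The filter meets those sets of the model that are dense everywhere. A property dense
  below \<open>p\<close> becomes such a set by adding the conditions incompatible with
  \<open>p\<close>, none of which belongs to the filter.\<close>

lemma generic:
 assumes D: "dfn (%e. D (e 0))" and p: "p:G" and dense: "!!r. r << p ==> EX s. s << r & D s"
 shows "EX s:G. s << p & D s"
proof -
 let ?D = "%s. (D s & s << p) | ~ (EX t. t << s & t << p)"
 have e: "el (set {s. s:el P & ?D s}) = {s:el P. ?D s}" by (rule el_sep) (intro dfn D)
 have "EX q:el (set {s. s:el P & ?D s}). q << r" if r: "r:el P" for r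
 proof (cases "EX t. t << r & t << p")
  case True
  then obtain t where t: "t << r" "t << p" by blast
  then obtain s where "s << t" "D s" using dense by blast
  then show ?thesis using t le_trans leq_P unfolding e by blast
 next
  case False
  then show ?thesis using r le_refl unfolding e by blast
 qed
 from G_gen[OF this] obtain s where "s:G" "?D s" unfolding e by blast
 then show ?thesis using G_dir p by blast
qed

section \<open>Forced equality and membership\<close>

definition B where
 "B Q p x y <->
  (ALL u q. pr u q:el x --> (ALL r. r << p & r << q --> (EX s. s << r & (EX v q'. pr v q':el y & s << q' & Q s u v)))) &
  (ALL v q. pr v q:el y --> (ALL r. r << p & r << q --> (EX s. s << r & (EX u q'. pr u q':el x & s << q' & Q s u v))))"

definition bis where
 "bis Q <-> (ALL p x y. Q p x y --> p:el P & B Q p x y)"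

definition EQ where
 "EQ p x y <-> (EX R. bis (%p x y. pr p (pr x y):el R) & pr p (pr x y):el R)"

lemma B_mono: "B Q p x y ==> (!!p x y. Q p x y ==> Q' p x y) ==> B Q' p x y"
 unfolding B_def by meson

lemma B_down: "B Q p x y ==> r << p ==> B Q r x y"
 unfolding B_def using le_trans by meson

lemma [dfn]: "dff s ==> dff t ==> dff u ==> dfn (%e. EQ (s e) (t e) (u e))"
 by (rule dfn_rel3) (unfold EQ_def bis_def B_def, intro dfn)

lemma dfn_B: "dff s ==> dff t ==> dff u ==> dfn (%e. B EQ (s e) (t e) (u e))"
 by (rule dfn_rel3) (unfold B_def, intro dfn)

lemma EQ_B: "EQ p x y ==> p:el P & B EQ p x y"
proof -
 assume "EQ p x y"
 then obtain R where R: "bis (%p x y. pr p (pr x y):el R)" "pr p (pr x y):el R" unfolding EQ_def by blast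
 then have "B (%p x y. pr p (pr x y):el R) p x y" "p:el P" unfolding bis_def by blast+
 moreover from R(1) have "EQ p x y" if "pr p (pr x y):el R" for p x y using that unfolding EQ_def by blast
 ultimately show ?thesis using B_mono[of "%p x y. pr p (pr x y):el R"] by blast
qed

lemma tc_name: "pr u q:el x ==> trans t ==> x:el t | el x <= el t ==> u:el t"
proof -
 assume a: "pr u q:el x" "trans t" "x:el t | el x <= el t"
 then have "pr u q:el t" unfolding trans_def by blast
 moreover have "dbl u u:el (pr u q)" "u:el (dbl u u)" by (auto simp: pr_def)
 ultimately show ?thesis using a(2) unfolding trans_def by blast
qed

text \<open>A definable bisimulation may be a proper class. Restricted to names in the transitive
  closure of \<open>dbl x y\<close> it becomes a set, as the definition of \<open>EQ\<close>
  demands, and it stays a bisimulation because members of names do not leave a transitive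
  set.\<close>

lemma EQ_coinduct:
 assumes Q: "dfn (%e. Q (e 0) (e (Suc 0)) (e (Suc (Suc 0))))" "bis Q" "Q p x y"
 shows "EQ p x y"
proof -
 define T where "T = tc (dbl x y)"
 have T: "trans T" "x:el T" "y:el T" using trans_tc subset_tc[of "dbl x y"] by (auto simp: T_def)
 define R where "R = set {z. z:el (times P (times T T)) & (EX p x y. z = pr p (pr x y) & Q p x y)}"
 have "el R = {z:el (times P (times T T)). EX p x y. z = pr p (pr x y) & Q p x y}"
  unfolding R_def by (rule el_sep) (intro dfn dfn_rel3[OF Q(1)])
 then have R: "pr p (pr x y):el R <-> p:el P & x:el T & y:el T & Q p x y" for p x y by auto
 have "bis (%p x y. pr p (pr x y):el R)" unfolding bis_def
 proof (intro allI impI)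
  fix p x y assume "pr p (pr x y):el R"
  then have h: "p:el P" "x:el T" "y:el T" "B Q p x y" using Q(2) unfolding R bis_def by blast+
  show "p:el P & B (%p x y. pr p (pr x y):el R) p x y"
  proof
   have t: "u:el T" if "pr u q:el x | pr u q:el y" for u q using tc_name T(1) h that by blast
   show "B (%p x y. pr p (pr x y):el R) p x y"
    using h(4) t leq_P(1) unfolding B_def R by meson
  qed fact
 qed
 moreover have "pr p (pr x y):el R" using Q(2,3) T unfolding R bis_def by blast
 ultimately show ?thesis unfolding EQ_def by blast
qed

lemma EQ_unfold: "p:el P ==> EQ p x y <-> B EQ p x y"
proof
 assume "p:el P" "B EQ p x y"
 show "EQ p x y"
 proof (rule EQ_coinduct[of "%p x y. p:el P & B EQ p x y"])
  show "bis (%p x y. p:el P & B EQ p x y)"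
   unfolding bis_def using B_mono[of EQ _ _ _ "%p x y. p:el P & B EQ p x y"] EQ_B by blast
 qed (intro dfn dfn_B, use \<open>p:el P\<close> \<open>B EQ p x y\<close> in blast)
qed (use EQ_B in blast)

lemma EQ_refl: "p:el P ==> EQ p x x"
proof (rule EQ_coinduct[of "%p x y. p:el P & x = y"])
 show "bis (%p x y. p:el P & x = y)" unfolding bis_def B_def using le_refl leq_P by blast
qed (intro dfn, blast)

lemma EQ_sym: "EQ p x y ==> EQ p y x"
proof (rule EQ_coinduct[of "%p x y. EQ p y x"])
 have "B EQ p x y ==> B (%p x y. EQ p y x) p y x" for p x y unfolding B_def by blast
 then show "bis (%p x y. EQ p y x)" unfolding bis_def using EQ_B by blast
qed (intro dfn)

lemma EQ_mono: "EQ p x y ==> r << p ==> EQ r x y"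
 using EQ_B B_down EQ_unfold leq_P by blast

lemma B_left:
 assumes "EQ p x y" "pr u q:el x" "r << p" "r << q"
 obtains s v q' where "s << r" "pr v q':el y" "s << q'" "EQ s u v"
 using EQ_B[OF assms(1)] assms(2-4) unfolding B_def by blast

lemma EQ_trans: "EQ p x y ==> EQ p y z ==> EQ p x z"
proof (rule EQ_coinduct[of "%p x z. EX y. EQ p x y & EQ p y z"])
 show "dfn (%e. EX y. EQ (e 0) (e (Suc 0)) y & EQ (e 0) y (e (Suc (Suc 0))))" by (intro dfn)
 have half: "EX s. s << r & (EX w q'. pr w q':el z & s << q' & (EX y. EQ s u y & EQ s y w))"
  if h: "EQ p x y" "EQ p y z" "pr u q:el x" "r << p" "r << q" for p x y z u q r
 proof -
  obtain s v q' where s: "s << r" "pr v q':el y" "s << q'" "EQ s u v" using B_left[OF h(1,3-5)] by blast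
  obtain t w q'' where "t << s" "pr w q'':el z" "t << q''" "EQ t v w"
   using B_left[OF h(2) s(2) _ s(3)] le_trans[OF s(1) h(4)] by blast
  then show ?thesis using s le_trans EQ_mono by blast
 qed
 show "bis (%p x z. EX y. EQ p x y & EQ p y z)" unfolding bis_def B_def
 proof (intro allI impI conjI; elim exE conjE)
  fix p x z y v q r assume h: "EQ p x y" "EQ p y z" "pr v q:el z" "r << p" "r << q"
  from half[OF EQ_sym[OF h(2)] EQ_sym[OF h(1)] h(3-5)]
  show "EX s. s << r & (EX u q'. pr u q':el x & s << q' & (EX y. EQ s u y & EQ s y v))" using EQ_sym by blast
 qed (use EQ_B half in blast)+
qed blast

lemma EQ_dense:
 assumes p: "p:el P" and d: "!!r. r << p ==> EX s. s << r & EQ s x y"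
 shows "EQ p x y"
proof -
 have half: "EX s. s << r & (EX v q'. pr v q':el y & s << q' & EQ s u v)"
  if d: "!!r. r << p ==> EX s. s << r & EQ s x y" and h: "pr u q:el x" "r << p" "r << q" for u q r x y
 proof -
  obtain s where s: "s << r" "EQ s x y" using d h by blast
  then obtain t v q' where "t << s" "pr v q':el y" "t << q'" "EQ t u v"
   using B_left[OF s(2) h(1), of s] le_refl leq_P le_trans[OF s(1) h(3)] by blast
  then show ?thesis using s le_trans by blast
 qed
 have d': "EX s. s << r & EQ s y x" if "r << p" for r using d[OF that] EQ_sym by blast
 show ?thesis unfolding EQ_unfold[OF p] B_def using half[OF d] half[OF d'] EQ_sym by blast
qed

definition MEM where
 "MEM p x y <-> p:el P & (ALL r. r << p --> (EX s. s << r & (EX v q. pr v q:el y & s << q & EQ s x v)))"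

lemma [dfn]: "dff s ==> dff t ==> dff u ==> dfn (%e. MEM (s e) (t e) (u e))"
 by (rule dfn_rel3) (unfold MEM_def, intro dfn)

lemma MEM_P: "MEM p x y ==> p:el P"
 by (simp add: MEM_def)

lemma MEM_mono: "MEM p x y ==> r << p ==> MEM r x y"
 unfolding MEM_def using le_trans leq_P by blast

lemma MEM_ex: "MEM p x y ==> EX s v q. s << p & pr v q:el y & s << q & EQ s x v"
 unfolding MEM_def using le_refl by blast

lemma MEM_dense: "p:el P ==> (!!r. r << p ==> EX s. s << r & MEM s x y) ==> MEM p x y"
proof -
 assume p: "p:el P" and d: "!!r. r << p ==> EX s. s << r & MEM s x y"
 have "EX s. s << r & (EX v q. pr v q:el y & s << q & EQ s x v)" if "r << p" for r
 proof -
  obtain s where s: "s << r" "MEM s x y" using d[OF \<open>r << p\<close>] by blast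
  then show ?thesis using MEM_ex[OF s(2)] le_trans by blast
 qed
 then show ?thesis unfolding MEM_def using p by blast
qed

lemma MEM_I: "pr u q:el x ==> r << q ==> MEM r u x"
 unfolding MEM_def using EQ_refl le_refl le_trans leq_P by meson

lemma MEM_cong1: "MEM p x y ==> EQ p x x' ==> MEM p x' y"
proof (rule MEM_dense)
 fix r assume a: "MEM p x y" "EQ p x x'" "r << p"
 then obtain s v q where s: "s << r" "pr v q:el y" "s << q" "EQ s x v" using MEM_ex[OF MEM_mono] by blast
 then have "MEM s v y" using MEM_I by blast
 have "EQ s x' v" using EQ_trans[OF EQ_sym s(4)] EQ_mono[OF a(2)] le_trans s(1) a(3) by blast
 then have "MEM s x' y" unfolding MEM_def using s(2,3) EQ_mono le_trans le_refl leq_P by meson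
 then show "EX s. s << r & MEM s x' y" using s(1) by blast
qed (rule MEM_P)

lemma MEM_cong2: "MEM p x y ==> EQ p y y' ==> MEM p x y'"
proof (rule MEM_dense)
 fix r assume a: "MEM p x y" "EQ p y y'" "r << p"
 then obtain s v q where s: "s << r" "pr v q:el y" "s << q" "EQ s x v" using MEM_ex[OF MEM_mono] by blast
 obtain t w q' where t: "t << s" "pr w q':el y'" "t << q'" "EQ t v w"
  using B_left[OF a(2) s(2) le_trans[OF s(1) a(3)] s(3)] by blast
 have "MEM t x y'" using MEM_cong1[OF MEM_I[OF t(2,3)] EQ_sym] EQ_trans[OF EQ_mono[OF s(4) t(1)] t(4)] by blast
 then show "EX s. s << r & MEM s x y'" using t(1) s(1) le_trans by blast
qed (rule MEM_P)

section \<open>The forcing relation and the truth lemma\<close>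

primrec fr :: "nat => fm => (nat => nat) => bool" where
 "fr p Bot e = False"
| "fr p (Mem i j) e = MEM p (e i) (e j)"
| "fr p (Eq i j) e = EQ p (e i) (e j)"
| "fr p (Imp ph \<psi>) e = (p:el P & (ALL r. r << p --> fr r ph e --> fr r \<psi> e))"
| "fr p (All ph) e = (p:el P & (ALL x. fr p ph (case_nat x e)))"

lemma dfn_fr0: "dfn (%e. fr (e 0) ph (%i. e (Suc i)))"
proof (induction ph)
 case (Imp ph \<psi>)
 have "dfn (%e. fr (e 0) \<chi> (%i. e (Suc (Suc i))))" if "dfn (%e. fr (e 0) \<chi> (%i. e (Suc i)))" for \<chi>
  using dfn_shift[OF that, of "%i. case i of 0 => 0 | Suc i => Suc (Suc i)"] by simp
 then show ?case unfolding fr.simps using Imp by (intro dfn) blast+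
next
 case (All ph)
 have e: "case_nat (e 0) (%i. e (Suc (Suc i))) = (%i. e (case i of 0 => 0 | Suc i => Suc (Suc i)))" for e :: "nat => nat"
  by (rule ext) (simp split: nat.split)
 have "dfn (%e. fr (e (Suc 0)) ph (case_nat (e 0) (%i. e (Suc (Suc i)))))"
  using dfn_shift[OF All, of "%i. case i of 0 => Suc 0 | Suc i => (case i of 0 => 0 | Suc i => Suc (Suc i))"]
  by (simp add: e)
 then show ?case unfolding fr.simps by (intro dfn)
qed (unfold fr.simps, (intro dfn)+)

lemma dfn_fr:
 assumes "isvar s" "!!i. isvar (t i)" shows "dfn (%e. fr (s e) ph (%i. t i e))"
proof -
 have "dfn (%e. fr (case_nat (s e) (%i. t i e) 0) ph (%i. case_nat (s e) (%i. t i e) (Suc i)))"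
 proof -
  have "isvar (%e. case_nat (s e) (%i. t i e) i)" for i using assms by (cases i) simp_all
  from dfn_subst[OF dfn_fr0[of ph], of "%i e. case_nat (s e) (%i. t i e) i", OF this] show ?thesis .
 qed
 then show ?thesis by simp
qed

lemma fr_mono: "fr p ph e ==> r << p ==> fr r ph e"
proof (induction ph arbitrary: e)
 case (Imp ph \<psi>)
 then show ?case using le_trans leq_P by (simp only: fr.simps) blast
next
 case (All ph)
 then show ?case using leq_P by (simp only: fr.simps) blast
qed (auto intro: MEM_mono EQ_mono)

text \<open>The clauses for \<open>Imp\<close> and \<open>All\<close> preserve closure under
  density, so classical logic comes out right without double negations in the definition of
  \<open>fr\<close>.\<close>

lemma fr_dense: "p:el P ==> (!!r. r << p ==> EX s. s << r & fr s ph e) ==> fr p ph e"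
proof (induction ph arbitrary: e p)
 case Bot
 then show ?case using le_refl by fastforce
next
 case (Imp ph \<psi>)
 have "fr r \<psi> e" if r: "r << p" "fr r ph e" for r
 proof (rule Imp.IH(2))
  show "r:el P" using r leq_P by blast
  fix t assume t: "t << r"
  then obtain s where s: "s << t" "fr s (Imp ph \<psi>) e" using Imp.prems(2) le_trans r(1) by blast
  then have "fr s ph e" using fr_mono r(2) le_trans t by blast
  then show "EX s. s << t & fr s \<psi> e" using s le_refl leq_P by (simp only: fr.simps) blast
 qed
 then show ?case using Imp.prems(1) by (simp only: fr.simps) blast
next
 case (All ph)
 have "fr p ph (case_nat x e)" for x
  by (rule All.IH[OF All.prems(1)]) (use All.prems(2) in \<open>simp only: fr.simps; blast\<close>)
 then show ?case using All.prems(1) by simp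
qed (auto intro: MEM_dense EQ_dense)

definition nE where "nE x y <-> (EX p:G. MEM p x y)"
definition nQ where "nQ x y <-> (EX p:G. EQ p x y)"

lemma G_mem: "p:G ==> p:el P"
 using G_P by blast

text \<open>For \<open>Imp\<close> and \<open>All\<close>, the conditions that either force the
  formula or rule it out are dense, so one of them is in the filter. Definability of forcing is what
  makes \<open>generic\<close> applicable.\<close>

theorem truth: "satq nE nQ ph e <-> (EX p:G. fr p ph e)"
proof (induction ph arbitrary: e)
 case (Imp ph \<psi>)
 have "(EX p:G. fr p (Imp ph \<psi>) e) <-> ((EX p:G. fr p ph e) --> (EX p:G. fr p \<psi> e))"
 proof
  assume "EX p:G. fr p (Imp ph \<psi>) e"
  then show "(EX p:G. fr p ph e) --> (EX p:G. fr p \<psi> e)"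
   using G_dir fr_mono le_refl by (simp only: fr.simps) meson
 next
  assume a: "(EX p:G. fr p ph e) --> (EX p:G. fr p \<psi> e)"
  obtain p where p: "p:G" using G_ne by blast
  let ?D = "%s. fr s (Imp ph \<psi>) e | (fr s ph e & (ALL t. t << s --> ~ fr t \<psi> e))"
  have "dfn (%e'. ?D (e' 0))" by (intro dfn dfn_fr isvar_var isvar_const)
  moreover have "EX s. s << r & ?D s" if "r << p" for r
  proof (cases "fr r (Imp ph \<psi>) e")
   case True
   then show ?thesis using that le_refl leq_P by blast
  next
   case False
   then obtain t where t: "t << r" "fr t ph e" "~ fr t \<psi> e" using leq_P(1)[OF \<open>r << p\<close>] by auto
   then obtain s where "s << t" "ALL t. t << s --> ~ fr t \<psi> e" using fr_dense[of t \<psi> e] leq_P by blast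
   then show ?thesis using t fr_mono le_trans by blast
  qed
  ultimately obtain s where s: "s:G" "?D s" using generic[of ?D, OF _ p] by blast
  then show "EX p:G. fr p (Imp ph \<psi>) e" using a G_dir fr_mono by blast
 qed
 then show ?case using Imp by simp
next
 case (All ph)
 have "(EX p:G. fr p (All ph) e) <-> (ALL x. EX p:G. fr p ph (case_nat x e))"
 proof
  assume a: "ALL x. EX p:G. fr p ph (case_nat x e)"
  obtain p where p: "p:G" using G_ne by blast
  let ?D = "%s. fr s (All ph) e | (EX x. ALL t. t << s --> ~ fr t ph (case_nat x e))"
  have "dfn (%e'. EX x. ALL t. t << e' 0 --> ~ fr t ph (case_nat x e))"
  proof (intro dfn)
   have iv: "isvar (%e'. case_nat (e' (Suc 0)) e i)" for i
    by (cases i) (simp_all add: isvar_var isvar_const)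
   show "dfn (%e'. fr (e' 0) ph (case_nat (e' (Suc 0)) e))"
    using dfn_fr[where t = "%i e'. case_nat (e' (Suc 0)) e i", OF isvar_var iv, of 0 ph] by simp
  qed
  then have "dfn (%e'. ?D (e' 0))" by (intro dfn_disj dfn_fr isvar_var isvar_const)
  moreover have "EX s. s << r & ?D s" if "r << p" for r
  proof (cases "fr r (All ph) e")
   case True
   then show ?thesis using that le_refl leq_P by blast
  next
   case False
   then obtain x where "~ fr r ph (case_nat x e)" using leq_P(1)[OF \<open>r << p\<close>] by auto
   then show ?thesis using fr_dense[of r ph "case_nat x e"] leq_P that by blast
  qed
  ultimately obtain s where s: "s:G" "?D s" using generic[of ?D, OF _ p] by blast
  then show "EX p:G. fr p (All ph) e" using a G_dir fr_mono by blast
 qed auto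
 then show ?case using All by simp
qed (auto simp: nE_def nQ_def)

end

section \<open>The generic extension\<close>

context forcing
begin

lemma nQ_refl: "nQ x x"
 using G_ne EQ_refl G_mem unfolding nQ_def by blast

lemma nQ_sym: "nQ x y ==> nQ y x"
 unfolding nQ_def using EQ_sym by blast

lemma nQ_trans: "nQ x y ==> nQ y z ==> nQ x z"
 unfolding nQ_def using EQ_trans EQ_mono G_dir by meson

lemma nE_cong:
 assumes "nQ x x'" "nQ y y'" "nE x y" shows "nE x' y'"
proof -
 obtain p q r where p: "p:G" "EQ p x x'" and q: "q:G" "EQ q y y'" and r: "r:G" "MEM r x y"
  using assms unfolding nQ_def nE_def by blast
 obtain s where s: "s:G" "s << p" "s << q" using G_dir[OF p(1) q(1)] by blast
 obtain t where t: "t:G" "t << s" "t << r" using G_dir[OF s(1) r(1)] by blast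
 have "MEM t x' y'"
  using MEM_cong2[OF MEM_cong1[OF MEM_mono[OF r(2) t(3)]]] EQ_mono[OF p(2)] EQ_mono[OF q(2)] s t(2) le_trans by blast
 then show ?thesis using t unfolding nE_def by blast
qed

text \<open>Recovers the usual evaluation of names from the definition through forcing: the members
  of \<open>y\<close> are given by the pairs whose condition is in the filter.\<close>

lemma nE_iff: "nE z y <-> (EX u q. pr u q:el y & q:G & nQ z u)"
proof
 assume "nE z y"
 then obtain p where p: "p:G" "MEM p z y" unfolding nE_def by blast
 have "EX s:G. s << p & (EX v q. pr v q:el y & s << q & EQ s z v)"
  by (rule generic[OF _ p(1)]) (intro dfn, use p(2) in \<open>unfold MEM_def, blast\<close>)
 then show "EX u q. pr u q:el y & q:G & nQ z u" unfolding nQ_def using G_up by blast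
next
 assume "EX u q. pr u q:el y & q:G & nQ z u"
 then obtain u q where u: "pr u q:el y" "q:G" "nQ z u" by blast
 then have "nE u y" unfolding nE_def using MEM_I[OF u(1), of q] le_refl G_mem by blast
 then show "nE z y" using nE_cong nQ_sym nQ_refl u by blast
qed

lemma nE_name: "pr u q:el y ==> q:G ==> nE u y"
 using nE_iff nQ_refl by blast

section \<open>The axioms of ZFC for names\<close>

lemma forced_nonmem: "p:G ==> (!!r. r << p ==> ~ MEM r u y) ==> ~ nE u y"
 unfolding nE_def using G_dir MEM_mono by meson

text \<open>\<open>W p x y\<close> says that \<open>p\<close> witnesses a difference: a member
  \<open>u\<close> of \<open>x\<close>, present below \<open>p\<close>, is forced out of
  \<open>y\<close>. Conditions forcing equality or witnessing a difference are dense, and if the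
  members agree, the filter contains none of the second kind.\<close>

lemma n_ext: "(!!z. nE z x <-> nE z y) ==> nQ x y"
proof -
 assume a: "!!z. nE z x <-> nE z y"
 define W where "W p x y <-> (EX u q. pr u q:el x & p << q & (ALL r. r << p --> ~ MEM r u y))" for p x y
 have noW: "~ W p x y" if "p:G" "!!z. nE z x <-> nE z y" for p x y
  using that forced_nonmem nE_name G_up unfolding W_def by meson
 have dW: "dff s ==> dff t ==> dff u ==> dfn (%e. W (s e) (t e) (u e))" for s t u
  by (rule dfn_rel3) (unfold W_def, intro dfn)
 obtain p where p: "p:G" using G_ne by blast
 have "EX s:G. s << p & (EQ s x y | W s x y | W s y x)"
 proof (rule generic[OF _ p])
  fix r assume "r << p"
  then have r: "r:el P" using leq_P by blast
  show "EX s. s << r & (EQ s x y | W s x y | W s y x)"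
  proof (cases "B EQ r x y")
   case True
   then show ?thesis using EQ_unfold r le_refl by blast
  next
   case False
   have half: "EX s. s << r & W s x y" if h: "pr u q:el x" "t << r" "t << q"
    "~ (EX s. s << t & (EX v q'. pr v q':el y & s << q' & EQ s u v))" for u q t x y
   proof -
    have "~ MEM s u y" if "s << t" for s using h(4) MEM_ex that le_trans by meson
    then show ?thesis unfolding W_def using h by blast
   qed
   from False show ?thesis unfolding B_def
   proof (simp only: de_Morgan_conj not_all not_imp, elim disjE exE conjE)
    fix u q t assume "pr u q:el x" "t << r" "t << q"
     "~ (EX s. s << t & (EX v q'. pr v q':el y & s << q' & EQ s u v))"
    from half[OF this] show ?thesis by blast
   next
    fix v q t assume h: "pr v q:el y" "t << r" "t << q"
     "~ (EX s. s << t & (EX u q'. pr u q':el x & s << q' & EQ s u v))"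
    then have "~ (EX s. s << t & (EX u q'. pr u q':el x & s << q' & EQ s v u))" using EQ_sym by blast
    from half[OF h(1-3) this] show ?thesis by blast
   qed
  qed
 qed (intro dfn dW)
 then show ?thesis using noW a unfolding nQ_def by blast
qed

text \<open>Induction on the rank, as the name \<open>v\<close> is not itself a member of
  \<open>y\<close> but hidden in a pair.\<close>

lemma name_induct:
 assumes Q: "dfn (%e. Q (e 0))" and step: "!!y. (!!v q. pr v q:el y ==> Q v) ==> Q y"
 shows "Q y"
proof -
 have "ALL y. rk y = a --> Q y" for a
 proof (induction a rule: eps_induct)
  case df show ?case by (intro dfn dfn_rel1[OF Q])
 next
  case (step a)
  show ?case
  proof (intro allI impI)
   fix y assume y: "rk y = a"
   show "Q y"
   proof (rule assms(2))
    fix v q assume v: "pr v q:el y"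
    have "rk (pr v q):el (rk y)" unfolding el_rk[of y] using v by blast
    then have "rk (pr v q):el a" unfolding y .
    moreover have "rk (dbl v v):el (rk (pr v q))" "rk v:el (rk (dbl v v))"
     using el_rk[of "pr v q"] el_rk[of "dbl v v"] by (auto simp: pr_def)
    ultimately have "rk v:el a" using Ord_rk[of y] y Ord_trans by blast
    then show "Q v" using step by blast
   qed
  qed
 qed
 then show ?thesis by blast
qed

text \<open>No well-founded order is at hand outside the model. A failure at \<open>x\<close> is
  therefore written as a formula and forced by some \<open>p0\<close>; induction on names, inside
  the ground model, then shows that below \<open>p0\<close> no name is forced into
  \<open>x\<close>.\<close>

lemma n_foundation: "EX z. nE z x ==> EX y. nE y x & (ALL z. nE z x --> ~ nE z y)"
proof (rule ccontr)
 assume ex: "EX z. nE z x" and "~ (EX y. nE y x & (ALL z. nE z x --> ~ nE z y))"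
 then have n: "!!y. nE y x ==> EX z. nE z x & nE z y" by blast
 \<comment> \<open>Under the constant assignment, index 1 below one quantifier and index 2 below two
   both denote \<open>x\<close>: every member of \<open>x\<close> has a member in common with
   \<open>x\<close>.\<close>
 define ph where "ph = All (Imp (Mem 0 1) (Imp (All (Imp (Mem 0 2) (Imp (Mem 0 1) Bot))) Bot))"
 have "satq nE nQ ph (%_. x)" unfolding ph_def using n by (auto simp: numeral_2_eq_2)
 then obtain p0 where p0: "p0:G" "fr p0 ph (%_. x)" unfolding truth by blast
 have step: "EX s z. s << r & MEM s z x & MEM s z y" if r: "r << p0" "MEM r y x" for r y
 proof -
  have "fr r (Imp (All (Imp (Mem 0 2) (Imp (Mem 0 1) Bot))) Bot) (case_nat y (%_. x))"
   using p0(2) r unfolding ph_def by simp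
  then have "~ fr r (All (Imp (Mem 0 2) (Imp (Mem 0 1) Bot))) (case_nat y (%_. x))"
   using le_refl leq_P(1)[OF r(1)] by (simp only: fr.simps) blast
  then obtain z t where "t << r" "MEM t z x" "~ (t:el P & (ALL s. s << t --> ~ MEM s z y))"
   using leq_P(1)[OF r(1)] by (auto simp: numeral_2_eq_2)
  then show ?thesis using le_trans MEM_mono MEM_P by meson
 qed
 have "ALL p. p << p0 --> ~ MEM p v x" for v
 proof (induction v rule: name_induct)
  show "dfn (%e. ALL p. p << p0 --> ~ MEM p (e 0) x)" by (intro dfn)
 next
  fix y assume IH: "!!v q. pr v q:el y ==> ALL p. p << p0 --> ~ MEM p v x"
  show "ALL p. p << p0 --> ~ MEM p y x"
  proof (intro allI impI notI)
   fix p assume p: "p << p0" "MEM p y x"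
   obtain s z where s: "s << p" "MEM s z x" "MEM s z y" using step[OF p] by blast
   obtain t v q where t: "t << s" "pr v q:el y" "EQ t z v" using MEM_ex[OF s(3)] by blast
   then have "MEM t v x" using MEM_cong1 MEM_mono s(2) by blast
   then show False using IH[OF t(2)] t(1) s(1) p(1) le_trans by blast
  qed
 qed
 moreover obtain z p where "p:G" "MEM p z x" using ex unfolding nE_def by blast
 ultimately show False using p0(1) G_dir MEM_mono by meson
qed

section \<open>Canonical names, and the extension as a model on \<open>nat\<close>\<close>

definition ckH :: "nat => nat => nat => nat" where "ckH p x f = times (img x (app f)) P"

lemma dff_ckH: "dff (%e. ckH (e 0) (e (Suc 0)) (e (Suc (Suc 0))))"
proof -
 have "dff (%e. img (e (Suc 0)) (app (e (Suc (Suc 0)))))"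
  using dff_img[of "%e. e (Suc 0)" "%x e. app (e (Suc (Suc 0))) x"] by (simp add: dfn)
 then show ?thesis unfolding ckH_def by (intro dfn)
qed

text \<open>Every condition is attached to every member, as the forcing notion comes without a
  designated largest condition.\<close>

definition ck :: "nat => nat" where "ck = rec ckH zero"

lemma [dfn]: "dff s ==> dff (%e. ck (s e))"
 unfolding ck_def by (intro dff_rec[OF dff_ckH] dfn)

lemma el_ck: "el (ck x) = {pr (ck y) p |y p. y:el x & p:el P}"
proof -
 have d: "dff (%e. ck (e 0))" by (intro dfn)
 have "img x (app (lam x ck)) = img x ck" by (rule img_cong) (rule app_lam[OF d])
 then have "ck x = times (img x ck) P"
  using rec[OF dff_ckH, of zero x] unfolding ck_def[symmetric] by (simp add: ckH_def)
 then show ?thesis by (auto simp: el_img[OF d])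
qed

lemma nE_ck: "nE z (ck x) <-> (EX y:el x. nQ z (ck y))"
 unfolding nE_iff el_ck using G_ne G_mem by auto

lemma EQ_ck: "EQ p (ck x) (ck y) ==> x = y"
proof -
 have half: "el x <= el y" if IH: "!!x'. x':el x ==> ALL y p. EQ p (ck x') (ck y) --> x' = y" and h: "EQ p (ck x) (ck y)" for x y p
 proof
  fix u assume u: "u:el x"
  have p: "p:el P" using EQ_B[OF h] by blast
  have m: "pr (ck u) p:el (ck x)" unfolding el_ck using u p by blast
  obtain s v q where "pr v q:el (ck y)" "EQ s (ck u) v"
using B_left[OF h m le_refl[OF p] le_refl[OF p]] by blast
  then show "u:el y" using IH[OF u] unfolding el_ck by auto
 qed
 have "ALL y p. EQ p (ck x) (ck y) --> x = y"
 proof (induction x rule: eps_induct)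
  case df show ?case by (intro dfn)
 next
  case (step x)
  show ?case
  proof (intro allI impI)
   fix y p assume h: "EQ p (ck x) (ck y)"
   then have xy: "el x <= el y" using half step by blast
   have "el y <= el x"
   proof
    fix u assume u: "u:el y"
    have p: "p:el P" using EQ_B[OF h] by blast
    have m: "pr (ck u) p:el (ck y)" unfolding el_ck using u p by blast
    obtain s v q where v: "pr v q:el (ck x)" "EQ s (ck u) v"
  using B_left[OF EQ_sym[OF h] m le_refl[OF p] le_refl[OF p]] by blast
    then obtain w where "w:el x" "v = ck w" unfolding el_ck by auto
    then show "u:el x" using step v EQ_sym by blast
   qed
   then show "x = y" using xy el_ext by blast
  qed
 qed
 then show "EQ p (ck x) (ck y) ==> x = y" by blast
qed

lemma nQ_ck: "nQ (ck x) (ck y) <-> x = y"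
 using EQ_ck nQ_refl unfolding nQ_def by blast

lemma equivp_nQ: "equivp nQ"
 by (intro equivpI reflpI sympI transpI) (rule nQ_refl, erule nQ_sym, erule (1) nQ_trans)

lemma infinite_nQ: "infinite (range nQ)"
proof
 assume "finite (range nQ)"
 then have "finite (range (%x. nQ (ck x)))" by (rule finite_subset[rotated]) auto
 moreover have "inj (%x. nQ (ck x))"
  using nQ_ck nQ_refl unfolding inj_def by metis
 ultimately show False using finite_imageD infinite_UNIV_nat by blast
qed

text \<open>The evaluation of names. Numbering the classes of \<open>nQ\<close> makes the extension
  a model on \<open>nat\<close> with true equality.\<close>

definition val :: "nat => nat" where
 "val = (SOME f. surj f & (ALL x y. f x = f y <-> nQ x y))"

lemma val: "surj val" "val x = val y <-> nQ x y"
proof -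
 have "EX f :: nat => nat. surj f & (ALL x y. f x = f y <-> nQ x y)" by (rule nat_quotient[OF equivp_nQ infinite_nQ]) blast
 then have "surj val & (ALL x y. val x = val y <-> nQ x y)" unfolding val_def by (rule someI_ex)
 then show "surj val" "val x = val y <-> nQ x y" by simp_all
qed

definition EN :: "nat => nat => bool" where
 "EN a b <-> (EX x y. a = val x & b = val y & nE x y)"

lemma EN_val: "EN (val x) (val y) <-> nE x y"
 unfolding EN_def val(2) using nE_cong nQ_refl nQ_sym by blast

lemma satq_EN: "satq nE nQ ph e = sat EN ph (val o e)"
 by (rule satq_quotient) (auto simp: val EN_val)

lemma satq_nQ_cong: "(!!i. nQ (e i) (e' i)) ==> satq nE nQ ph e = satq nE nQ ph e'"
 unfolding satq_EN by (rule arg_cong[where f = "sat EN ph"]) (auto simp: val)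

text \<open>The common source of sets in the extension: a name that attaches to each
  \<open>u\<close> in \<open>T\<close> the conditions \<open>p\<close> with
  \<open>W u p\<close>.\<close>

lemma name_exists: "dfn (%e. W (e 0) (e (Suc 0))) ==>
 EX b. ALL z. nE z b <-> (EX u:el T. EX p:G. W u p & nQ z u)"
proof -
 assume W: "dfn (%e. W (e 0) (e (Suc 0)))"
 obtain b where b: "el b = {z:el (times T P). EX u p. z = pr u p & W u p}" by (erule sep_ex) (intro dfn dfn_rel2[OF W])
 have "nE z b <-> (EX u:el T. EX p:G. W u p & nQ z u)" for z
  unfolding nE_iff b using G_mem by auto
 then show ?thesis by blast
qed

lemma dfn_name_rel: "pr v q:el y ==> v:el (tc y)"
 using tc_name trans_tc subset_tc by blast

lemma tc_tc: "pr v q:el u ==> u:el (tc y) ==> v:el (tc y)"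
 using tc_name trans_tc by blast

lemma n_separation: "EX b. ALL x. nE x b <-> nE x a & satq nE nQ ph (case_nat x v)"
proof -
 have iv: "isvar (%e. case_nat (e 0) v i)" for i
  by (cases i) (simp_all add: isvar_var isvar_const)
 have d: "dfn (%e. MEM (e (Suc 0)) (e 0) a & fr (e (Suc 0)) ph (case_nat (e 0) v))"
  using dfn_fr[where t = "%i e. case_nat (e 0) v i", OF isvar_var iv, of "Suc 0" ph] by (intro dfn) simp
 obtain b where b: "!!z. nE z b <-> (EX u:el (tc a). EX p:G. (MEM p u a & fr p ph (case_nat u v)) & nQ z u)"
  using name_exists[OF d] by blast
 have cong: "satq nE nQ ph (case_nat x v) = satq nE nQ ph (case_nat u v)" if "nQ x u" for x u
  by (rule satq_nQ_cong) (use that nQ_refl in \<open>auto split: nat.split\<close>)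
 have "nE x b <-> nE x a & satq nE nQ ph (case_nat x v)" for x
 proof
  assume "nE x b"
  then obtain u p where u: "p:G" "MEM p u a" "fr p ph (case_nat u v)" "nQ x u" using b by blast
  then have "nE u a" "satq nE nQ ph (case_nat u v)" unfolding truth nE_def by blast+
  then show "nE x a & satq nE nQ ph (case_nat x v)" using cong[OF u(4)] u(4) nE_cong nQ_sym nQ_refl by blast
 next
  assume x: "nE x a & satq nE nQ ph (case_nat x v)"
  then obtain u q where u: "pr u q:el a" "q:G" "nQ x u" unfolding nE_iff by blast
  then have "satq nE nQ ph (case_nat u v)" "nE u a" using x cong nE_name by blast+
  then obtain p p' where "p:G" "fr p ph (case_nat u v)" "p':G" "MEM p' u a" unfolding truth nE_def by blast
  then obtain r where "r:G" "MEM r u a" "fr r ph (case_nat u v)" using G_dir MEM_mono fr_mono by meson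
  then show "nE x b" unfolding b using u(3) dfn_name_rel[OF u(1)] by blast
 qed
 then show ?thesis by blast
qed

text \<open>The name of a value is determined only up to equality in the extension. So Collection in
  the ground model is used, to find a set \<open>Y\<close> of names that contains a value for every
  name in \<open>tc a\<close> and every condition forcing that some name is a value.\<close>

lemma n_replacement:
 assumes "ALL x. nE x a --> (EX y. satq nE nQ ph (case_nat x (case_nat y v)) &
    (ALL z. satq nE nQ ph (case_nat x (case_nat z v)) --> nQ z y))"
 shows "EX b. ALL y. nE y b <-> (EX x. nE x a & satq nE nQ ph (case_nat x (case_nat y v)))"
proof -
 let ?F = "%p u y. fr p ph (case_nat u (case_nat y v))"
 let ?S = "%x y. satq nE nQ ph (case_nat x (case_nat y v))"
 have iv: "isvar (%e. case_nat (e m) (case_nat (e n) v) i)" for i m n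
 proof (cases i)
  case (Suc j)
  then show ?thesis by (cases j) (simp_all add: isvar_var isvar_const)
 qed (simp add: isvar_var)
 have dF: "dfn (%e. ?F (e l) (e m) (e n))" for l m n
  using dfn_fr[where t = "%i e. case_nat (e m) (case_nat (e n) v) i", OF isvar_var iv, of l ph] by simp
 have dR: "dfn (%e. EX u p. e 0 = pr u p & ?F p u (e (Suc 0)))" by (intro dfn dF)
 obtain Y where Y: "!!x y. x:el (times (tc a) P) ==> (EX u p. x = pr u p & ?F p u y) ==>
   EX y:el Y. EX u p. x = pr u p & ?F p u y"
  using collection[OF dR, of "times (tc a) P"] by blast
 have d: "dfn (%e. EX u:el (tc a). MEM (e (Suc 0)) u a & ?F (e (Suc 0)) u (e 0))" by (intro dfn dF)
 obtain b where b: "!!z. nE z b <-> (EX y:el Y. EX p:G. (EX u:el (tc a). MEM p u a & ?F p u y) & nQ z y)"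
  using name_exists[OF d] by blast
 have cong: "?S x y = ?S x' y'" if "nQ x x'" "nQ y y'" for x x' y y'
  by (rule satq_nQ_cong) (use that nQ_refl in \<open>auto split: nat.split\<close>)
 have "nE y b <-> (EX x. nE x a & ?S x y)" for y
 proof
  assume "nE y b"
  then obtain y' p u where u: "p:G" "MEM p u a" "?F p u y'" "nQ y y'" using b by blast
  then have "nE u a" "?S u y'" unfolding truth nE_def by blast+
  then show "EX x. nE x a & ?S x y" using cong[OF nQ_refl u(4)] by blast
 next
  assume "EX x. nE x a & ?S x y"
  then obtain x where x: "nE x a" "?S x y" by blast
  then obtain u q where u: "pr u q:el a" "q:G" "nQ x u" unfolding nE_iff by blast
  then have "?S u y" "nE u a" using x cong nQ_refl nE_name by blast+
  then obtain p p' where "p:G" "?F p u y" "p':G" "MEM p' u a" unfolding truth nE_def by blast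
  then obtain r where r: "r:G" "MEM r u a" "?F r u y" using G_dir MEM_mono fr_mono by meson
  have ut: "u:el (tc a)" using dfn_name_rel[OF u(1)] .
  then have "pr u r:el (times (tc a) P)" using r(1) G_mem by auto
  from Y[OF this, of y] r(3) obtain y' where y': "y':el Y" "?F r u y'" by auto
  then have "?S u y'" unfolding truth using r(1) by blast
  moreover obtain y0 where "!!z. ?S u z ==> nQ z y0" using assms \<open>nE u a\<close> by blast
  ultimately have "nQ y y'" using \<open>?S u y\<close> nQ_trans nQ_sym by blast
  then show "nE y b" unfolding b using y' r ut by blast
 qed
 then show ?thesis by blast
qed

lemma n_pairing: "EX b. ALL z. nE z b <-> nQ z x | nQ z y"
proof -
 have "dfn (%e. e 0 = x | e 0 = y)" by (intro dfn)
 from name_exists[OF this, of "dbl x y"] show ?thesis using G_ne by auto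
qed

lemma n_union: "EX b. ALL z. nE z b <-> (EX y. nE y x & nE z y)"
proof -
 have d: "dfn (%e. EX u q q'. pr u q:el x & e (Suc 0) << q & pr (e 0) q':el u & e (Suc 0) << q')" by (intro dfn)
 obtain b where b: "!!z. nE z b <-> (EX v:el (tc x). EX p:G. (EX u q q'. pr u q:el x & p << q & pr v q':el u & p << q') & nQ z v)"
  using name_exists[OF d, of "tc x"] by blast
 have "nE z b <-> (EX y. nE y x & nE z y)" for z
 proof
  assume "nE z b"
  then obtain v p u q q' where h: "p:G" "pr u q:el x" "p << q" "pr v q':el u" "p << q'" "nQ z v" using b by blast
  then have "nE u x" "nE v u" using nE_name G_up by blast+
  then show "EX y. nE y x & nE z y" using nE_cong[OF nQ_sym[OF h(6)] nQ_refl] by blast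
 next
  assume "EX y. nE y x & nE z y"
  then obtain y where y: "nE y x" "nE z y" by blast
  then obtain u q where u: "pr u q:el x" "q:G" "nQ y u" unfolding nE_iff[of y x] by blast
  then have "nE z u" using nE_cong nQ_refl y by blast
  then obtain v q' where v: "pr v q':el u" "q':G" "nQ z v" unfolding nE_iff[of z u] by blast
  obtain p where "p:G" "p << q" "p << q'" using G_dir u(2) v(2) by blast
  then show "nE z b" unfolding b using u v tc_tc[OF v(1) dfn_name_rel[OF u(1)]] by blast
 qed
 then show ?thesis by blast
qed

text \<open>Every subset of \<open>x\<close> in the extension has a name included in
  \<open>times (tc x) P\<close>: names of elements of \<open>x\<close>, each with the conditions
  that force it into the subset. All such names form a set.\<close>

lemma n_power: "EX b. ALL z. nE z b <-> (ALL w. nE w z --> nE w x)"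
proof -
 have d: "dfn (%e. ALL v q. pr v q:el (e 0) --> MEM q v x)" by (intro dfn)
 obtain b where b: "!!z. nE z b <-> (EX w:el (pw (times (tc x) P)). EX p:G. (ALL v q. pr v q:el w --> MEM q v x) & nQ z w)"
  using name_exists[OF d] by blast
 have "nE z b <-> (ALL w. nE w z --> nE w x)" for z
 proof
  assume "nE z b"
  then obtain w where w: "!!v q. pr v q:el w ==> MEM q v x" "nQ z w" using b by blast
  have "nE u x" if "nE u w" for u
  proof -
   obtain v q where v: "pr v q:el w" "q:G" "nQ u v" using \<open>nE u w\<close> unfolding nE_iff by blast
   then have "nE v x" using w(1) unfolding nE_def by blast
   then show ?thesis using v(3) nE_cong nQ_sym nQ_refl by blast
  qed
  then show "ALL u. nE u z --> nE u x" using w(2) nE_cong nQ_refl by blast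
 next
  assume s: "ALL u. nE u z --> nE u x"
  obtain w where w: "el w = {c:el (times (tc x) P). EX v q. c = pr v q & MEM q v z & MEM q v x}" by (erule sep_ex) (intro dfn)
  have "nQ z w"
  proof (rule n_ext, rule iffI)
   fix u assume u: "nE u z"
   then obtain v q where v: "pr v q:el x" "q:G" "nQ u v" using nE_iff[of u x] s by blast
   then have "nE v z" "nE v x" using u s nE_cong nQ_refl by blast+
   then obtain p where p: "p:G" "MEM p v z" "MEM p v x" unfolding nE_def using G_dir MEM_mono by meson
   then have "pr v p:el w" unfolding w using dfn_name_rel[OF v(1)] G_mem by auto
   then show "nE u w" unfolding nE_iff using p v by blast
  next
   fix u assume "nE u w"
   then obtain v q where v: "pr v q:el w" "q:G" "nQ u v" unfolding nE_iff by blast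
   then have "nE v z" unfolding w nE_def by auto
   then show "nE u z" using v(3) nE_cong nQ_sym nQ_refl by blast
  qed
  moreover have "w:el (pw (times (tc x) P))" using w by auto
  moreover have "ALL v q. pr v q:el w --> MEM q v x" unfolding w by auto
  ultimately show "nE z b" unfolding b using G_ne by blast
 qed
 then show ?thesis by blast
qed

lemma n_infinity: "EX w. (EX e. nE e w & (ALL z. ~ nE z e)) &
 (ALL x. nE x w --> (EX s. nE s w & (ALL z. nE z s <-> nE z x | nQ z x)))"
proof (rule exI[of _ "ck om"], intro conjI allI impI)
 have "nE (ck zero) (ck om)" unfolding nE_ck using zero_omega nQ_refl by blast
 moreover have "~ nE z (ck zero)" for z by (simp add: nE_ck)
 ultimately show "EX e. nE e (ck om) & (ALL z. ~ nE z e)" by blast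
 fix x assume "nE x (ck om)"
 then obtain n where n: "n:el om" "nQ x (ck n)" unfolding nE_ck by blast
 have "nE z (ck (succ n)) <-> nE z x | nQ z x" for z
 proof -
  have "nE z (ck (succ n)) <-> nE z (ck n) | nQ z (ck n)" unfolding nE_ck by auto
  then show ?thesis using n(2) nE_cong nQ_refl nQ_trans nQ_sym by blast
 qed
 moreover have "nE (ck (succ n)) (ck om)" unfolding nE_ck using n(1) succ_omega nQ_refl by blast
 ultimately show "EX s. nE s (ck om) & (ALL z. nE z s <-> nE z x | nQ z x)" by blast
qed

text \<open>The names in \<open>tc a\<close> are well-ordered in the ground model. From each member
  \<open>u\<close> of \<open>a\<close>, the set \<open>c\<close> takes the first name whose value is
  in \<open>u\<close>; \<open>L p u j\<close> says that \<open>p\<close> forces \<open>j\<close> to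
  be its index.\<close>

lemma n_choice:
 assumes ne: "ALL x. nE x a --> (EX z. nE z x)"
  and disj: "ALL x. nE x a --> (ALL y. nE y a --> ~ nQ x y --> ~ (EX z. nE z x & nE z y))"
 shows "EX c. ALL x. nE x a --> (EX z. (nE z x & nE z c) & (ALL y. nE y x & nE y c --> nQ y z))"
proof -
 obtain k f where k: "Ord k" "app f ` el k = el (tc a)" "inj_on (app f) (el k)" using enumeration by blast
 define L where "L p u j <-> MEM p (app f j) u & (ALL i:el j. ALL r. r << p --> ~ MEM r (app f i) u)" for p u j
 have dL: "dff s ==> dff t ==> dff u ==> dfn (%e. L (s e) (t e) (u e))" for s t u
  by (rule dfn_rel3) (unfold L_def, intro dfn)
 have d: "dfn (%e. EX j:el k. e 0 = app f j & (EX u:el (tc a). MEM (e (Suc 0)) u a & L (e (Suc 0)) u j))"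
  by (intro dfn dL)
 obtain c where c: "!!z. nE z c <-> (EX v:el (tc a). EX p:G. (EX j:el k. v = app f j & (EX u:el (tc a). MEM p u a & L p u j)) & nQ z v)"
  using name_exists[OF d, of "tc a"] by blast
 have "EX z. (nE z x & nE z c) & (ALL y. nE y x & nE y c --> nQ y z)" if x: "nE x a" for x
 proof -
  obtain u q where u: "pr u q:el a" "q:G" "nQ x u" using x nE_iff by metis
  have ut: "u:el (tc a)" using dfn_name_rel[OF u(1)] .
  obtain z where "nE z u" using ne x u(3) nE_cong nQ_refl by blast
  then obtain v q' where v: "pr v q':el u" "q':G" unfolding nE_iff by blast
  have vt: "v:el (tc a)" using tc_tc[OF v(1) ut] .
  have "nE u a" "nE v u" using nE_name u v by blast+
  then obtain p where p: "p:G" "MEM p u a" "MEM p v u" unfolding nE_def using G_dir MEM_mono by meson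
  have "EX s:G. s << p & (EX j:el k. L s u j)"
  proof (rule generic[OF _ p(1)])
   show "dfn (%e. EX j:el k. L (e 0) u j)" by (intro dfn dL)
   fix r assume r: "r << p"
   obtain j0 where j0: "j0:el k" "v = app f j0" using vt k(2) by blast
   have d0: "dfn (%e. e 0:el k & (EX s. s << r & MEM s (app f (e 0)) u))" by (intro dfn)
   have h0: "j0:el k & (EX s. s << r & MEM s (app f j0) u)"
    using j0 r MEM_mono[OF p(3) r] le_refl leq_P by blast
   obtain j where j: "j:el k & (EX s. s << r & MEM s (app f j) u)"
    "!!i. i:el j ==> ~ (i:el k & (EX s. s << r & MEM s (app f i) u))"
    by (rule Ord_least[OF d0 Ord_mem[OF k(1) j0(1)] h0]) blast
   then obtain s where "s << r" "MEM s (app f j) u" by blast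
   then have "L s u j" unfolding L_def using j Ord_trans[OF k(1)] le_trans by blast
   then show "EX s. s << r & (EX j:el k. L s u j)" using \<open>s << r\<close> j by blast
  qed
  then obtain s j where s: "s:G" "s << p" "j:el k" "L s u j" by blast
  have Lz: "nE (app f j) u" using s unfolding L_def nE_def by blast
  have "nE (app f j) x" using Lz u(3) nE_cong nQ_sym nQ_refl by blast
  moreover have "nE (app f j) c" unfolding c
   using s MEM_mono[OF p(2) s(2)] ut k(2) nQ_refl by blast
  moreover have "nQ y (app f j)" if y: "nE y x" "nE y c" for y
  proof -
   obtain p' j' u' where h: "p':G" "j':el k" "u':el (tc a)" "MEM p' u' a" "L p' u' j'" "nQ y (app f j')"
    using y(2) unfolding c by blast
   have j'u: "nE (app f j') u'" "nE u' a" using h unfolding L_def nE_def by blast+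
   have "nE y u'" using j'u h(6) nE_cong nQ_sym nQ_refl by blast
   then have "nQ x u'" using disj x j'u y(1) by blast
   then have uu: "nQ u u'" using u(3) nQ_trans nQ_sym by blast
   have "~ nE (app f i) u" if "i:el j" for i
    using forced_nonmem[OF s(1)] s(4) that unfolding L_def by blast
   moreover have "~ nE (app f i) u'" if "i:el j'" for i
    using forced_nonmem[OF h(1)] h(5) that unfolding L_def by blast
   moreover have "nE (app f j') u" "nE (app f j) u'" using j'u Lz uu nE_cong nQ_sym nQ_refl by blast+
   ultimately have "j = j'" using Ord_linear Ord_mem[OF k(1)] h(2) s(3) by blast
   then show ?thesis using h(6) by blast
  qed
  ultimately show ?thesis by blast
 qed
 then show ?thesis by blast
qed

lemma n_ZFC: "ph:ZFC ==> satq nE nQ ph e"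
proof -
 assume "ph:ZFC"
 then consider "ph:sentence ` {Defs.extensionality, Defs.foundation, pairing, Defs.union, powerset, infinity, choice}"
  | k p where "ph = closure k (separation p)" "fv p <= {..<k + 1}"
  | k p where "ph = closure k (replacement p)" "fv p <= {..<k + 2}"
  unfolding ZFC_def by blast
 then show ?thesis
 proof cases
  case 1
  have "satq nE nQ (sentence Defs.extensionality) e" unfolding satq_extensionality using n_ext by blast
  moreover have "satq nE nQ (sentence Defs.foundation) e" unfolding satq_foundation using n_foundation by blast
  moreover have "satq nE nQ (sentence pairing) e" unfolding satq_pairing using n_pairing by blast
  moreover have "satq nE nQ (sentence Defs.union) e" unfolding satq_union using n_union by blast
  moreover have "satq nE nQ (sentence powerset) e" unfolding satq_powerset using n_power by blast
  moreover have "satq nE nQ (sentence infinity) e" unfolding satq_infinity using n_infinity .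
  moreover have "satq nE nQ (sentence choice) e" unfolding satq_choice using n_choice by blast
  ultimately show ?thesis using 1 by blast
 next
  case 2
  show ?thesis unfolding 2(1) satq_separation[OF 2(2)] using n_separation by blast
 next
  case 3
  show ?thesis unfolding 3(1) satq_replacement[OF 3(2)] using n_replacement by blast
 qed
qed

lemma zfc_EN: "zfc EN"
proof
 fix q and e :: "nat => nat" assume q: "q:ZFC"
 have "e = val o (%i. inv val (e i))" by (rule ext) (simp add: surj_f_inv_f[OF val(1)])
 then show "sat EN q e" using n_ZFC[OF q, of "%i. inv val (e i)"] unfolding satq_EN by simp
qed

end

section \<open>Finite and countable sets\<close>

context zfc
begin

definition "vfst p = (if EX! x. EX y. p = pr x y then THE x. EX y. p = pr x y else zero)"

definition "vsnd p = (if EX! y. EX x. p = pr x y then THE y. EX x. p = pr x y else zero)"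

lemma vfst_pr [simp]: "vfst (pr x y) = x" and vsnd_pr [simp]: "vsnd (pr x y) = y"
 unfolding vfst_def vsnd_def by auto

lemma [dfn]:
 "dff s ==> dff (%e. vfst (s e))"
 "dff s ==> dff (%e. vsnd (s e))"
 by (rule dff_fun1, (unfold vfst_def vsnd_def)[1], (intro dfn)[1], assumption+)+

text \<open>Recursion along \<open>om\<close>; the union \<open>Uni n\<close> of a nonzero number
  \<open>n\<close> is its predecessor.\<close>

definition nrec :: "('m => 'm) => ('m => 'm => 'm) => 'm => 'm => 'm" where
 "nrec A S = rec (%p n f. if n = zero then A p else S p (app f (Uni n)))"

lemma dff_nrec0:
 assumes "dff (%e. A (e 0))" "dff (%e. S (e 0) (e (Suc 0)))"
 shows "dff (%e. (%p n f. if n = zero then A p else S p (app f (Uni n))) (e 0) (e (Suc 0)) (e (Suc (Suc 0))))"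
 by (intro dfn dff_fun1[OF assms(1)] dff_fun2[OF assms(2)])

lemma dff_nrec:
 assumes "dff (%e. A (e 0))" "dff (%e. S (e 0) (e (Suc 0)))" "dff p" "dff n"
 shows "dff (%e. nrec A S (p e) (n e))"
 unfolding nrec_def by (rule dff_rec[OF dff_nrec0[OF assms(1,2)] assms(3,4)])

lemma Uni_succ: "n:el om ==> Uni (succ n) = n"
 by (rule el_ext) (use trans_nat in \<open>auto simp: trans_def\<close>)

lemma succ_neq_zero [simp]: "succ n ~= zero"
 by (metis el_succ el_zero insert_not_empty)

lemma nrec_zero:
 assumes "dff (%e. A (e 0))" "dff (%e. S (e 0) (e (Suc 0)))" shows "nrec A S p zero = A p"
 using rec[OF dff_nrec0[OF assms], of p zero] unfolding nrec_def by simp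

lemma nrec_succ:
 assumes "dff (%e. A (e 0))" "dff (%e. S (e 0) (e (Suc 0)))" "n:el om"
 shows "nrec A S p (succ n) = S p (nrec A S p n)"
proof -
 have d: "dff (%e. nrec A S p (e 0))" by (intro dff_nrec assms dfn)
 have "app (lam (succ n) (nrec A S p)) n = nrec A S p n" by (rule app_lam[OF d]) simp
 then show ?thesis
  using rec[OF dff_nrec0[OF assms(1,2)], of p "succ n"] unfolding nrec_def[symmetric]
  by (simp add: Uni_succ[OF assms(3)])
qed

lemma nat_cases: "n:el om ==> n = zero | (EX m:el om. n = succ m)"
proof (induction rule: om_induct)
 case df show ?case by (intro dfn)
qed auto

lemma [simp]: "succ m = succ n <-> m = n"
 using mem_asym mem_irrefl by (metis el_succ insertE insertI1)

subsection \<open>Comparing sets\<close>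

text \<open>Maps are used through \<open>app\<close> only, so any element may serve as
  \<open>f\<close>; \<open>lam\<close> supplies one for each definable function.\<close>

definition "inj_fun f x y <-> (ALL u:el x. app f u:el y) & (ALL u:el x. ALL v:el x. app f u = app f v --> u = v)"

definition "lep x y <-> (EX f. inj_fun f x y)"

definition "eqp x y <-> (EX f. inj_fun f x y & (ALL v:el y. EX u:el x. v = app f u))"

definition fin where "fin x <-> (EX n:el om. EX f. ALL y. y:el x <-> (EX m:el n. y = app f m))"

abbreviation cnt :: "'m => bool" where "cnt x \<equiv> lep x om"

lemma [dfn]: "dff s ==> dff t ==> dff u ==> dfn (%e. inj_fun (s e) (t e) (u e))"
 by (rule dfn_rel3) (unfold inj_fun_def, intro dfn)
lemma [dfn]:
 "dff s ==> dff t ==> dfn (%e. lep (s e) (t e))"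
 "dff s ==> dff t ==> dfn (%e. eqp (s e) (t e))"
 by (rule dfn_rel2, (unfold lep_def eqp_def)[1], (intro dfn)[1], assumption+)+
lemma [dfn]: "dff s ==> dfn (%e. fin (s e))"
 by (rule dfn_rel1) (unfold fin_def, intro dfn)

lemma lepI:
 assumes "dff (%e. F (e 0))" "!!u. u:el x ==> F u:el y"
  "!!u v. u:el x ==> v:el x ==> F u = F v ==> u = v"
 shows "lep x y"
 unfolding lep_def inj_fun_def using assms by (intro exI[of _ "lam x F"]) (simp add: app_lam)

lemma lep_subset: "el x <= el y ==> lep x y"
 by (rule lepI[of "%u. u"]) (intro dfn, auto)

lemma lep_trans: "lep x y ==> lep y z ==> lep x z"
proof -
 assume "lep x y" "lep y z"
 then obtain f g where "inj_fun f x y" "inj_fun g y z" unfolding lep_def by blast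
 then show "lep x z" unfolding inj_fun_def by (intro lepI[of "%u. app g (app f u)"]) (intro dfn, blast+)
qed

lemma lep_img:
 assumes F: "dff (%e. F (e 0))" shows "lep (img x F) x"
proof -
 define S where "S z = set {u. u:el x & F u = z}" for z
 have S: "el (S z) = {u:el x. F u = z}" for z
  unfolding S_def by (rule el_sep) (intro dfn dff_fun1[OF F])
 have dS: "dff (%e. S (e 0))" unfolding S_def by (intro dfn dff_fun1[OF F])
 obtain c where c: "!!y. y:el (img (img x F) S) ==> el y ~= {} ==> app c y:el y" using choice_fun by blast
 have ac: "app c (S z):el x & F (app c (S z)) = z" if z: "z:el (img x F)" for z
 proof -
  have "S z:el (img (img x F) S)" unfolding el_img[OF dS] using z by blast
  moreover have "el (S z) ~= {}" using z unfolding el_img[OF F] S by auto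
  ultimately have "app c (S z):el (S z)" by (rule c)
  then show ?thesis unfolding S by blast
 qed
 show ?thesis
 proof (rule lepI[of "%z. app c (S z)"])
  show "dff (%e. app c (S (e 0)))" by (intro dfn dS)
  show "u = v" if "u:el (img x F)" "v:el (img x F)" "app c (S u) = app c (S v)" for u v
   using ac[OF that(1)] ac[OF that(2)] that(3) by metis
 qed (use ac in blast)
qed

lemma eqp_lep: "eqp x y ==> lep x y"
 unfolding eqp_def lep_def by blast

lemma eqp_sym: "eqp x y ==> eqp y x"
proof -
 assume "eqp x y"
 then obtain f where f: "!!u. u:el x ==> app f u:el y" "!!u v. u:el x ==> v:el x ==> app f u = app f v ==> u = v"
  "!!v. v:el y ==> EX u:el x. v = app f u" unfolding eqp_def inj_fun_def by blast
 define g where "g v = (if EX! u. u:el x & app f u = v then THE u. u:el x & app f u = v else zero)" for v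
 have dg: "dff (%e. g (e 0))" unfolding g_def by (intro dfn)
 have g: "g (app f u) = u" if "u:el x" for u
 proof -
  have "EX! w. w:el x & app f w = app f u" using f(2) that by blast
  moreover from this have "(THE w. w:el x & app f w = app f u) = u" by (rule the1_equality) (use that in simp)
  ultimately show ?thesis unfolding g_def by simp
 qed
 have ag: "app (lam y g) v = g v" if "v:el y" for v using app_lam[OF dg that] .
 have "inj_fun (lam y g) y x" unfolding inj_fun_def using ag g f(3) by metis
 moreover have "EX v:el y. u = app (lam y g) v" if "u:el x" for u
  using that f(1) ag g by (intro bexI[of _ "app f u"]) auto
 ultimately show ?thesis unfolding eqp_def by blast
qed

lemma eqpI:
 assumes "dff (%e. F (e 0))" "!!u. u:el x ==> F u:el y"
  "!!u v. u:el x ==> v:el x ==> F u = F v ==> u = v" "!!v. v:el y ==> EX u:el x. v = F u"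
 shows "eqp x y"
 unfolding eqp_def inj_fun_def using assms by (intro exI[of _ "lam x F"]) (simp add: app_lam)

lemma eqp_trans: "eqp x y ==> eqp y z ==> eqp x z"
proof -
 assume "eqp x y" "eqp y z"
 then obtain f g where f: "inj_fun f x y" "ALL v:el y. EX u:el x. v = app f u" and g: "inj_fun g y z" "ALL v:el z. EX u:el y. v = app g u"
  unfolding eqp_def by blast
 show "eqp x z"
 proof (rule eqpI[of "%u. app g (app f u)"])
  show "EX u:el x. v = app g (app f u)" if "v:el z" for v using f g that by metis
  show "dff (%e. app g (app f (e 0)))" by (intro dfn)
  show "app g (app f u):el z" if "u:el x" for u using that f(1) g(1) unfolding inj_fun_def by blast
  show "u = v" if "u:el x" "v:el x" "app g (app f u) = app g (app f v)" for u v
   using that f(1)[unfolded inj_fun_def] g(1)[unfolded inj_fun_def] by metis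
 qed
qed

lemma eqp_refl: "eqp x x"
 by (rule eqpI[of "%u. u"]) (intro dfn, auto)

text \<open>\<open>Z\<close> is the least set that contains the points of \<open>x\<close> outside
  the range of \<open>g\<close> and is closed under \<open>f\<close> followed by \<open>g\<close>.
  The bijection is \<open>f\<close> on \<open>Z\<close> and the inverse of \<open>g\<close>
  elsewhere; surjectivity rests on \<open>Z3\<close>, by which points of \<open>Z\<close> in the
  range of \<open>g\<close> come from \<open>Z\<close>.\<close>

lemma cantor_bernstein:
 assumes "lep x y" "lep y x" shows "eqp x y"
proof -
 obtain f where f: "!!u. u:el x ==> app f u:el y" "!!u v. u:el x ==> v:el x ==> app f u = app f v ==> u = v"
  using assms(1) unfolding lep_def inj_fun_def by blast
 obtain g where g: "!!u. u:el y ==> app g u:el x" "!!u v. u:el y ==> v:el y ==> app g u = app g v ==> u = v"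
  using assms(2) unfolding lep_def inj_fun_def by blast
 let ?C = "%X. (ALL v:el x. (~ (EX w:el y. v = app g w)) --> v:el X) & (ALL v:el x. v:el X --> app g (app f v):el X)"
 obtain Z where Z: "el Z = {u:el x. ALL X. ?C X --> u:el X}" by (erule sep_ex) (intro dfn)
 have Z1: "v:el Z" if "v:el x" "~ (EX w:el y. v = app g w)" for v using that unfolding Z by blast
 have Z2: "app g (app f v):el Z" if "v:el Z" for v using that f(1) g(1) unfolding Z by blast
 have Z3: "EX v:el Z. u = app g (app f v)" if u: "u:el Z" "u = app g w" "w:el y" for u w
 proof (rule ccontr)
  assume n: "~ ?thesis"
  have "?C (vmin Z (dbl u u))" using Z1 Z2 n u unfolding el_vmin el_dbl by auto
  moreover have "u~:el (vmin Z (dbl u u))" by simp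
  ultimately show False using u(1) unfolding Z by blast
 qed
 define gi where "gi u = (if EX! w. w:el y & app g w = u then THE w. w:el y & app g w = u else zero)" for u
 have gi: "gi (app g w) = w" if "w:el y" for w
 proof -
  have "EX! v. v:el y & app g v = app g w" using g(2) that by blast
  moreover from this have "(THE v. v:el y & app g v = app g w) = w" by (rule the1_equality) (use that in simp)
  ultimately show ?thesis unfolding gi_def by simp
 qed
 define h where "h u = (if u:el Z then app f u else gi u)" for u
 have notZ: "EX w:el y. u = app g w & h u = w" if "u:el x" "u~:el Z" for u
 proof -
  have "EX w:el y. u = app g w" using Z1 that by blast
  then show ?thesis using gi that(2) unfolding h_def by auto
 qed
 have Zx: "u:el Z ==> u:el x" for u unfolding Z by blast
 show ?thesis
 proof (rule eqpI[of h])
  show "dff (%e. h (e 0))" unfolding h_def gi_def by (intro dfn)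
  show "h u:el y" if "u:el x" for u using notZ[OF that] f(1)[OF that] by (cases "u:el Z") (auto simp: h_def)
  have mix: False if "u:el Z" "v:el x" "v~:el Z" "h u = h v" for u v
   using notZ[OF that(2,3)] Z2[OF that(1)] that by (auto simp: h_def)
  show "u = v" if "u:el x" "v:el x" "h u = h v" for u v
  proof -
   consider "u:el Z" "v:el Z" | "u:el Z" "v~:el Z" | "u~:el Z" "v:el Z" | "u~:el Z" "v~:el Z" by blast
   then show ?thesis
   proof cases
    case 1
    then show ?thesis using f(2) that by (simp add: h_def)
   next
    case 2
    then show ?thesis using mix that by blast
   next
    case 3
    then show ?thesis using mix[OF 3(2) that(1) 3(1)] that by simp
   next
    case 4
    then show ?thesis using notZ[OF that(1)] notZ[OF that(2)] that(3) by metis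
   qed
  qed
  show "EX u:el x. v = h u" if v: "v:el y" for v
  proof (cases "app g v:el Z")
   case True
   then obtain u where "u:el Z" "app g v = app g (app f u)" using Z3 v by blast
   then have "v = h u" "u:el x" using g(2) v f(1) Zx by (auto simp: h_def)
   then show ?thesis by blast
  next
   case False
   then have "h (app g v) = v" using gi[OF v] by (simp add: h_def)
   then show ?thesis using g(1)[OF v] by metis
  qed
 qed
qed

lemma cantor: "~ lep (pw x) x"
proof
 assume "lep (pw x) x"
 then obtain f where f0: "inj_fun f (pw x) x" unfolding lep_def by blast
 have f: "el u <= el x ==> el v <= el x ==> app f u = app f v ==> u = v"
  "el u <= el x ==> app f u:el x" for u v
  using f0 unfolding inj_fun_def by simp_all
 obtain D where D: "el D = {u:el x. EX X. el X <= el x & app f X = u & u~:el X}" by (erule sep_ex) (intro dfn)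
 have Dx: "el D <= el x" unfolding D by blast
 show False
 proof (cases "app f D:el D")
  case True
  then obtain X where X: "el X <= el x" "app f X = app f D" "app f D~:el X" unfolding D by blast
  have "X = D" by (rule f(1)[OF X(1) Dx X(2)])
  then show False using X(3) True by simp
 next
  case False
  moreover have "app f D:el D" unfolding D using f(2)[OF Dx] Dx False by blast
  ultimately show False by simp
 qed
qed

lemma ex_cardinal: "EX k. Ord k & eqp x k & (ALL a:el k. ~ eqp a k)"
proof -
 obtain k f where k: "Ord k" "app f ` el k = el x" "inj_on (app f) (el k)" using enumeration by blast
 have "eqp k x" by (rule eqpI[of "app f"]) (intro dfn, use k in \<open>auto simp: inj_on_def\<close>)
 then have "eqp x k" by (rule eqp_sym)
 moreover have "dfn (%e. eqp x (e 0))" by (intro dfn)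
 ultimately obtain b where b: "Ord b" "eqp x b" "!!c. c:el b ==> ~ eqp x c" using Ord_least[OF _ k(1), of "eqp x"] by metis
 then show ?thesis using eqp_trans eqp_sym by blast
qed

lemma ex_omega1: "EX k. Ord k & ~ cnt k & (ALL a:el k. cnt a)"
proof -
 obtain k where k: "Ord k" "eqp (pw om) k" using ex_cardinal by blast
 then have "~ cnt k" using cantor eqp_lep lep_trans by blast
 moreover have "dfn (%e. ~ cnt (e 0))" by (intro dfn)
 ultimately show ?thesis using Ord_least[OF _ k(1), of "%k. ~ cnt k"] by metis
qed

subsection \<open>Finite sets\<close>

lemma fin_img_nat: "n:el om ==> dff (%e. F (e 0)) ==> fin (img n F)"
 unfolding fin_def by (rule bexI[of _ n], rule exI[of _ "lam n F"]) (auto simp: el_img app_lam)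

lemma fin_induct [consumes 1, case_names df zero ins]:
 assumes "fin x" and P: "dfn (%e. P (e 0))" and "P zero" and step: "!!y z. fin y ==> P y ==> z:el x ==> P (ins z y)"
 shows "P x"
proof -
 obtain n f where n: "n:el om" "!!y. y:el x <-> (EX m:el n. y = app f m)" using assms(1) unfolding fin_def by blast
 have da: "dff (%e. app f (e 0))" by (intro dfn)
 have di: "dff (%e. img (e 0) (app f))" using dff_img[of "%e. e 0" "%x e. app f x"] by (simp add: dfn)
 have "el m <= el n --> P (img m (app f))" if "m:el om" for m
  using that
 proof (induction rule: om_induct)
  case df show ?case by (intro dfn dfn_rel1[OF P] di)
 next
  case zero
  have "img zero (app f) = zero" by (rule el_ext) (simp add: el_img[OF da])
  then show ?case using assms(3) by simp
 next
  case (succ m)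
  have "img (succ m) (app f) = ins (app f m) (img m (app f))" by (rule el_ext) (simp add: el_img[OF da])
  then show ?case using step succ fin_img_nat[OF succ(1) da] n(2) by auto
 qed
 moreover have "img n (app f) = x" by (rule el_ext) (use n(2) in \<open>auto simp: el_img[OF da]\<close>)
 ultimately show ?thesis using n(1) by auto
qed

lemma fin_zero [simp]: "fin zero"
 unfolding fin_def by (rule bexI[of _ zero]) auto

lemma fin_ins [simp]: "fin x ==> fin (ins z x)"
proof -
 assume "fin x"
 then obtain n f where n: "n:el om" "!!y. y:el x <-> (EX m:el n. y = app f m)" unfolding fin_def by blast
 have d: "dff (%e. if e 0 = n then z else app f (e 0))" by (intro dfn)
 have "ins z x = img (succ n) (%m. if m = n then z else app f m)"
  by (rule el_ext) (use n mem_irrefl in \<open>auto simp: el_img[OF d]\<close>)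
 then show ?thesis using fin_img_nat[OF succ_omega[OF n(1)] d] by simp
qed

lemma fin_cong: "fin x ==> el x = el y ==> fin y"
 using el_ext by blast

lemma fin_img: "fin x ==> dff (%e. F (e 0)) ==> fin (img x F)"
proof -
 assume x: "fin x" and F: "dff (%e. F (e 0))"
 from x show ?thesis
 proof (induction rule: fin_induct)
  case df show ?case by (intro dfn dff_fun1[OF F])
 next
  case zero
  show ?case by (rule fin_cong[OF fin_zero]) (simp add: el_img[OF F])
 next
  case (ins y z)
  show ?case by (rule fin_cong[OF fin_ins[OF ins.IH, of "F z"]]) (simp add: el_img[OF F])
 qed
qed

lemma fin_un: "fin x ==> fin y ==> fin (un x y)"
proof (induction x rule: fin_induct)
 case df show ?case by (intro dfn)
next
 case zero
 have "un zero y = y" by (rule el_ext) simp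
 then show ?case using zero by simp
next
 case (ins x z)
 have "un (ins z x) y = ins z (un x y)" by (rule el_ext) simp
 then show ?case using ins by simp
qed

lemma fin_subset: "fin x ==> el y <= el x ==> fin y"
proof -
 assume "fin x"
 then have "ALL y. el y <= el x --> fin y"
 proof (induction rule: fin_induct)
  case df show ?case by (intro dfn)
 next
  case zero
  show ?case using fin_cong[OF fin_zero] by auto
 next
  case (ins x z)
  show ?case
  proof (intro allI impI)
   fix y assume y: "el y <= el (ins z x)"
   then have "el (vmin y (dbl z z)) <= el x" by auto
   then have f: "fin (vmin y (dbl z z))" using ins.IH by blast
   show "fin y"
   proof (cases "z:el y")
    case True
    then show ?thesis by (intro fin_cong[OF fin_ins[OF f, of z], of y]) auto
   next
    case False
    then show ?thesis by (intro fin_cong[OF f, of y]) auto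
   qed
  qed
 qed
 then show "el y <= el x ==> fin y" by blast
qed

lemma fin_dbl [simp]: "fin (dbl a b)"
 by (rule fin_cong[OF fin_ins[OF fin_ins[OF fin_zero, of b], of a]]) simp

lemma fin_nat: "n:el om ==> fin n"
 by (rule fin_cong[OF fin_img_nat[of n "%x. x"]]) (auto simp: dff_var el_img)

lemma fin_Uni: "fin x ==> (!!y. y:el x ==> fin y) ==> fin (Uni x)"
proof -
 assume "fin x"
 then have "(ALL y:el x. fin y) --> fin (Uni x)"
 proof (induction rule: fin_induct)
  case df show ?case by (intro dfn)
 next
  case zero
  show ?case by (rule impI, rule fin_cong[OF fin_zero]) simp
 next
  case (ins x z)
  show ?case
  proof
   assume "ALL y:el (ins z x). fin y"
   then have "fin (un z (Uni x))" using ins fin_un by auto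
   then show "fin (Uni (ins z x))" by (rule fin_cong) simp
  qed
 qed
 then show "(!!y. y:el x ==> fin y) ==> fin (Uni x)" by blast
qed

lemma fin_pw: "fin x ==> fin (pw x)"
proof (induction rule: fin_induct)
 case df show ?case by (intro dfn)
next
 case zero
 show ?case by (rule fin_cong[OF fin_dbl[of zero zero]]) (auto simp: zero_iff)
next
 case (ins x z)
 have d: "dff (%e. ins z (e 0))" by (intro dfn)
 have "el (un (pw x) (img (pw x) (ins z))) = el (pw (ins z x))"
 proof (intro equalityI subsetI)
  fix y assume y: "y:el (pw (ins z x))"
  show "y:el (un (pw x) (img (pw x) (ins z)))"
  proof (cases "z:el y")
   case True
   then have "y = ins z (vmin y (dbl z z))" by (intro el_ext) auto
   moreover have "el (vmin y (dbl z z)) <= el x" using y by auto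
   ultimately show ?thesis unfolding el_un el_img[OF d] by auto
  qed (use y in auto)
 qed (auto simp: el_img[OF d])
 then show ?case using fin_cong[OF fin_un[OF ins.IH fin_img[OF ins.IH d]]] by blast
qed

lemma fin_bounded: "fin x ==> el x <= el om ==> EX n:el om. el x <= el n"
proof -
 assume "fin x"
 then have "el x <= el om --> (EX n:el om. el x <= el n)"
 proof (induction rule: fin_induct)
  case df show ?case by (intro dfn)
 next
  case zero
  show ?case by (rule impI, rule bexI[OF _ zero_omega]) simp
 next
  case (ins x z)
  show ?case
  proof
   assume h: "el (ins z x) <= el om"
   then obtain n where n: "n:el om" "el x <= el n" using ins by auto
   have z: "z:el om" using h by simp
   consider "z:el n" | "z = n" | "n:el z" using Ord_linear Ord_nat n z by blast
   then show "EX n:el om. el (ins z x) <= el n"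
   proof cases
    case 3
    then have "el n <= el z" using trans_nat z unfolding trans_def by blast
    then show ?thesis using z n by (intro bexI[of _ "succ z"]) auto
   next
    case 2
    then show ?thesis using n by (intro bexI[of _ "succ n"]) auto
   qed (use n in auto)
  qed
 qed
 then show "el x <= el om ==> EX n:el om. el x <= el n" by blast
qed

lemma not_fin_omega: "~ fin om"
 using fin_bounded[of om] mem_irrefl by blast

lemma infinite_unbounded: "~ fin x ==> el x <= el om ==> n:el om ==> EX m:el x. m~:el n"
 using fin_subset[OF fin_nat] by blast

lemma unbounded_infinite: "(!!n. n:el om ==> EX m:el x. m~:el n) ==> el x <= el om ==> ~ fin x"
 using fin_bounded by blast

lemma fin_eqp_nat: "fin x ==> EX n:el om. eqp n x"
proof (induction rule: fin_induct)
 case df show ?case by (intro dfn)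
next
 case zero
 show ?case using eqp_refl zero_omega by blast
next
 case (ins x z)
 then obtain n where n: "n:el om" "eqp n x" by blast
 show ?case
 proof (cases "z:el x")
  case True
  then have "ins z x = x" by (intro el_ext) auto
  then show ?thesis using n by auto
 next
  case False
  obtain f where f: "!!u. u:el n ==> app f u:el x" "!!u v. u:el n ==> v:el n ==> app f u = app f v ==> u = v"
   "!!v. v:el x ==> EX u:el n. v = app f u" using n(2) unfolding eqp_def inj_fun_def by blast
  have d: "dff (%e. if e 0 = n then z else app f (e 0))" by (intro dfn)
  have nn: "u:el n ==> u ~= n" for u using mem_irrefl by blast
  have "eqp (succ n) (ins z x)"
  proof (rule eqpI[OF d])
   show "EX u:el (succ n). v = (if u = n then z else app f u)" if v: "v:el (ins z x)" for v
   proof (cases "v = z")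
    case False
    then obtain u where "u:el n" "v = app f u" using v f(3) by auto
    then show ?thesis using nn by auto
   qed auto
  qed (use f False nn in \<open>auto split: if_splits\<close>)
  then show ?thesis using succ_omega[OF n(1)] by blast
 qed
qed

lemma eqp_nat_fin: "n:el om ==> eqp n x ==> fin x"
proof -
 assume n: "n:el om" "eqp n x"
 then obtain f where "inj_fun f n x" "ALL v:el x. EX u:el n. v = app f u" unfolding eqp_def by blast
 then have "ALL y. y:el x <-> (EX m:el n. y = app f m)" unfolding inj_fun_def by blast
 then show ?thesis unfolding fin_def using n by blast
qed

subsection \<open>Countable sets\<close>

lemma fin_cnt: "fin x ==> cnt x"
proof -
 assume "fin x"
 then obtain n where "n:el om" "eqp n x" using fin_eqp_nat by blast
 moreover have "el n <= el om" using calculation trans_omega unfolding trans_def by blast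
 ultimately show ?thesis using eqp_sym eqp_lep lep_trans lep_subset by blast
qed

definition plus where "plus = nrec (%p. p) (%p x. succ x)"

lemma [dfn]: "dff s ==> dff t ==> dff (%e. plus (s e) (t e))"
 unfolding plus_def by (intro dff_nrec dfn)

lemma plus_zero: "plus m zero = m"
 unfolding plus_def by (rule nrec_zero) (intro dfn)+

lemma plus_succ: "n:el om ==> plus m (succ n) = succ (plus m n)"
 unfolding plus_def by (rule nrec_succ) (intro dfn)+

lemma plus_nat [simp]: "n:el om ==> m:el om ==> plus m n:el om"
proof (induction n rule: om_induct)
 case df show ?case by (intro dfn)
qed (simp_all add: plus_zero plus_succ)

lemma plus_zero_left: "n:el om ==> plus zero n = n"
proof (induction n rule: om_induct)
 case df show ?case by (intro dfn)
qed (simp_all add: plus_zero plus_succ)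

lemma plus_succ_left: "n:el om ==> plus (succ m) n = succ (plus m n)"
proof (induction n rule: om_induct)
 case df show ?case by (intro dfn)
qed (simp_all add: plus_zero plus_succ)

text \<open>\<open>N\<close> walks along the antidiagonals: from \<open>pr a (succ b)\<close> to
  \<open>pr (succ a) b\<close>, and from the end \<open>pr a zero\<close> of one to the start
  \<open>pr zero (succ a)\<close> of the next. By induction on the sum of the coordinates the walk
  reaches every pair.\<close>

lemma cnt_omega_times: "cnt (times om om)"
proof -
 define N where "N q c = (if vsnd c = zero then pr zero (succ (vfst c)) else pr (succ (vfst c)) (Uni (vsnd c)))" for q c :: 'm
 have N1: "N q (pr a (succ b)) = pr (succ a) b" if "b:el om" for q a b
  unfolding N_def using that by (simp add: Uni_succ)
 have N2: "N q (pr a zero) = pr zero (succ a)" for q a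
  unfolding N_def by simp
 have dN: "dff (%e. N (e 0) (e (Suc 0)))" unfolding N_def by (intro dfn)
 define g where "g = nrec (%p. pr zero zero) N zero"
 have dA: "dff (%e. pr zero zero)" by (intro dfn)
 have dg: "dff (%e. g (e 0))" unfolding g_def by (intro dff_nrec dA dN dfn)
 have g0: "g zero = pr zero zero" unfolding g_def by (rule nrec_zero[OF dA dN])
 have gS: "g (succ n) = N zero (g n)" if "n:el om" for n unfolding g_def by (rule nrec_succ[OF dA dN that])
 let ?R = "%a b. EX n:el om. g n = pr a b"
 have dR: "dff s ==> dff t ==> dfn (%e. ?R (s e) (t e))" for s t
  by (rule dfn_rel2) (intro dfn dff_fun1[OF dg])
 have R1: "?R (succ a) b" if "?R a (succ b)" "b:el om" for a b
  using that gS N1 succ_omega by metis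
 have R2: "?R zero (succ a)" if "?R a zero" for a
  using that gS N2 succ_omega by metis
 have all: "ALL a:el om. ALL b:el om. plus a b = s --> ?R a b" if "s:el om" for s
  using that
 proof (induction s rule: om_induct)
  case df show ?case by (intro dfn dR)
 next
  case zero
  have "plus a b ~= zero" if "a:el om" "b:el om" "a ~= zero | b ~= zero" for a b
   using that nat_cases[OF that(1)] nat_cases[OF that(2)] by (auto simp: plus_succ plus_succ_left plus_zero)
  then show ?case using g0 zero_omega by metis
 next
  case (succ s)
  have "ALL b:el om. plus a b = succ s --> ?R a b" if "a:el om" for a
   using that
  proof (induction a rule: om_induct)
   case df show ?case by (intro dfn dR)
  next
   case zero
   have "?R s zero" using succ plus_zero zero_omega by blast
   then show ?case using R2 by (auto simp: plus_zero_left)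
  next
   case (succ a)
   then show ?case using R1 by (auto simp: plus_succ plus_succ_left)
  qed
  then show ?case by blast
 qed
 have "el (times om om) <= el (img om g)"
  unfolding el_img[OF dg] using all by (auto simp: image_iff) (metis plus_nat)
 then show ?thesis using lep_trans[OF lep_subset lep_img[OF dg]] by blast
qed

lemma lep_times: "lep a b ==> lep c d ==> lep (times a c) (times b d)"
proof -
 assume "lep a b" "lep c d"
 then obtain f g where fg: "inj_fun f a b" "inj_fun g c d" unfolding lep_def by blast
 define F where "F p = pr (app f (vfst p)) (app g (vsnd p))" for p
 have F: "F (pr x y) = pr (app f x) (app g y)" for x y unfolding F_def by simp
 show ?thesis
 proof (rule lepI[of F])
  show "dff (%e. F (e 0))" unfolding F_def by (intro dfn)
 qed (use fg in \<open>auto simp: F inj_fun_def\<close>)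
qed

lemma cnt_times: "cnt a ==> cnt b ==> cnt (times a b)"
 using lep_times lep_trans cnt_omega_times by blast

lemma surj_of_cnt: "cnt x ==> EX f. el x <= app f ` el om"
proof -
 assume "cnt x"
 then obtain f where f: "inj_fun f x om" unfolding lep_def by blast
 define g where "g n = (if EX! u. u:el x & app f u = n then THE u. u:el x & app f u = n else zero)" for n
 have dg: "dff (%e. g (e 0))" unfolding g_def by (intro dfn)
 have "u = app (lam om g) (app f u)" "app f u:el om" if "u:el x" for u
 proof -
  show o: "app f u:el om" using f that unfolding inj_fun_def by blast
  have "EX! w. w:el x & app f w = app f u" using f that unfolding inj_fun_def by blast
  moreover from this have "(THE w. w:el x & app f w = app f u) = u" by (rule the1_equality) (use that in simp)
  ultimately show "u = app (lam om g) (app f u)" unfolding app_lam[OF dg o] g_def by simp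
 qed
 then show ?thesis by blast
qed

text \<open>Two choices, of a counting function for each member of \<open>a\<close> and of a member
  of \<open>a\<close> for each point of the union, send a point to this member and the number of the
  point in it.\<close>

lemma lep_Uni:
 assumes "!!x. x:el a ==> cnt x" shows "lep (Uni a) (times a om)"
proof -
 \<comment> \<open>Only counting functions included in \<open>times x om\<close> are collected, so
   that they form a set from which one can be chosen.\<close>
 define S where "S x = set {f. f:el (pw (times x om)) & inj_fun f x om}" for x
 have S: "el (S x) = {f:el (pw (times x om)). inj_fun f x om}" for x
  unfolding S_def by (rule el_sep) (intro dfn)
 have dS: "dff (%e. S (e 0))" unfolding S_def by (intro dfn)
 have Sne: "el (S x) ~= {}" if h: "x:el a" for x
 proof -
  obtain f where f: "inj_fun f x om" using assms[OF h] unfolding lep_def by blast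
  have da: "dff (%e. app f (e 0))" by (intro dfn)
  have "inj_fun (lam x (app f)) x om" using f unfolding inj_fun_def by (simp add: app_lam[OF da])
  moreover have "el (lam x (app f)) <= el (times x om)" using f unfolding inj_fun_def by (auto simp: el_lam[OF da])
  ultimately show ?thesis unfolding S by auto
 qed
 obtain c where c: "!!y. y:el (img a S) ==> el y ~= {} ==> app c y:el y" using choice_fun by blast
 have c': "inj_fun (app c (S x)) x om" if "x:el a" for x
  using c[of "S x"] Sne[OF that] that S unfolding el_img[OF dS] by blast
 obtain d where d: "!!u. u:el (Uni a) ==> app d u:el a & u:el (app d u)"
 proof -
  define T where "T u = set {x. x:el a & u:el x}" for u
  have T: "el (T u) = {x:el a. u:el x}" for u unfolding T_def by (rule el_sep) (intro dfn)
  have dT: "dff (%e. T (e 0))" unfolding T_def by (intro dfn)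
  obtain c where c: "!!y. y:el (img (Uni a) T) ==> el y ~= {} ==> app c y:el y" using choice_fun by blast
  have dd: "dff (%e. app c (T (e 0)))" by (intro dfn dT)
  have "app (lam (Uni a) (%u. app c (T u))) u:el (T u)" if "u:el (Uni a)" for u
   unfolding app_lam[OF dd that] by (rule c) (use that T in \<open>auto simp: el_img[OF dT]\<close>)
  then show ?thesis using that T by blast
 qed
 show ?thesis
 proof (rule lepI)
  show "dff (%e. pr (app d (e 0)) (app (app c (S (app d (e 0)))) (e 0)))"
   by (intro dfn dff_fun1[OF dS])
  show "pr (app d u) (app (app c (S (app d u))) u):el (times a om)" if "u:el (Uni a)" for u
   using d[OF that] c' unfolding inj_fun_def by auto
  show "u = v" if "u:el (Uni a)" "v:el (Uni a)"
   "pr (app d u) (app (app c (S (app d u))) u) = pr (app d v) (app (app c (S (app d v))) v)" for u v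
   using d[OF that(1)] d[OF that(2)] c' that(3) unfolding inj_fun_def pr_inject by metis
 qed
qed

lemma cnt_Uni: "cnt a ==> (!!x. x:el a ==> cnt x) ==> cnt (Uni a)"
 using lep_trans[OF lep_Uni lep_trans[OF lep_times[OF _ lep_subset] cnt_omega_times]] by blast

lemma cnt_vUN: "dff (%e. F (e 0)) ==> cnt a ==> (!!x. x:el a ==> cnt (F x)) ==> cnt (vUN a F)"
proof -
 assume a: "dff (%e. F (e 0))" "cnt a" "!!x. x:el a ==> cnt (F x)"
 have "cnt (Uni (img a F))" by (rule cnt_Uni) (use a lep_trans[OF lep_img] in \<open>auto simp: el_img\<close>)
 moreover have "el (vUN a F) <= el (Uni (img a F))" using a by (auto simp: el_img el_vUN)
 ultimately show ?thesis using lep_trans lep_subset by blast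
qed

lemma cnt_un: "cnt a ==> cnt b ==> cnt (un a b)"
proof -
 assume "cnt a" "cnt b"
 then have "cnt (Uni (dbl a b))" by (intro cnt_Uni[OF fin_cnt[OF fin_dbl]]) auto
 moreover have "el (un a b) <= el (Uni (dbl a b))" by auto
 ultimately show ?thesis using lep_trans lep_subset by blast
qed

definition "Fin x = set {y. el y <= el x & fin y}"

lemma [dfn]: "dff s ==> dff (%e. Fin (s e))"
 by (rule dff_fun1) (unfold Fin_def, intro dfn)

lemma el_Fin [simp]: "el (Fin x) = {y. el y <= el x & fin y}"
proof -
 have "small {y. el y <= el x & fin y}" by (rule small_subset[of _ "pw x"]) (intro dfn, simp)
 then show ?thesis unfolding Fin_def by (rule el_set)
qed

text \<open>A finite subset is included in the image of some natural number under an enumeration of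
  \<open>x\<close>, and each such image has only finitely many subsets.\<close>

lemma cnt_Fin: "cnt x ==> cnt (Fin x)"
proof -
 assume "cnt x"
 then obtain f where f: "el x <= app f ` el om" using surj_of_cnt by blast
 have da: "dff (%e. app f (e 0))" by (intro dfn)
 have di: "dff (%e. pw (img (e 0) (app f)))" using dff_pw[OF dff_img[of "%e. e 0" "%x e. app f x"]] by (simp add: dfn)
 have "cnt (vUN om (%n. pw (img n (app f))))"
  by (rule cnt_vUN[OF di lep_subset]) (use fin_cnt fin_pw fin_img_nat da in auto)
 moreover have "el (Fin x) <= el (vUN om (%n. pw (img n (app f))))"
 proof
  fix y assume "y:el (Fin x)"
  then have y: "fin y" "el y <= el x" by auto
  from y(1) have "el y <= el x --> (EX n:el om. el y <= el (img n (app f)))"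
  proof (induction rule: fin_induct)
   case df show ?case by (intro dfn)
  next
   case zero show ?case by (rule impI, rule bexI[OF _ zero_omega]) simp
  next
   case (ins y z)
   show ?case
   proof
    assume h: "el (ins z y) <= el x"
    then obtain n m where n: "n:el om" "el y <= app f ` el n" "m:el om" "z = app f m"
     using ins f by (auto simp: el_img[OF da])
    then obtain k where "k:el om" "el n <= el k" "m:el k"
     using fin_bounded[of "ins m n"] fin_nat trans_omega unfolding trans_def by auto
    then show "EX n:el om. el (ins z y) <= el (img n (app f))"
     using n by (intro bexI[of _ k]) (simp_all add: el_img[OF da], blast)
   qed
  qed
  then show "y:el (vUN om (%n. pw (img n (app f))))" using y by (auto simp: el_vUN[OF di])
 qed
 ultimately show ?thesis using lep_trans[OF lep_subset] by blast
qed

end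

section \<open>Ground model elements in the extension\<close>

sublocale forcing \<subseteq> N: zfc EN
 by (rule zfc_EN)

context forcing
begin

definition i :: "nat => nat" where "i x = val (ck x)"

lemma N_elts_val: "N.el (val x) = val ` {u. nE u x}"
proof -
 have "EN z (val x) <-> z:val ` {u. nE u x}" for z
 proof -
  obtain u where "z = val u" using val(1) by (metis surjD)
  then show ?thesis using EN_val val(2) nE_cong nQ_refl nQ_sym by blast
 qed
 then show ?thesis unfolding N.el_def by blast
qed

lemma N_elts_i [simp]: "N.el (i x) = i ` el x"
proof -
 have "nE u (ck x) <-> (EX y:el x. val u = val (ck y))" for u unfolding nE_ck val(2) ..
 then show ?thesis unfolding i_def N_elts_val image_def by blast
qed

lemma i_inject [simp]: "i x = i y <-> x = y"
 unfolding i_def val(2) nQ_ck ..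

lemma i_dbl: "i (dbl x y) = N.dbl (i x) (i y)"
 by (rule N.el_ext) simp

lemma i_pr: "i (pr x y) = N.pr (i x) (i y)"
 unfolding pr_def N.pr_def i_dbl ..

lemma i_zero: "i zero = N.zero"
 by (rule N.el_ext) simp

lemma i_ins: "i (ins x y) = N.ins (i x) (i y)"
 by (rule N.el_ext) simp

lemma i_succ: "i (succ x) = N.succ (i x)"
 unfolding succ_def N.succ_def i_ins ..

lemma i_times: "i (times x y) = N.times (i x) (i y)"
proof (rule N.el_ext, intro equalityI subsetI)
 fix z assume "z:N.el (i (times x y))"
 then obtain a b where "z = i (pr a b)" "a:el x" "b:el y" by auto
 then show "z:N.el (N.times (i x) (i y))" unfolding N.el_times N_elts_i i_pr by blast
next
 fix z assume "z:N.el (N.times (i x) (i y))"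
 then obtain a b where "z = N.pr (i a) (i b)" "a:el x" "b:el y" by auto
 then have "z = i (pr a b)" "pr a b:el (times x y)" by (auto simp: i_pr)
 then show "z:N.el (i (times x y))" by simp
qed

lemma i_Ord: "Ord x ==> N.Ord (i x)"
proof -
 have "trans t ==> N.trans (i t)" for t unfolding trans_def N.trans_def by (simp add: image_mono)
 then show "Ord x ==> N.Ord (i x)" unfolding Ord_def N.Ord_def by simp
qed

text \<open>Forcing adds no natural numbers: Foundation in the extension would give a minimal
  element of \<open>i om\<close> outside the \<open>om\<close> of the extension, and it could be
  neither zero nor a successor.\<close>

lemma i_omega: "i om = N.om"
proof (rule N.el_ext)
 have "N.ind (i om)" unfolding N.ind_def by (auto simp flip: i_succ i_zero)
 then have "N.el N.om <= N.el (i om)" unfolding N.el_omega by blast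
 moreover have "N.el (i om) <= N.el N.om"
 proof (rule ccontr)
  assume "~ ?thesis"
  then have "N.el (N.vmin (i om) N.om) ~= {}" by auto
  then obtain y where y: "y:N.el (i om)" "y~:N.el N.om"
   "N.el (N.vmin (i om) N.om) Int N.el y = {}" using N.foundation by (metis DiffE N.el_vmin)
  then obtain n where n: "y = i n" "n:el om" by auto
  then consider "n = zero" | m where "m:el om" "n = succ m" using nat_cases by blast
  then show False
  proof cases
   case 1
   then show ?thesis using y n i_zero by simp
  next
   case 2
   then have "i m:N.el N.om" using y(3) n by auto
   then show ?thesis using 2 y(2) n by (simp add: i_succ)
  qed
 qed
 ultimately show "N.el (i om) = N.el N.om" by blast
qed

lemma N_omega: "N.el N.om = i ` el om"
 by (simp flip: i_omega)

lemma i_app: "dff (%e. F (e 0)) ==> x:el a ==> N.app (i (lam a F)) (i x) = i (F x)"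
proof (rule N.app_eq)
 fix z assume F: "dff (%e. F (e 0))" and x: "x:el a"
 show "N.pr (i x) z:N.el (i (lam a F)) <-> z = i (F x)"
 proof
  assume "N.pr (i x) z:N.el (i (lam a F))"
  then obtain u where "N.pr (i x) z = i (pr u (F u))" by (auto simp: el_lam[OF F])
  then show "z = i (F x)" by (simp add: i_pr)
 next
  assume z: "z = i (F x)"
  have "pr x (F x):el (lam a F)" using x by (auto simp: el_lam[OF F])
  then show "N.pr (i x) z:N.el (i (lam a F))" unfolding z i_pr[symmetric] N_elts_i by (rule imageI)
 qed
qed

lemma i_lep: "lep x y ==> N.lep (i x) (i y)"
proof -
 assume "lep x y"
 then obtain f where f: "inj_fun f x y" unfolding lep_def by blast
 have d: "dff (%e. app f (e 0))" by (intro dfn)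
 have "N.inj_fun (i (lam x (app f))) (i x) (i y)"
  using f unfolding inj_fun_def N.inj_fun_def by (auto simp: i_app[OF d])
 then show ?thesis unfolding N.lep_def by blast
qed

lemma i_fin: "fin x ==> N.fin (i x)"
proof -
 assume "fin x"
 then obtain n f where n: "n:el om" "!!y. y:el x <-> (EX m:el n. y = app f m)" unfolding fin_def by blast
 have d: "dff (%e. app f (e 0))" by (intro dfn)
 have "ALL y. y:N.el (i x) <-> (EX m:N.el (i n). y = N.app (i (lam n (app f))) m)"
  using n(2) by (auto simp: i_app[OF d])
 then show ?thesis unfolding N.fin_def using n(1) N_omega by blast
qed

lemma N_Fin: "N.el (N.Fin (i x)) = i ` el (Fin x)"
proof (intro equalityI subsetI)
 fix y assume "y:N.el (N.Fin (i x))"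
 then have y: "N.fin y" "N.el y <= N.el (i x)" by auto
 from y(1) have "N.el y <= N.el (i x) --> y:N.el (i (Fin x))"
 proof (induction rule: N.fin_induct)
  case df show ?case by (intro N.dfn)
 next
  case zero
  show ?case by (auto simp flip: i_zero intro!: imageI)
 next
  case (ins y z)
  show ?case
  proof
   assume "N.el (N.ins z y) <= N.el (i x)"
   then obtain u w where "z = i u" "u:el x" "y = i w" "w:el (Fin x)" using ins.IH by auto
   then show "N.ins z y:N.el (i (Fin x))" by (auto simp flip: i_ins intro!: imageI)
  qed
 qed
 then show "y:i ` el (Fin x)" using y by simp
next
 fix y assume "y:i ` el (Fin x)"
 then obtain u where "y = i u" "fin u" "el u <= el x" by auto
 then show "y:N.el (N.Fin (i x))" using i_fin by (simp add: image_mono)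
qed

lemma i_Fin: "i (Fin x) = N.Fin (i x)"
 by (rule N.el_ext) (simp only: N_elts_i N_Fin)

text \<open>The filter as an element of the extension, by the name that attaches to each
  \<open>ck p\<close> the condition \<open>p\<close> itself.\<close>

definition gN :: nat where
 "gN = val (set {z. z:el (times (img P ck) P) & (EX p. z = pr (ck p) p)})"

lemma N_elts_gN: "N.el gN = i ` G"
proof -
 have d: "dff (%e. ck (e 0))" by (intro dfn)
 have "el (set {z. z:el (times (img P ck) P) & (EX p. z = pr (ck p) p)}) = {z:el (times (img P ck) P). EX p. z = pr (ck p) p}"
  by (rule el_sep) (intro dfn)
 then have e: "el (set {z. z:el (times (img P ck) P) & (EX p. z = pr (ck p) p)}) = {pr (ck p) p |p. p:el P}"
  by (auto simp: el_img[OF d])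
 have "nE u (set {z. z:el (times (img P ck) P) & (EX p. z = pr (ck p) p)}) <-> (EX p:G. nQ u (ck p))" for u
  unfolding nE_iff e using G_mem by auto
 then show ?thesis unfolding gN_def N_elts_val i_def using val(2) nQ_refl by (auto simp: image_iff) blast
qed

text \<open>All elements of \<open>X\<close> have canonical names, so the conditions forcing them
  into \<open>X\<close> can be recorded in the ground model as a set \<open>Q\<close>.\<close>

lemma ground_name:
 assumes "N.el X <= i ` el C"
 obtains Q where "el Q <= el (times C P)"
  "!!c. c:el C ==> i c:N.el X <-> (EX p:G. pr c p:el Q)"
  "!!c p r. pr c p:el Q ==> r << p ==> pr c r:el Q"
proof -
 obtain x where x: "X = val x" using val(1) by (metis surjD)
 obtain Q where Q: "el Q = {z:el (times C P). EX c p. z = pr c p & MEM p (ck c) x}" by (erule sep_ex) (intro dfn)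
 show ?thesis
 proof (rule that[of Q])
  show "el Q <= el (times C P)" unfolding Q by blast
  show "i c:N.el X <-> (EX p:G. pr c p:el Q)" if "c:el C" for c
  proof -
   have "i c:N.el X <-> nE (ck c) x"
   proof
    assume "i c:N.el X"
    then obtain u where "val (ck c) = val u" "nE u x" unfolding x N_elts_val i_def by blast
    then show "nE (ck c) x" using val(2) nE_cong[OF nQ_sym nQ_refl] by blast
   qed (auto simp: x N_elts_val i_def)
   then show ?thesis unfolding nE_def Q using that G_mem by auto
  qed
  show "pr c r:el Q" if "pr c p:el Q" "r << p" for c p r
   using that MEM_mono leq_P unfolding Q by auto
 qed
qed

text \<open>In the presence of the countable chain condition, functions of the extension are covered by
 countable-valued functions of the ground model.\<close>

lemma covering:
 assumes ccc: "!!A. el A <= el P ==> (!!p q. p:el A ==> q:el A ==> p ~= q ==> ~ (EX r. r << p & r << q)) ==> cnt A"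
  and g: "!!c. c:el C ==> N.app g (i c):i ` el D"
 obtains h where "!!c. c:el C ==> cnt (app h c) & el (app h c) <= el D & N.app g (i c):i ` el (app h c)"
proof -
 define X where "X = N.set {z. z:N.el (i (times C D)) & (EX c d. z = N.pr c d & N.app g c = d)}"
 have X: "N.el X = {z:N.el (i (times C D)). EX c d. z = N.pr c d & N.app g c = d}"
  unfolding X_def by (rule N.el_sep) (intro N.dfn)
 have "N.el X <= i ` el (times C D)" unfolding X by auto
 from ground_name[OF this] obtain Q where Q: "el Q <= el (times (times C D) P)"
  "!!c. c:el (times C D) ==> i c:N.el X <-> (EX p:G. pr c p:el Q)"
  "!!c p r. pr c p:el Q ==> r << p ==> pr c r:el Q" by blast
 have QG: "N.app g (i c) = i d" if "pr (pr c d) p:el Q" "p:G" for c d p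
 proof -
  have cd: "pr c d:el (times C D)" using that(1) Q(1) by auto
  then have "i (pr c d):N.el X" using Q(2)[OF cd] that by blast
  then show ?thesis unfolding X i_pr by auto
 qed
 \<comment> \<open>\<open>p\<close> puts the pair into the graph, and no extension of
   \<open>p\<close> allows another value. Such conditions are incompatible for different
   \<open>d\<close>, so by the chain condition there are only countably many \<open>d\<close> for
   each \<open>c\<close>.\<close>
 define W where "W c d p <-> pr (pr c d) p:el Q & ~ (EX r d'. r << p & d' ~= d & pr (pr c d') r:el Q)" for c d p
 have dW: "dff s ==> dff t ==> dff u ==> dfn (%e. W (s e) (t e) (u e))" for s t u
  by (rule dfn_rel3) (unfold W_def, intro dfn)
 define H where "H c = set {d. d:el D & (EX p:el P. W c d p)}" for c
 have H: "el (H c) = {d:el D. EX p:el P. W c d p}" for c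
  unfolding H_def by (rule el_sep) (intro dfn dW)
 have dH: "dff (%e. H (e 0))" unfolding H_def by (intro dfn dW)
 have cH: "cnt (H c)" for c
 proof -
  define S where "S d = set {p. p:el P & W c d p}" for d
  have S: "el (S d) = {p:el P. W c d p}" for d unfolding S_def by (rule el_sep) (intro dfn dW)
  have dS: "dff (%e. S (e 0))" unfolding S_def by (intro dfn dW)
  obtain f where f: "!!y. y:el (img (H c) S) ==> el y ~= {} ==> app f y:el y" using choice_fun by blast
  have fS: "app f (S d):el P" "W c d (app f (S d))" if "d:el (H c)" for d
   using f[of "S d"] that unfolding el_img[OF dS] H S by blast+
  have inc: "d = d'" if "d:el (H c)" "d':el (H c)" "r << app f (S d)" "r << app f (S d')" for d d' r
   using fS[OF that(1)] fS[OF that(2)] that(3,4) Q(3) unfolding W_def by blast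
  have dF: "dff (%e. app f (S (e 0)))" by (intro dfn dS)
  have A: "el (img (H c) (%d. app f (S d))) = (%d. app f (S d)) ` el (H c)" by (rule el_img[OF dF])
  have "cnt (img (H c) (%d. app f (S d)))"
   by (rule ccc) (use fS(1) inc in \<open>unfold A, blast+\<close>)
  moreover have "lep (H c) (img (H c) (%d. app f (S d)))"
  proof (rule lepI[OF dF])
   show "d = d'" if "d:el (H c)" "d':el (H c)" "app f (S d) = app f (S d')" for d d'
    using inc[OF that(1,2) le_refl[OF fS(1)[OF that(1)]]] le_refl[OF fS(1)[OF that(1)]] that(3) by simp
  qed (use A in blast)
  ultimately show ?thesis using lep_trans by blast
 qed
 show ?thesis
 proof (rule that[of "lam C H"])
  fix c assume c: "c:el C"
  obtain d where d: "d:el D" "N.app g (i c) = i d" using g[OF c] by auto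
  have "pr c d:el (times C D)" using c d by auto
  moreover have "i (pr c d):N.el X"
  proof -
   have "i (pr c d) = N.pr (i c) (i d)" by (rule i_pr)
   moreover have "i (pr c d):N.el (i (times C D))" using c d by auto
   ultimately show ?thesis unfolding X using d(2) by blast
  qed
  ultimately obtain p where p: "p:G" "pr (pr c d) p:el Q" using Q(2) by blast
  \<comment> \<open>Densely often, either another value is allowed by \<open>s\<close> itself or by
    no extension of \<open>s\<close>; in the filter only the second can occur.\<close>
  let ?D = "%s. (EX d'. d' ~= d & pr (pr c d') s:el Q) | ~ (EX r d'. r << s & d' ~= d & pr (pr c d') r:el Q)"
  have "EX s:G. s << p & ?D s"
  proof (rule generic[OF _ p(1)])
   show "EX s. s << r & ?D s" if "r << p" for r
    using le_refl leq_P that by (cases "EX s d'. s << r & d' ~= d & pr (pr c d') s:el Q") blast+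
  qed (intro dfn)
  then obtain s where s: "s:G" "s << p" "?D s" by blast
  have "~ (EX d'. d' ~= d & pr (pr c d') s:el Q)" using QG s(1) d(2) by (metis i_inject)
  then have "W c d s" unfolding W_def using s Q(3)[OF p(2) s(2)] by blast
  then have "d:el (H c)" unfolding H using d(1) G_mem s(1) by blast
  then show "cnt (app (lam C H) c) & el (app (lam C H) c) <= el D & N.app g (i c):i ` el (app (lam C H) c)"
   unfolding app_lam[OF dH c] using cH H d(2) by blast
 qed
qed

end

section \<open>The forcing notion\<close>

context zfc
begin

definition "om1 = (SOME k. Ord k & ~ cnt k & (ALL a:el k. cnt a))"

lemma om1: "Ord om1" "~ cnt om1" "a:el om1 ==> cnt a"
 using someI_ex[OF ex_omega1] unfolding om1_def by blast+

definition "JJ = times (dbl zero zero) om1"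
text \<open>The tags \<open>zero\<close> and \<open>succ zero\<close> keep the two kinds of indices
  apart. If the extension could map all indices injectively into \<open>times om1 om\<close>, the
  ground model would have an injection of this power set into
  \<open>times (times om1 om) om\<close>; the underlying set is chosen so that this contradicts
  Cantor's theorem.\<close>

definition "II = times (dbl (succ zero) (succ zero)) (pw (times (times om1 om) om))"
definition "LL = un JJ II"

abbreviation pn :: "'m => 'm" where "pn p \<equiv> vfst p"
abbreviation pF :: "'m => 'm" where "pF p \<equiv> vfst (vsnd p)"
abbreviation pa :: "'m => 'm" where "pa p \<equiv> vsnd (vsnd p)"

text \<open>A condition \<open>(n, F, a)\<close> describes the sets with indices in the finite set \<open>F\<close> below \<open>n\<close>. Sets with
 different indices in \<open>JJ\<close> have to be almost disjoint: those in \<open>F\<close> get no common elements beyond \<open>n\<close>.\<close>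

definition "PP = set {p. p:el (times om (times (Fin LL) (pw (times LL om)))) & el (pa p) <= el (times (pF p) (pn p))}"

definition "pext q p <-> el (pn p) <= el (pn q) & el (pF p) <= el (pF q) &
  (ALL b:el (pF p). ALL k:el (pn p). pr b k:el (pa q) <-> pr b k:el (pa p)) &
  (ALL b:el (pF p). ALL c:el (pF p). b:el JJ --> c:el JJ --> b ~= c -->
   (ALL k. pr b k:el (pa q) --> pr c k:el (pa q) --> k:el (pn p)))"

definition "LE = set {z. z:el (times PP PP) & (EX q p. z = pr q p & pext q p)}"

lemma [dfn]: "dff s ==> dff t ==> dfn (%e. pext (s e) (t e))"
 by (rule dfn_rel2) (unfold pext_def, intro dfn)

lemma PP_iff: "p:el PP <-> (EX n F a. p = pr n (pr F a) & n:el om & fin F & el F <= el LL & el a <= el (times F n))"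
proof -
 have e: "el PP = {p:el (times om (times (Fin LL) (pw (times LL om)))). el (pa p) <= el (times (pF p) (pn p))}"
  unfolding PP_def by (rule el_sep) (intro dfn)
 have "el a <= el (times LL om)" if "el a <= el (times F n)" "n:el om" "el F <= el LL" for a F n
 proof -
  have "el (times F n) <= el (times LL om)" using that(2,3) nat_in_omega by auto
  then show ?thesis using that(1) by blast
 qed
 then show ?thesis unfolding e by auto
qed

lemma PP_D: "p:el PP ==> pn p:el om" "p:el PP ==> fin (pF p)" "p:el PP ==> el (pF p) <= el LL"
 "p:el PP ==> pr b k:el (pa p) ==> b:el (pF p) & k:el (pn p)"
 "p:el PP ==> pr (pn p) (pr (pF p) (pa p)) = p" "p:el PP ==> z:el (pa p) ==> EX b k. z = pr b k"
 unfolding PP_iff by auto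

lemma PP_I: "n:el om ==> fin F ==> el F <= el LL ==> el a <= el (times F n) ==> pr n (pr F a):el PP"
 unfolding PP_iff by blast

abbreviation ple (infix "<|" 50) where "q <| p \<equiv> lq PP LE q p"

lemma ple_iff: "q <| p <-> q:el PP & p:el PP & pext q p"
proof -
 have "el LE = {z:el (times PP PP). EX q p. z = pr q p & pext q p}"
  unfolding LE_def by (rule el_sep) (intro dfn)
 then show ?thesis unfolding lq_def by auto
qed

lemma ple_refl: "p:el PP ==> p <| p"
 unfolding ple_iff pext_def using PP_D(4) by blast

lemma ple_trans: "r <| q ==> q <| p ==> r <| p"
proof -
 assume "r <| q" "q <| p"
 then have P: "r:el PP" "p:el PP" and r: "pext r q" and q: "pext q p" unfolding ple_iff by blast+
 note q' = q[unfolded pext_def] and r' = r[unfolded pext_def]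
 note sub = q'[THEN conjunct1] q'[THEN conjunct2, THEN conjunct1] r'[THEN conjunct1] r'[THEN conjunct2, THEN conjunct1]
 have 1: "pr b k:el (pa r) <-> pr b k:el (pa p)" if "b:el (pF p)" "k:el (pn p)" for b k
  using that r q sub unfolding pext_def by blast
 have 2: "k:el (pn p)" if h: "b:el (pF p)" "c:el (pF p)" "b:el JJ" "c:el JJ" "b ~= c"
  "pr b k:el (pa r)" "pr c k:el (pa r)" for b c k
 proof -
  have F: "b:el (pF q)" "c:el (pF q)" using h sub by blast+
  have "k:el (pn q)" using r F h unfolding pext_def by blast
  then have "pr b k:el (pa q)" "pr c k:el (pa q)" using r F h unfolding pext_def by blast+
  then show ?thesis using q h unfolding pext_def by blast
 qed
 show "r <| p" unfolding ple_iff pext_def using P sub 1 2 by blast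
qed

section \<open>The countable chain condition\<close>

lemma agree_compat:
 assumes p: "p:el PP" "q:el PP" "pn p = pn q"
  and ag: "!!b k. b:el (pF p) ==> b:el (pF q) ==> pr b k:el (pa p) <-> pr b k:el (pa q)"
 shows "EX r. r <| p & r <| q"
proof -
 \<comment> \<open>The union of the two conditions has no element beyond the common length, so
   almost disjointness cannot be violated.\<close>
 define r where "r = pr (pn p) (pr (un (pF p) (pF q)) (un (pa p) (pa q)))"
 have s: "el (pa p) <= el (times (pF p) (pn p))" "el (pa q) <= el (times (pF q) (pn p))"
  using p unfolding PP_iff by auto
 have "r:el PP" unfolding r_def
 proof (rule PP_I)
  show "fin (un (pF p) (pF q))" using p PP_D(2) fin_un by blast
  show "el (un (pF p) (pF q)) <= el LL" using p(1,2) PP_D(3) by simp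
  show "el (un (pa p) (pa q)) <= el (times (un (pF p) (pF q)) (pn p))" using s p(3) by auto
 qed (use p PP_D(1) in blast)
 have r: "pn r = pn p" "pF r = un (pF p) (pF q)" "el (pa r) = el (pa p) Un el (pa q)" by (simp_all add: r_def)
 have "pr b k:el (pa r) <-> pr b k:el (pa p)" if "b:el (pF p)" for b k
  using that ag PP_D(4)[OF p(2)] unfolding r by blast
 then have "pext r p" unfolding pext_def using PP_D(4)[OF p(1)] r(1,2) by auto
 have "pr b k:el (pa r) <-> pr b k:el (pa q)" if "b:el (pF q)" for b k
  using that ag PP_D(4)[OF p(1)] unfolding r by blast
 then have "pext r q" unfolding pext_def using PP_D(4)[OF p(2)] p(3) r(1,2) by auto
 note \<open>r:el PP\<close> \<open>pext r p\<close> \<open>pext r q\<close>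
 then show ?thesis unfolding ple_iff using p by blast
qed

lemma lep_remove: "lep x (succ k) ==> b:el x ==> lep (vmin x (dbl b b)) k"
proof -
 assume "lep x (succ k)" and b: "b:el x"
 then obtain f where f: "!!u. u:el x ==> app f u:el (succ k)"
  "!!u v. u:el x ==> v:el x ==> app f u = app f v ==> u = v" unfolding lep_def inj_fun_def by blast
 show ?thesis
 proof (rule lepI[of "%u. if app f u = k then app f b else app f u"])
  show "(if app f u = k then app f b else app f u):el k" if "u:el (vmin x (dbl b b))" for u
   using f(1)[of u] f(1)[OF b] f(2)[of u b] that b by auto
  show "u = v" if "u:el (vmin x (dbl b b))" "v:el (vmin x (dbl b b))"
   "(if app f u = k then app f b else app f u) = (if app f v = k then app f b else app f v)" for u v
   using f(2)[of u v] f(2)[of u b] f(2)[of v b] that b by (auto split: if_splits)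
 qed (intro dfn)
qed

text \<open>Takes the place of the Delta-system lemma. Two members of \<open>A\<close> always differ
  at a common index outside \<open>B\<close>, and \<open>k\<close> bounds the number of indices
  outside \<open>B\<close>. Fix \<open>p\<close> in \<open>A\<close>: every other \<open>q\<close>
  shares with \<open>p\<close> one of finitely many indices \<open>b\<close> outside
  \<open>B\<close> and has there one of finitely many traces on \<open>n\<close>. Members with the
  same \<open>b\<close> and the same trace differ elsewhere, so \<open>b\<close> can be moved into
  \<open>B\<close>, which lowers \<open>k\<close>.\<close>

lemma ccc_bounded:
 assumes n: "n:el om" and k: "k:el om"
 shows "ALL A B. (ALL p:el A. p:el PP & pn p = n & lep (vmin (pF p) B) k) &
  (ALL p:el A. ALL q:el A. p ~= q --> (EX b:el (pF p). b:el (pF q) & b~:el B &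
   (EX m. ~ (pr b m:el (pa p) <-> pr b m:el (pa q))))) --> cnt A"
 using k
proof (induction rule: om_induct)
 case df show ?case by (intro dfn)
next
 case zero
 show ?case
 proof (intro allI impI, elim conjE)
  fix A B assume A: "ALL p:el A. p:el PP & pn p = n & lep (vmin (pF p) B) zero"
   "ALL p:el A. ALL q:el A. p ~= q --> (EX b:el (pF p). b:el (pF q) & b~:el B &
    (EX m. ~ (pr b m:el (pa p) <-> pr b m:el (pa q))))"
  have "b:el B" if "p:el A" "b:el (pF p)" for p b
   using A(1) that unfolding lep_def inj_fun_def by auto
  then have one: "p = q" if "p:el A" "q:el A" for p q using A(2) that by blast
  show "cnt A" by (rule lepI[of "%_. zero"]) (intro dfn, use one in auto)
 qed
next
 case (succ k)
 show ?case
 proof (intro allI impI, elim conjE)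
  fix A B assume A: "ALL p:el A. p:el PP & pn p = n & lep (vmin (pF p) B) (succ k)"
   "ALL p:el A. ALL q:el A. p ~= q --> (EX b:el (pF p). b:el (pF q) & b~:el B &
    (EX m. ~ (pr b m:el (pa p) <-> pr b m:el (pa q))))"
  show "cnt A"
  proof (cases "el A = {}")
   case True
   then show ?thesis by (intro lep_subset) simp
  next
   case False
   then obtain p where p: "p:el A" by blast
   define T where "T z = set {q. q:el A & vfst z:el (pF q) & vfst z~:el B &
    (ALL m. pr (vfst z) m:el (pa q) <-> m:el (vsnd z))}" for z
   have T: "el (T z) = {q:el A. vfst z:el (pF q) & vfst z~:el B &
    (ALL m. pr (vfst z) m:el (pa q) <-> m:el (vsnd z))}" for z
    unfolding T_def by (rule el_sep) (intro dfn)
   have dT: "dff (%e. T (e 0))" unfolding T_def by (intro dfn)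
   have cT: "cnt (T z)" for z
   proof -
    have "(ALL q:el (T z). q:el PP & pn q = n & lep (vmin (pF q) (ins (vfst z) B)) k) &
     (ALL q:el (T z). ALL q':el (T z). q ~= q' --> (EX b:el (pF q). b:el (pF q') & b~:el (ins (vfst z) B) &
      (EX m. ~ (pr b m:el (pa q) <-> pr b m:el (pa q')))))"
    proof (intro conjI ballI impI)
     fix q assume q: "q:el (T z)"
     then have "lep (vmin (pF q) B) (succ k)" "vfst z:el (vmin (pF q) B)" using A(1) unfolding T by auto
     then have "lep (vmin (vmin (pF q) B) (dbl (vfst z) (vfst z))) k" by (rule lep_remove)
     moreover have "vmin (vmin (pF q) B) (dbl (vfst z) (vfst z)) = vmin (pF q) (ins (vfst z) B)"
      by (rule el_ext) auto
     ultimately show "lep (vmin (pF q) (ins (vfst z) B)) k" by simp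
    next
     fix q q' assume q: "q:el (T z)" "q':el (T z)" "q ~= q'"
     then obtain b m where "b:el (pF q)" "b:el (pF q')" "b~:el B"
      "~ (pr b m:el (pa q) <-> pr b m:el (pa q'))" using A(2) unfolding T by blast
     moreover from this have "b ~= vfst z" using q unfolding T by blast
     ultimately show "EX b:el (pF q). b:el (pF q') & b~:el (ins (vfst z) B) &
      (EX m. ~ (pr b m:el (pa q) <-> pr b m:el (pa q')))" by auto
    qed (use A(1) in \<open>auto simp: T\<close>)
    then show ?thesis using succ.IH by blast
   qed
   have "cnt (vUN (times (pF p) (pw n)) T)"
    using p A(1) PP_D(2) fin_nat[OF n] by (intro cnt_vUN[OF dT] cT cnt_times fin_cnt fin_pw) blast+
   then have "cnt (un (dbl p p) (vUN (times (pF p) (pw n)) T))" by (intro cnt_un fin_cnt[OF fin_dbl])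
   moreover have "el A <= el (un (dbl p p) (vUN (times (pF p) (pw n)) T))"
   proof
    fix q assume q: "q:el A"
    show "q:el (un (dbl p p) (vUN (times (pF p) (pw n)) T))"
    proof (cases "q = p")
     case False
     then obtain b where b: "b:el (pF p)" "b:el (pF q)" "b~:el B" using A(2) p q by metis
     obtain t where t: "el t = {m:el n. pr b m:el (pa q)}" by (erule sep_ex) (intro dfn)
     have "q:el (T (pr b t))" unfolding T using b q t A(1) PP_D(4) by auto
     moreover have "pr b t:el (times (pF p) (pw n))" using b t by auto
     ultimately show ?thesis unfolding el_un el_vUN[OF dT] by blast
    qed simp
   qed
   ultimately show ?thesis using lep_trans lep_subset by blast
  qed
 qed
qed

text \<open>Sorting conditions by their length and by the size of their index set gives countably
  many classes. Incompatible conditions of the same length differ at a common index, by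
  \<open>agree_compat\<close>.\<close>

lemma ccc:
 assumes A: "el A <= el PP" "!!p q. p:el A ==> q:el A ==> p ~= q ==> ~ (EX r. r <| p & r <| q)"
 shows "cnt A"
proof -
 define T where "T z = set {p. p:el A & pn p = vfst z & lep (pF p) (vsnd z)}" for z
 have T: "el (T z) = {p:el A. pn p = vfst z & lep (pF p) (vsnd z)}" for z
  unfolding T_def by (rule el_sep) (intro dfn)
 have dT: "dff (%e. T (e 0))" unfolding T_def by (intro dfn)
 have "cnt (T z)" if z: "z:el (times om om)" for z
 proof -
  obtain n k where nk: "z = pr n k" "n:el om" "k:el om" using z by auto
  have "lep (vmin (pF p) zero) k" if "p:el (T z)" for p
  proof -
   have "lep (vmin (pF p) zero) (pF p)" by (rule lep_subset) simp
   then show ?thesis using that lep_trans unfolding T nk by auto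
  qed
  moreover have "EX b:el (pF p). b:el (pF q) & b~:el zero & (EX m. ~ (pr b m:el (pa p) <-> pr b m:el (pa q)))"
   if "p:el (T z)" "q:el (T z)" "p ~= q" for p q
  proof (rule ccontr)
   assume n: "~ ?thesis"
   have pq: "p:el A" "q:el A" "pn p = pn q" using that unfolding T by auto
   have "EX r. r <| p & r <| q" by (rule agree_compat) (use pq A(1) n in auto)
   then show False using A(2) pq that(3) by blast
  qed
  ultimately show ?thesis
   using ccc_bounded[OF nk(2,3), THEN HOL.spec, THEN HOL.spec, of "T z" zero] A(1) unfolding T nk by auto
 qed
 then have "cnt (vUN (times om om) T)" by (rule cnt_vUN[OF dT cnt_omega_times])
 moreover have "el A <= el (vUN (times om om) T)"
 proof
  fix p assume p: "p:el A"
  then have P: "p:el PP" using A(1) by blast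
  obtain k where "k:el om" "eqp k (pF p)" using fin_eqp_nat PP_D(2)[OF P] by blast
  then have "p:el (T (pr (pn p) k))" "pr (pn p) k:el (times om om)"
   using p PP_D(1)[OF P] eqp_lep eqp_sym unfolding T by auto
  then show "p:el (vUN (times om om) T)" unfolding el_vUN[OF dT] by blast
 qed
 ultimately show ?thesis using lep_trans lep_subset by blast
qed

end

lemma (in zfc) empty_cond: "pr zero (pr zero zero):el PP"
 by (rule PP_I) auto

context zfc
begin

lemma pleI:
 assumes "q:el PP" "p:el PP" "el (pn p) <= el (pn q)" "el (pF p) <= el (pF q)"
  "!!b k. b:el (pF p) ==> k:el (pn p) ==> pr b k:el (pa q) <-> pr b k:el (pa p)"
  "!!b c k. b:el (pF p) ==> c:el (pF p) ==> b:el JJ ==> c:el JJ ==> b ~= c ==>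
   pr b k:el (pa q) ==> pr c k:el (pa q) ==> k:el (pn p)"
 shows "q <| p"
 unfolding ple_iff pext_def using assms by blast

lemma ple_D:
 assumes "q <| p"
 shows "q:el PP" "p:el PP" "el (pn p) <= el (pn q)" "el (pF p) <= el (pF q)"
  "b:el (pF p) ==> k:el (pn p) ==> pr b k:el (pa q) <-> pr b k:el (pa p)"
  "b:el (pF p) ==> c:el (pF p) ==> b:el JJ ==> c:el JJ ==> b ~= c ==>
   pr b k:el (pa q) ==> pr c k:el (pa q) ==> k:el (pn p)"
proof -
 note h = assms[unfolded ple_iff pext_def]
 show "q:el PP" "p:el PP" "el (pn p) <= el (pn q)" "el (pF p) <= el (pF q)" using h by blast+
 show "pr b k:el (pa q) <-> pr b k:el (pa p)" if "b:el (pF p)" "k:el (pn p)" using h that by blast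
 show "k:el (pn p)" if "b:el (pF p)" "c:el (pF p)" "b:el JJ" "c:el JJ" "b ~= c"
  "pr b k:el (pa q)" "pr c k:el (pa q)" using h that by blast
qed

lemma ple_keep: "q <| p ==> pr b k:el (pa p) ==> pr b k:el (pa q)"
 using ple_D(5) PP_D(4) ple_D(2) by blast

end

text \<open>Every set of the model is a number, so step \<open>n\<close> of the descending sequence
  can enter the set coded by \<open>n\<close> whenever this is possible; a dense set
  \<open>D\<close> is met by \<open>f (Suc D)\<close>.\<close>

lemma forcing_exists:
 fixes E :: "nat => nat => bool"
 assumes "zfc E"
 obtains G where "forcing E (zfc.PP E) (zfc.LE E) G"
proof -
 interpret zfc E by fact
 define f where "f = rec_nat (pr zero (pr zero zero)) (%n p. if EX q:el n. q <| p then SOME q. q:el n & q <| p else p)"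
 have f0: "f 0 = pr zero (pr zero zero)" and fS: "f (Suc n) = (if EX q:el n. q <| f n then SOME q. q:el n & q <| f n else f n)" for n
  by (simp_all add: f_def)
 have step: "(EX q:el n. q <| f n) ==> f (Suc n):el n & f (Suc n) <| f n" for n
  unfolding fS using someI_ex[of "%q. q:el n & q <| f n"] by auto
 have P: "f n:el PP" for n
 proof (induction n)
  case (Suc n)
  then show ?case using step[of n] unfolding ple_iff by (cases "EX q:el n. q <| f n") (auto simp: fS ple_iff)
 qed (simp add: f0 empty_cond)
 have d: "f (Suc n) <| f n" for n using step[of n] ple_refl[OF P] by (cases "EX q:el n. q <| f n") (auto simp: fS)
 have dec: "f n <| f m" if "m <= n" for m n
  using that by (induction rule: dec_induct) (use ple_refl P ple_trans d in blast)+
 define G where "G = {p. EX n. f n <| p}"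
 have "forcing E PP LE G"
 proof
  show "p:el PP ==> p <| p" for p by (rule ple_refl)
  show "r <| q ==> q <| p ==> r <| p" for r q p by (rule ple_trans)
  show "G <= el PP" unfolding G_def ple_iff by blast
  show "G ~= {}" unfolding G_def using ple_refl[OF P] by blast
  show "p:G ==> p <| q ==> q:G" for p q unfolding G_def using ple_trans by blast
  show "EX r:G. r <| p & r <| q" if "p:G" "q:G" for p q
  proof -
   obtain m n where mn: "f m <| p" "f n <| q" using \<open>p:G\<close> \<open>q:G\<close> unfolding G_def by blast
   have "f (max m n) <| p" "f (max m n) <| q" using mn dec ple_trans max.cobounded1 max.cobounded2 by blast+
   moreover have "f (max m n):G" unfolding G_def using ple_refl[OF P] by blast
   ultimately show ?thesis by blast
  qed
  show "EX p:G. p:el D" if "!!p. p:el PP ==> EX q:el D. q <| p" for D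
  proof -
   have "f (Suc D):el D" using step[of D] that[OF P] by blast
   then show ?thesis unfolding G_def using ple_refl[OF P] by blast
  qed
 qed
 then show ?thesis by (rule that)
qed

section \<open>The generic sets\<close>

locale ext = forcing E "zfc.PP E" "zfc.LE E" G for E :: "nat => nat => bool" and G
begin

text \<open>Defined inside the extension from the filter, so that it is a definable function of the
  index there.\<close>

definition AN :: "nat => nat" where
 "AN b = N.set {k. k:N.el N.om & (EX p:N.el gN. N.pr b k:N.el (N.vsnd (N.vsnd p)))}"

lemma [N.dfn]: "N.dff s ==> N.dff (%e. AN (s e))"
 by (rule N.dff_fun1) (unfold AN_def, intro N.dfn)

lemma el_AN: "N.el (AN b) = {k:N.el N.om. EX p:N.el gN. N.pr b k:N.el (N.vsnd (N.vsnd p))}"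
 unfolding AN_def by (rule N.el_sep) (intro N.dfn)

lemma [simp]: "i x:i ` A <-> x:A"
 by (auto simp: image_iff)

lemma AN_iff: "i k:N.el (AN (i b)) <-> (EX p:G. pr b k:el (pa p))"
proof -
 have "N.pr (i b) (i k):N.el (N.vsnd (N.vsnd (i p))) <-> pr b k:el (pa p)" if "p:G" for p
 proof -
  have "i p = N.pr (i (pn p)) (N.pr (i (pF p)) (i (pa p)))"
   using PP_D(5)[OF G_mem[OF that]] by (metis i_pr)
  then have "N.vsnd (N.vsnd (i p)) = i (pa p)" by (metis N.vsnd_pr)
  then show ?thesis by (simp flip: i_pr)
 qed
 moreover have "k:el om" if "p:G" "pr b k:el (pa p)" for p
  using PP_D(1,4)[OF G_mem[OF that(1)]] that(2) nat_in_omega by blast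
 ultimately show ?thesis unfolding el_AN N_elts_gN N_omega by auto
qed

lemma AN_dec: "p:G ==> b:el (pF p) ==> k:el (pn p) ==> i k:N.el (AN (i b)) <-> pr b k:el (pa p)"
proof
 assume h: "p:G" "b:el (pF p)" "k:el (pn p)" "i k:N.el (AN (i b))"
 then obtain q where q: "q:G" "pr b k:el (pa q)" unfolding AN_iff by blast
 then obtain r where "r <| p" "r <| q" using G_dir h(1) by blast
 then show "pr b k:el (pa p)" using ple_D(5)[OF \<open>r <| p\<close> h(2,3)] ple_keep q(2) by blast
qed (use AN_iff in blast)

lemma AN_ad: "p:G ==> b:el (pF p) ==> c:el (pF p) ==> b:el JJ ==> c:el JJ ==> b ~= c ==>
 i k:N.el (AN (i b)) ==> i k:N.el (AN (i c)) ==> k:el (pn p)"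
proof -
 assume h: "p:G" "b:el (pF p)" "c:el (pF p)" "b:el JJ" "c:el JJ" "b ~= c"
  "i k:N.el (AN (i b))" "i k:N.el (AN (i c))"
 obtain q r where q: "q:G" "pr b k:el (pa q)" and r: "r:G" "pr c k:el (pa r)"
  using h(7,8) unfolding AN_iff by blast
 obtain s where s: "s:G" "s <| p" "s <| q" using G_dir h(1) q(1) by blast
 obtain t where t: "t:G" "t <| s" "t <| r" using G_dir s(1) r(1) by blast
 have u: "t <| p" "t <| q" using t s ple_trans by blast+
 have "pr b k:el (pa t)" "pr c k:el (pa t)" using ple_keep[OF u(2) q(2)] ple_keep[OF t(3) r(2)] .
 then show ?thesis using ple_D(6)[OF u(1) h(2-6)] by blast
qed

text \<open>New indices get the empty set and the additional length gets no elements, so almost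
  disjointness is not endangered.\<close>

lemma extend:
 assumes v: "v:el PP" and F: "fin F" "el F <= el LL" and n: "n:el om"
 shows "EX w. w <| v & el F <= el (pF w) & el n <= el (pn w)"
proof -
 have "fin (un n (pn v))" "el (un n (pn v)) <= el om"
  using n PP_D(1)[OF v] fin_un fin_nat nat_in_omega by auto
 then obtain m where m: "m:el om" "el (un n (pn v)) <= el m" using fin_bounded by blast
 define w where "w = pr m (pr (un F (pF v)) (pa v))"
 have a: "el (pa v) <= el (times (pF v) (pn v))" using v unfolding PP_iff by auto
 have "w:el PP" unfolding w_def
 proof (rule PP_I[OF m(1)])
  show "fin (un F (pF v))" using F PP_D(2)[OF v] fin_un by blast
  show "el (un F (pF v)) <= el LL" using F PP_D(3)[OF v] by simp
  have "el (times (pF v) (pn v)) <= el (times (un F (pF v)) m)" using m(2) by auto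
  then show "el (pa v) <= el (times (un F (pF v)) m)" using a by blast
 qed
 moreover have "pext w v" unfolding pext_def w_def using m(2) PP_D(4)[OF v] by auto
 ultimately show ?thesis unfolding ple_iff using v m(2) by (intro exI[of _ w]) (auto simp: w_def)
qed

lemma G_extend:
 assumes v: "v:G" and F: "fin F" "el F <= el LL" and n: "n:el om"
 shows "EX w:G. w <| v & el F <= el (pF w) & el n <= el (pn w)"
proof (rule generic[OF _ v])
 show "EX s. s <| r & el F <= el (pF s) & el n <= el (pn s)" if "r <| v" for r
  using extend[OF _ F n, of r] that unfolding ple_iff by blast
qed (intro dfn)

lemma N_AD:
 assumes "b:el JJ" "c:el JJ" "b ~= c"
 shows "EX n:el om. ALL k. i k:N.el (AN (i b)) --> i k:N.el (AN (i c)) --> k:el n"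
proof -
 obtain v where v: "v:G" using G_ne by blast
 have "el (dbl b c) <= el LL" using assms by (auto simp: LL_def)
 from G_extend[OF v fin_dbl this zero_omega] obtain w where w: "w:G" "el (dbl b c) <= el (pF w)" by blast
 then show ?thesis using AN_ad[OF w(1)] assms PP_D(1)[OF G_mem[OF w(1)]] by (intro bexI[of _ "pn w"]) auto
qed

section \<open>Genericity of all but countably many of the sets\<close>

definition prj :: "nat => nat => nat" where
 "prj S v = pr (pn v) (pr (vint (pF v) S) (set {z. z:el (pa v) & vfst z:el S}))"

lemma [dfn]: "dff s ==> dff t ==> dff (%e. prj (s e) (t e))"
 by (rule dff_fun2) (unfold prj_def, intro dfn)

lemma prj_simps: "pn (prj S v) = pn v" "pF (prj S v) = vint (pF v) S"
 "pr b k:el (pa (prj S v)) <-> pr b k:el (pa v) & b:el S"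
proof -
 have "el (set {z. z:el (pa v) & vfst z:el S}) = {z:el (pa v). vfst z:el S}"
  by (rule el_sep) (intro dfn)
 then show "pn (prj S v) = pn v" "pF (prj S v) = vint (pF v) S"
  "pr b k:el (pa (prj S v)) <-> pr b k:el (pa v) & b:el S" by (auto simp: prj_def)
qed

lemma prj_PP: "v:el PP ==> prj S v:el PP"
proof -
 assume v: "v:el PP"
 have a: "el (set {z. z:el (pa v) & vfst z:el S}) = {z:el (pa v). vfst z:el S}"
  by (rule el_sep) (intro dfn)
 have "el (pa v) <= el (times (pF v) (pn v))" using v unfolding PP_iff by auto
 then show ?thesis unfolding prj_def
  by (intro PP_I PP_D(1)[OF v] fin_subset[OF PP_D(2)[OF v]]) (use a PP_D(3)[OF v] in auto)
qed

lemma prj_mono: "v <| w ==> prj S v <| prj S w"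
proof -
 assume h: "v <| w"
 show ?thesis
 proof (rule pleI, unfold prj_simps)
  show "prj S v:el PP" "prj S w:el PP" using prj_PP ple_D(1,2)[OF h] by blast+
  show "el (pn w) <= el (pn v)" by (rule ple_D(3)[OF h])
  show "el (vint (pF w) S) <= el (vint (pF v) S)" using ple_D(4)[OF h] by auto
  show "(pr b k:el (pa v) & b:el S) = (pr b k:el (pa w) & b:el S)" if "b:el (vint (pF w) S)" "k:el (pn w)" for b k
   using ple_D(5)[OF h, of b k] that by simp
  show "k:el (pn w)" if "b:el (vint (pF w) S)" "c:el (vint (pF w) S)" "b:el JJ" "c:el JJ" "b ~= c"
   "pr b k:el (pa v) & b:el S" "pr c k:el (pa v) & c:el S" for b c k
   using ple_D(6)[OF h, of b c k] that by simp
 qed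
qed

lemma prj_below: "v <| p ==> el (pF p) <= el S ==> prj S v <| p"
proof -
 assume h: "v <| p" and S: "el (pF p) <= el S"
 show ?thesis
 proof (rule pleI, unfold prj_simps)
  show "prj S v:el PP" "p:el PP" using prj_PP ple_D(1,2)[OF h] by blast+
  show "el (pn p) <= el (pn v)" by (rule ple_D(3)[OF h])
  show "el (pF p) <= el (vint (pF v) S)" using ple_D(4)[OF h] S by auto
  show "(pr b k:el (pa v) & b:el S) = (pr b k:el (pa p))" if "b:el (pF p)" "k:el (pn p)" for b k
   using ple_D(5)[OF h that] S that by blast
  show "k:el (pn p)" if "b:el (pF p)" "c:el (pF p)" "b:el JJ" "c:el JJ" "b ~= c"
   "pr b k:el (pa v) & b:el S" "pr c k:el (pa v) & c:el S" for b c k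
   using ple_D(6)[OF h that(1-5)] that(6,7) by blast
 qed
qed

text \<open>A condition \<open>v\<close> and an extension \<open>t\<close> of its restriction to \<open>S\<close> are compatible, and outside \<open>S\<close> the
 slice at one index \<open>c\<close> may be prolonged freely, as long as it avoids the sets in \<open>pF v\<close>.\<close>

lemma amalgam:
 assumes v: "v:el PP" "c:el (pF v)" "c~:el S" and t: "el (pF t) <= el S" "t <| prj S v"
  and m: "el s <= el m" "el m <= el (pn t)"
  and sc: "!!k. k:el (pn v) ==> pr c k:el (pa v) <-> k:el s"
  and av: "!!b k. b:el (pF v) ==> b:el S ==> b:el JJ ==> c:el JJ ==> k:el s ==> k~:el (pn v) ==> pr b k~:el (pa t)"
 shows "EX u. u <| v & u <| t & pn u = pn t & el (pF u) = el (pF v) Un el (pF t) &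
  (ALL k. pr c k:el (pa u) <-> k:el s)"
proof -
 have tP: "t:el PP" by (rule ple_D(1)[OF t(2)])
 define a where "a = set {z. z:el (times (un (pF v) (pF t)) (pn t)) &
  (z:el (pa t) | z:el (pa v) & vfst z~:el S & vfst z ~= c | vfst z = c & vsnd z:el s)}"
 have a0: "el a = {z:el (times (un (pF v) (pF t)) (pn t)).
  z:el (pa t) | z:el (pa v) & vfst z~:el S & vfst z ~= c | vfst z = c & vsnd z:el s}"
  unfolding a_def by (rule el_sep) (intro dfn)
 have nv: "el (pn v) <= el (pn t)" using ple_D(3)[OF t(2)] unfolding prj_simps .
 have a: "pr b k:el a <-> (if b:el S then pr b k:el (pa t) else
   if b = c then k:el s else pr b k:el (pa v))" for b k
  unfolding a0 using PP_D(4)[OF tP, of b k] PP_D(4)[OF v(1), of b k] t(1) nv m v(2,3) by auto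
 define u where "u = pr (pn t) (pr (un (pF v) (pF t)) a)"
 have u: "pn u = pn t" "pF u = un (pF v) (pF t)" "pa u = a" by (simp_all add: u_def)
 have uP: "u:el PP" unfolding u_def
  by (intro PP_I PP_D(1)[OF tP] fin_un PP_D(2)[OF tP] PP_D(2)[OF v(1)])
   (use PP_D(3)[OF tP] PP_D(3)[OF v(1)] a0 in auto)
 have vt: "pr b k:el (pa t) <-> pr b k:el (pa v)" if "b:el S" "b:el (pF v)" "k:el (pn v)" for b k
  using ple_D(5)[OF t(2), of b k] that unfolding prj_simps by simp
 have old: "pr b k:el a <-> pr b k:el (pa v)" if "b:el (pF v)" "k:el (pn v)" for b k
  using that vt sc unfolding a by auto
 have new: "k:el (pn v)" if h: "b:el (pF v)" "d:el (pF v)" "b:el JJ" "d:el JJ" "b ~= d"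
  "pr b k:el a" "pr d k:el a" for b d k
 proof (rule ccontr)
  assume k: "k~:el (pn v)"
  have out: "x = c" if "x~:el S" "pr x k:el a" for x
   using that k PP_D(4)[OF v(1)] unfolding a by (auto split: if_splits)
  show False
  proof (cases "b:el S"; cases "d:el S")
   assume S: "b:el S" "d:el S"
   then have "pr b k:el (pa t)" "pr d k:el (pa t)" using h unfolding a by auto
   then show False using ple_D(6)[OF t(2), of b d k] h S k unfolding prj_simps by simp
  next
   assume S: "b:el S" "d~:el S"
   then show False using out[OF S(2) h(7)] av[OF h(1) S(1) h(3)] h k v(3) unfolding a by auto
  next
   assume S: "b~:el S" "d:el S"
   then show False using out[OF S(1) h(6)] av[OF h(2) S(2) h(4)] h k v(3) unfolding a by auto
  next
   assume "b~:el S" "d~:el S"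
   then show False using out h by blast
  qed
 qed
 have "u <| v" by (rule pleI[OF uP v(1)]; unfold u) (use nv old in simp_all, rule new)
 moreover have "u <| t"
 proof (rule pleI[OF uP tP]; unfold u)
  show "pr b k:el a <-> pr b k:el (pa t)" if "b:el (pF t)" for b k using that t(1) unfolding a by auto
  show "k:el (pn t)" if "pr b k:el a" for b k using that PP_D(4)[OF uP] unfolding u by blast
 qed auto
 moreover have "pr c k:el (pa u) <-> k:el s" for k unfolding u a using v(3) by simp
 ultimately show ?thesis using u by (intro exI[of _ u]) simp
qed

text \<open>Codes of requirements: in \<open>pr e (pr m s)\<close>, \<open>s\<close> is an initial
  segment, up to \<open>m\<close>, of the set under consideration, and \<open>e\<close> a finite set
  of indices of sets that its further elements may have to avoid.\<close>

definition CC :: nat where "CC = times (Fin JJ) (times om (Fin om))"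

text \<open>\<open>W\<close> is countable and predense in \<open>Qc\<close>. When \<open>Qc\<close>
  is closed downwards, a filter that meets \<open>Qc\<close> also meets \<open>W\<close>.\<close>

definition nice :: "nat => nat => bool" where
 "nice Qc W <-> el W <= el Qc & cnt W & (ALL q:el Qc. EX p:el W. EX r. r <| p & r <| q)"

lemma [dfn]: "dff s ==> dff t ==> dfn (%e. nice (s e) (t e))"
 by (rule dfn_rel2) (unfold nice_def, intro dfn)

text \<open>A maximal antichain of \<open>Qc\<close>, countable by the chain condition.\<close>

lemma nice_exists: "el Qc <= el PP ==> EX W. nice Qc W"
proof -
 assume Q: "el Qc <= el PP"
 let ?R = "%q Y. ALL p:el Y. ~ (EX r. r <| p & r <| q)"
 have dR: "dfn (%e. ?R (e 0) (e (Suc 0)))" by (intro dfn)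
 obtain k f where k: "Ord k" "!!a. a:el k ==> app f a:el Qc"
  "!!a. a:el k ==> app f a~:el (img a (app f)) & ?R (app f a) (img a (app f))"
  "!!x. x:el Qc ==> x:el (img k (app f)) | ~ ?R x (img k (app f))"
  using greedy[OF dR, of Qc] by blast
 have im: "el (img a (app f)) = app f ` el a" for a by (rule el_img) (intro dfn)
 have inc: "~ (EX r. r <| app f a & r <| app f b)" if "a:el k" "b:el k" "a ~= b" for a b
  using k(3)[OF that(1)] k(3)[OF that(2)] Ord_linear[OF Ord_mem[OF k(1) that(1)] Ord_mem[OF k(1) that(2)]] that(3)
  unfolding im by blast
 have "cnt (img k (app f))"
  by (rule ccc) (use k(2) Q inc in \<open>unfold im, blast+\<close>)
 moreover have "EX p:el (img k (app f)). EX r. r <| p & r <| q" if "q:el Qc" for q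
  using k(4)[OF that] ple_refl Q that by blast
 ultimately have "nice Qc (img k (app f))" unfolding nice_def im using k(2) by auto
 then show ?thesis ..
qed

lemma nice_generic:
 assumes W: "nice Qc W" "el Qc <= el PP" "!!q r. q:el Qc ==> r <| q ==> r:el Qc"
  and q: "q:G" "q:el Qc"
 shows "EX p:G. p:el W"
proof -
 have "EX s:G. s <| q & (EX p:el W. s <| p)"
 proof (rule generic[OF _ q(1)])
  show "EX s. s <| r & (EX p:el W. s <| p)" if "r <| q" for r
   using W(3)[OF q(2) that] W(1) unfolding nice_def by blast
 qed (intro dfn)
 then show ?thesis using G_up by blast
qed

text \<open>Although \<open>D\<close> lives in the extension, a countable set \<open>S\<close> of
  indices controls it. \<open>S\<close> is closed under the supports of countable predense sets of
  conditions that force codes into \<open>D\<close>, and under a ground model cover of a function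
  choosing extensions in \<open>D\<close>. At an index \<open>c\<close> outside \<open>S\<close> a
  condition can be prolonged by \<open>amalgam\<close>, so that a code put into \<open>D\<close> by
  the part over \<open>S\<close> is realized there.\<close>

lemma Gen:
 assumes D: "N.el D <= i ` el CC"
  and dense: "!!e m s. e:el (Fin JJ) ==> m:el om ==> el s <= el m ==>
   EX e' m' s'. i (pr e' (pr m' s')):N.el D & el e <= el e' & el m <= el m' & el s' <= el m' &
    el s' Int el m = el s & (av --> (ALL b:el e. ALL k:el s'. k~:el m --> i k~:N.el (AN (i b))))"
 obtains S where "cnt S" "!!c. c:el LL ==> c~:el S ==> (c:el JJ --> av) ==>
  EX e m s. i (pr e (pr m s)):N.el D & m:el om & el s <= el m &
   (ALL k:el m. i k:N.el (AN (i c)) <-> k:el s)"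
proof -
 let ?X = "%d c. N.el (N.vfst c) <= N.el (N.vfst d) &
  N.el (N.vfst (N.vsnd c)) <= N.el (N.vfst (N.vsnd d)) &
  N.el (N.vsnd (N.vsnd d)) <= N.el (N.vfst (N.vsnd d)) &
  N.vint (N.vsnd (N.vsnd d)) (N.vfst (N.vsnd c)) = N.vsnd (N.vsnd c) &
  (av --> (ALL b:N.el (N.vfst c). ALL k:N.el (N.vsnd (N.vsnd d)). k~:N.el (N.vfst (N.vsnd c)) --> k~:N.el (AN b)))"
 \<comment> \<open>The elements of \<open>D\<close> that extend the code \<open>c\<close> as in the
   density hypothesis; the function \<open>g\<close> chooses one of them.\<close>
 define XT where "XT c = N.set {d. d:N.el D & ?X d c}" for c
 have dXT: "N.dff (%e. XT (e 0))" unfolding XT_def by (intro N.dfn)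
 have XT: "N.el (XT c) = {d:N.el D. ?X d c}" for c
  unfolding XT_def by (rule N.el_sep) (intro N.dfn)
 obtain ch where ch: "!!y. y:N.el (N.img (i CC) XT) ==> N.el y ~= {} ==> N.app ch y:N.el y"
  using N.choice_fun by blast
 define g where "g = N.lam (i CC) (%c. if XT c = N.zero then c else N.app ch (XT c))"
 have dg: "N.dff (%e. if XT (e 0) = N.zero then e 0 else N.app ch (XT (e 0)))" by (intro N.dfn dXT)
 have g: "N.app g (i c) = (if XT (i c) = N.zero then i c else N.app ch (XT (i c)))" if "c:el CC" for c
  unfolding g_def using N.app_lam[OF dg, of "i c" "i CC"] that by simp
 have gX: "N.app g (i c):N.el (XT (i c))" if "c:el CC" "N.el (XT (i c)) ~= {}" for c
  using that ch[of "XT (i c)"] unfolding g[OF that(1)] N.el_img[OF dXT] by auto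
 have gC: "N.app g (i c):i ` el CC" if "c:el CC" for c
 proof (cases "N.el (XT (i c)) = {}")
  case True
  then show ?thesis using that by (simp add: g N.zero_iff)
 next
  case False
  then show ?thesis using gX[OF that] D unfolding XT by blast
 qed
 \<comment> \<open>In the ground model, countably many candidates for the chosen extension of each
   code.\<close>
 obtain h where h: "!!c. c:el CC ==> cnt (app h c) & el (app h c) <= el CC & N.app g (i c):i ` el (app h c)"
  by (rule covering[OF ccc gC]) blast+
 obtain Q where Q: "el Q <= el (times CC PP)"
  "!!c. c:el CC ==> i c:N.el D <-> (EX p:G. pr c p:el Q)"
  "!!c p r. pr c p:el Q ==> r <| p ==> pr c r:el Q" using ground_name[OF D] by blast
 define Qc where "Qc c = set {p. p:el PP & pr c p:el Q}" for c
 have Qc: "el (Qc c) = {p:el PP. pr c p:el Q}" for c unfolding Qc_def by (rule el_sep) (intro dfn)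
 have dQc: "dff s ==> dff (%e. Qc (s e))" for s by (rule dff_fun1) (unfold Qc_def, intro dfn)
 define NW where "NW c = set {W. W:el (pw PP) & nice (Qc c) W}" for c
 have NW: "el (NW c) = {W:el (pw PP). nice (Qc c) W}" for c unfolding NW_def by (rule el_sep) (intro dfn dQc)
 have dNW: "dff s ==> dff (%e. NW (s e))" for s by (rule dff_fun1) (unfold NW_def, intro dfn dQc)
 have dNW0: "dff (%e. NW (e 0))" by (intro dNW dfn)
 obtain cw where cw: "!!y. y:el (img CC NW) ==> el y ~= {} ==> app cw y:el y" using choice_fun by blast
 define W where "W c = app cw (NW c)" for c
 have dW: "dff s ==> dff (%e. W (s e))" for s unfolding W_def by (intro dfn dNW)
 have W: "nice (Qc c) (W c)" "el (W c) <= el PP" if "c:el CC" for c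
 proof -
  obtain W0 where "nice (Qc c) W0" using nice_exists[of "Qc c"] Qc by blast
  moreover from this have "el W0 <= el PP" using Qc unfolding nice_def by blast
  ultimately have "el (NW c) ~= {}" unfolding NW by auto
  then have "W c:el (NW c)" unfolding W_def using that by (intro cw) (auto simp: el_img[OF dNW0])
  then show "nice (Qc c) (W c)" "el (W c) <= el PP" unfolding NW by auto
 qed
 have dF: "dff (%e. pF (e 0))" by (intro dfn)
 define sp where "sp c = vUN (W c) (%p. pF p)" for c
 have dsp: "dff s ==> dff (%e. sp (s e))" for s unfolding sp_def by (intro dfn dW)
 have sp: "el (sp c) = (UN p:el (W c). el (pF p))" for c unfolding sp_def by (rule el_vUN[OF dF])
 have csp: "cnt (sp c)" if "c:el CC" for c unfolding sp_def
  by (rule cnt_vUN[OF dF]) (use W[OF that] PP_D(2) fin_cnt in \<open>auto simp: nice_def\<close>)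
 define CS where "CS S = times (Fin (vint S JJ)) (times om (Fin om))" for S
 have CS_CC: "el (CS S) <= el CC" for S unfolding CS_def CC_def by auto
 define U where "U c = un (sp c) (vUN (app h c) vfst)" for c
 have dv: "dff (%e. vfst (e 0))" by (intro dfn)
 have dU: "dff (%e. U (e 0))" unfolding U_def by (intro dfn dsp)
 have U: "el (U c) = el (sp c) Un (UN d:el (app h c). el (vfst d))" for c unfolding U_def by (simp add: el_vUN[OF dv])
 have cU: "cnt (U c)" if "c:el CC" for c
 proof -
  have "cnt (vUN (app h c) vfst)"
   by (rule cnt_vUN[OF dv]) (use h[OF that] fin_cnt in \<open>auto simp: CC_def\<close>)
  then show ?thesis unfolding U_def using csp[OF that] cnt_un by blast
 qed
 define T where "T S = un S (vUN (CS S) U)" for S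
 have dT: "dff (%e. T (e (Suc 0)))" unfolding T_def CS_def by (intro dfn dU dff_fun1[OF dU])
 have T: "el (T S) = el S Un (UN c:el (CS S). el (U c))" for S unfolding T_def by (simp add: el_vUN[OF dU])
 have cT: "cnt (T S)" if "cnt S" for S
 proof -
  have "cnt (vint S JJ)" by (rule lep_trans[OF lep_subset that]) simp
  then have "cnt (CS S)" unfolding CS_def
   by (intro cnt_times[OF cnt_Fin cnt_times[OF lep_subset cnt_Fin[OF lep_subset]]]) simp_all
  then have "cnt (vUN (CS S) U)" by (rule cnt_vUN[OF dU]) (use cU CS_CC in blast)
  then show ?thesis unfolding T_def using that cnt_un by blast
 qed
 define Sn where "Sn = nrec (%p. p) (%p x. T x) zero"
 have dp: "dff (%e. e 0)" by (intro dfn)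
 have dSn: "dff (%e. Sn (e 0))" unfolding Sn_def by (intro dff_nrec dT dfn)
 have Sn0: "Sn zero = zero" unfolding Sn_def by (rule nrec_zero[OF dp dT])
 have SnS: "Sn (succ n) = T (Sn n)" if "n:el om" for n unfolding Sn_def by (rule nrec_succ[OF dp dT that])
 define S where "S = vUN om Sn"
 have S: "el S = (UN n:el om. el (Sn n))" unfolding S_def by (rule el_vUN[OF dSn])
 have cSn: "cnt (Sn n)" if "n:el om" for n
  using that
 proof (induction n rule: om_induct)
  case df show ?case by (intro dfn dff_fun1[OF dSn])
 next
  case zero
  show ?case unfolding Sn0 by (rule lep_subset) simp
 qed (use cT SnS in simp)
 have cS: "cnt S" unfolding S_def by (rule cnt_vUN[OF dSn lep_subset cSn]) simp_all
 have Smono: "ALL m:el n. el (Sn m) <= el (Sn n)" if "n:el om" for n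
  using that
 proof (induction n rule: om_induct)
  case df show ?case by (intro dfn dff_fun1[OF dSn])
 next
  case (succ n)
  then show ?case unfolding SnS[OF succ(1)] T by auto
 qed simp
 have Sfin: "EX n:el om. el e <= el (Sn n)" if "fin e" "el e <= el S" for e
 proof -
  from that(1) have "el e <= el S --> (EX n:el om. el e <= el (Sn n))"
  proof (induction rule: fin_induct)
   case df show ?case by (intro dfn dff_fun1[OF dSn])
  next
   case zero show ?case by (rule impI, rule bexI[OF _ zero_omega]) simp
  next
   case (ins y z)
   show ?case
   proof
    assume "el (ins z y) <= el S"
    then obtain n m where n: "n:el om" "el y <= el (Sn n)" and m: "m:el om" "z:el (Sn m)"
     using ins.IH unfolding S by auto
    consider "n:el m" | "n = m" | "m:el n" using Ord_linear Ord_nat n(1) m(1) by blast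
    then show "EX n:el om. el (ins z y) <= el (Sn n)"
     using n m Smono by cases (fastforce intro: bexI[of _ m] bexI[of _ n])+
   qed
  qed
  then show ?thesis using that by blast
 qed
 have closed: "el (sp c) <= el S" "d:el (app h c) ==> el (vfst d) <= el S" if c: "c:el (CS S)" for c d
 proof -
  obtain e m s where ems: "c = pr e (pr m s)" "fin e" "el e <= el S" "el e <= el JJ" "m:el om" "s:el (Fin om)"
   using c unfolding CS_def by auto
  obtain n where n: "n:el om" "el e <= el (Sn n)" using Sfin ems by blast
  have "c:el (CS (Sn n))" unfolding CS_def using ems n by auto
  then have "el (U c) <= el (Sn (succ n))" unfolding SnS[OF n(1)] T by blast
  then have "el (U c) <= el S" unfolding S using succ_omega[OF n(1)] by blast
  then show "el (sp c) <= el S" "d:el (app h c) ==> el (vfst d) <= el S" unfolding U by blast+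
 qed
 show ?thesis
 proof (rule that[OF cS])
  fix c assume c: "c:el LL" "c~:el S" and cav: "c:el JJ --> av"
  \<comment> \<open>\<open>v\<close> realizes an element of \<open>D\<close> at \<open>c\<close>,
    and is below a condition in \<open>W\<close> that forces it into \<open>D\<close>.\<close>
  define good where "good v <-> c:el (pF v) & (EX e m s. pr e (pr m s):el CC & (EX p:el (W (pr e (pr m s))). v <| p) &
   el m <= el (pn v) & el s <= el m & (ALL k. pr c k:el (pa v) <-> k:el s))" for v
  \<comment> \<open>A condition \<open>t\<close> over \<open>S\<close>, compatible with
    \<open>v\<close>, provides an element of \<open>D\<close> that can be realized at
    \<open>c\<close>; these are the hypotheses of \<open>amalgam\<close>, so densely often
    \<open>st v\<close> leads to \<open>good\<close>.\<close>
  define st where "st v <-> (EX t e m s. el (pF t) <= el S & t <| prj S v & pr e (pr m s):el CC &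
   (EX p:el (W (pr e (pr m s))). t <| p) & el m <= el (pn t) & el s <= el m &
   (ALL k:el (pn v). pr c k:el (pa v) <-> k:el s) &
   (ALL b:el (pF v). b:el S --> b:el JJ --> c:el JJ --> (ALL k:el s. k~:el (pn v) --> pr b k~:el (pa t))))" for v
  have dgs: "dfn (%e. good (e 0) | c:el (pF (e 0)) & ~ st (e 0))"
   unfolding good_def st_def by (intro dfn dW)
  obtain v0 where v0: "v0:G" using G_ne by blast
  have "EX v:G. v <| v0 & (good v | c:el (pF v) & ~ st v)"
  proof (rule generic[OF dgs v0])
   fix r assume "r <| v0"
   then have rP: "r:el PP" unfolding ple_iff by blast
   have "el (dbl c c) <= el LL" using c(1) by simp
   from extend[OF rP fin_dbl this zero_omega] obtain v where v: "v <| r" "c:el (pF v)" by auto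
   have vP: "v:el PP" using v(1) unfolding ple_iff by blast
   show "EX s. s <| r & (good s | c:el (pF s) & ~ st s)"
   proof (cases "st v")
    case True
    then obtain t e m s where t: "el (pF t) <= el S" "t <| prj S v" "pr e (pr m s):el CC"
     "EX p:el (W (pr e (pr m s))). t <| p" "el m <= el (pn t)" "el s <= el m"
     "ALL k:el (pn v). pr c k:el (pa v) <-> k:el s"
     "ALL b:el (pF v). b:el S --> b:el JJ --> c:el JJ --> (ALL k:el s. k~:el (pn v) --> pr b k~:el (pa t))"
     unfolding st_def by blast
    obtain u where u: "u <| v" "u <| t" "pn u = pn t" "el (pF u) = el (pF v) Un el (pF t)"
     "!!k. pr c k:el (pa u) <-> k:el s"
     using amalgam[OF vP v(2) c(2) t(1,2,6,5)] t(7,8) by blast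
    obtain p where p: "p:el (W (pr e (pr m s)))" "t <| p" using t(4) by blast
    have "good u" unfolding good_def
    proof (rule conjI; (rule exI[of _ e], rule exI[of _ m], rule exI[of _ s])?; (intro conjI)?)
     show "EX p:el (W (pr e (pr m s))). u <| p" using ple_trans u(2) p by blast
    qed (use u t v(2) c(2) in auto)
    then show ?thesis using u(1) v(1) ple_trans by blast
   qed (use v in blast)
  qed
  then obtain v where v: "v:G" "good v | c:el (pF v) & ~ st v" by blast
  have vP: "v:el PP" using G_mem v(1) .
  \<comment> \<open>Otherwise \<open>st v\<close> fails, which the filter itself refutes: the code
    read off from \<open>v\<close> belongs to \<open>CS S\<close>, so its chosen extension and the
    condition forcing that into \<open>D\<close> are over \<open>S\<close>, and the restriction to
    \<open>S\<close> of a condition in the filter serves as \<open>t\<close>.\<close>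
  have "good v"
  proof (rule ccontr)
   assume "~ good v"
   then have cv: "c:el (pF v)" and ns: "~ st v" using v(2) by blast+
   define e0 where "e0 = vint (pF v) (vint S JJ)"
   obtain s0 where s0: "el s0 = {k:el (pn v). pr c k:el (pa v)}" by (erule sep_ex) (intro dfn)
   have e0: "fin e0" unfolding e0_def by (rule fin_subset[OF PP_D(2)[OF vP]]) simp
   have n: "pn v:el om" by (rule PP_D(1)[OF vP])
   have s0f: "s0:el (Fin om)"
    using s0 fin_subset[OF fin_nat[OF n]] n nat_in_omega by auto
   let ?c = "pr e0 (pr (pn v) s0)"
   have cCS: "?c:el (CS S)" unfolding CS_def using e0 n s0f by (auto simp: e0_def)
   then have cCC: "?c:el CC" using CS_CC by blast
   have "e0:el (Fin JJ)" using e0 by (auto simp: e0_def)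
   from dense[OF this n, of s0] s0 obtain e' m' s' where x: "i (pr e' (pr m' s')):N.el D" "el e0 <= el e'"
    "el (pn v) <= el m'" "el s' <= el m'" "el s' Int el (pn v) = el s0"
    "av --> (ALL b:el e0. ALL k:el s'. k~:el (pn v) --> i k~:N.el (AN (i b)))" by blast
   have "vint s' (pn v) = s0" by (rule el_ext) (use x(5) in simp)
   then have vs: "N.vint (i s') (i (pn v)) = i s0" by (intro N.el_ext) (auto simp: image_iff)
   have "i (pr e' (pr m' s')):N.el (XT (i ?c))" unfolding XT i_pr using x vs by (auto simp: i_pr image_mono)
   then have "N.app g (i ?c):N.el (XT (i ?c))" using gX[OF cCC] by blast
   moreover obtain d where d: "d:el (app h ?c)" "N.app g (i ?c) = i d" using h[OF cCC] by blast
   ultimately have dX: "i d:N.el (XT (i ?c))" by simp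
   have dCC: "d:el CC" using d h[OF cCC] by blast
   then obtain e m s where ems: "d = pr e (pr m s)" "fin e" "el e <= el JJ" "m:el om" "s:el (Fin om)"
    unfolding CC_def by auto
   have y: "i d:N.el D" "el e0 <= el e" "el (pn v) <= el m" "el s <= el m"
    "N.vint (i s) (i (pn v)) = i s0" "av --> (ALL b:el e0. ALL k:el s. k~:el (pn v) --> i k~:N.el (AN (i b)))"
    using dX unfolding XT ems i_pr by auto
   have sI: "k:el s0 <-> k:el s & k:el (pn v)" for k
    using arg_cong[OF y(5), of "%x. i k:N.el x"] by simp
   have eS: "el e <= el S" using closed(2)[OF cCS d(1)] ems by simp
   have dCS: "d:el (CS S)" unfolding CS_def using ems eS by auto
   obtain q where q: "q:G" "pr d q:el Q" using Q(2)[OF dCC] y(1) by blast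
   obtain p where p: "p:G" "p:el (W d)"
    using nice_generic[OF W(1)[OF dCC] _ _ q(1)] q Q(3) G_mem unfolding Qc ple_iff by blast
   have pS: "el (pF p) <= el S" using closed(1)[OF dCS] p(2) unfolding sp by blast
   obtain w0 where w0: "w0:G" "w0 <| v" "w0 <| p" using G_dir v(1) p(1) by blast
   have "el e <= el LL" using ems(3) unfolding LL_def by auto
   from G_extend[OF w0(1) ems(2) this ems(4)] obtain w where w: "w:G" "w <| w0" "el e <= el (pF w)" "el m <= el (pn w)" by blast
   have wv: "w <| v" "w <| p" using w(2) w0 ple_trans by blast+
   have "st v" unfolding st_def
   proof (intro exI conjI)
    show "el (pF (prj S w)) <= el S" unfolding prj_simps by simp
    show "prj S w <| prj S v" by (rule prj_mono[OF wv(1)])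
    show "pr e (pr m s):el CC" using dCC ems by simp
    show "EX p:el (W (pr e (pr m s))). prj S w <| p" using p(2) prj_below[OF wv(2) pS] ems by blast
    show "el m <= el (pn (prj S w))" unfolding prj_simps by (rule w(4))
    show "el s <= el m" by (rule y(4))
    show "ALL k:el (pn v). pr c k:el (pa v) <-> k:el s" using sI s0 by blast
    show "ALL b:el (pF v). b:el S --> b:el JJ --> c:el JJ --> (ALL k:el s. k~:el (pn v) --> pr b k~:el (pa (prj S w)))"
     using y(6) cav AN_iff w(1) unfolding prj_simps by (auto simp: e0_def)
   qed
   then show False using ns by blast
  qed
  then obtain e m s p where r: "c:el (pF v)" "pr e (pr m s):el CC" "p:el (W (pr e (pr m s)))" "v <| p"
   "el m <= el (pn v)" "el s <= el m" "!!k. pr c k:el (pa v) <-> k:el s"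
   unfolding good_def by blast
  show "EX e m s. i (pr e (pr m s)):N.el D & m:el om & el s <= el m &
   (ALL k:el m. i k:N.el (AN (i c)) <-> k:el s)"
  proof (rule exI[of _ e], rule exI[of _ m], rule exI[of _ s], intro conjI ballI)
   have "p:el (Qc (pr e (pr m s)))" using W(1)[OF r(2)] r(3) unfolding nice_def by blast
   then show "i (pr e (pr m s)):N.el D" using Q(2)[OF r(2)] G_up[OF v(1) r(4)] unfolding Qc by blast
   show "m:el om" using r(2) unfolding CC_def by auto
   show "el s <= el m" by fact
   show "i k:N.el (AN (i c)) <-> k:el s" if "k:el m" for k
    using AN_dec[OF v(1) r(1)] r(5,7) that by blast
  qed
 qed
qed

end

section \<open>Isbell-Mrowka spaces and their hyperspaces\<close>

context zfc
begin

lemma un_nat: "m:el om ==> n:el om ==> un m n:el om"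
proof -
 assume m: "m:el om" and n: "n:el om"
 have "el m <= el n | el n <= el m"
  using Ord_linear[OF Ord_nat[OF m] Ord_nat[OF n]] Ord_subset[OF Ord_nat[OF m] Ord_nat[OF n]] Ord_subset[OF Ord_nat[OF n] Ord_nat[OF m]] by blast
 then have "un m n = m | un m n = n" by (metis el_un el_ext sup.absorb1 sup.absorb2)
 then show ?thesis using m n by auto
qed

lemma nat_not_mem: "m:el om ==> k:el om ==> k~:el m ==> el m <= el k"
 using Ord_linear[OF Ord_nat Ord_nat, of m k] Ord_subset[OF Ord_nat Ord_nat, of m k] by blast

lemma fin_lep: "lep x n ==> fin n ==> fin x"
proof -
 assume "lep x n" and n: "fin n"
 then obtain f where f: "inj_fun f x n" unfolding lep_def by blast
 define g where "g m = Uni (set {u. u:el x & app f u = m})" for m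
 have "el (set {u. u:el x & app f u = m}) = {u:el x. app f u = m}" for m
  by (rule el_sep) (intro dfn)
 then have g: "g (app f u) = u" if "u:el x" for u
  using that f unfolding g_def inj_fun_def by (intro el_ext) auto
 have dg: "dff (%e. g (e 0))" unfolding g_def by (intro dfn)
 have "el x <= el (img n g)" unfolding el_img[OF dg] using g f unfolding inj_fun_def
  by (metis image_eqI subsetI)
 then show ?thesis using fin_subset[OF fin_img[OF n dg]] by blast
qed

lemma fin_vUN: "dff (%e. F (e 0)) ==> fin x ==> (!!u. u:el x ==> fin (F u)) ==> fin (vUN x F)"
proof -
 assume F: "dff (%e. F (e 0))" and x: "fin x" "!!u. u:el x ==> fin (F u)"
 have "fin (Uni (img x F))" by (rule fin_Uni[OF fin_img[OF x(1) F]]) (use x(2) el_img[OF F] in auto)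
 then show ?thesis by (rule fin_cong) (simp add: el_img[OF F] el_vUN[OF F])
qed

text \<open>The Teichmueller-Tukey lemma: points are taken greedily as long as \<open>P\<close>
  holds for them together with each finite set of earlier ones.\<close>

lemma tukey:
 assumes dP: "dfn (%e. P (e 0))" and z: "P zero"
 obtains K where "el K <= el X" "!!d. fin d ==> el d <= el K ==> P d"
  "!!x. x:el X ==> x~:el K ==> EX d. fin d & el d <= el K & ~ P (ins x d)"
proof -
 have dR: "dfn (%e. ALL d:el (Fin (e (Suc 0))). P (ins (e 0) d))" by (intro dfn dfn_rel1[OF dP])
 obtain k f where k: "Ord k" "!!a. a:el k ==> app f a:el X"
  "!!a. a:el k ==> app f a~:el (img a (app f)) & (ALL d:el (Fin (img a (app f))). P (ins (app f a) d))"
  "!!x. x:el X ==> x:el (img k (app f)) | ~ (ALL d:el (Fin (img k (app f))). P (ins x d))"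
  using greedy[OF dR, of X] by blast
 have df: "dff (%e. app f (e 0))" by (intro dfn)
 have im: "el (img a (app f)) = app f ` el a" for a by (rule el_img[OF df])
 \<comment> \<open>A nonempty finite subset has a last element in the enumeration, and
   \<open>P\<close> was secured when this element was taken.\<close>
 have last: "el d <= app f ` el k --> d = zero | (EX a:el k. EX d'. fin d' & el d' <= app f ` el a & d = ins (app f a) d')"
  if "fin d" for d
  using that
 proof (induction rule: fin_induct)
  case df
  have "dfn (%e. el (e 0) <= el (img k (app f)) --> e 0 = zero |
   (EX a:el k. EX d'. fin d' & el d' <= el (img a (app f)) & e 0 = ins (app f a) d'))" by (intro dfn)
  then show ?case unfolding im .
 next
  case (ins y z)
  show ?case
  proof
   assume h: "el (ins z y) <= app f ` el k"
   then obtain b where b: "b:el k" "z = app f b" by auto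
   from h ins.IH consider "y = zero" | a d where "a:el k" "fin d" "el d <= app f ` el a" "y = ins (app f a) d" by auto
   then show "ins z y = zero | (EX a:el k. EX d'. fin d' & el d' <= app f ` el a & ins z y = ins (app f a) d')"
   proof cases
    case 1
    then show ?thesis using b by (intro disjI2 bexI[OF _ b(1)] exI[of _ zero]) simp
   next
    case (2 a d)
    consider "b:el a" | "a = b" | "a:el b"
     using Ord_linear[OF Ord_mem[OF k(1) b(1)] Ord_mem[OF k(1) 2(1)]] by blast
    then show ?thesis
    proof cases
     case 1
     then show ?thesis using 2 b by (intro disjI2 bexI[OF _ 2(1)] exI[of _ "ins z d"]) (auto intro: el_ext)
    next
     case 22: 2
     then show ?thesis using 2 b by (intro disjI2 bexI[OF _ 2(1)] exI[of _ d]) (auto intro: el_ext)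
    next
     case 3
     then have "app f ` el a <= app f ` el b" using Ord_trans[OF Ord_mem[OF k(1) b(1)]] by blast
     then have "el y <= app f ` el b" using 2 3 by auto
     then show ?thesis using 2 b by (intro disjI2 bexI[OF _ b(1)] exI[of _ y]) auto
    qed
   qed
  qed
 qed simp
 show ?thesis
 proof (rule that[of "img k (app f)"])
  show "el (img k (app f)) <= el X" unfolding im using k(2) by blast
  show "P d" if "fin d" "el d <= el (img k (app f))" for d
  proof -
   from last[OF that(1)] that(2)[unfolded im] consider "d = zero" | a d' where "a:el k" "fin d'" "el d' <= app f ` el a" "d = ins (app f a) d'" by blast
   then show ?thesis
   proof cases
    case (2 a d')
    have "d':el (Fin (img a (app f)))" using 2 im by simp
    then show ?thesis using k(3)[OF 2(1)] 2(4) by blast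
   qed (use z in simp)
  qed
  show "EX d. fin d & el d <= el (img k (app f)) & ~ P (ins x d)" if "x:el X" "x~:el (img k (app f))" for x
   using k(4)[OF that(1)] that(2) by auto
 qed
qed

section \<open>Almost disjoint families and basic open sets\<close>

definition ad where "ad A <-> ~ fin A & (ALL x:el A. el x <= el om & ~ fin x) &
  (ALL x:el A. ALL y:el A. x ~= y --> fin (vint x y))"

definition mad where "mad A <-> ad A & (ALL x. el x <= el om --> ~ fin x --> (EX y:el A. ~ fin (vint x y)))"

definition "psiT A = set {U. U:el (pw (un A om)) & (ALL x:el A. x:el U --> (EX n:el om. el (vmin x n) <= el U))}"

definition "psiCL A = set {F. F:el (pw (un A om)) & (F ~= zero & vmin (un A om) F:el (psiT A))}"

definition "vie F C <-> el F <= el (Uni C) & (ALL U:el C. EX x:el F. x:el U)"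

text \<open>The trace on \<open>om\<close> of a basic neighbourhood of \<open>x\<close>; a set of
  natural numbers can meet the neighbourhood only there.\<close>

definition "nb x n = (if x:el om then dbl x x else vmin x n)"

lemma [dfn]: "dff s ==> dff (%e. psiT (s e))"
 by (rule dff_fun1) (unfold psiT_def, intro dfn)
lemma [dfn]: "dff s ==> dff (%e. psiCL (s e))"
 by (rule dff_fun1) (unfold psiCL_def, intro dfn)
lemma [dfn]: "dff s ==> dff t ==> dfn (%e. vie (s e) (t e))"
 by (rule dfn_rel2) (unfold vie_def, intro dfn)
lemma [dfn]: "dff s ==> dff t ==> dff (%e. nb (s e) (t e))"
 by (rule dff_fun2) (unfold nb_def, intro dfn)

lemma psiT: "U:el (psiT A) <-> el U <= el A Un el om &
  (ALL x:el A. x:el U --> (EX n:el om. el x - el n <= el U))"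
proof -
 have "el (psiT A) = {U:el (pw (un A om)). ALL x:el A. x:el U --> (EX n:el om. el (vmin x n) <= el U)}"
  unfolding psiT_def by (rule el_sep) (intro dfn)
 then show ?thesis by simp
qed

lemma psiCL: "F:el (psiCL A) <-> el F <= el A Un el om & F ~= zero &
  (ALL x:el A. x~:el F --> (EX n:el om. el x - el n <= el A Un el om - el F))"
proof -
 have "el (psiCL A) = {F:el (pw (un A om)). F ~= zero & vmin (un A om) F:el (psiT A)}"
  unfolding psiCL_def by (rule el_sep) (intro dfn)
 then show ?thesis by (auto simp: psiT)
qed

lemma ad_not_nat: "ad A ==> x:el A ==> x~:el om"
 using fin_nat unfolding ad_def by blast

lemma nb_mono: "el m <= el n ==> el (nb x n) <= el (nb x m)"
 unfolding nb_def by auto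

lemma psiT_nb: "U:el (psiT A) ==> x:el U ==> EX n:el om. el (nb x n) <= el U"
proof (cases "x:el om")
 case False
 assume h: "U:el (psiT A)" "x:el U"
 then have "x:el A" using False unfolding psiT by blast
 then show ?thesis using h False unfolding psiT nb_def by auto
qed (use zero_omega in \<open>auto simp: nb_def\<close>)

lemma Fin_psiCL: "ad A ==> fin F ==> el F <= el om ==> F ~= zero ==> F:el (psiCL A)"
proof -
 assume A: "ad A" and F: "fin F" "el F <= el om" "F ~= zero"
 obtain n where n: "n:el om" "el F <= el n" using fin_bounded F by blast
 then show ?thesis unfolding psiCL using F A unfolding ad_def by (intro conjI ballI impI bexI[OF _ n(1)]) blast+
qed

text \<open>Density of \<open>om\<close> in the space carries over to the hyperspace: a natural
  number from each of the finitely many open sets gives a finite set in the same Vietoris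
  neighbourhood.\<close>

lemma Fin_dense:
 assumes A: "ad A" and F: "F:el (psiCL A)" and C: "fin C" "el C <= el (psiT A)" "vie F C"
 obtains F' where "fin F'" "el F' <= el om" "F' ~= zero" "vie F' C"
proof -
 have pt: "EX k:el om. k:el U" if U: "U:el C" for U
 proof -
  obtain x where x: "x:el U" using C(3) U unfolding vie_def by blast
  obtain n where n: "n:el om" "el (nb x n) <= el U" using psiT_nb x U C(2) by blast
  show ?thesis
  proof (cases "x:el om")
   case False
   then have "x:el A" using x U C(2) psiT by blast
   then have "~ fin x" "el x <= el om" using A unfolding ad_def by blast+
   then obtain k where "k:el x" "k~:el n" using infinite_unbounded n(1) by blast
   then show ?thesis using n(2) False \<open>el x <= el om\<close> unfolding nb_def by auto
  qed (use x in blast)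
 qed
 have "el C <= el C --> (EX F'. fin F' & el F' <= el om & el F' <= el (Uni C) & (ALL U:el C. EX x:el F'. x:el U))"
  using C(1)
 proof (induction rule: fin_induct)
  case df
  show ?case by (intro dfn)
 next
  case zero show ?case by (intro impI exI[of _ zero]) simp
 next
  case (ins y z)
  obtain k where k: "k:el om" "k:el z" using pt ins by blast
  obtain F' where "fin F'" "el F' <= el om" "el F' <= el (Uni y)" "ALL U:el y. EX x:el F'. x:el U"
   using ins.IH by auto
  then show ?case using k by (intro impI exI[of _ "ins k F'"]) auto
 qed
 then obtain F' where F': "fin F'" "el F' <= el om" "el F' <= el (Uni C)" "ALL U:el C. EX x:el F'. x:el U" by blast
 have "el C ~= {}" using F C(3) zero_iff unfolding psiCL vie_def by fastforce
 then have "F' ~= zero" using F'(4) by auto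
 then show ?thesis using that F' unfolding vie_def by blast
qed

text \<open>A function on the hyperspace is bounded above if every infinite set of finite sets has an
 accumulation point: otherwise consider the finite sets at which, along an enumeration of all finite
 sets, the function exceeds all previous values.\<close>

lemma bounded_above:
 assumes A: "ad A"
  and acc: "!!R. el R <= el (Fin om) ==> zero~:el R ==> ~ fin R ==>
   EX K:el (psiCL A). ALL C. fin C --> el C <= el (psiT A) --> vie K C --> ~ fin (set {F. F:el R & vie F C})"
  and dl: "dfn (%e. lt (e 0) (e (Suc 0)))"
  and trans: "!!x y z. x:el K ==> y:el K ==> z:el K ==> lt x y ==> lt y z ==> lt x z"
  and irr: "!!x. x:el K ==> ~ lt x x"
  and lin: "!!x y. x:el K ==> y:el K ==> lt x y | x = y | lt y x"
  and no_max: "!!x. x:el K ==> EX y:el K. lt x y" and no_min: "!!x. x:el K ==> EX y:el K. lt y x"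
  and ne: "el K ~= {}"
  and f: "!!F. F:el (psiCL A) ==> app f F:el K"
  and cont: "!!F a b. F:el (psiCL A) ==> a:el K ==> b:el K ==> lt a (app f F) ==> lt (app f F) b ==>
   EX C. fin C & el C <= el (psiT A) & vie F C & (ALL F':el (psiCL A). vie F' C --> lt a (app f F') & lt (app f F') b)"
 shows "EX b:el K. ALL F:el (psiCL A). lt (app f F) b"
proof (rule ccontr)
 assume nb: "~ ?thesis"
 note dl' = dfn_rel2[OF dl]
 define FF where "FF = vmin (Fin om) (dbl zero zero)"
 have FF: "F:el FF <-> fin F & el F <= el om & F ~= zero" for F unfolding FF_def by auto
 have CL: "F:el (psiCL A)" if "F:el FF" for F using that Fin_psiCL[OF A] FF by blast
 have big: "EX F:el FF. lt b (app f F)" if b: "b:el K" for b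
 proof -
  obtain b' where b': "b':el K" "lt b b'" using no_max b by blast
  then obtain F where F: "F:el (psiCL A)" "~ lt (app f F) b'" using nb by blast
  have "lt b (app f F)" using lin[OF b'(1) f[OF F(1)]] F b' b trans f by blast
  moreover obtain c where "c:el K" "lt (app f F) c" using no_max f F by blast
  ultimately obtain C where C: "fin C" "el C <= el (psiT A)" "vie F C" "ALL F':el (psiCL A). vie F' C --> lt b (app f F')"
   using cont[OF F(1) b] by blast
  show ?thesis by (rule Fin_dense[OF A F(1) C(1-3)]) (use C(4) CL FF in blast)
 qed
 have "cnt FF" by (rule lep_trans[OF lep_subset cnt_Fin[OF lep_subset]]) (auto simp: FF_def)
 then obtain c where c: "!!F. F:el FF ==> app c F:el om"
  "!!F F'. F:el FF ==> F':el FF ==> app c F = app c F' ==> F = F'"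
  unfolding lep_def inj_fun_def by blast
 obtain R where R: "el R = {F:el FF. ALL F':el FF. app c F':el (app c F) --> lt (app f F') (app f F)}" by (erule sep_ex) (intro dfn dl')
 \<comment> \<open>Given a bound \<open>b\<close> for the values on finitely many such sets, the
   first finite set with a value above \<open>b\<close> would be another one.\<close>
 have "~ fin R"
 proof
  assume "fin R"
  then have "el R <= el FF --> (EX b:el K. ALL F:el R. lt (app f F) b)"
  proof (induction rule: fin_induct)
   case df show ?case by (intro dfn dl')
  next
   case (ins y z)
   show ?case
   proof
    assume h: "el (ins z y) <= el FF"
    then obtain b where b: "b:el K" "ALL F:el y. lt (app f F) b" using ins.IH by auto
    have z: "app f z:el K" using h f CL by simp
    then obtain b' where b': "b':el K" "lt (app f z) b'" using no_max by blast
    have K: "app f F:el K" if "F:el y" for F using that h f CL by auto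
    have "EX c:el K. (b = c | lt b c) & (b' = c | lt b' c)" using lin[OF b(1) b'(1)] b(1) b'(1) by blast
    then obtain c where c: "c:el K" "b = c | lt b c" "b' = c | lt b' c" by blast
    have "lt (app f F) c" if F: "F:el y" for F
     using c(2) b(2) F trans[OF K[OF F] b(1) c(1)] by blast
    moreover have "lt (app f z) c" using c(3) b'(2) trans[OF z b'(1) c(1)] by blast
    ultimately show "EX b:el K. ALL F:el (ins z y). lt (app f F) b" using c(1) by (intro bexI[of _ c]) auto
   qed
  qed (use ne in auto)
  then obtain b where b: "b:el K" "!!F. F:el R ==> lt (app f F) b" unfolding R by blast
  obtain F0 where F0: "F0:el FF" "lt b (app f F0)" using big b by blast
  have dn: "dfn (%e. EX F:el FF. lt b (app f F) & app c F = e 0)" by (intro dfn dl')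
  obtain n where n: "EX F:el FF. lt b (app f F) & app c F = n" "!!m. m:el n ==> ~ (EX F:el FF. lt b (app f F) & app c F = m)"
   using Ord_least[OF dn Ord_nat[OF c(1)[OF F0(1)]]] F0 by metis
  then obtain F where F: "F:el FF" "lt b (app f F)" "app c F = n" by blast
  have K: "app f F':el K" if "F':el FF" for F' using that f CL by blast
  have "lt (app f F') (app f F)" if F': "F':el FF" "app c F':el n" for F'
   using lin[OF K[OF F'(1)] b(1)] n(2)[OF F'(2)] F'(1) F trans K b(1) by blast
  then have "F:el R" unfolding R using F by blast
  then show False using b F trans irr K by blast
 qed
 moreover have "el R <= el (Fin om)" "zero~:el R" unfolding R by (auto simp: FF)
 ultimately obtain X where X: "X:el (psiCL A)"
  "!!C. fin C ==> el C <= el (psiT A) ==> vie X C ==> ~ fin (set {F. F:el R & vie F C})" using acc by blast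
 obtain a b where ab: "a:el K" "b:el K" "lt a (app f X)" "lt (app f X) b" using no_max no_min f X(1) by blast
 obtain C where C: "fin C" "el C <= el (psiT A)" "vie X C" "ALL F':el (psiCL A). vie F' C --> lt (app f F') b"
  using cont[OF X(1) ab] by blast
 \<comment> \<open>Infinitely many members of \<open>R\<close> lie near \<open>X\<close>, so one of
   them comes later than \<open>F1\<close> in the enumeration. Its value exceeds that of
   \<open>F1\<close>, hence \<open>b\<close>, although \<open>C\<close> keeps it below
   \<open>b\<close>.\<close>
 obtain F1 where F1: "F1:el FF" "lt b (app f F1)" using big ab by blast
 let ?S = "set {F. F:el R & vie F C}"
 have S: "el ?S = {F:el R. vie F C}" by (rule el_sep) (intro dfn)
 have n1: "succ (app c F1):el om" using succ_omega c(1)[OF F1(1)] by blast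
 have "EX F:el ?S. app c F~:el (succ (app c F1))"
 proof (rule ccontr)
  assume "~ ?thesis"
  then have h: "app c F:el (succ (app c F1))" if "F:el ?S" for F using that by blast
  have "lep ?S (succ (app c F1))"
  proof (rule lepI[of "app c"])
   show "dff (%e. app c (e 0))" by (intro dfn)
   have "F:el FF" if "F:el ?S" for F using that unfolding S unfolding R by blast
   then show "u = v" if "u:el ?S" "v:el ?S" "app c u = app c v" for u v using that c(2) by blast
  qed (rule h)
  then show False using fin_lep fin_nat n1 X(2)[OF C(1-3)] by blast
 qed
 then obtain F where F: "F:el ?S" "app c F~:el (succ (app c F1))" by blast
 then have FR: "F:el R" "vie F C" "F:el FF" using S R by blast+
 have "app c F1:el (app c F)"
  using F(2) Ord_linear[OF Ord_nat[OF c(1)[OF F1(1)]] Ord_nat[OF c(1)[OF FR(3)]]] by auto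
 then have "lt (app f F1) (app f F)" using FR(1) F1(1) unfolding R by blast
 moreover have "lt (app f F) b" using C(4) FR CL by blast
 ultimately show False using F1 ab trans irr f CL FR(3) by meson
qed

end

section \<open>A generic family\<close>

text \<open>The sets \<open>app a c\<close>, \<open>c \<in> J\<close>, are generic
 among the almost disjoint ones (\<open>av\<close>: new elements avoid finitely many of the other sets), the
 \<open>app a c\<close>, \<open>c \<notin> J\<close>, are Cohen generic.\<close>

locale gext = zfc E for E :: "'m => 'm => bool" +
 fixes w J I L a :: 'm
 assumes w: "Ord w" "~ cnt w" "x:el w ==> cnt x"
  and Jw: "eqp J w" and Iw: "eqp I w"
  and sub: "el J <= el L" "el I <= el L" "el I Int el J = {}"
  and a_omega: "c:el L ==> el (app a c) <= el om"
  and a_inf: "c:el J ==> ~ fin (app a c)"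
  and a_ad: "b:el J ==> c:el J ==> b ~= c ==> fin (vint (app a b) (app a c))"
  and big: "~ lep L (times w om)"
  and gen: "el D <= el (times om (Fin om)) ==>
   (!!e m s. e:el (Fin J) ==> m:el om ==> el s <= el m ==>
    EX m' s'. pr m' s':el D & el m <= el m' & el s' <= el m' & el s' Int el m = el s &
     (av --> (ALL b:el e. ALL k:el s'. k~:el m --> k~:el (app a b)))) ==>
   EX S. cnt S & (ALL c:el L. c~:el S --> (c:el J --> av) -->
    (EX m s. pr m s:el D & m:el om & vint (app a c) m = s))"
begin

text \<open>Countably many dense requirements are treated at once by uniting the exceptional
  sets.\<close>

lemma gen_fam:
 assumes dW: "dfn (%e. W (e 0) (e (Suc 0)) (e (Suc (Suc 0))))" and Z: "cnt Z"
  and dense: "!!z e m s. z:el Z ==> e:el (Fin J) ==> m:el om ==> el s <= el m ==>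
   EX m' s'. m':el om & W z m' s' & el m <= el m' & el s' <= el m' & el s' Int el m = el s &
     (av --> (ALL b:el e. ALL k:el s'. k~:el m --> k~:el (app a b)))"
 shows "EX S. cnt S & (ALL c:el L. c~:el S --> (c:el J --> av) --> (ALL z:el Z. EX m:el om. W z m (vint (app a c) m)))"
proof -
 note dW' = dfn_rel3[OF dW]
 define X where "X z = set {c. c:el L & ((c:el J --> av) & ~ (EX m:el om. W z m (vint (app a c) m)))}" for z
 have X: "el (X z) = {c:el L. (c:el J --> av) & ~ (EX m:el om. W z m (vint (app a c) m))}" for z
  unfolding X_def by (rule el_sep) (intro dfn dW')
 have dX: "dff (%e. X (e 0))" unfolding X_def by (intro dfn dW')
 have "cnt (X z)" if z: "z:el Z" for z
 proof -
  obtain D where D: "el D = {x:el (times om (Fin om)). W z (vfst x) (vsnd x)}" by (erule sep_ex) (intro dfn dW')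
  have "EX S. cnt S & (ALL c:el L. c~:el S --> (c:el J --> av) -->
    (EX m s. pr m s:el D & m:el om & vint (app a c) m = s))"
  proof (rule gen)
   fix e m s assume h: "e:el (Fin J)" "m:el om" "el s <= el m"
   obtain m' s' where x: "m':el om" "W z m' s'" "el m <= el m'" "el s' <= el m'" "el s' Int el m = el s"
     "av --> (ALL b:el e. ALL k:el s'. k~:el m --> k~:el (app a b))" using dense[OF z h] by blast
   have "s':el (Fin om)" using fin_subset[OF fin_nat[OF x(1)] x(4)] x(1,4) nat_in_omega by auto
   then have "pr m' s':el D" unfolding D using x(1,2) by simp
   then show "EX m' s'. pr m' s':el D & el m <= el m' & el s' <= el m' & el s' Int el m = el s &
     (av --> (ALL b:el e. ALL k:el s'. k~:el m --> k~:el (app a b)))" using x by blast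
  qed (use D in blast)
  then obtain S where S: "cnt S" "ALL c:el L. c~:el S --> (c:el J --> av) -->
    (EX m s. pr m s:el D & m:el om & vint (app a c) m = s)" by blast
  have "el (X z) <= el S" unfolding X using S(2) unfolding D by auto
  then show ?thesis using lep_trans[OF lep_subset S(1)] by blast
 qed
 then have "cnt (vUN Z X)" using cnt_vUN[OF dX Z] by blast
 then show ?thesis by (intro exI[of _ "vUN Z X"]) (auto simp: el_vUN[OF dX] X)
qed

text \<open>Here one new element meets a requirement: the initial segment is prolonged by
  \<open>k\<close> alone.\<close>

lemma gen_hit:
 assumes dW: "dfn (%e. W (e 0) (e (Suc 0)))" and Z: "cnt Z"
  and dense: "!!z e m. z:el Z ==> e:el (Fin J) ==> m:el om ==>
   EX k:el om. k~:el m & (ALL b:el e. k~:el (app a b)) & W z k"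
 obtains S where "cnt S" "!!c z. c:el J ==> c~:el S ==> z:el Z ==> EX k:el (app a c). W z k"
proof -
 have "EX S. cnt S & (ALL c:el L. c~:el S --> (c:el J --> True) --> (ALL z:el Z. EX m:el om. EX k:el (vint (app a c) m). W z k))"
 proof (rule gen_fam[OF _ Z])
  show "dfn (%e. EX k:el (e (Suc (Suc 0))). W (e 0) k)" by (intro dfn dfn_rel2[OF dW])
  fix z e m s assume h: "z:el Z" "e:el (Fin J)" "m:el om" "el s <= el m"
  obtain k where k: "k:el om" "k~:el m" "ALL b:el e. k~:el (app a b)" "W z k" using dense h by blast
  have m: "el m <= el k" using nat_not_mem h(3) k by blast
  have "succ k:el om" using succ_omega k(1) .
  moreover have "el (ins k s) Int el m = el s" using h(4) k(2) by auto
  ultimately show "EX m' s'. m':el om & (EX k:el s'. W z k) & el m <= el m' & el s' <= el m' & el s' Int el m = el s &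
     (True --> (ALL b:el e. ALL k:el s'. k~:el m --> k~:el (app a b)))"
   using k m h(4) by (intro exI[of _ "succ k"] exI[of _ "ins k s"]) auto
 qed
 then obtain S where S: "cnt S" "ALL c:el L. c~:el S --> (c:el J --> True) --> (ALL z:el Z. EX m:el om. EX k:el (vint (app a c) m). W z k)" by blast
 show ?thesis
 proof (rule that[OF S(1)])
  fix c z assume "c:el J" "c~:el S" "z:el Z"
  then obtain m where "EX k:el (vint (app a c) m). W z k" using S(2) sub(1) by blast
  then show "EX k:el (app a c). W z k" by auto
 qed
qed

lemma J_not_cnt: "~ cnt J"
 using Jw w(2) lep_trans[OF eqp_lep[OF eqp_sym]] by blast

lemma outside:
 assumes X: "el X <= el om" "~ fin X" and e: "fin e" "!!b. b:el e ==> fin (vint X (app a b))" and m: "m:el om"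
 shows "EX k:el X. k~:el m & (ALL b:el e. k~:el (app a b))"
proof (rule ccontr)
 have d: "dff (%e. vint X (app a (e 0)))" by (intro dfn)
 assume "~ ?thesis"
 then have "el X <= el (un m (vUN e (%b. vint X (app a b))))" by (auto simp: el_vUN[OF d])
 then show False using fin_subset[OF fin_un[OF fin_nat[OF m] fin_vUN[OF d e]]] X(2) by blast
qed

lemma outside_omega:
 assumes "e:el (Fin J)" "m:el om"
 shows "EX k:el om. k~:el m & (ALL b:el e. k~:el (app a b))"
proof -
 have "~ el J <= el e" using J_not_cnt fin_cnt lep_trans[OF lep_subset] assms(1) by auto
 then obtain c where c: "c:el J" "c~:el e" by blast
 have "fin (vint (app a c) (app a b))" if "b:el e" for b
  by (rule a_ad) (use c assms(1) that in auto)
 moreover have o: "el (app a c) <= el om" using a_omega c sub(1) by blast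
 ultimately show ?thesis using outside[OF o a_inf[OF c(1)], of e m] assms by auto
qed

definition "A0 = img J (app a)"

lemma el_A0: "el A0 = app a ` el J"
 unfolding A0_def by (rule el_img) (intro dfn)

lemma a_inject: "b:el J ==> c:el J ==> app a b = app a c ==> b = c"
proof (rule ccontr)
 assume h: "b:el J" "c:el J" "app a b = app a c" "b ~= c"
 have "vint (app a c) (app a c) = app a c" by (rule el_ext) simp
 then show False using a_ad[OF h(1,2,4)] h a_inf by simp
qed

lemma A0_J: "eqp J A0"
 by (rule eqpI[of "app a"]) (intro dfn, use el_A0 a_inject in auto)

lemma ad_A0: "ad A0"
 unfolding ad_def
proof (intro conjI ballI impI)
 show "~ fin A0" using lep_trans[OF eqp_lep[OF A0_J]] fin_cnt J_not_cnt by blast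
 show "el x <= el om" "~ fin x" if "x:el A0" for x using that a_omega a_inf sub(1) unfolding el_A0 by blast+
 show "fin (vint x y)" if "x:el A0" "y:el A0" "x ~= y" for x y using that a_ad unfolding el_A0 by blast
qed

text \<open>If \<open>X\<close> were almost disjoint from all members, then outside any finitely
  many of them it would have arbitrarily large elements for a generic set to take, and some member
  would meet \<open>X\<close> in an infinite set.\<close>

lemma mad_A0: "mad A0"
 unfolding mad_def
proof (intro conjI allI impI ad_A0)
 fix X assume X: "el X <= el om" "~ fin X"
 show "EX y:el A0. ~ fin (vint X y)"
 proof (rule ccontr)
  assume n: "~ ?thesis"
  have f: "fin (vint X (app a b))" if "b:el J" for b using that n unfolding el_A0 by blast
  obtain S where S: "cnt S" "!!c z. c:el J ==> c~:el S ==> z:el om ==> EX k:el (app a c). k:el X & k~:el z"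
  proof (rule gen_hit[of "%z k. k:el X & k~:el z" om])
   show "EX k:el om. k~:el m & (ALL b:el e. k~:el (app a b)) & (k:el X & k~:el z)"
    if h: "z:el om" "e:el (Fin J)" "m:el om" for z e m
   proof -
    have "EX k:el X. k~:el (un m z) & (ALL b:el e. k~:el (app a b))"
     by (rule outside[OF X]) (use h f un_nat in auto)
    then show ?thesis using X(1) by auto
   qed
  qed (intro dfn, rule lep_subset, simp, blast)
  obtain c where c: "c:el J" "c~:el S" using S(1) J_not_cnt lep_trans[OF lep_subset] by blast
  have "~ fin (vint X (app a c))" by (rule unbounded_infinite) (use S(2)[OF c] X(1) in auto)
  then show False using f c(1) by blast
 qed
qed

section \<open>Accumulation points in the hyperspace of the first family\<close>

definition "hs R d n = set {F. F:el R & (ALL x:el d. EX k:el F. k:el (nb x n))}"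

lemma [dfn]: "dff s ==> dff t ==> dff u ==> dff (%e. hs (s e) (t e) (u e))"
 by (rule dff_fun3) (unfold hs_def, intro dfn)

lemma el_hs: "el (hs R d n) = {F:el R. ALL x:el d. EX k:el F. k:el (nb x n)}"
 unfolding hs_def by (rule el_sep) (intro dfn)

lemma hs_mono: "el d <= el d' ==> el n <= el n' ==> el (hs R d' n') <= el (hs R d n)"
 unfolding el_hs using nb_mono[of n n'] by blast

text \<open>Maximality of \<open>K\<close> makes \<open>K\<close> closed, and its definition takes
  care of meeting open sets. The difficulty is \<open>main\<close>: infinitely many of the sets must
  also lie inside an open \<open>U\<close> including \<open>K\<close>. If not, generic members of
  the family contain points of these sets outside \<open>U\<close>, against the openness of
  \<open>U\<close> or the maximality of \<open>K\<close>.\<close>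

lemma accumulation:
 assumes R: "el R <= el (Fin om)" "zero~:el R" "~ fin R"
 shows "EX K:el (psiCL A0). ALL C. fin C --> el C <= el (psiT A0) --> vie K C --> ~ fin (set {F. F:el R & vie F C})"
proof -
 have RF: "fin F" "el F <= el om" if "F:el R" for F using that R(1) by auto
 define hit where "hit d <-> (ALL n:el om. ~ fin (hs R d n))" for d
 have dh: "dfn (%e. hit (e 0))" unfolding hit_def by (intro dfn)
 have "hs R zero n = R" for n by (rule el_ext) (simp add: el_hs)
 then have "hit zero" unfolding hit_def using R(3) by simp
 from tukey[of hit "un A0 om", OF dh this] obtain K where K0: "el K <= el (un A0 om)"
  "!!d. fin d ==> el d <= el K ==> hit d"
  "!!x. x:el (un A0 om) ==> x~:el K ==> EX d. fin d & el d <= el K & ~ hit (ins x d)" by blast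
 have K1: "~ fin (hs R d n)" if "fin d" "el d <= el K" "n:el om" for d n
  using K0(2) that unfolding hit_def by blast
 have K2: "EX d n. fin d & el d <= el K & n:el om & fin (hs R (ins x d) n)" if "x:el A0 Un el om" "x~:el K" for x
  using K0(3) that unfolding hit_def by (metis el_un)
 have nat: "nb k n = dbl k k" if "k:el om" for k n using that unfolding nb_def by simp
 have nA: "el (nb x n) = el x - el n" if "x:el A0" for x n
  using ad_not_nat[OF ad_A0 that] unfolding nb_def by simp
 \<comment> \<open>By monotonicity of \<open>hs\<close>, finitely many points outside
   \<open>K\<close> are excluded by the same \<open>d\<close> and \<open>n\<close>.\<close>
 have joint: "EX d n. fin d & el d <= el K & n:el om & (ALL x:el T. fin (hs R (ins x d) n))"
  if T: "fin T" "el T <= el A0 Un el om - el K" for T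
 proof -
  have "el T <= el (vmin (un A0 om) K) -->
   (EX d n. fin d & el d <= el K & n:el om & (ALL x:el T. fin (hs R (ins x d) n)))"
   using T(1)
  proof (induction rule: fin_induct)
   case df show ?case by (intro dfn)
  next
   case zero show ?case by (intro impI exI[of _ zero]) simp
  next
   case (ins y z)
   show ?case
   proof
    assume h: "el (ins z y) <= el (vmin (un A0 om) K)"
    then obtain d n where d: "fin d" "el d <= el K" "n:el om" "ALL x:el y. fin (hs R (ins x d) n)" using ins.IH by auto
    obtain d' n' where d': "fin d'" "el d' <= el K" "n':el om" "fin (hs R (ins z d') n')" using K2[of z] h by auto
    have "fin (hs R (ins x (un d d')) (un n n'))" if "x:el (ins z y)" for x
    proof (cases "x = z")
     case True
     show ?thesis by (rule fin_subset[OF d'(4)], rule hs_mono) (use True in auto)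
    next
     case False
     then have x: "fin (hs R (ins x d) n)" using d(4) that by auto
     show ?thesis by (rule fin_subset[OF x], rule hs_mono) auto
    qed
    then show "EX d n. fin d & el d <= el K & n:el om & (ALL x:el (ins z y). fin (hs R (ins x d) n))"
     using d d' fin_un un_nat by (intro exI[of _ "un d d'"] exI[of _ "un n n'"]) auto
   qed
  qed
  then show ?thesis using T(2) by auto
 qed
 have main: "~ fin (set {F. F:el (hs R d0 n0) & el F <= el U})"
  if U: "U:el (psiT A0)" "el K <= el U" and d0: "fin d0" "el d0 <= el K" and n0: "n0:el om" for U d0 n0
 proof
  let ?B = "set {F. F:el (hs R d0 n0) & el F <= el U}"
  have B: "el ?B = {F:el (hs R d0 n0). el F <= el U}" by (rule el_sep) (intro dfn)
  assume fB: "fin ?B"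
  \<comment> \<open>Only countably many requirements can be met at once. If \<open>K\<close> is
    uncountable, those for the empty set of points will do.\<close>
  define K' where "K' = (if cnt K then K else zero)"
  have K': "el K' <= el K" "cnt K'" using lep_subset[of zero om] unfolding K'_def by auto
  define Z where "Z = times (Fin K') om"
  have Z: "cnt Z" unfolding Z_def by (intro cnt_times cnt_Fin K' lep_subset) simp
  define W where "W z k <-> k~:el U & k~:el (vsnd z) & (EX F:el (hs R (vfst z) (vsnd z)). k:el F)" for z k
  obtain S where S: "cnt S" "!!c z. c:el J ==> c~:el S ==> z:el Z ==> EX k:el (app a c). W z k"
  proof (rule gen_hit[of W Z, OF _ Z])
   show "dfn (%e. W (e 0) (e (Suc 0)))" unfolding W_def by (intro dfn)
   fix z e m assume h: "z:el Z" "e:el (Fin J)" "m:el om"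
   then obtain d1 n1 where z: "z = pr d1 n1" "fin d1" "el d1 <= el K" "n1:el om" using K'(1) unfolding Z_def by auto
   have da: "dff (%e. app a (e 0))" by (intro dfn)
   define T where "T = vmin (img e (app a)) K"
   have T: "el T = app a ` el e - el K" unfolding T_def by (simp add: el_img[OF da])
   have "fin T" by (rule fin_subset[OF fin_img[OF _ da, of e]]) (use h(2) T_def in auto)
   moreover have "el T <= el A0 Un el om - el K" unfolding T el_A0 using h(2) by auto
   ultimately obtain d2 n2 where t: "fin d2" "el d2 <= el K" "n2:el om" "!!x. x:el T ==> fin (hs R (ins x d2) n2)"
    using joint[of T] by blast
   \<comment> \<open>A member of the family that belongs to \<open>K\<close> is almost included in
     \<open>U\<close>; the finite remainder is kept below \<open>q\<close>.\<close>
   define Q where "Q x = (if x:el K then vmin x U else zero)" for x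
   have dQ: "dff (%e. Q (e 0))" unfolding Q_def by (intro dfn)
   have "fin (Q x)" if x: "x:el (img e (app a))" for x
   proof (cases "x:el K")
    case True
    have xA: "x:el A0" using x h(2) unfolding el_img[OF da] el_A0 by auto
    then obtain n where "n:el om" "el x - el n <= el U" using U True psiT by blast
    then show ?thesis using fin_subset[OF fin_nat, of n "vmin x U"] True unfolding Q_def by auto
   qed (simp add: Q_def)
   then have "fin (vUN (img e (app a)) Q)" by (intro fin_vUN[OF dQ] fin_img[OF _ da]) (use h(2) in auto)
   moreover have "el (vUN (img e (app a)) Q) <= el om"
    proof -
    have "el (app a b) <= el om" if "b:el e" for b using that h(2) a_omega sub(1) by auto
    moreover have "el (Q x) <= el x" for x unfolding Q_def by auto
    ultimately show ?thesis unfolding el_vUN[OF dQ] el_img[OF da] by fastforce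
   qed
   ultimately obtain q where q: "q:el om" "el (vUN (img e (app a)) Q) <= el q" using fin_bounded by blast
   define m' where "m' = un m (un n1 (un n2 q))"
   have m': "m':el om" "el m' = el m Un el n1 Un el n2 Un el q"
    unfolding m'_def using un_nat h(3) z(4) t(3) q(1) by auto
   have "fin (vmin m' K)" by (rule fin_subset[OF fin_nat[OF m'(1)]]) simp
   moreover have "el (vmin m' K) <= el A0 Un el om - el K" using nat_in_omega[OF m'(1)] by auto
   ultimately obtain d3 n3 where r: "fin d3" "el d3 <= el K" "n3:el om" "!!x. x:el (vmin m' K) ==> fin (hs R (ins x d3) n3)"
    using joint[of "vmin m' K"] by blast
   define d where "d = un d0 (un d1 (un d2 d3))"
   define n where "n = un n0 (un n1 (un n2 n3))"
   have d: "fin d" "el d <= el K" unfolding d_def using d0 z t r fin_un by auto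
   have n: "n:el om" unfolding n_def using n0 z t r un_nat by auto
   have dh1: "dff (%e. hs R (ins (e 0) d2) n2)" and dh2: "dff (%e. hs R (ins (e 0) d3) n3)" by (intro dfn)+
   \<comment> \<open>Finitely many exceptions: sets inside \<open>U\<close>, sets meeting some
     \<open>app a b\<close> outside \<open>K\<close> beyond \<open>n2\<close>, and sets containing a
     number below \<open>m'\<close> that is not in \<open>K\<close>. Any other set that hits
     \<open>d\<close> has a point outside \<open>U\<close>, and this point satisfies all
     requirements.\<close>
   define Y where "Y = un ?B (un (vUN T (%x. hs R (ins x d2) n2)) (vUN (vmin m' K) (%x. hs R (ins x d3) n3)))"
   have Y: "el Y = el ?B Un (UN x:el T. el (hs R (ins x d2) n2)) Un (UN x:el (vmin m' K). el (hs R (ins x d3) n3))"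
    unfolding Y_def by (simp only: el_un el_vUN[OF dh1] el_vUN[OF dh2] Un_assoc)
   have "fin Y" unfolding Y_def
    by (intro fin_un fB fin_vUN[OF dh1] fin_vUN[OF dh2] \<open>fin T\<close> \<open>fin (vmin m' K)\<close> t(4) r(4))
   then obtain F where F: "F:el (hs R d n)" "F~:el Y" using K1[OF d n] fin_subset by blast
   have Fd: "F:el (hs R d0 n0)" "F:el (hs R d1 n1)" "F:el (hs R d2 n2)" "F:el (hs R d3 n3)"
    using F(1) hs_mono[of _ d _ n R] unfolding d_def n_def by auto
   have FR: "F:el R" using F(1) unfolding el_hs by blast
   have "~ el F <= el U" using F(2) Fd(1) unfolding Y B by blast
   then obtain k where k: "k:el F" "k~:el U" by blast
   have ko: "k:el om" using RF[OF FR] k(1) by blast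
   have kK: "k~:el K" using U(2) k(2) by blast
   have add: "F:el (hs R (ins x d') n')" if "F:el (hs R d' n')" "k:el (nb x n')" for x d' n'
    using that k(1) unfolding el_hs by auto
   have km: "k~:el m'"
   proof
    assume "k:el m'"
    moreover have "F:el (hs R (ins k d3) n3)" by (rule add[OF Fd(4)]) (simp add: nat[OF ko])
    ultimately show False using F(2) kK unfolding Y by auto
   qed
   have kb: "k~:el (app a b)" if b: "b:el e" for b
   proof
    assume kb: "k:el (app a b)"
    have bA: "app a b:el A0" using b h(2) el_A0 by auto
    show False
    proof (cases "app a b:el K")
     case True
     then have "k:el (vUN (img e (app a)) Q)" using b kb k(2) unfolding el_vUN[OF dQ] el_img[OF da] Q_def by auto
     then show False using q(2) km m'(2) by blast
    next
     case False
     then have "app a b:el T" unfolding T using b by blast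
     moreover have "F:el (hs R (ins (app a b) d2) n2)"
      by (rule add[OF Fd(3)]) (use nA[OF bA] kb km m'(2) in blast)
     ultimately show False using F(2) unfolding Y by blast
    qed
   qed
   have "W z k" unfolding W_def z vfst_pr vsnd_pr using k km m'(2) Fd(2) by blast
   then show "EX k:el om. k~:el m & (ALL b:el e. k~:el (app a b)) & W z k" using ko km m'(2) kb by blast
  qed blast
  show False
  \<comment> \<open>If \<open>K\<close> is countable, some generic member is outside
    \<open>K\<close>, and the sets through its points contradict maximality. Otherwise some generic
    member belongs to \<open>K\<close>, so it is almost included in \<open>U\<close>, and yet has
    points outside \<open>U\<close> beyond any bound.\<close>
  proof (cases "cnt K")
   case True
   have "EX c:el J. c~:el S & app a c~:el K"
   proof (rule ccontr)
    assume "~ ?thesis"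
    then have "lep (vmin J S) K" by (intro lepI[of "app a"]) (intro dfn, use a_inject in auto)
    then have "cnt (un S (vmin J S))" by (intro cnt_un S(1) lep_trans[OF _ True])
    then show False using J_not_cnt lep_trans[OF lep_subset, of J "un S (vmin J S)"] by auto
   qed
   then obtain c where c: "c:el J" "c~:el S" "app a c~:el K" by blast
   have cA: "app a c:el A0" using c el_A0 by blast
   obtain d n where d: "fin d" "el d <= el K" "n:el om" "fin (hs R (ins (app a c) d) n)" using K2[of "app a c"] cA c(3) by blast
   let ?Y = "Uni (hs R (ins (app a c) d) n)"
   have "fin ?Y" by (rule fin_Uni[OF d(4)]) (use RF el_hs in blast)
   moreover have "el ?Y <= el om" using RF(2) el_hs by auto
   ultimately obtain q where q: "q:el om" "el ?Y <= el q" using fin_bounded by blast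
   have "pr d (un n q):el Z" unfolding Z_def K'_def using True d un_nat q by simp
   then obtain k where k: "k:el (app a c)" "W (pr d (un n q)) k" using S(2)[OF c(1,2)] by blast
   then obtain F where F: "F:el (hs R d (un n q))" "k:el F" "k~:el n" "k~:el q" unfolding W_def by auto
   have "F:el (hs R d n)" using F(1) hs_mono[of d d n "un n q" R] by auto
   moreover have "k:el (nb (app a c) n)" using nA[OF cA] k(1) F(3) by blast
   ultimately have "F:el (hs R (ins (app a c) d) n)" using F(2) unfolding el_hs by auto
   then show False using q(2) F(2,4) by auto
  next
   case False
   have "EX c:el J. c~:el S & app a c:el K"
   proof (rule ccontr)
    assume n: "~ ?thesis"
    have da: "dff (%e. app a (e 0))" by (intro dfn)
    have "el K <= el (un om (img S (app a)))" using K0(1) n unfolding el_un el_img[OF da] el_A0 by blast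
    moreover have "cnt (un om (img S (app a)))" by (intro cnt_un lep_trans[OF lep_img[OF da] S(1)] lep_subset) simp
    ultimately show False using False lep_trans[OF lep_subset] by blast
   qed
   then obtain c where c: "c:el J" "c~:el S" "app a c:el K" by blast
   then obtain n where n: "n:el om" "el (app a c) - el n <= el U" using U psiT el_A0 by blast
   have "pr zero n:el Z" unfolding Z_def using n by simp
   then obtain k where "k:el (app a c)" "W (pr zero n) k" using S(2)[OF c(1,2)] by blast
   then show False using n(2) unfolding W_def by auto
  qed
 qed
 have "K ~= zero"
 proof
  assume z: "K = zero"
  have "zero:el (psiT A0)" unfolding psiT by simp
  then have "~ fin (set {F. F:el (hs R zero zero) & el F <= el zero})"
   by (rule main) (use z in simp_all)
  moreover have "el (set {F. F:el (hs R zero zero) & el F <= el zero}) = {F:el (hs R zero zero). el F <= el zero}"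
   by (rule el_sep) (intro dfn)
  then have "el (set {F. F:el (hs R zero zero) & el F <= el zero}) = {}" using R(2) zero_iff unfolding el_hs by auto
  then have "set {F. F:el (hs R zero zero) & el F <= el zero} = zero" using zero_iff by blast
  ultimately show False by simp
 qed
 moreover have "EX n:el om. el x - el n <= el A0 Un el om - el K" if x: "x:el A0" "x~:el K" for x
 proof -
  obtain d n where d: "fin d" "el d <= el K" "n:el om" "fin (hs R (ins x d) n)" using K2[of x] x by blast
  \<comment> \<open>A set that contains \<open>k\<close> also meets the neighbourhood of
    \<open>x\<close>. With \<open>k\<close> in \<open>K\<close>, infinitely many sets would thus hit
    \<open>x\<close> together with \<open>d\<close>.\<close>
  have "k~:el K" if k: "k:el x - el n" for k
  proof
   assume kK: "k:el K"
   have ko: "k:el om" using ad_A0 x(1) k unfolding ad_def by blast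
   have "k:el (nb x n)" using nA[OF x(1)] k by blast
   then have "el (hs R (ins k d) n) <= el (hs R (ins x d) n)" unfolding el_hs nat[OF ko] by (auto simp: nat[OF ko])
   then show False using K1[of "ins k d" n] d kK fin_subset by auto
  qed
  moreover have "el x <= el om" using ad_A0 x(1) unfolding ad_def by blast
  ultimately show ?thesis by (intro bexI[OF _ d(3)]) blast
 qed
 ultimately have "K:el (psiCL A0)" unfolding psiCL using K0(1) by simp
 moreover have "~ fin (set {F. F:el R & vie F C})" if C: "fin C" "el C <= el (psiT A0)" "vie K C" for C
 proof -
  have meet: "EX x:el K. x:el U" if "U:el C" for U using C(3) that unfolding vie_def by blast
  have "el C <= el C --> (EX d n. fin d & el d <= el K & n:el om & (ALL U:el C. EX x:el d. el (nb x n) <= el U))"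
   using C(1)
  proof (induction rule: fin_induct)
   case df show ?case by (intro dfn)
  next
   case zero show ?case by (intro impI exI[of _ zero]) simp
  next
   case (ins y z)
   obtain d n where d: "fin d" "el d <= el K" "n:el om" "ALL U:el y. EX x:el d. el (nb x n) <= el U"
    using ins.IH by auto
   obtain x where x: "x:el K" "x:el z" using meet ins.hyps(2) by blast
   obtain n' where n': "n':el om" "el (nb x n') <= el z" using psiT_nb[OF subsetD[OF C(2) ins.hyps(2)] x(2)] by blast
   have "el (nb u (un n n')) <= el (nb u n)" "el (nb u (un n n')) <= el (nb u n')" for u by (rule nb_mono, simp)+
   then have "ALL U:el (ins z y). EX x:el (ins x d). el (nb x (un n n')) <= el U" using d(4) n'(2) by simp (meson subset_trans)
   then show ?case using d x n' un_nat by (intro impI exI[of _ "ins x d"] exI[of _ "un n n'"]) auto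
  qed
  then obtain d n where d: "fin d" "el d <= el K" "n:el om" "ALL U:el C. EX x:el d. el (nb x n) <= el U" by blast
  have "Uni C:el (psiT A0)" unfolding psiT
  proof (intro conjI ballI impI)
   show "el (Uni C) <= el A0 Un el om" using C(2) psiT by auto
   fix x assume x: "x:el A0" "x:el (Uni C)"
   then obtain U where U: "U:el C" "x:el U" by auto
   then obtain n where n: "n:el om" "el x - el n <= el U" using C(2) x(1) psiT by blast
   show "EX n:el om. el x - el n <= el (Uni C)" by (rule bexI[OF _ n(1)]) (use n(2) U(1) in auto)
  qed
  then have inf: "~ fin (set {F. F:el (hs R d n) & el F <= el (Uni C)})"
   by (rule main) (use C(3) d in \<open>auto simp: vie_def\<close>)
  have e1: "el (set {F. F:el (hs R d n) & el F <= el (Uni C)}) = {F:el (hs R d n). el F <= el (Uni C)}"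
   by (rule el_sep) (intro dfn)
  have e2: "el (set {F. F:el R & vie F C}) = {F:el R. vie F C}" by (rule el_sep) (intro dfn)
  have "el (set {F. F:el (hs R d n) & el F <= el (Uni C)}) <= el (set {F. F:el R & vie F C})"
  proof
   fix F assume "F:el (set {F. F:el (hs R d n) & el F <= el (Uni C)})"
   then have F: "F:el R" "ALL x:el d. EX k:el F. k:el (nb x n)" "el F <= el (Uni C)"
    unfolding e1 unfolding el_hs by blast+
   have "EX x:el F. x:el U" if "U:el C" for U using d(4) F(2) that by (meson subsetD)
   then show "F:el (set {F. F:el R & vie F C})" unfolding e2 unfolding vie_def using F by blast
  qed
  then show ?thesis using inf fin_subset by blast
 qed
 ultimately show ?thesis by blast
qed

end

context gext
begin

section \<open>The continuum exceeds \<open>w\<close>\<close>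

lemma fibre_cnt: "cnt (set {c. c:el L & app a c = r})"
proof -
 let ?T = "set {c. c:el L & app a c = r}"
 have T: "el ?T = {c:el L. app a c = r}" by (rule el_sep) (intro dfn)
 have "EX S. cnt S & (ALL c:el L. c~:el S --> (c:el J --> True) -->
  (ALL z:el (dbl r r). EX m:el om. vint (app a c) m ~= vint z m))"
 proof (rule gen_fam)
  show "dfn (%e. e (Suc (Suc 0)) ~= vint (e 0) (e (Suc 0)))" by (intro dfn)
  show "cnt (dbl r r)" by (rule fin_cnt) simp
  fix z e m s assume h: "z:el (dbl r r)" "e:el (Fin J)" "m:el om" "el s <= el m"
  obtain k where k: "k:el om" "k~:el m" "ALL b:el e. k~:el (app a b)" using outside_omega h by blast
  \<comment> \<open>The new element \<open>k\<close> is put into the set exactly if it is not in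
    \<open>z\<close>, so that the generic set differs from \<open>z\<close>.\<close>
  define s' where "s' = (if k:el z then s else ins k s)"
  have m: "el m <= el k" using nat_not_mem h(3) k by blast
  have "k:el s' <-> k~:el (vint z (succ k))" using h(4) k(2) unfolding s'_def by auto
  then have "s' ~= vint z (succ k)" by blast
  then show "EX m' s'. m':el om & s' ~= vint z m' & el m <= el m' & el s' <= el m' & el s' Int el m = el s &
     (True --> (ALL b:el e. ALL k:el s'. k~:el m --> k~:el (app a b)))"
   using k m h(4) succ_omega by (intro exI[of _ "succ k"] exI[of _ s']) (auto simp: s'_def)
 qed
 then obtain S where S: "cnt S" "ALL c:el L. c~:el S --> (c:el J --> True) -->
  (ALL z:el (dbl r r). EX m:el om. vint (app a c) m ~= vint z m)" by blast
 have "el ?T <= el S"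
 proof
  fix c assume "c:el ?T"
  then have c: "c:el L" "app a c = r" unfolding T by blast+
  show "c:el S"
  proof (rule ccontr)
   assume "c~:el S"
   then have "ALL z:el (dbl r r). EX m:el om. vint (app a c) m ~= vint z m" using S(2) c(1) by simp
   then show False using c(2) by simp
  qed
 qed
 then show ?thesis using lep_trans[OF lep_subset S(1)] by blast
qed

text \<open>Each real is the generic set of at most countably many indices, so with at most
  \<open>w\<close> many reals there would be at most \<open>times w om\<close> many indices.\<close>

lemma continuum_big: "~ lep (pw om) w"
proof
 assume h: "lep (pw om) w"
 define T where "T r = set {c. c:el L & app a c = r}" for r
 have T: "el (T r) = {c:el L. app a c = r}" for r unfolding T_def by (rule el_sep) (intro dfn)
 have dT: "dff (%e. T (e 0))" unfolding T_def by (intro dfn)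
 have "el L <= el (Uni (img (pw om) T))" using a_omega by (auto simp: el_img[OF dT] T)
 then have "lep L (Uni (img (pw om) T))" by (rule lep_subset)
 moreover have "lep (Uni (img (pw om) T)) (times (img (pw om) T) om)"
  by (rule lep_Uni) (use fibre_cnt in \<open>auto simp: el_img[OF dT] T_def\<close>)
 moreover have "lep (times (img (pw om) T) om) (times w om)"
  by (rule lep_times[OF lep_trans[OF lep_img[OF dT] h] lep_subset]) simp
 ultimately show False using big lep_trans by blast
qed

text \<open>Nodes of the binary tree, the branches \<open>br f\<close> and the levels \<open>lv n\<close>. A set \<open>app a c\<close> picks a
 node of level \<open>n\<close> if it contains no other node of this level.\<close>

definition "cd n s = app (SOME g. inj_fun g (times om (Fin om)) om) (pr n s)"

definition "br f = img om (%n. cd n (vint f n))"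
definition "lv n = img (pw n) (cd n)"

definition "tr c n s <-> vint (app a c) (lv n) = dbl (cd n s) (cd n s)"

definition "ty X f c <-> el X <= el (br f) & (ALL n:el om. cd n (vint f n):el X --> tr c n (vint f n))"

definition "good X <-> el X <= el om & ~ fin X & ((EX f:el (pw om). EX c:el I. ty X f c) |
  (ALL f:el (pw om). fin (vint X (br f))))"

lemma dff_cd [dfn]: "dff s ==> dff t ==> dff (%e. cd (s e) (t e))"
 by (rule dff_fun2) (unfold cd_def, intro dfn)
lemma [dfn]:
 "dff s ==> dff (%e. br (s e))"
 "dff s ==> dff (%e. lv (s e))"
 by (rule dff_fun1, (unfold br_def lv_def)[1], (intro dfn)[1], assumption+)+
lemma [dfn]: "dff s ==> dff t ==> dff u ==> dfn (%e. tr (s e) (t e) (u e))"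
 by (rule dfn_rel3) (unfold tr_def, intro dfn)
lemma [dfn]: "dff s ==> dff t ==> dff u ==> dfn (%e. ty (s e) (t e) (u e))"
 by (rule dfn_rel3) (unfold ty_def, intro dfn)
lemma [dfn]: "dff s ==> dfn (%e. good (s e))"
 by (rule dfn_rel1) (unfold good_def, intro dfn)

section \<open>Nodes, branches and levels\<close>

lemma cd: "n:el om ==> s:el (Fin om) ==> cd n s:el om"
 "n:el om ==> s:el (Fin om) ==> n':el om ==> s':el (Fin om) ==> cd n s = cd n' s' ==> n = n' & s = s'"
proof -
 have "cnt (times om (Fin om))" by (intro cnt_times cnt_Fin lep_subset) simp_all
 then have "inj_fun (SOME g. inj_fun g (times om (Fin om)) om) (times om (Fin om)) om"
  unfolding lep_def by (rule someI_ex)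
 then have c: "!!u. u:el (times om (Fin om)) ==> app (SOME g. inj_fun g (times om (Fin om)) om) u:el om"
  "!!u v. u:el (times om (Fin om)) ==> v:el (times om (Fin om)) ==>
   app (SOME g. inj_fun g (times om (Fin om)) om) u = app (SOME g. inj_fun g (times om (Fin om)) om) v ==> u = v"
  unfolding inj_fun_def by blast+
 show "n:el om ==> s:el (Fin om) ==> cd n s:el om"
  unfolding cd_def by (rule c(1)) simp
 show "n:el om ==> s:el (Fin om) ==> n':el om ==> s':el (Fin om) ==> cd n s = cd n' s' ==> n = n' & s = s'"
  using c(2)[of "pr n s" "pr n' s'"] unfolding cd_def by simp
qed

lemma sub_nat_Fin: "n:el om ==> el s <= el n ==> s:el (Fin om)"
 using fin_subset[OF fin_nat] nat_in_omega by auto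

lemma node: "n:el om ==> vint f n:el (Fin om)"
 by (rule sub_nat_Fin) auto

lemma cd_inj: "n:el om ==> n':el om ==> el s <= el n ==> el s' <= el n' ==> cd n s = cd n' s' ==> n = n' & s = s'"
 using cd(2) sub_nat_Fin by blast

lemma node_inj: "n:el om ==> n':el om ==> cd n (vint f n) = cd n' (vint f' n') ==> n = n' & vint f n = vint f' n'"
 using cd(2) node by blast

lemma el_br: "el (br f) = (%n. cd n (vint f n)) ` el om"
 unfolding br_def by (rule el_img) (intro dfn)
lemma el_lv: "el (lv n) = cd n ` {s. el s <= el n}"
 unfolding lv_def using el_img[of "cd n" "pw n"] dff_cd[OF dff_const dff_var] by simp

lemma br_omega: "el (br f) <= el om"
 unfolding el_br using cd(1) node by blast
lemma lv_omega: "n:el om ==> el (lv n) <= el om"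
 unfolding el_lv using cd(1) sub_nat_Fin by blast
lemma fin_lv: "n:el om ==> fin (lv n)"
 unfolding lv_def by (rule fin_img[OF fin_pw[OF fin_nat]]) (assumption, intro dfn)
lemma lv_ne: "lv n ~= zero"
proof -
 have "cd n zero:el (lv n)" unfolding el_lv by simp
 then show ?thesis by auto
qed
lemma lv_disjoint: "n:el om ==> n':el om ==> k:el (lv n) ==> k:el (lv n') ==> n = n'"
 unfolding el_lv using cd_inj by (elim imageE) blast
lemma br_lv: "n:el om ==> k:el (lv n) ==> k:el (br f) ==> k = cd n (vint f n)"
proof -
 assume n: "n:el om" and k: "k:el (lv n)" "k:el (br f)"
 obtain s where s: "el s <= el n" "k = cd n s" using k(1) unfolding el_lv by blast
 obtain m where m: "m:el om" "k = cd m (vint f m)" using k(2) unfolding el_br by blast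
 have "n = m & s = vint f m" by (rule cd_inj) (use n s m in auto)
 then show ?thesis using s by simp
qed

lemma br_inf: "~ fin (br f)"
proof
 assume "fin (br f)"
 moreover have "lep om (br f)"
 proof (rule lepI[of "%n. cd n (vint f n)"])
  show "dff (%e. cd (e 0) (vint f (e 0)))" by (intro dfn)
 qed (use el_br node_inj in blast)+
 ultimately show False using fin_lep not_fin_omega by blast
qed

lemma differ: "el f <= el om ==> el f' <= el om ==> f ~= f' ==>
 EX k:el om. ALL n:el om. vint f n = vint f' n --> n:el (succ k)"
proof -
 assume h: "el f <= el om" "el f' <= el om" "f ~= f'"
 then obtain k where k: "k:el f <-> k~:el f'" using el_ext by blast
 then have ko: "k:el om" using h by blast
 have "n:el (succ k)" if n: "n:el om" "vint f n = vint f' n" for n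
 proof (rule ccontr)
  assume "n~:el (succ k)"
  then have "k:el n" using Ord_linear[OF Ord_nat[OF n(1)] Ord_nat[OF ko]] by auto
  then have "k:el (vint f n) <-> k~:el (vint f' n)" using k by auto
  then show False unfolding n(2) by blast
 qed
 then show ?thesis using ko by blast
qed

lemma br_ad: "el f <= el om ==> el f' <= el om ==> f ~= f' ==> fin (vint (br f) (br f'))"
proof -
 assume "el f <= el om" "el f' <= el om" "f ~= f'"
 from differ[OF this] obtain k where k: "k:el om" "ALL n:el om. vint f n = vint f' n --> n:el (succ k)" ..
 have d: "dff (%e. cd (e 0) (vint f (e 0)))" by (intro dfn)
 have "el (vint (br f) (br f')) <= el (img (succ k) (%n. cd n (vint f n)))"
 proof
  fix x assume "x:el (vint (br f) (br f'))"
  then obtain n n' where n: "n:el om" "x = cd n (vint f n)" "n':el om" "x = cd n' (vint f' n')" by (auto simp: el_br)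
  then have "n = n' & vint f n = vint f' n'" using cd(2) node by metis
  then show "x:el (img (succ k) (%n. cd n (vint f n)))" unfolding el_img[OF d] using k(2) n by (intro image_eqI[of _ _ n]) auto
 qed
 then show ?thesis using fin_subset[OF fin_img[OF fin_nat[OF succ_omega[OF k(1)]] d]] by blast
qed

text \<open>If \<open>X\<close> meets a branch in an infinite set, a Cohen set picks at infinitely
  many levels the node of this branch, with that node in \<open>X\<close>; these nodes form a good
  set. The index of the Cohen set is outside \<open>J\<close>, hence \<open>False\<close> in place
  of \<open>av\<close>.\<close>

lemma good_below:
 assumes X: "el X <= el om" "~ fin X"
 shows "EX Y. good Y & el Y <= el X"
proof (cases "ALL f:el (pw om). fin (vint X (br f))")
 case True
 then have "good X" unfolding good_def using X by blast
 then show ?thesis by blast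
next
 case False
 then obtain f where f: "el f <= el om" "~ fin (vint X (br f))" by auto
 have d: "dff (%e. cd (e 0) (vint f (e 0)))" by (intro dfn)
 obtain M where M: "el M = {n:el om. cd n (vint f n):el X}" by (erule sep_ex) (intro dfn)
 have "el (vint X (br f)) <= el (img M (%n. cd n (vint f n)))" unfolding el_img[OF d] M by (auto simp: el_br)
 then have Mi: "~ fin M" using f(2) fin_subset[OF fin_img[OF _ d]] by blast
 define W where "W z m s <-> (EX n:el om. n~:el z & cd n (vint f n):el X & el (lv n) <= el m &
  vint s (lv n) = dbl (cd n (vint f n)) (cd n (vint f n)))" for z m s
 have "EX S. cnt S & (ALL c:el L. c~:el S --> (c:el J --> False) --> (ALL z:el om. EX m:el om. W z m (vint (app a c) m)))"
 proof (rule gen_fam)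
  show "dfn (%e. W (e 0) (e (Suc 0)) (e (Suc (Suc 0))))" unfolding W_def by (intro dfn)
  show "cnt om" by (rule lep_subset) simp
  fix z e m s assume h: "z:el om" "e:el (Fin J)" "m:el om" "el s <= el m"
  \<comment> \<open>The level of a node. Only finitely many levels meet \<open>m\<close>, so there
    is one outside \<open>m\<close> whose node on the branch belongs to \<open>X\<close>.\<close>
  define lev where "lev k = Uni (set {n. n:el om & k:el (lv n)})" for k
  have dlev: "dff (%e. lev (e 0))" unfolding lev_def by (intro dfn)
  have lev: "lev k = n" if n: "n:el om" "k:el (lv n)" for k n
  proof -
   have "el (set {n. n:el om & k:el (lv n)}) = {n:el om. k:el (lv n)}"
    by (rule el_sep) (intro dfn)
   also have "... = {n}" using n lv_disjoint by blast
   finally show ?thesis unfolding lev_def by (intro el_ext) simp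
  qed
  have "fin (un (img m lev) z)" by (intro fin_un fin_img[OF fin_nat dlev] fin_nat h)
  then obtain n where n: "n:el M" "n~:el (un (img m lev) z)" using Mi fin_subset by blast
  have no: "n:el om" using n(1) M by blast
  have dis: "k~:el m" if "k:el (lv n)" for k using n(2) lev[OF no that] by (auto simp: el_img[OF dlev])
  have "fin (un m (lv n))" "el (un m (lv n)) <= el om" using fin_un fin_nat fin_lv lv_omega no h(3) nat_in_omega by auto
  then obtain m' where m': "m':el om" "el (un m (lv n)) <= el m'" using fin_bounded by blast
  let ?k = "cd n (vint f n)"
  have k: "?k:el (lv n)" unfolding el_lv by simp
  have "vint (ins ?k s) (lv n) = dbl ?k ?k" by (rule el_ext) (use k dis h(4) in auto)
  then have "W z m' (ins ?k s)" unfolding W_def using n no M m'(2) by (intro bexI[OF _ no]) auto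
  moreover have "el (ins ?k s) Int el m = el s" using h(4) dis[OF k] by auto
  moreover have "el (ins ?k s) <= el m'" "el m <= el m'" using h(4) k m'(2) by auto
  ultimately show "EX m' s'. m':el om & W z m' s' & el m <= el m' & el s' <= el m' & el s' Int el m = el s &
     (False --> (ALL b:el e. ALL k:el s'. k~:el m --> k~:el (app a b)))" using m'(1) by blast
 qed
 then obtain S where S: "cnt S" "ALL c:el L. c~:el S --> (c:el J --> False) --> (ALL z:el om. EX m:el om. W z m (vint (app a c) m))" by blast
 have "~ cnt I" using Iw w(2) lep_trans[OF eqp_lep[OF eqp_sym]] by blast
 then obtain c where c: "c:el I" "c~:el S" using S(1) lep_trans[OF lep_subset] by blast
 have "c:el L" "c~:el J" using c(1) sub by blast+
 then have cW: "EX m:el om. W z m (vint (app a c) m)" if "z:el om" for z using S(2) c(2) that by blast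
 obtain N where N: "el N = {n:el M. tr c n (vint f n)}" by (erule sep_ex) (intro dfn)
 have Ni: "~ fin N"
 proof (rule unbounded_infinite)
  fix z assume "z:el om"
  then obtain m n where n: "n:el om" "n~:el z" "cd n (vint f n):el X" "el (lv n) <= el m"
   "vint (vint (app a c) m) (lv n) = dbl (cd n (vint f n)) (cd n (vint f n))" using cW unfolding W_def by blast
  have "vint (vint (app a c) m) (lv n) = vint (app a c) (lv n)" by (rule el_ext) (use n(4) in auto)
  then have "n:el N" unfolding N M tr_def using n by simp
  then show "EX n:el N. n~:el z" using n(2) by blast
 qed (use N M in blast)
 define Y where "Y = img N (%n. cd n (vint f n))"
 have Y: "el Y = (%n. cd n (vint f n)) ` el N" unfolding Y_def by (rule el_img[OF d])
 have No: "n:el om" if "n:el N" for n using that N M by blast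
 have "lep N Y"
 proof (rule lepI[of "%n. cd n (vint f n)", OF d])
  show "u = v" if "u:el N" "v:el N" "cd u (vint f u) = cd v (vint f v)" for u v
   using node_inj[OF No No] that by blast
 qed (use Y in blast)
 then have "~ fin Y" using Ni fin_lep by blast
 moreover have YX: "el Y <= el X" using N M Y by auto
 moreover have "ty Y f c" unfolding ty_def
 proof (intro conjI ballI impI)
  show "el Y <= el (br f)" unfolding Y el_br using No by blast
  show "tr c n (vint f n)" if "n:el om" "cd n (vint f n):el Y" for n
  proof -
   obtain n' where n': "n':el N" "cd n (vint f n) = cd n' (vint f n')" using \<open>cd n (vint f n):el Y\<close> Y by blast
   then have "n = n'" using node_inj[OF \<open>n:el om\<close> No[OF n'(1)]] by blast
   then show ?thesis using n'(1) N by blast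
  qed
 qed
 ultimately have "good Y" unfolding good_def using X(1) f(1) c(1) by auto
 then show ?thesis using YX by blast
qed

section \<open>The second family\<close>

lemma exists_A1: "EX A. (ALL x:el A. good x) & (ALL x:el A. ALL y:el A. x ~= y --> fin (vint x y)) &
 (ALL x. good x --> (EX y:el A. ~ fin (vint x y)))"
proof -
 obtain X where X: "el X = {x:el (pw om). good x}" by (erule sep_ex) (intro dfn)
 define P where "P d <-> (ALL x:el d. ALL y:el d. x ~= y --> fin (vint x y))" for d
 have "dfn (%e. P (e 0))" "P zero" unfolding P_def by (intro dfn) simp
 from tukey[of P X, OF this] obtain K where K: "el K <= el X" "!!d. fin d ==> el d <= el K ==> P d"
  "!!x. x:el X ==> x~:el K ==> EX d. fin d & el d <= el K & ~ P (ins x d)" by blast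
 have com: "vint x y = vint y x" for x y by (rule el_ext) auto
 have p: "fin (vint x y)" if "x:el K" "y:el K" "x ~= y" for x y
  using K(2)[of "dbl x y"] that unfolding P_def by simp
 moreover have "EX y:el K. ~ fin (vint x y)" if x: "good x" for x
 proof (cases "x:el K")
  case True
  have "vint x x = x" by (rule el_ext) simp
  moreover have "~ fin x" using x unfolding good_def by blast
  ultimately show ?thesis using True by (intro bexI[of _ x]) simp_all
 next
  case False
  have "x:el X" using x unfolding X good_def by simp
  then obtain d where d: "el d <= el K" "~ P (ins x d)" using K(3) False by blast
  then obtain u v where "u:el (ins x d)" "v:el (ins x d)" "u ~= v" "~ fin (vint u v)" unfolding P_def by blast
  then consider "u = x" "v:el d" | "v = x" "u:el d" | "u:el d" "v:el d" by auto
  then show ?thesis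
   by cases (use \<open>~ fin (vint u v)\<close> \<open>u ~= v\<close> d(1) p com in \<open>auto simp: subset_iff\<close>)
 qed
 ultimately show ?thesis using K(1) X by blast
qed

definition "A1 = (SOME A. (ALL x:el A. good x) & (ALL x:el A. ALL y:el A. x ~= y --> fin (vint x y)) &
  (ALL x. good x --> (EX y:el A. ~ fin (vint x y))))"

lemma A1: "x:el A1 ==> good x" "x:el A1 ==> y:el A1 ==> x ~= y ==> fin (vint x y)"
 "good x ==> EX y:el A1. ~ fin (vint x y)"
 using someI_ex[OF exists_A1, folded A1_def] by blast+

text \<open>By \<open>good_below\<close>, maximality among good sets already implies maximality
  among all infinite sets.\<close>

lemma A1_meets: "el x <= el om ==> ~ fin x ==> EX y:el A1. ~ fin (vint x y)"
proof -
 assume "el x <= el om" "~ fin x"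
 then obtain Y where Y: "good Y" "el Y <= el x" using good_below by blast
 then obtain y where y: "y:el A1" "~ fin (vint Y y)" using A1(3) by blast
 have "~ fin (vint x y)" using y(2) fin_subset[of "vint x y" "vint Y y"] Y(2) by auto
 then show ?thesis using y(1) by blast
qed

text \<open>Branches are almost disjoint, so a member lying on another branch could not meet
  \<open>br f\<close> in an infinite set.\<close>

lemma on_branch:
 assumes "X:el A1" "el f <= el om" "~ fin (vint (br f) X)"
 shows "EX c:el I. ty X f c"
proof -
 have "vint (br f) X = vint X (br f)" by (rule el_ext) auto
 then obtain f' c where f': "el f' <= el om" "c:el I" "ty X f' c"
  using A1(1)[OF assms(1)] assms(2,3) unfolding good_def by auto
 have "f' = f"
 proof (rule ccontr)
  assume "f' ~= f"
  then have "fin (vint (br f) (br f'))" using br_ad f'(1) assms(2) by blast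
  moreover have "el (vint (br f) X) <= el (vint (br f) (br f'))" using f'(3) unfolding ty_def by auto
  ultimately show False using fin_subset assms(3) by blast
 qed
 then show ?thesis using f' by blast
qed

text \<open>Every branch includes a member of the family, and the members on different branches
  differ since branches are almost disjoint.\<close>

lemma A1_pw: "eqp A1 (pw om)"
proof (rule cantor_bernstein)
 show "lep A1 (pw om)" by (rule lep_subset) (use A1(1) good_def in auto)
 define T where "T f = set {X. X:el A1 & el X <= el (br f)}" for f
 have T: "el (T f) = {X:el A1. el X <= el (br f)}" for f unfolding T_def by (rule el_sep) (intro dfn)
 have dT: "dff (%e. T (e 0))" unfolding T_def by (intro dfn)
 obtain ch where ch: "!!y. y:el (img (pw om) T) ==> el y ~= {} ==> app ch y:el y" using choice_fun by blast
 have F: "app ch (T f):el (T f)" if f: "f:el (pw om)" for f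
 proof -
  obtain X where "X:el A1" "~ fin (vint (br f) X)" using A1_meets[OF br_omega br_inf] by blast
  then have "X:el (T f)" unfolding T using on_branch[of X f] f unfolding ty_def by auto
  then show ?thesis by (intro ch) (use f el_img[OF dT] in auto)
 qed
 show "lep (pw om) A1"
 proof (rule lepI[of "%f. app ch (T f)"])
  show "dff (%e. app ch (T (e 0)))" by (intro dfn dT)
  show "f = f'" if h: "f:el (pw om)" "f':el (pw om)" "app ch (T f) = app ch (T f')" for f f'
  proof (rule ccontr)
   assume "f ~= f'"
   then have "fin (vint (br f) (br f'))" using br_ad h by simp
   moreover have "el (app ch (T f)) <= el (vint (br f) (br f'))" using F[OF h(1)] F[OF h(2)] h(3) unfolding T by auto
   ultimately have "fin (app ch (T f))" using fin_subset by blast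
   then show False using A1(1) F[OF h(1)] unfolding T good_def by blast
  qed
 qed (use F T in blast)
qed

lemma mad_A1: "mad A1"
proof -
 have "~ fin A1" using lep_trans[OF eqp_lep[OF eqp_sym[OF A1_pw]]] fin_cnt cantor by blast
 then show ?thesis unfolding mad_def ad_def using A1(1,2) A1_meets good_def by blast
qed

lemma open_cofin: "ad A ==> fin F ==> el F <= el om ==> vmin (un A om) F:el (psiT A)"
proof -
 assume A: "ad A" and F: "fin F" "el F <= el om"
 obtain n where n: "n:el om" "el F <= el n" using fin_bounded F by blast
 show ?thesis unfolding psiT
 proof (intro conjI ballI impI bexI[OF _ n(1)])
  show "el x - el n <= el (vmin (un A om) F)" if "x:el A" for x using that A n(2) unfolding ad_def by auto
 qed auto
qed

lemma open_nat: "ad A ==> el U <= el om ==> U:el (psiT A)"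
 unfolding psiT using ad_not_nat by blast

lemma open_nbhd: "ad A ==> X:el A ==> n:el om ==> ins X (vmin X n):el (psiT A)"
 unfolding psiT
proof (intro conjI ballI impI)
 assume A: "ad A" and X: "X:el A" and n: "n:el om"
 have Xo: "el X <= el om" using A X unfolding ad_def by blast
 then show "el (ins X (vmin X n)) <= el A Un el om" using X by auto
 fix x assume "x:el A" "x:el (ins X (vmin X n))"
 then have "x = X" using ad_not_nat[OF A] Xo by auto
 then show "EX n':el om. el x - el n' <= el (ins X (vmin X n))" using n by auto
qed

lemma vieI: "el F <= el (Uni C) ==> (!!U. U:el C ==> EX x:el F. x:el U) ==> vie F C"
 unfolding vie_def by blast

text \<open>A closed set containing a natural number is separated by elementary means, since at most
  one level contains this number. A closed set of members of the family is the case for which the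
  guessing was designed.\<close>

lemma no_accumulation:
 assumes F: "F:el (psiCL A1)" "!!n. n:el om ==> F ~= lv n"
 shows "EX C. fin C & el C <= el (psiT A1) & vie F C & (ALL n:el om. ~ vie (lv n) C)"
proof -
 have A: "ad A1" using mad_A1 unfolding mad_def by blast
 let ?X = "un A1 om"
 have FX: "el F <= el ?X" and Fne: "el F ~= {}" using F(1) zero_iff unfolding psiCL by auto
 have X: "?X:el (psiT A1)" unfolding psiT using A unfolding ad_def by (auto intro: bexI[OF _ zero_omega])
 show ?thesis
 proof (cases "el F Int el om = {}")
  case False
  then obtain k where k: "k:el F" "k:el om" by blast
  have sk: "dbl k k:el (psiT A1)" by (rule open_nat[OF A]) (use k in simp)
  show ?thesis
  proof (cases "EX n:el om. k:el (lv n)")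
   case False
   then show ?thesis using k FX sk X by (intro exI[of _ "dbl (dbl k k) ?X"]) (auto simp: vie_def)
  next
   case True
   then obtain n where n: "n:el om" "k:el (lv n)" by blast
   have only: "n' = n" if "n':el om" "k:el (lv n')" for n' using lv_disjoint[OF that(1) n(1) that(2) n(2)] .
   show ?thesis
   proof (cases "el F <= el (lv n)")
    case False
    then obtain x where x: "x:el F" "x~:el (lv n)" by blast
    let ?C = "ins (vmin ?X (lv n)) (dbl (dbl k k) ?X)"
    have "el ?C <= el (psiT A1)" using sk X open_cofin[OF A fin_lv[OF n(1)] lv_omega[OF n(1)]] by simp
    moreover have "EX y:el F. y:el (vmin ?X (lv n))" using x FX by (intro bexI[OF _ x(1)]) auto
    then have "vie F ?C" by (intro vieI) (use FX k in auto)
    moreover have "~ vie (lv n') ?C" if "n':el om" for n'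
     using only[OF that] unfolding vie_def by auto
    ultimately show ?thesis by (intro exI[of _ ?C]) simp
   next
    case True
    then obtain p where p: "p:el (lv n)" "p~:el F" using F(2)[OF n(1)] el_ext by blast
    have po: "p:el om" using p(1) lv_omega[OF n(1)] by blast
    let ?C = "dbl (dbl k k) (vmin ?X (dbl p p))"
    have "el ?C <= el (psiT A1)" using sk open_cofin[OF A fin_dbl, of p p] po by simp
    moreover have "vie F ?C" by (rule vieI) (use FX p k in auto)
    moreover have "~ vie (lv n') ?C" if "n':el om" for n'
     using only[OF that] p k(1) unfolding vie_def by auto
    ultimately show ?thesis by (intro exI[of _ ?C]) simp
   qed
  qed
 next
  case F0: True
  have FA: "el F <= el A1" using FX F0 by auto
  show ?thesis
  proof (cases "EX f:el (pw om). ALL X:el F. fin (vint (br f) X)")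
   case True
   then obtain f where f: "el f <= el om" "ALL X:el F. fin (vint (br f) X)" by auto
   \<comment> \<open>The complement of the branch and of the members that meet it in an infinite
     set. No level is included in \<open>U\<close>, as every level meets the branch.\<close>
   obtain U where U: "el U = {x:el ?X. x~:el (br f) & (x:el A1 --> fin (vint (br f) x))}" by (erule sep_ex) (intro dfn)
   have "U:el (psiT A1)" unfolding psiT
   proof (intro conjI ballI impI)
    fix x assume x: "x:el A1" "x:el U"
    then have "fin (vint (br f) x)" unfolding U by blast
    then obtain n where n: "n:el om" "el (vint (br f) x) <= el n" using fin_bounded[of "vint (br f) x"] br_omega by auto
    have "el x <= el om" using A x(1) unfolding ad_def by blast
    then have "el x - el n <= el U" unfolding U using n(2) ad_not_nat[OF A] by auto
    then show "EX n:el om. el x - el n <= el U" using n(1) by blast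
   qed (use U in auto)
   moreover have "el F <= el U" unfolding U using FX F0 f(2) br_omega by blast
   moreover have "~ el (lv n) <= el U" if "n:el om" for n
   proof -
    have "cd n (vint f n):el (lv n)" "cd n (vint f n):el (br f)" using that unfolding el_lv el_br by auto
    then show ?thesis unfolding U by blast
   qed
   ultimately show ?thesis using Fne by (intro exI[of _ "dbl U U"]) (auto simp: vie_def)
  next
   case False
   have ex: "EX X:el F. EX c:el I. ty X f c" if f: "f:el (pw om)" for f
   proof -
    obtain X where "X:el F" "~ fin (vint (br f) X)" using False f by blast
    then show ?thesis using on_branch[of X f] f FA by auto
   qed
   define T where "T f = set {c. c:el I & (EX X:el F. ty X f c)}" for f
   have T: "el (T f) = {c:el I. EX X:el F. ty X f c}" for f unfolding T_def by (rule el_sep) (intro dfn)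
   have dT: "dff (%e. T (e 0))" unfolding T_def by (intro dfn)
   obtain ch where ch: "!!y. y:el (img (pw om) T) ==> el y ~= {} ==> app ch y:el y" using choice_fun by blast
   have chT: "app ch (T f):el (T f)" if "f:el (pw om)" for f
    by (rule ch) (use ex[OF that] that el_img[OF dT] T in auto)
   \<comment> \<open>There are more branches than elements of \<open>I\<close>, so two branches
     share a guess.\<close>
   have "EX f:el (pw om). EX f':el (pw om). f ~= f' & app ch (T f) = app ch (T f')"
   proof (rule ccontr)
    assume h: "~ ?thesis"
    have "lep (pw om) I"
    proof (rule lepI[of "%f. app ch (T f)"])
     show "dff (%e. app ch (T (e 0)))" by (intro dfn dT)
    qed (use h chT T in blast)+
    then show False using continuum_big lep_trans[OF _ eqp_lep[OF Iw]] by blast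
   qed
   then obtain f f' where f: "el f <= el om" "el f' <= el om" "f ~= f'" "app ch (T f) = app ch (T f')" by auto
   define c where "c = app ch (T f)"
   have "c:el (T f)" "c:el (T f')" using chT[of f] chT[of f'] f unfolding c_def by auto
   then obtain Y Y' where Y: "Y:el F" "ty Y f c" "Y':el F" "ty Y' f' c" unfolding T by blast
   from differ[OF f(1-3)] obtain k where k: "k:el om" "ALL n:el om. vint f n = vint f' n --> n:el (succ k)" ..
   have dlv: "dff (%e. lv (e 0))" by (intro dfn)
   have sk: "succ k:el om" using succ_omega k(1) .
   have "fin (vUN (succ k) lv)" by (intro fin_vUN[OF dlv] fin_nat[OF sk] fin_lv nat_in_omega[OF sk])
   moreover have "el (vUN (succ k) lv) <= el om" unfolding el_vUN[OF dlv] using lv_omega nat_in_omega[OF sk] by blast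
   ultimately obtain m where m: "m:el om" "el (vUN (succ k) lv) <= el m" using fin_bounded by blast
   let ?C = "ins ?X (dbl (ins Y (vmin Y m)) (ins Y' (vmin Y' m)))"
   have "el ?C <= el (psiT A1)" using X open_nbhd[OF A _ m(1)] Y FA by auto
   moreover have "vie F ?C" by (rule vieI) (use FX Y Fne in auto)
   moreover have "~ vie (lv n) ?C" if n: "n:el om" for n
   proof
    assume v: "vie (lv n) ?C"
    have hit: "tr c n (vint g n) & n~:el (succ k)"
     if h: "ty Z g c" "Z:el F" "EX x:el (lv n). x:el (ins Z (vmin Z m))" for Z g
    proof -
     obtain x where x: "x:el (lv n)" "x:el (ins Z (vmin Z m))" using h(3) by blast
     have "x:el om" using x(1) lv_omega n by blast
     then have "x ~= Z" using ad_not_nat[OF A] h(2) FA by blast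
     then have x2: "x:el Z" "x~:el m" using x(2) by auto
     then have "x = cd n (vint g n)" using br_lv[OF n x(1)] h(1) unfolding ty_def by blast
     then have "tr c n (vint g n)" using h(1) x2(1) n unfolding ty_def by blast
     moreover have "n~:el (succ k)" using x(1) x2(2) m(2) unfolding el_vUN[OF dlv] by blast
     ultimately show ?thesis by blast
    qed
    have m1: "EX x:el (lv n). x:el (ins Y (vmin Y m))" and m2: "EX x:el (lv n). x:el (ins Y' (vmin Y' m))"
     using v unfolding vie_def by auto
    have t: "tr c n (vint f n)" "tr c n (vint f' n)" "n~:el (succ k)"
     using hit[OF Y(2,1) m1] hit[OF Y(4,3) m2] by blast+
    then have "el (dbl (cd n (vint f n)) (cd n (vint f n))) = el (dbl (cd n (vint f' n)) (cd n (vint f' n)))" unfolding tr_def by simp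
    then have "cd n (vint f n) = cd n (vint f' n)" by simp
    then have "vint f n = vint f' n" using cd(2) n node by blast
    then show False using k(2) n t(3) by blast
   qed
   ultimately show ?thesis by (intro exI[of _ ?C]) simp
  qed
 qed
qed

lemma lv_inject: "n:el om ==> n':el om ==> lv n = lv n' ==> n = n'"
 using lv_disjoint lv_ne zero_iff by (metis all_not_in_conv)

lemma lv_CL: "n:el om ==> lv n:el (psiCL A1)"
 using Fin_psiCL fin_lv lv_omega lv_ne mad_A1 unfolding mad_def by blast

text \<open>Levels are isolated in the hyperspace: the singletons of the elements of a level
  determine a neighbourhood containing nothing else. Around any other point,
  \<open>no_accumulation\<close> gives a neighbourhood where the default \<open>z\<close> is taken
  throughout.\<close>

lemma locally_constant:
 assumes z: "z:el K" and g: "!!n. n:el om ==> app g n:el K"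
 obtains f where "!!n. n:el om ==> app f (lv n) = app g n"
  "!!F. F:el (psiCL A1) ==> app f F:el K"
  "!!F. F:el (psiCL A1) ==> EX C. fin C & el C <= el (psiT A1) & vie F C &
   (ALL F':el (psiCL A1). vie F' C --> app f F' = app f F)"
  "el f = (%F. pr F (app f F)) ` el (psiCL A1)"
proof -
 define lev where "lev F = Uni (set {n. n:el om & F = lv n})" for F
 have dlev: "dff s ==> dff (%e. lev (s e))" for s by (rule dff_fun1) (unfold lev_def, intro dfn)
 have lev: "lev (lv n) = n" if n: "n:el om" for n
 proof -
  have "el (set {n'. n':el om & lv n = lv n'}) = {n':el om. lv n = lv n'}"
   by (rule el_sep) (intro dfn)
  also have "... = {n}" using n lv_inject by blast
  finally show ?thesis unfolding lev_def by (intro el_ext) simp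
 qed
 define ph where "ph F = (if EX n:el om. F = lv n then app g (lev F) else z)" for F
 have dph: "dff (%e. ph (e 0))" unfolding ph_def by (intro dfn dlev)
 define f where "f = lam (psiCL A1) ph"
 have f: "app f F = ph F" if "F:el (psiCL A1)" for F unfolding f_def by (rule app_lam[OF dph that])
 have fl: "app f (lv n) = app g n" if "n:el om" for n
  using that f[OF lv_CL] lev unfolding ph_def by auto
 show ?thesis
 proof (rule that[of f])
  show "app f F:el K" if "F:el (psiCL A1)" for F
   using f[OF that] z g lev unfolding ph_def by auto
  show "el f = (%F. pr F (app f F)) ` el (psiCL A1)"
  proof -
   have "el f = (%F. pr F (ph F)) ` el (psiCL A1)" unfolding f_def by (rule el_lam[OF dph])
   then show ?thesis using f by (auto simp: image_iff)
  qed
  fix F assume F: "F:el (psiCL A1)"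
  show "EX C. fin C & el C <= el (psiT A1) & vie F C & (ALL F':el (psiCL A1). vie F' C --> app f F' = app f F)"
  proof (cases "EX n:el om. F = lv n")
   case True
   then obtain n where n: "n:el om" "F = lv n" by blast
   have ds: "dff (%e. dbl (e 0) (e 0))" by (intro dfn)
   define C where "C = img (lv n) (%x. dbl x x)"
   have C: "el C = (%x. dbl x x) ` el (lv n)" unfolding C_def by (rule el_img[OF ds])
   have "fin C" unfolding C_def by (rule fin_img[OF fin_lv[OF n(1)] ds])
   moreover have "el C <= el (psiT A1)" unfolding C
    using open_nat mad_A1 lv_omega[OF n(1)] unfolding mad_def by auto
   moreover have "vie F' C <-> F' = lv n" for F'
   proof -
    have "vie F' C <-> el F' = el (lv n)" unfolding vie_def C by (auto simp: C)
    then show ?thesis using el_ext by blast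
   qed
   ultimately show ?thesis using n(2) by (intro exI[of _ C]) simp
  next
   case False
   then obtain C where C: "fin C" "el C <= el (psiT A1)" "vie F C" "ALL n:el om. ~ vie (lv n) C" using no_accumulation F by blast
   have "app f F' = z" if "F':el (psiCL A1)" "vie F' C" for F' using f[OF that(1)] C(4) that(2) unfolding ph_def by auto
   then show ?thesis using C F by (intro exI[of _ C]) simp
  qed
 qed (use fl in simp)
qed

end

section \<open>The complete ordered field of a model\<close>

subsection \<open>Differences\<close>

text \<open>Properties of the natural numbers of a model, standard or not, that make their
  differences an ordered domain; \<open>g_disc\<close> serves to write denominators in the form
  \<open>d + 1\<close>.\<close>

class gsem = comm_semiring_1 +
 assumes g_cancel: "a + c = b + c ==> a = b"
  and g_lin: "(EX c. a + c = b) | (EX c. b + c = a)"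
  and g_zero: "a + b = 0 ==> a = 0"
  and g_dom: "a * b = 0 ==> a = 0 | b = 0"
  and g_disc: "a ~= 0 ==> EX b. a = b + 1"

definition grel :: "'a::gsem \<times> 'a => 'a \<times> 'a => bool" where
 "grel x y <-> fst x + snd y = fst y + snd x"

lemma grel_trans: "grel x y ==> grel y z ==> grel x z"
proof -
 assume h: "grel x y" "grel y z"
 have "(fst x + snd z) + snd y = (fst x + snd y) + snd z" by (simp add: ac_simps)
 also have "... = (fst y + snd z) + snd x" using h(1) unfolding grel_def by (simp add: ac_simps)
 also have "... = (fst z + snd x) + snd y" using h(2) unfolding grel_def by (simp add: ac_simps)
 finally show ?thesis unfolding grel_def by (rule g_cancel)
qed

lemma equivp_grel: "equivp grel"
 by (rule equivpI; rule reflpI sympI transpI) (simp add: grel_def, simp add: grel_def, rule grel_trans)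

quotient_type (overloaded) 'a gr = "'a::gsem \<times> 'a" / grel morphisms rep_pair abs_pair by (rule equivp_grel)

definition gmul :: "'a::gsem \<times> 'a => 'a \<times> 'a => 'a \<times> 'a" where
 "gmul x y = (fst x * fst y + snd x * snd y, fst x * snd y + snd x * fst y)"

lemma gmul_left: "grel x x' ==> grel (gmul x y) (gmul x' y)"
proof -
 assume h: "grel x x'"
 have "fst x * fst y + snd x * snd y + (fst x' * snd y + snd x' * fst y) = (fst x + snd x') * fst y + (fst x' + snd x) * snd y"
  by (simp add: algebra_simps)
 also have "... = (fst x' + snd x) * fst y + (fst x + snd x') * snd y" using h unfolding grel_def by simp
 also have "... = fst x' * fst y + snd x' * snd y + (fst x * snd y + snd x * fst y)" by (simp add: algebra_simps)
 finally show ?thesis unfolding grel_def gmul_def by simp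
qed

lemma gmul_comm: "gmul x y = gmul y x"
 unfolding gmul_def by (simp add: algebra_simps)

instantiation gr :: (gsem) comm_ring_1
begin
lift_definition zero_gr :: "'a gr" is "(0, 0)" .
lift_definition one_gr :: "'a gr" is "(1, 0)" .
lift_definition plus_gr :: "'a gr => 'a gr => 'a gr" is "%x y. (fst x + fst y, snd x + snd y)"
 unfolding grel_def by (simp add: ac_simps) (metis add.assoc add.left_commute)
lift_definition uminus_gr :: "'a gr => 'a gr" is "%x. (snd x, fst x)"
 unfolding grel_def by (simp add: ac_simps)
lift_definition times_gr :: "'a gr => 'a gr => 'a gr" is gmul
 using gmul_left gmul_comm grel_trans by metis
definition minus_gr :: "'a gr => 'a gr => 'a gr" where "minus_gr x y = x + - y"
instance
proof
 fix a b c :: "'a gr"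
 show "a + b + c = a + (b + c)" "a + b = b + a" "0 + a = a" "- a + a = 0" "1 * a = a"
  by (transfer, simp add: grel_def gmul_def ac_simps)+
 show "a - b = a + - b" by (simp add: minus_gr_def)
 show "a * b * c = a * (b * c)" "a * b = b * a" "(a + b) * c = a * c + b * c"
  by (transfer, simp add: grel_def gmul_def algebra_simps)+
 show "(0::'a gr) ~= 1" by transfer (simp add: grel_def)
qed
end

lift_definition emb :: "'a::gsem => 'a gr" is "%a. (a, 0)" .

lemma emb_hom: "emb (a + b) = emb a + emb b" "emb (a * b) = emb a * emb b" "emb 0 = 0" "emb 1 = 1"
 by (transfer, simp add: grel_def gmul_def)+

lemma emb_inject: "emb a = emb b <-> a = b"
 by transfer (simp add: grel_def)

lemma gr_cases: "EX a b. x = emb a - emb b"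
proof -
 have "EX a b. x = emb a + - emb b" by transfer (auto simp: grel_def intro: add.commute)
 then show ?thesis by simp
qed

lemma gr_sign: "EX a. x = emb a | x = - emb a"
proof -
 obtain a b where x: "x = emb a - emb b" using gr_cases by blast
 from g_lin[of a b] show ?thesis
 proof
  assume "EX c. a + c = b"
  then obtain c where "b = a + c" by blast
  then have "x = - emb c" using x by (simp add: emb_hom)
  then show ?thesis by blast
 next
  assume "EX c. b + c = a"
  then obtain c where "a = b + c" by blast
  then have "x = emb c" using x by (simp add: emb_hom)
  then show ?thesis by blast
 qed
qed

lemma emb_sum_zero: "emb a + emb b = 0 ==> emb a = 0"
 using g_zero[of a b] emb_inject[of "a + b" 0] by (simp add: emb_hom)

instantiation gr :: (gsem) linordered_idom
begin
definition less_eq_gr :: "'a gr => 'a gr => bool" where "less_eq_gr x y <-> (EX a. y - x = emb a)"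
definition less_gr :: "'a gr => 'a gr => bool" where "less_gr x y <-> x <= y & x ~= y"
definition abs_gr :: "'a gr => 'a gr" where "abs_gr x = (if x < 0 then - x else x)"
definition sgn_gr :: "'a gr => 'a gr" where "sgn_gr x = (if x = 0 then 0 else if 0 < x then 1 else - 1)"
instance
proof
 fix x y z :: "'a gr"
 have anti: "x = y" if h: "x <= y" "y <= x" for x y :: "'a gr"
 proof -
  obtain a b where "y - x = emb a" "x - y = emb b" using h unfolding less_eq_gr_def by blast
  then have "emb a + emb b = 0" by (metis diff_add_cancel add_diff_cancel_left' diff_self add_diff_eq)
  then show ?thesis using emb_sum_zero \<open>y - x = emb a\<close> by (metis eq_iff_diff_eq_0)
 qed
 show "(x < y) = (x <= y & ~ y <= x)" unfolding less_gr_def using anti by (auto simp: less_eq_gr_def intro: exI[of _ 0] simp: emb_hom)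
 show "x <= x" unfolding less_eq_gr_def by (intro exI[of _ 0]) (simp add: emb_hom)
 show "x <= z" if "x <= y" "y <= z"
 proof -
  obtain a b where "y - x = emb a" "z - y = emb b" using \<open>x <= y\<close> \<open>y <= z\<close> unfolding less_eq_gr_def by blast
  then have "z - x = emb (a + b)" unfolding emb_hom by (metis add.commute diff_add_cancel add_diff_eq)
  then show ?thesis unfolding less_eq_gr_def by blast
 qed
 show "x <= y ==> y <= x ==> x = y" by (rule anti)
 show "x <= y | y <= x" using gr_sign[of "y - x"] unfolding less_eq_gr_def by (metis minus_diff_eq minus_minus)
 show "x <= y ==> z + x <= z + y" unfolding less_eq_gr_def by simp
 show "x < y ==> 0 < z ==> z * x < z * y"
 proof -
  assume h: "x < y" "0 < z"
  then obtain a b where a: "y - x = emb a" and b: "z = emb b" unfolding less_gr_def less_eq_gr_def by auto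
  have "z * y - z * x = emb (b * a)" unfolding emb_hom using a b by (simp flip: right_diff_distrib)
  moreover have "z * x ~= z * y"
  proof
   assume "z * x = z * y"
   then have "emb (b * a) = emb 0" using \<open>z * y - z * x = emb (b * a)\<close> by (simp add: emb_hom)
   then have "b = 0 | a = 0" unfolding emb_inject by (rule g_dom)
   then show False using a b h unfolding less_gr_def by (auto simp: emb_hom)
  qed
  ultimately show ?thesis unfolding less_gr_def less_eq_gr_def by blast
 qed
 show "\<bar>x\<bar> = (if x < 0 then - x else x)" by (rule abs_gr_def)
 show "sgn x = (if x = 0 then 0 else if 0 < x then 1 else - 1)" by (rule sgn_gr_def)
qed
end

definition iq :: "'a::gsem => 'a gr fract" where "iq a = Fract (emb a) 1"

lemma iq_hom: "iq (a + b) = iq a + iq b" "iq (a * b) = iq a * iq b" "iq 0 = 0" "iq 1 = 1"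
 unfolding iq_def by (simp_all add: emb_hom Zero_fract_def One_fract_def)

lemma emb_nonneg: "0 <= emb a"
 unfolding less_eq_gr_def by (intro exI[of _ a]) simp

lemma iq_nonneg: "0 <= iq a"
 unfolding iq_def by (simp add: zero_le_Fract_iff emb_nonneg)

lemma Fract_cases_pos: "EX u v. (x::'a::gsem gr fract) = Fract u v & v > 0"
 by (induct x rule: fract_induct_pos) blast

text \<open>A denominator \<open>iq d + 1\<close> is never zero, so fractions can be coded by
  arbitrary triples of natural numbers.\<close>

lemma iq_cases: "EX a b d. (x::'a::gsem gr fract) = (iq a - iq b) / (iq d + 1)"
proof -
 obtain u v where x: "x = Fract u v" "v > 0" by (metis Fract_cases_pos)
 obtain a b where u: "u = emb a - emb b" using gr_cases by blast
 obtain c where v: "v = emb c" using x(2) unfolding less_gr_def less_eq_gr_def by auto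
 then have "c ~= 0" using x(2) by (auto simp: emb_hom)
 then obtain d where "c = d + 1" using g_disc by blast
 then have "x = (iq a - iq b) / (iq d + 1)" using x u v by (simp add: iq_def emb_hom One_fract_def)
 then show ?thesis by blast
qed

text \<open>Archimedean with respect to the natural numbers of the model, the only sense that counts
  inside it: the difference is bounded by \<open>iq a\<close>, and the denominator is at least
  1.\<close>

lemma iq_arch: "EX n. (x::'a::gsem gr fract) <= iq n"
proof -
 obtain a b d where x: "x = (iq a - iq b) / (iq d + 1)" using iq_cases by blast
 have "iq a - iq b <= iq a * (iq d + 1)" using iq_nonneg[of a] iq_nonneg[of b] iq_nonneg[of d]
  by (simp add: algebra_simps add_increasing2)
 then have "x <= iq a" unfolding x using iq_nonneg[of d] by (subst divide_le_eq) (auto simp: add_nonneg_pos)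
 then show ?thesis by blast
qed

subsection \<open>Cauchy sequences in an ordered field\<close>

text \<open>The Cauchy condition with an approximating constant in place of a second index, so that
  only eventual truth occurs; this makes sense for any filter and is easily expressed inside a
  model.\<close>

definition cau :: "'i filter => ('i => 'q::linordered_field) => bool" where
 "cau F f <-> (ALL e>0. EX c. \<forall>\<^sub>F n in F. \<bar>f n - c\<bar> < e)"

definition nul :: "'i filter => ('i => 'q::linordered_field) => bool" where
 "nul F f <-> (ALL e>0. \<forall>\<^sub>F n in F. \<bar>f n\<bar> < e)"

definition psv :: "'i filter => ('i => 'q::linordered_field) => bool" where
 "psv F f <-> (EX e>0. \<forall>\<^sub>F n in F. e < f n)"

lemma [simp]: "nul F (%n. 0)"
 unfolding nul_def by simp

lemma [simp]: "cau F (%n. c)"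
 unfolding cau_def by (auto intro: exI[of _ c])

lemma cau_neg: "cau F f ==> cau F (%n. - f n)"
 unfolding cau_def
proof (intro allI impI)
 fix e :: 'b assume "ALL e>0. EX c. \<forall>\<^sub>F n in F. \<bar>f n - c\<bar> < e" "0 < e"
 then obtain c where "\<forall>\<^sub>F n in F. \<bar>f n - c\<bar> < e" by blast
 then have "\<forall>\<^sub>F n in F. \<bar>- f n - (- c)\<bar> < e" by eventually_elim (simp add: abs_minus_commute)
 then show "EX c. \<forall>\<^sub>F n in F. \<bar>- f n - c\<bar> < e" by blast
qed

lemma cau_add: "cau F f ==> cau F g ==> cau F (%n. f n + g n)"
 unfolding cau_def
proof (intro allI impI)
 fix e :: 'b assume h: "ALL e>0. EX c. \<forall>\<^sub>F n in F. \<bar>f n - c\<bar> < e" "ALL e>0. EX c. \<forall>\<^sub>F n in F. \<bar>g n - c\<bar> < e" "0 < e"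
 then have "0 < e / 2" by simp
 then obtain c d where "\<forall>\<^sub>F n in F. \<bar>f n - c\<bar> < e / 2" "\<forall>\<^sub>F n in F. \<bar>g n - d\<bar> < e / 2" using h(1,2) by blast
 then have "\<forall>\<^sub>F n in F. \<bar>f n + g n - (c + d)\<bar> < e" by eventually_elim (simp only: abs_less_iff, linarith)
 then show "EX c. \<forall>\<^sub>F n in F. \<bar>f n + g n - c\<bar> < e" by blast
qed

lemma cau_bounded: "cau F f ==> EX B>0. \<forall>\<^sub>F n in F. \<bar>f n\<bar> < B"
proof -
 assume "cau F f"
 then obtain c where c: "\<forall>\<^sub>F n in F. \<bar>f n - c\<bar> < 1" unfolding cau_def using zero_less_one by blast
 have "\<forall>\<^sub>F n in F. \<bar>f n\<bar> < \<bar>c\<bar> + 1" using c by eventually_elim (auto simp: abs_if split: if_splits)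
 then show ?thesis by (intro exI[of _ "\<bar>c\<bar> + 1"]) auto
qed

lemma cau_mult: "cau F f ==> cau F g ==> cau F (%n. f n * g n)"
proof -
 assume f: "cau F f" and g: "cau F g"
 obtain B where B: "B > 0" "\<forall>\<^sub>F n in F. \<bar>f n\<bar> < B" using cau_bounded f by blast
 show ?thesis unfolding cau_def
 proof (intro allI impI)
  fix e :: 'b assume e: "0 < e"
  then have "0 < e / (2 * B)" using B by simp
  then obtain d where d: "\<forall>\<^sub>F n in F. \<bar>g n - d\<bar> < e / (2 * B)" using g unfolding cau_def by blast
  have "0 < e / (2 * (\<bar>d\<bar> + 1))" using e by (simp add: add_nonneg_pos)
  then obtain c where c: "\<forall>\<^sub>F n in F. \<bar>f n - c\<bar> < e / (2 * (\<bar>d\<bar> + 1))" using f unfolding cau_def by blast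
  have "\<forall>\<^sub>F n in F. \<bar>f n * g n - c * d\<bar> < e" using B(2) c d
  proof eventually_elim
   case (elim n)
   have "\<bar>f n * g n - c * d\<bar> = \<bar>f n * (g n - d) + d * (f n - c)\<bar>" by (simp add: algebra_simps)
   also have "... <= \<bar>f n\<bar> * \<bar>g n - d\<bar> + \<bar>d\<bar> * \<bar>f n - c\<bar>" by (metis abs_mult abs_triangle_ineq)
   also have "... <= B * \<bar>g n - d\<bar> + (\<bar>d\<bar> + 1) * \<bar>f n - c\<bar>" using elim by (intro add_mono mult_right_mono) auto
   also have "... < B * (e / (2 * B)) + (\<bar>d\<bar> + 1) * (e / (2 * (\<bar>d\<bar> + 1)))"
    using elim B(1) by (intro add_strict_mono mult_strict_left_mono) auto
   also have "(\<bar>d\<bar> + 1) * (e / (2 * (\<bar>d\<bar> + 1))) = e / 2" using abs_ge_zero[of d] by (simp add: field_simps add_nonneg_eq_0_iff)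
   also have "B * (e / (2 * B)) + e / 2 = e" using B(1) by (simp add: field_simps)
   finally show ?case .
  qed
  then show "EX c. \<forall>\<^sub>F n in F. \<bar>f n * g n - c\<bar> < e" by blast
 qed
qed

lemma nul_neg: "nul F f ==> nul F (%n. - f n)"
 unfolding nul_def by simp

lemma nul_add: "nul F f ==> nul F g ==> nul F (%n. f n + g n)"
 unfolding nul_def
proof (intro allI impI)
 fix e :: 'b assume h: "ALL e>0. \<forall>\<^sub>F n in F. \<bar>f n\<bar> < e" "ALL e>0. \<forall>\<^sub>F n in F. \<bar>g n\<bar> < e" "0 < e"
 then have "\<forall>\<^sub>F n in F. \<bar>f n\<bar> < e / 2" "\<forall>\<^sub>F n in F. \<bar>g n\<bar> < e / 2" using half_gt_zero by blast+
 then show "\<forall>\<^sub>F n in F. \<bar>f n + g n\<bar> < e" by eventually_elim (simp only: abs_less_iff, linarith)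
qed

lemma nul_mult: "cau F f ==> nul F g ==> nul F (%n. f n * g n)"
 unfolding nul_def
proof (intro allI impI)
 fix e :: 'b assume h: "cau F f" "ALL e>0. \<forall>\<^sub>F n in F. \<bar>g n\<bar> < e" "0 < e"
 obtain B where B: "B > 0" "\<forall>\<^sub>F n in F. \<bar>f n\<bar> < B" using cau_bounded h by blast
 then have "\<forall>\<^sub>F n in F. \<bar>g n\<bar> < e / B" using h by simp
 with B(2) show "\<forall>\<^sub>F n in F. \<bar>f n * g n\<bar> < e"
 proof eventually_elim
  case (elim n)
  have "\<bar>f n * g n\<bar> <= B * \<bar>g n\<bar>" unfolding abs_mult using elim by (intro mult_right_mono) auto
  also have "... < B * (e / B)" using elim B(1) by (intro mult_strict_left_mono) auto
  finally show ?case using B(1) by simp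
 qed
qed

lemma psv_add: "psv F f ==> psv F g ==> psv F (%n. f n + g n)"
 unfolding psv_def
proof (elim exE conjE)
 fix e d assume "e > 0" "\<forall>\<^sub>F n in F. e < f n" "d > 0" "\<forall>\<^sub>F n in F. d < g n"
 then have "\<forall>\<^sub>F n in F. e + d < f n + g n" by (auto elim: eventually_elim2)
 then show "EX e>0. \<forall>\<^sub>F n in F. e < f n + g n" using \<open>e > 0\<close> \<open>d > 0\<close> by (intro exI[of _ "e + d"]) auto
qed

lemma psv_nul: "psv F f ==> nul F g ==> psv F (%n. f n + g n)"
proof -
 assume "psv F f" and g: "nul F g"
 then obtain e where e: "e > 0" "\<forall>\<^sub>F n in F. e < f n" unfolding psv_def by blast
 then have "\<forall>\<^sub>F n in F. \<bar>g n\<bar> < e / 2" using g half_gt_zero unfolding nul_def by blast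
 with e(2) have "\<forall>\<^sub>F n in F. e / 2 < f n + g n" by eventually_elim (simp only: abs_less_iff, linarith)
 then show ?thesis unfolding psv_def using e(1) by (intro exI[of _ "e / 2"]) auto
qed

lemma psv_mult: "psv F f ==> psv F g ==> psv F (%n. f n * g n)"
 unfolding psv_def
proof (elim exE conjE)
 fix e d assume h: "e > 0" "\<forall>\<^sub>F n in F. e < f n" "d > 0" "\<forall>\<^sub>F n in F. d < g n"
 from h(2,4) have "\<forall>\<^sub>F n in F. e * d < f n * g n" by eventually_elim (use h in \<open>intro mult_strict_mono, auto\<close>)
 then show "EX e>0. \<forall>\<^sub>F n in F. e < f n * g n" using h by (intro exI[of _ "e * d"]) auto
qed

lemma psv_not_nul: "F ~= bot ==> psv F f ==> ~ nul F f"
proof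
 assume F: "F ~= bot" and "psv F f" and n: "nul F f"
 then obtain e where e: "e > 0" "\<forall>\<^sub>F n in F. e < f n" unfolding psv_def by blast
 then have "\<forall>\<^sub>F n in F. \<bar>f n\<bar> < e" using n unfolding nul_def by blast
 with e(2) have "\<forall>\<^sub>F n in F. False" by eventually_elim auto
 then show False using F by simp
qed

lemma psv_trichotomy: "cau F f ==> nul F f | psv F f | psv F (%n. - f n)"
proof (rule ccontr)
 assume f: "cau F f" and h: "~ (nul F f | psv F f | psv F (%n. - f n))"
 then obtain e where e: "e > 0" "~ (\<forall>\<^sub>F n in F. \<bar>f n\<bar> < e)" unfolding nul_def by blast
 then have e3: "e / 3 > 0" by simp
 then obtain c where c: "\<forall>\<^sub>F n in F. \<bar>f n - c\<bar> < e / 3" using f unfolding cau_def by blast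
 \<comment> \<open>At precision \<open>e / 3\<close> the constant \<open>c\<close> tells the cases
   apart: if it is close to 0, then \<open>f\<close> is eventually smaller than \<open>e\<close>; if
   not, \<open>f\<close> is bounded away from 0 on one side.\<close>
 consider "\<bar>c\<bar> <= 2 * (e / 3)" | "2 * (e / 3) < c" | "2 * (e / 3) < - c" by (metis abs_le_iff not_le)
 then show False
 proof cases
  case 1
  have "\<forall>\<^sub>F n in F. \<bar>f n\<bar> < e" using c by eventually_elim (use 1 in \<open>simp only: abs_less_iff abs_le_iff, linarith\<close>)
  then show False using e by blast
 next
  case 2
  have "\<forall>\<^sub>F n in F. e / 3 < f n" using c by eventually_elim (use 2 in \<open>simp only: abs_less_iff, linarith\<close>)
  then show False using h e3 unfolding psv_def by blast
 next
  case 3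
  have "\<forall>\<^sub>F n in F. e / 3 < - f n" using c by eventually_elim (use 3 in \<open>simp only: abs_less_iff, linarith\<close>)
  then show False using h e3 unfolding psv_def by blast
 qed
qed

lemma cau_inverse_pos: "cau F f ==> psv F f ==> cau F (%n. inverse (f n))"
 unfolding cau_def
proof (intro allI impI)
 fix e :: 'b assume f: "ALL e>0. EX c. \<forall>\<^sub>F n in F. \<bar>f n - c\<bar> < e" and "psv F f" and e: "0 < e"
 then obtain d where d: "d > 0" "\<forall>\<^sub>F n in F. d < f n" unfolding psv_def by blast
 \<comment> \<open>The first bound keeps the constant \<open>c\<close> above \<open>d / 2\<close>;
   then \<open>f n\<close> times \<open>c\<close> is at least \<open>d * (d / 2)\<close>, and the
   second bound makes the difference of the inverses smaller than \<open>e\<close>.\<close>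
 define r where "r = min (d / 2) (e * (d * d / 2))"
 have r: "r > 0" "r <= d / 2" "r <= e * (d * d / 2)" using d e unfolding r_def by auto
 then obtain c where c: "\<forall>\<^sub>F n in F. \<bar>f n - c\<bar> < r" using f by blast
 \<comment> \<open>That \<open>c\<close> exceeds \<open>d / 2\<close> is seen only at an index where
   both estimates hold, and the filter might be trivial; hence the default 0.\<close>
 have "\<forall>\<^sub>F n in F. \<bar>inverse (f n) - (if c > d / 2 then inverse c else 0)\<bar> < e" using d(2) c
 proof eventually_elim
  case (elim n)
  have c2: "c > d / 2" using elim r(2) by (simp only: abs_less_iff, linarith)
  then have p: "f n > 0" "c > 0" using elim d(1) by (auto intro: less_trans)
  have "\<bar>inverse (f n) - inverse c\<bar> = \<bar>f n - c\<bar> / (f n * c)"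
   using p by (simp add: field_simps abs_divide abs_mult abs_minus_commute)
  also have "... < e * (d * d / 2) / (f n * c)" using elim r(3) p by (intro divide_strict_right_mono) auto
  also have "... <= e * (d * d / 2) / (d * (d / 2))"
   using elim c2 d(1) e p by (intro divide_left_mono mult_mono) auto
  also have "... = e" using d(1) by simp
  finally show ?case using c2 by simp
 qed
 then show "EX c. \<forall>\<^sub>F n in F. \<bar>inverse (f n) - c\<bar> < e" by blast
qed

lemma cau_inverse: "cau F f ==> ~ nul F f ==> cau F (%n. inverse (f n)) & nul F (%n. f n * inverse (f n) - 1)"
proof
 assume f: "cau F f" "~ nul F f"
 then consider "psv F f" | "psv F (%n. - f n)" using psv_trichotomy by blast
 then show "cau F (%n. inverse (f n))"
 proof cases
  case 2
  then show ?thesis using cau_neg[OF cau_inverse_pos[OF cau_neg[OF f(1)] 2]] by simp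
 qed (use cau_inverse_pos f in blast)
 have "\<forall>\<^sub>F n in F. f n ~= 0"
  using f psv_trichotomy[OF f(1)] unfolding psv_def by (auto elim: eventually_mono)
 then show "nul F (%n. f n * inverse (f n) - 1)" unfolding nul_def by (auto elim: eventually_mono)
qed

context zfc
begin

section \<open>Arithmetic of the natural numbers of a model\<close>

definition mult where "mult = nrec (%p. zero) (%p x. plus x p)"

lemma [dfn]: "dff s ==> dff t ==> dff (%e. mult (s e) (t e))"
 unfolding mult_def by (intro dff_nrec dfn)

lemma mult_zero: "mult m zero = zero"
 unfolding mult_def by (rule nrec_zero) (intro dfn)+

lemma mult_succ: "n:el om ==> mult m (succ n) = plus (mult m n) m"
 unfolding mult_def by (rule nrec_succ) (intro dfn)+

lemma mult_nat [simp]: "n:el om ==> m:el om ==> mult m n:el om"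
proof (induction n rule: om_induct)
 case df show ?case by (intro dfn)
qed (simp_all add: mult_zero mult_succ)

lemma plus_comm: "n:el om ==> m:el om ==> plus m n = plus n m"
proof (induction n rule: om_induct)
 case df show ?case by (intro dfn)
qed (simp_all add: plus_zero plus_zero_left plus_succ plus_succ_left)

lemma plus_assoc: "k:el om ==> n:el om ==> m:el om ==> plus (plus m n) k = plus m (plus n k)"
proof (induction k rule: om_induct)
 case df show ?case by (intro dfn)
qed (simp_all add: plus_zero plus_succ)

lemma plus_left_comm: "k:el om ==> n:el om ==> m:el om ==> plus m (plus n k) = plus n (plus m k)"
 by (metis plus_assoc plus_comm)

lemma mult_zero_left: "n:el om ==> mult zero n = zero"
proof (induction n rule: om_induct)
 case df show ?case by (intro dfn)
qed (simp_all add: mult_zero mult_succ plus_zero)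

lemma mult_succ_left: "n:el om ==> m:el om ==> mult (succ m) n = plus (mult m n) n"
proof (induction n rule: om_induct)
 case df show ?case by (intro dfn)
next
 case (succ n)
 then show ?case by (simp add: mult_succ plus_succ plus_assoc) (metis plus_comm)
qed (simp add: mult_zero plus_zero)

lemma mult_comm: "n:el om ==> m:el om ==> mult m n = mult n m"
proof (induction n rule: om_induct)
 case df show ?case by (intro dfn)
qed (simp_all add: mult_zero mult_zero_left mult_succ mult_succ_left)

lemma mult_distrib: "k:el om ==> n:el om ==> m:el om ==> mult (plus m n) k = plus (mult m k) (mult n k)"
proof (induction k rule: om_induct)
 case df show ?case by (intro dfn)
next
 case (succ k)
 then show ?case by (simp add: mult_succ plus_assoc plus_left_comm)
qed (simp add: mult_zero plus_zero)

lemma mult_assoc: "k:el om ==> n:el om ==> m:el om ==> mult (mult m n) k = mult m (mult n k)"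
proof (induction k rule: om_induct)
 case df show ?case by (intro dfn)
next
 case (succ k)
 then have "mult m (plus (mult n k) n) = plus (mult m (mult n k)) (mult m n)"
  using mult_distrib[of m n "mult n k"] mult_comm[of m "plus (mult n k) n"] mult_comm[of m "mult n k"] mult_comm[of m n] by simp
 then show ?case using succ by (simp add: mult_succ)
qed (simp add: mult_zero)

lemma plus_cancel: "k:el om ==> m:el om ==> n:el om ==> plus m k = plus n k ==> m = n"
proof -
 assume h: "k:el om" "m:el om" "n:el om" "plus m k = plus n k"
 have "plus m k = plus n k --> m = n" using h(1)
 proof (induction k rule: om_induct)
  case df show ?case by (intro dfn)
 qed (simp_all add: plus_zero plus_succ)
 then show ?thesis using h by blast
qed

lemma plus_zero_iff: "m:el om ==> n:el om ==> plus m n = zero ==> m = zero"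
 using nat_cases[of n] by (auto simp: plus_zero plus_succ)

lemma mult_zero_iff: "m:el om ==> n:el om ==> mult m n = zero ==> m = zero | n = zero"
proof -
 assume h: "m:el om" "n:el om" "mult m n = zero"
 then consider "n = zero" | k where "k:el om" "n = succ k" using nat_cases by blast
 then show ?thesis
 proof cases
  case (2 k)
  then have "plus m (mult m k) = zero" using h mult_succ plus_comm by simp
  then show ?thesis using plus_zero_iff h 2 mult_nat by blast
 qed simp
qed

lemma mem_iff_plus: "n:el om ==> m:el om ==> m:el n <-> (EX k:el om. n = succ (plus m k))"
proof (induction n rule: om_induct)
 case df show ?case by (intro dfn)
next
 case (succ n)
 show ?case
 proof
  assume "m:el (succ n)"
  then consider "m = n" | k where "k:el om" "n = succ (plus m k)" using succ by auto
  then show "EX k:el om. succ n = succ (plus m k)"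
  proof cases
   case 1 then show ?thesis by (intro bexI[OF _ zero_omega]) (simp add: plus_zero)
  next
   case (2 k) then show ?thesis by (intro bexI[OF _ succ_omega[OF 2(1)]]) (simp add: plus_succ)
  qed
 next
  assume "EX k:el om. succ n = succ (plus m k)"
  then obtain k where k: "k:el om" "n = plus m k" by auto
  then consider "k = zero" | j where "j:el om" "k = succ j" using nat_cases by blast
  then show "m:el (succ n)"
  proof cases
   case (2 j) then show ?thesis using succ k by (auto simp: plus_succ)
  qed (use k in \<open>simp add: plus_zero\<close>)
 qed
next
 case zero show ?case using succ_neq_zero by (simp add: eq_commute)
qed

lemma nat_lin: "m:el om ==> n:el om ==> (EX k:el om. plus m k = n) | (EX k:el om. plus n k = m)"
proof -
 assume h: "m:el om" "n:el om"
 consider "m:el n" | "m = n" | "n:el m" using Ord_linear Ord_nat h by blast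
 then show ?thesis
 proof cases
  case 1
  then obtain k where "k:el om" "n = succ (plus m k)" using mem_iff_plus h by blast
  then show ?thesis by (intro disjI1 bexI[of _ "succ k"]) (auto simp: plus_succ succ_omega)
 next
  case 2 then show ?thesis by (intro disjI1 bexI[OF _ zero_omega]) (simp add: plus_zero)
 next
  case 3
  then obtain k where "k:el om" "m = succ (plus n k)" using mem_iff_plus h by blast
  then show ?thesis by (intro disjI2 bexI[of _ "succ k"]) (auto simp: plus_succ succ_omega)
 qed
qed

section \<open>Ordered fields inside a model\<close>

definition "fnr f x y <-> (ALL p:el f. EX u:el x. EX v:el y. p = pr u v) & (ALL u:el x. EX! v. pr u v:el f)"

definition "abm K f e <-> fnr f (times K K) K & e:el K & (ALL x:el K. pr (pr x e) x:el f) &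
  (ALL x:el K. ALL y:el K. ALL z:el K. pr (pr x y) z:el f --> pr (pr y x) z:el f) &
  (ALL x:el K. ALL y:el K. ALL z:el K. ALL u:el K. ALL v:el K. ALL r:el K.
   pr (pr x y) u:el f & pr (pr y z) v:el f & pr (pr u z) r:el f --> pr (pr x v) r:el f)"

definition "fld K add mul zer one <-> abm K add zer & abm K mul one & zer ~= one &
  (ALL x:el K. EX y:el K. pr (pr x y) zer:el add) &
  (ALL x:el K. x ~= zer --> (EX y:el K. pr (pr x y) one:el mul)) &
  (ALL x:el K. ALL y:el K. ALL z:el K. ALL s:el K. ALL u:el K. ALL v:el K. ALL r:el K.
   pr (pr y z) s:el add & pr (pr x y) u:el mul & pr (pr x z) v:el mul & pr (pr x s) r:el mul -->
   pr (pr u v) r:el add)"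

definition "ofld K add mul lt <-> (EX zer one. fld K add mul zer one &
  (ALL p:el lt. EX x:el K. EX y:el K. p = pr x y) & (ALL x:el K. pr x x~:el lt) &
  (ALL x:el K. ALL y:el K. ALL z:el K. pr x y:el lt & pr y z:el lt --> pr x z:el lt) &
  (ALL x:el K. ALL y:el K. pr x y:el lt | x = y | pr y x:el lt) &
  (ALL x:el K. ALL y:el K. ALL z:el K. ALL u:el K. ALL v:el K.
   pr x y:el lt & pr (pr x z) u:el add & pr (pr y z) v:el add --> pr u v:el lt) &
  (ALL x:el K. ALL y:el K. ALL z:el K. pr zer x:el lt & pr zer y:el lt & pr (pr x y) z:el mul --> pr zer z:el lt))"

definition "ubd b S K lt <-> b:el K & (ALL x:el S. pr x b:el lt | x = b)"

definition "rls K add mul lt <-> ofld K add mul lt &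
  (ALL S. el S <= el K & S ~= zero & (EX b. ubd b S K lt) -->
   (EX b. ubd b S K lt & (ALL c. ubd c S K lt --> pr b c:el lt | b = c)))"

end

text \<open>An unbounded sequence is recorded together with the field; the unbounded continuous
  function on the hyperspace will take its terms as values.\<close>

definition has_rls :: "(nat => nat => bool) => bool" where
 "has_rls E <-> (EX K add mul lt ph. zfc.rls E K add mul lt &
  (ALL n:zfc.el E (zfc.om E). zfc.app E ph n:zfc.el E K) &
  (ALL b:zfc.el E K. EX n:zfc.el E (zfc.om E). zfc.pr E b (zfc.app E ph n):zfc.el E lt))"

text \<open>To compute with the natural numbers of a model by means of type classes, we fix a model \<open>E0\<close>,
 a counterexample if there is one, and a type whose elements correspond to its natural numbers
 (to the actual ones if there is no model at all).\<close>

definition E0 :: "nat => nat => bool" where "E0 = (SOME E. zfc E & ~ has_rls E)"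

typedef inat = "UNIV :: nat set" by simp

definition arith :: "nat => nat => (nat => nat => nat) => (nat => nat => nat) => (nat => nat) => bool" where
 "arith z o1 p t \<nu> <-> class.gsem t o1 p z & (zfc E0 --> bij_betw \<nu> UNIV (zfc.el E0 (zfc.om E0)) &
  \<nu> z = zfc.zero E0 & \<nu> o1 = zfc.succ E0 (zfc.zero E0) & (ALL x y. \<nu> (p x y) = zfc.plus E0 (\<nu> x) (\<nu> y)) &
  (ALL x y. \<nu> (t x y) = zfc.mult E0 (\<nu> x) (\<nu> y)))"

lemma ex_arith: "EX z o1 p t \<nu>. arith z o1 p t \<nu>"
proof (cases "zfc E0")
 case False
 have "class.gsem (*) (1::nat) (+) 0"
 proof unfold_locales
  show "(EX c. a + c = b) | (EX c. b + c = a)" for a b :: nat by (metis le_add_diff_inverse nat_le_linear)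
  show "a ~= 0 ==> EX b. a = b + 1" for a :: nat by (cases a) auto
 qed (auto simp: algebra_simps)
 then show ?thesis using False unfolding arith_def by blast
next
 case True
 then interpret zfc E0 .
 have inf: "infinite (el om)"
 proof
  assume "finite (el om)"
  moreover have "succ ` el om <= el om" "inj_on succ (el om)" using succ_omega by (auto simp: inj_on_def)
  ultimately have "succ ` el om = el om" using endo_inj_surj by blast
  then have "zero:succ ` el om" by simp
  then obtain n where "zero = succ n" by blast
  then show False using succ_neq_zero[of n] by simp
 qed
 define \<nu> where "\<nu> = from_nat_into (el om)"
 have \<nu>: "bij_betw \<nu> UNIV (el om)" unfolding \<nu>_def by (rule bij_betw_from_nat_into[OF _ inf]) simp
 define \<mu> where "\<mu> = inv_into UNIV \<nu>"
 have \<nu>\<mu>: "\<nu> (\<mu> n) = n" if "n:el om" for n unfolding \<mu>_def using that \<nu> by (simp add: bij_betw_def f_inv_into_f)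
 have \<mu>\<nu>: "\<mu> (\<nu> n) = n" for n unfolding \<mu>_def using \<nu> by (simp add: bij_betw_def)
 have \<nu>o [simp]: "\<nu> n:el om" for n using \<nu> unfolding bij_betw_def by blast
 have eq: "x = y" if "\<nu> x = \<nu> y" for x y using that \<mu>\<nu> by metis
 have mo: "\<mu> x = \<mu> y <-> x = y" if "x:el om" "y:el om" for x y using that \<nu>\<mu> by metis
 let ?p = "%x y. \<mu> (plus (\<nu> x) (\<nu> y))" and ?t = "%x y. \<mu> (mult (\<nu> x) (\<nu> y))"
 have "class.gsem ?t (\<mu> (succ zero)) ?p (\<mu> zero)"
 proof
  fix a b c
  show "?p (?p a b) c = ?p a (?p b c)" by (simp add: \<nu>\<mu> plus_assoc)
  show "?p a b = ?p b a" by (simp add: plus_comm)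
  show "?p (\<mu> zero) a = a" by (simp add: \<nu>\<mu> plus_zero_left \<mu>\<nu>)
  show "?t (?t a b) c = ?t a (?t b c)" by (simp add: \<nu>\<mu> mult_assoc)
  show "?t a b = ?t b a" by (simp add: mult_comm)
  show "?t (\<mu> (succ zero)) a = a" by (simp add: \<nu>\<mu> succ_omega mult_succ_left mult_zero_left plus_zero_left \<mu>\<nu>)
  show "?t (?p a b) c = ?p (?t a c) (?t b c)" by (simp add: \<nu>\<mu> mult_distrib)
  show "?t (\<mu> zero) a = \<mu> zero" "?t a (\<mu> zero) = \<mu> zero" by (simp_all add: \<nu>\<mu> mult_zero mult_zero_left)
  show "\<mu> zero ~= \<mu> (succ zero)" using succ_neq_zero[of zero] mo succ_omega by (metis zero_omega)
  show "?p a c = ?p b c ==> a = b" using plus_cancel[of "\<nu> c" "\<nu> a" "\<nu> b"] eq by (simp add: mo)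
  show "(EX c. ?p a c = b) | (EX c. ?p b c = a)" using nat_lin[of "\<nu> a" "\<nu> b"] \<nu>\<mu> \<mu>\<nu> by (metis \<nu>o)
  show "?p a b = \<mu> zero ==> a = \<mu> zero" using plus_zero_iff[of "\<nu> a" "\<nu> b"] \<mu>\<nu> by (simp add: mo) metis
  show "?t a b = \<mu> zero ==> a = \<mu> zero | b = \<mu> zero" using mult_zero_iff[of "\<nu> a" "\<nu> b"] \<mu>\<nu> by (simp add: mo) metis
  show "a ~= \<mu> zero ==> EX b. a = ?p b (\<mu> (succ zero))"
  proof -
   assume "a ~= \<mu> zero"
   then have "\<nu> a ~= zero" using \<mu>\<nu> by metis
   then obtain m where m: "m:el om" "\<nu> a = succ m" using nat_cases[OF \<nu>o] by blast
   then have "?p (\<mu> m) (\<mu> (succ zero)) = a" using \<mu>\<nu>[of a] by (simp add: \<nu>\<mu> succ_omega plus_succ plus_zero)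
   then show ?thesis by metis
  qed
 qed
 then have "arith (\<mu> zero) (\<mu> (succ zero)) ?p ?t \<nu>" unfolding arith_def using \<nu> \<nu>\<mu> by (simp add: succ_omega)
 then show ?thesis by blast
qed

definition ops where
 "ops = (SOME x. case x of (z, o1, p, t, \<nu>) => arith z o1 p t \<nu>)"

lemma ops: "case ops of (z, o1, p, t, \<nu>) => arith z o1 p t \<nu>"
 unfolding ops_def by (rule someI_ex) (use ex_arith in auto)

definition nu :: "inat => nat" where "nu x = (case ops of (z, o1, p, t, \<nu>) => \<nu> (Rep_inat x))"

instantiation inat :: gsem
begin
definition "zero_inat = (case ops of (z, o1, p, t, \<nu>) => Abs_inat z)"
definition "one_inat = (case ops of (z, o1, p, t, \<nu>) => Abs_inat o1)"
definition "plus_inat x y = (case ops of (z, o1, p, t, \<nu>) => Abs_inat (p (Rep_inat x) (Rep_inat y)))"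
definition "times_inat x y = (case ops of (z, o1, p, t, \<nu>) => Abs_inat (t (Rep_inat x) (Rep_inat y)))"
instance
proof -
 define z o1 p t \<nu> where zdef: "z = fst ops" "o1 = fst (snd ops)" "p = fst (snd (snd ops))" "t = fst (snd (snd (snd ops)))"
  "\<nu> = snd (snd (snd (snd ops)))"
 have o: "ops = (z, o1, p, t, \<nu>)" unfolding zdef by simp
 then have g: "class.gsem t o1 p z" using ops unfolding o arith_def by simp
 interpret g: gsem t o1 p z by (rule g)
 have d: "(0::inat) = Abs_inat z" "(1::inat) = Abs_inat o1" "x + y = Abs_inat (p (Rep_inat x) (Rep_inat y))"
  "x * y = Abs_inat (t (Rep_inat x) (Rep_inat y))" for x y :: inat
  unfolding zero_inat_def one_inat_def plus_inat_def times_inat_def o by simp_all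
 have a: "Abs_inat x = Abs_inat y <-> x = y" for x y by (simp add: Abs_inat_inject)
 have r: "Rep_inat (Abs_inat x) = x" for x by (simp add: Abs_inat_inverse)
 have e: "(x::inat) = y <-> Rep_inat x = Rep_inat y" for x y by (simp add: Rep_inat_inject)
 show "OFCLASS(inat, gsem_class)"
 proof
  fix a b c :: inat
  show "a + b + c = a + (b + c)" "a + b = b + a" "0 + a = a" "1 * a = a" "a * b * c = a * (b * c)" "a * b = b * a"
   "(a + b) * c = a * c + b * c" "0 * a = 0" "a * 0 = 0"
   unfolding d e r by (rule g.add.assoc g.add.commute g.add_0 g.mult_1 g.mult.assoc g.mult.commute g.distrib_right g.mult_zero_left g.mult_zero_right)+
  show "(0::inat) ~= 1" unfolding d e r by simp
  show "a + c = b + c ==> a = b" unfolding d e r by (rule g.g_cancel)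
  show "(EX c. a + c = b) | (EX c. b + c = a)" using g.g_lin[of "Rep_inat a" "Rep_inat b"] unfolding d e r by (metis r)
  show "a + b = 0 ==> a = 0" unfolding d e r by (rule g.g_zero)
  show "a * b = 0 ==> a = 0 | b = 0" unfolding d e r by (rule g.g_dom)
  show "a ~= 0 ==> EX b. a = b + 1" using g.g_disc[of "Rep_inat a"] unfolding d e r by (metis r)
 qed
qed
end

text \<open>The filter of tails, formed with the addition of the model; in a nonstandard model a
  tail need not be cofinite.\<close>

definition at_inf :: "inat filter" where "at_inf = Abs_filter (%P. EX N. ALL m. P (N + m))"

lemma at_inf: "eventually P at_inf <-> (EX N. ALL m. P (N + m))"
 unfolding at_inf_def
proof (rule eventually_Abs_filter, rule is_filter.intro)
 fix P Q :: "inat => bool"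
 assume "EX N. ALL m. P (N + m)" "EX N. ALL m. Q (N + m)"
 then obtain M N where "ALL m. P (M + m)" "ALL m. Q (N + m)" by blast
 then have "P (M + N + m) & Q (M + N + m)" for m by (metis add.assoc add.commute)
 then show "EX N. ALL m. P (N + m) & Q (N + m)" by blast
qed auto

lemma at_inf_bot: "at_inf ~= bot"
 using at_inf[of "%_. False"] by (simp add: trivial_limit_def)

type_synonym q = "inat gr fract"

locale zfc0 = zfc E0
begin

lemma nu: "bij_betw nu UNIV (el om)" "nu 0 = zero" "nu 1 = succ zero" "nu (x + y) = plus (nu x) (nu y)"
 "nu (x * y) = mult (nu x) (nu y)"
proof -
 obtain z o1 p t \<nu> where o: "ops = (z, o1, p, t, \<nu>)" by (cases ops)
 then have g: "bij_betw \<nu> UNIV (el om) &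
  \<nu> z = zero & \<nu> o1 = succ zero & (ALL x y. \<nu> (p x y) = plus (\<nu> x) (\<nu> y)) & (ALL x y. \<nu> (t x y) = mult (\<nu> x) (\<nu> y))"
  using ops zfc_axioms unfolding o arith_def by simp
 have n: "nu x = \<nu> (Rep_inat x)" for x unfolding nu_def o by simp
 have "bij_betw Rep_inat UNIV UNIV" by (metis bij_betw_def inj_def Rep_inat_inject surj_def Abs_inat_inverse UNIV_I)
 then have "bij_betw (\<nu> o Rep_inat) UNIV (el om)" using g bij_betw_trans by blast
 moreover have "\<nu> o Rep_inat = nu" using n by auto
 ultimately show "bij_betw nu UNIV (el om)" by simp
 show "nu 0 = zero" "nu 1 = succ zero" "nu (x + y) = plus (nu x) (nu y)" "nu (x * y) = mult (nu x) (nu y)"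
  unfolding n zero_inat_def one_inat_def plus_inat_def times_inat_def o using g by (simp_all add: Abs_inat_inverse)
qed

definition de :: "nat => inat" where "de = inv_into UNIV nu"

lemma nu_omega [simp]: "nu x:el om" and nu_de: "n:el om ==> nu (de n) = n" and de_nu [simp]: "de (nu x) = x"
 using nu(1) unfolding de_def bij_betw_def by (auto simp: f_inv_into_f)

lemma de: "m:el om ==> n:el om ==> de (plus m n) = de m + de n"
 "m:el om ==> n:el om ==> de (mult m n) = de m * de n"
 "m:el om ==> de (succ m) = de m + 1" "de zero = 0"
proof -
 show "m:el om ==> n:el om ==> de (plus m n) = de m + de n"
  "m:el om ==> n:el om ==> de (mult m n) = de m * de n" by (metis nu(4,5) nu_de de_nu)+
 show "m:el om ==> de (succ m) = de m + 1"
 proof -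
  assume m: "m:el om"
  have "nu (de m + 1) = succ m" using m nu_de by (simp add: nu plus_succ plus_zero)
  then show ?thesis by (metis de_nu)
 qed
 show "de zero = 0" by (metis nu(2) de_nu)
qed

lemma all_omega: "(ALL n:el om. P n) <-> (ALL x. P (nu x))" and ex_omega: "(EX n:el om. P n) <-> (EX x. P (nu x))"
 using nu_omega nu_de by metis+

lemma iq_less: "m:el om ==> n:el om ==> iq (de m) < iq (de n) <-> m:el n"
proof -
 assume h: "m:el om" "n:el om"
 have lt: "iq (de m) < iq (de n)" if mn: "m:el n" "m:el om" "n:el om" for m n
 proof -
  obtain k where k: "k:el om" "n = succ (plus m k)" using mem_iff_plus mn by blast
  then have "iq (de n) = iq (de m) + iq (de k) + 1" using mn by (simp add: de iq_hom)
  then show ?thesis using iq_nonneg[of "de k"] by simp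
 qed
 consider "m:el n" | "m = n" | "n:el m" using Ord_linear Ord_nat h by blast
 then show ?thesis by cases (use lt h mem_asym mem_irrefl in \<open>auto dest: less_asym\<close>)
qed

section \<open>Codes for rational numbers, and sequences of them\<close>

definition CQ :: nat where "CQ = times om (times om om)"

definition vq :: "nat => q" where
 "vq c = (iq (de (vfst c)) - iq (de (vfst (vsnd c)))) / (iq (de (vsnd (vsnd c))) + 1)"

text \<open>A code \<open>pr a (pr b n)\<close> stands for the fraction with numerator
  \<open>a - b\<close> and denominator \<open>n + 1\<close>. The last component of the result is
  formed so that adding 1 gives the product of the two denominators.\<close>

definition addc where "addc c d = pr (plus (mult (vfst c) (succ (vsnd (vsnd d)))) (mult (vfst d) (succ (vsnd (vsnd c)))))
 (pr (plus (mult (vfst (vsnd c)) (succ (vsnd (vsnd d)))) (mult (vfst (vsnd d)) (succ (vsnd (vsnd c)))))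
  (plus (mult (vsnd (vsnd c)) (vsnd (vsnd d))) (plus (vsnd (vsnd c)) (vsnd (vsnd d)))))"
definition mulc where "mulc c d = pr (plus (mult (vfst c) (vfst d)) (mult (vfst (vsnd c)) (vfst (vsnd d))))
 (pr (plus (mult (vfst c) (vfst (vsnd d))) (mult (vfst (vsnd c)) (vfst d)))
  (plus (mult (vsnd (vsnd c)) (vsnd (vsnd d))) (plus (vsnd (vsnd c)) (vsnd (vsnd d)))))"
definition negc where "negc c = pr (vfst (vsnd c)) (pr (vfst c) (vsnd (vsnd c)))"
text \<open>Denominators are positive, so it suffices to look at the numerator in the code of the
  difference of \<open>d\<close> and \<open>c\<close>.\<close>

definition ltc where "ltc c d <-> vfst (vsnd (addc d (negc c))):el (vfst (addc d (negc c)))"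
definition natc where "natc n = pr n (pr zero zero)"

lemma [dfn]:
 "dff s ==> dff t ==> dff (%e. addc (s e) (t e))"
 "dff s ==> dff t ==> dff (%e. mulc (s e) (t e))"
 by (rule dff_fun2, (unfold addc_def mulc_def)[1], (intro dfn)[1], assumption+)+
lemma [dfn]:
 "dff s ==> dff (%e. negc (s e))"
 "dff s ==> dff (%e. natc (s e))"
 by (rule dff_fun1, (unfold negc_def natc_def)[1], (intro dfn)[1], assumption+)+
lemma [dfn]: "dff s ==> dff t ==> dfn (%e. ltc (s e) (t e))"
 by (rule dfn_rel2) (unfold ltc_def, intro dfn)

lemma CQ_cases: "c:el CQ ==> EX a b n. c = pr a (pr b n) & a:el om & b:el om & n:el om"
 unfolding CQ_def by auto

lemma pos1: "iq x + 1 > 0" "iq x + 1 ~= 0"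
 using iq_nonneg[of x] by (auto simp: add_nonneg_pos add_nonneg_eq_0_iff)

lemma addc: assumes "c:el CQ" "d:el CQ" shows "addc c d:el CQ" "vq (addc c d) = vq c + vq d"
proof -
 obtain a b n a' b' n' where h: "c = pr a (pr b n)" "a:el om" "b:el om" "n:el om"
  "d = pr a' (pr b' n')" "a':el om" "b':el om" "n':el om" using CQ_cases assms by metis
 show "addc c d:el CQ" using h by (simp add: addc_def CQ_def succ_omega)
 have "iq (de n) * iq (de n') + (iq (de n) + iq (de n')) + 1 = (iq (de n) + 1) * (iq (de n') + 1)" by (simp add: algebra_simps)
 then show "vq (addc c d) = vq c + vq d" using h pos1[of "de n"] pos1[of "de n'"]
  by (simp add: vq_def addc_def succ_omega de iq_hom add_frac_eq) (simp add: algebra_simps)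
qed

lemma mulc: assumes "c:el CQ" "d:el CQ" shows "mulc c d:el CQ" "vq (mulc c d) = vq c * vq d"
proof -
 obtain a b n a' b' n' where h: "c = pr a (pr b n)" "a:el om" "b:el om" "n:el om"
  "d = pr a' (pr b' n')" "a':el om" "b':el om" "n':el om" using CQ_cases assms by metis
 show "mulc c d:el CQ" using h by (simp add: mulc_def CQ_def succ_omega)
 have "iq (de n) * iq (de n') + (iq (de n) + iq (de n')) + 1 = (iq (de n) + 1) * (iq (de n') + 1)" by (simp add: algebra_simps)
 then show "vq (mulc c d) = vq c * vq d" using h
  by (simp add: vq_def mulc_def succ_omega de iq_hom) (simp add: algebra_simps)
qed

lemma negc: assumes "c:el CQ" shows "negc c:el CQ" "vq (negc c) = - vq c"
proof -
 obtain a b n where h: "c = pr a (pr b n)" "a:el om" "b:el om" "n:el om" using CQ_cases assms by metis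
 show "negc c:el CQ" using h by (simp add: negc_def CQ_def)
 show "vq (negc c) = - vq c" using h by (simp add: vq_def negc_def minus_divide_left)
qed

lemma ltc: assumes "c:el CQ" "d:el CQ" shows "ltc c d <-> vq c < vq d"
proof -
 have pos: "vfst (vsnd c):el (vfst c) <-> 0 < vq c" if "c:el CQ" for c
 proof -
  obtain a b n where h: "c = pr a (pr b n)" "a:el om" "b:el om" "n:el om" using CQ_cases \<open>c:el CQ\<close> by metis
  then show ?thesis using iq_less[of b a] pos1(1)[of "de n"] by (simp add: vq_def zero_less_divide_iff less_asym)
 qed
 show ?thesis unfolding ltc_def using pos addc negc assms by simp
qed

lemma natc: "n:el om ==> natc n:el CQ" "n:el om ==> vq (natc n) = iq (de n)"
 unfolding natc_def CQ_def vq_def by (simp_all add: de iq_hom)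

lemma vq_surj: "EX c:el CQ. vq c = x"
proof -
 obtain a b d where "x = (iq a - iq b) / (iq d + 1)" using iq_cases by blast
 then show ?thesis by (intro bexI[of _ "pr (nu a) (pr (nu b) (nu d))"]) (simp_all add: vq_def CQ_def)
qed

definition fs :: "nat => inat => q" where "fs s x = vq (app s (nu x))"

definition seqs :: nat where "seqs = set {s. s:el (pw (times om CQ)) & (ALL n:el om. app s n:el CQ)}"

lemma el_seqs: "el seqs = {s:el (pw (times om CQ)). ALL n:el om. app s n:el CQ}"
 unfolding seqs_def by (rule el_sep) (intro dfn)

lemma [simp]: "s:el seqs ==> app s (nu x):el CQ"
 unfolding el_seqs by simp

lemma mk_seq:
 assumes "dff (%e. H (e 0))" "!!x. H (nu x):el CQ"
 shows "lam om H:el seqs" "fs (lam om H) x = vq (H (nu x))"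
proof -
 have a: "app (lam om H) n = H n" if "n:el om" for n by (rule app_lam[OF assms(1) that])
 have "H n:el CQ" if "n:el om" for n using assms(2)[of "de n"] nu_de that by simp
 then show "lam om H:el seqs" unfolding el_seqs using a by (auto simp: el_lam[OF assms(1)])
 show "fs (lam om H) x = vq (H (nu x))" unfolding fs_def using a by simp
qed

definition near where "near c d e <-> ltc (addc c (negc d)) e & ltc (addc d (negc c)) e"

lemma [dfn]: "dff s ==> dff t ==> dff u ==> dfn (%e. near (s e) (t e) (u e))"
 by (rule dfn_rel3) (unfold near_def, intro dfn)

lemma near: "c:el CQ ==> d:el CQ ==> e:el CQ ==> near c d e <-> \<bar>vq c - vq d\<bar> < vq e"
 unfolding near_def by (simp add: ltc addc negc abs_less_iff)

definition evI where "evI P <-> (EX N:el om. ALL m:el om. P (plus N m))"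

lemma evI: "evI P <-> (\<forall>\<^sub>F x in at_inf. P (nu x))"
 unfolding evI_def at_inf all_omega ex_omega by (simp add: nu)

lemma all_pos: "(ALL e:el CQ. ltc (natc zero) e --> P (vq e)) <-> (ALL e>0. P e)"
 using vq_surj ltc[of "natc zero"] natc[OF zero_omega] by (metis de(4) iq_hom(3))

lemma ex_pos: "(EX e:el CQ. ltc (natc zero) e & P (vq e)) <-> (EX e>0. P e)"
 using vq_surj ltc[of "natc zero"] natc[OF zero_omega] by (metis de(4) iq_hom(3))

definition Cau :: nat where
 "Cau = set {s. s:el seqs & (ALL e:el CQ. ltc (natc zero) e --> (EX c:el CQ. evI (%n. near (app s n) c e)))}"

definition nulI where "nulI s t <-> (ALL e:el CQ. ltc (natc zero) e --> evI (%n. near (app s n) (app t n) e))"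
definition psvI where "psvI s t <-> (EX e:el CQ. ltc (natc zero) e & evI (%n. ltc (addc e (app s n)) (app t n)))"

lemma [dfn]:
 "dff s ==> dff t ==> dfn (%e. nulI (s e) (t e))"
 "dff s ==> dff t ==> dfn (%e. psvI (s e) (t e))"
 by (rule dfn_rel2, (unfold nulI_def evI_def psvI_def evI_def)[1], (intro dfn)[1], assumption+)+

lemma Cau: "s:el Cau <-> s:el seqs & cau at_inf (fs s)"
proof -
 have "el Cau = {s:el seqs. ALL e:el CQ. ltc (natc zero) e --> (EX c:el CQ. evI (%n. near (app s n) c e))}"
  unfolding Cau_def by (rule el_sep) (unfold evI_def, intro dfn)
 moreover have "(ALL e:el CQ. ltc (natc zero) e --> (EX c:el CQ. evI (%n. near (app s n) c e))) <-> cau at_inf (fs s)"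
  if s: "s:el seqs"
 proof -
  have "(ALL e:el CQ. ltc (natc zero) e --> (EX c:el CQ. evI (%n. near (app s n) c e))) <->
   (ALL e:el CQ. ltc (natc zero) e --> (EX c:el CQ. \<forall>\<^sub>F x in at_inf. \<bar>fs s x - vq c\<bar> < vq e))"
   unfolding evI fs_def using s by (simp add: near)
  also have "... <-> (ALL e:el CQ. ltc (natc zero) e --> (EX c. \<forall>\<^sub>F x in at_inf. \<bar>fs s x - c\<bar> < vq e))"
   using vq_surj by metis
  finally show ?thesis unfolding all_pos[of "%e. EX c. \<forall>\<^sub>F x in at_inf. \<bar>fs s x - c\<bar> < e"] cau_def .
 qed
 ultimately show ?thesis by blast
qed

lemma nulI: "s:el seqs ==> t:el seqs ==> nulI s t <-> nul at_inf (%x. fs s x - fs t x)"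
proof -
 assume s: "s:el seqs" "t:el seqs"
 have "nulI s t <-> (ALL e:el CQ. ltc (natc zero) e --> (\<forall>\<^sub>F x in at_inf. \<bar>fs s x - fs t x\<bar> < vq e))"
  unfolding nulI_def evI fs_def using s by (simp add: near)
 then show ?thesis unfolding all_pos[of "%e. \<forall>\<^sub>F x in at_inf. \<bar>fs s x - fs t x\<bar> < e"] nul_def .
qed

lemma psvI: "s:el seqs ==> t:el seqs ==> psvI s t <-> psv at_inf (%x. fs t x - fs s x)"
proof -
 assume s: "s:el seqs" "t:el seqs"
 have "psvI s t <-> (EX e:el CQ. ltc (natc zero) e & (\<forall>\<^sub>F x in at_inf. vq e < fs t x - fs s x))"
  unfolding psvI_def evI fs_def using s by (simp add: ltc addc less_diff_eq)
 then show ?thesis unfolding ex_pos[of "%e. \<forall>\<^sub>F x in at_inf. e < fs t x - fs s x"] psv_def .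
qed

end

context zfc0
begin

section \<open>The field of classes of Cauchy sequences\<close>

definition cls :: "nat => nat" where "cls s = set {u. u:el Cau & nulI u s}"
definition KK :: nat where "KK = img Cau cls"
definition opK :: "(nat => nat => nat) => nat" where
 "opK h = lam (times KK KK) (%p. set {u. u:el Cau &
  (EX s:el (vfst p). EX t:el (vsnd p). nulI u (lam om (%n. h (app s n) (app t n))))})"
definition ltK :: nat where
 "ltK = set {p. p:el (times KK KK) & (EX s:el (vfst p). EX t:el (vsnd p). psvI s t)}"

lemma [dfn]: "dff s ==> dff (%e. cls (s e))"
 by (rule dff_fun1) (unfold cls_def, intro dfn)
abbreviation cauf :: "(inat => q) => bool" where "cauf \<equiv> cau at_inf"
abbreviation null :: "(inat => q) => bool" where "null \<equiv> nul at_inf"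
abbreviation posf :: "(inat => q) => bool" where "posf \<equiv> psv at_inf"

definition CC :: "(inat => q) set" where "CC = fs ` el Cau"
definition kp :: "(inat => q) => nat" where "kp f = cls (SOME s. s:el Cau & fs s = f)"

lemma CC_cau: "f:CC ==> cauf f"
 unfolding CC_def using Cau by blast

lemma seq_CC: "s:el seqs ==> cauf (fs s) ==> fs s:CC"
 unfolding CC_def using Cau by blast

lemma el_cls: "s:el Cau ==> u:el (cls s) <-> u:el Cau & null (%x. fs u x - fs s x)"
proof -
 assume s: "s:el Cau"
 have "el (cls s) = {u:el Cau. nulI u s}" unfolding cls_def by (rule el_sep) (intro dfn)
 then show ?thesis using s nulI Cau by auto
qed

lemma null_sym: "null (%x. f x - g x) ==> null (%x. g x - f x)"
 using nul_neg[of at_inf "%x. f x - g x"] by simp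

lemma null_trans: "null (%x. f x - g x) ==> null (%x. g x - h x) ==> null (%x. f x - h x)"
 using nul_add[of at_inf "%x. f x - g x" "%x. g x - h x"] by simp

lemma cls_eq: "s:el Cau ==> t:el Cau ==> cls s = cls t <-> null (%x. fs s x - fs t x)"
proof
 assume s: "s:el Cau" "t:el Cau"
 show "null (%x. fs s x - fs t x)" if "cls s = cls t"
  using el_cls[OF s(1), of s] el_cls[OF s(2), of s] that s by simp
 show "cls s = cls t" if n: "null (%x. fs s x - fs t x)"
  by (rule el_ext) (use el_cls s n null_sym null_trans in blast)
qed

lemma kp: "s:el Cau ==> kp (fs s) = cls s"
proof -
 assume s: "s:el Cau"
 then have "EX t. t:el Cau & fs t = fs s" by blast
 from someI_ex[OF this] show ?thesis unfolding kp_def using cls_eq s by simp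
qed

lemma el_KK: "el KK = kp ` CC"
proof -
 have "el KK = cls ` el Cau" unfolding KK_def by (rule el_img) (intro dfn)
 then show ?thesis unfolding CC_def image_image using kp by simp
qed

lemma kp_eq: "f:CC ==> g:CC ==> kp f = kp g <-> null (%x. f x - g x)"
 unfolding CC_def using kp cls_eq by auto

lemma kp_KK [simp]: "f:CC ==> kp f:el KK"
 unfolding el_KK by blast

text \<open>Addition and multiplication at once: \<open>h\<close> operates on codes,
  \<open>b\<close> is the operation on rationals that it represents, and \<open>nb\<close> makes the
  class of the result independent of the representatives.\<close>

lemma opK:
 assumes dh: "dff (%e. h (e 0) (e (Suc 0)))"
  and h: "!!c d. c:el CQ ==> d:el CQ ==> h c d:el CQ & vq (h c d) = b (vq c) (vq d)"
  and cb: "!!f g. cauf f ==> cauf g ==> cauf (%x. b (f x) (g x))"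
  and nb: "!!f f' g g'. cauf f' ==> cauf g ==> null (%x. f' x - f x) ==> null (%x. g' x - g x) ==>
   null (%x. b (f' x) (g' x) - b (f x) (g x))"
 shows "f:CC ==> g:CC ==> (%x. b (f x) (g x)):CC"
  "f:CC ==> g:CC ==> pr (pr (kp f) (kp g)) z:el (opK h) <-> z = kp (%x. b (f x) (g x))"
  "fnr (opK h) (times KK KK) KK"
proof -
 define hS where "hS s t = lam om (%n. h (app s n) (app t n))" for s t
 note dh' = dff_fun2[OF dh]
 have dhS: "dff (%e. hS (s e) (t e))" if "dff s" "dff t" for s t by (rule dff_fun2[OF _ that]) (unfold hS_def, intro dfn dh')
 have hS: "hS s t:el seqs & fs (hS s t) x = b (fs s x) (fs t x)" if "s:el seqs" "t:el seqs" for s t x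
 proof -
  have d: "dff (%e. h (app s (e 0)) (app t (e 0)))" by (intro dfn dh')
  show ?thesis unfolding hS_def using mk_seq[OF d] h that by (simp add: fs_def)
 qed
 have sq: "s:el seqs" "cauf (fs s)" if "s:el Cau" for s using that Cau by blast+
 have hC: "hS s t:el Cau" "fs (hS s t) = (%x. b (fs s x) (fs t x))" if "s:el Cau" "t:el Cau" for s t
 proof -
  note h = hS[OF sq(1)[OF that(1)] sq(1)[OF that(2)]]
  show f: "fs (hS s t) = (%x. b (fs s x) (fs t x))" using h by auto
  show "hS s t:el Cau" unfolding Cau f using h cb[OF sq(2)[OF that(1)] sq(2)[OF that(2)]] by blast
 qed
 show C: "(%x. b (f x) (g x)):CC" if fg: "f:CC" "g:CC" for f g
 proof -
  obtain s t where s: "s:el Cau" "t:el Cau" "f = fs s" "g = fs t" using fg unfolding CC_def by blast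
  then show ?thesis unfolding CC_def using hC[OF s(1,2)] by (intro image_eqI[of _ _ "hS s t"]) simp_all
 qed
 define K where "K X Y = set {u. u:el Cau & (EX s:el X. EX t:el Y. nulI u (hS s t))}" for X Y
 have dK: "dff (%e. K (s e) (t e))" if "dff s" "dff t" for s t by (rule dff_fun2[OF _ that]) (unfold K_def, intro dfn dhS)
 have K: "K (cls s) (cls t) = cls (hS s t)" if s: "s:el Cau" "t:el Cau" for s t
 proof (rule el_ext)
  have "el (K (cls s) (cls t)) = {u:el Cau. EX s':el (cls s). EX t':el (cls t). nulI u (hS s' t')}"
   unfolding K_def by (rule el_sep) (intro dfn dhS)
  also have "... = el (cls (hS s t))"
  proof (intro set_eqI iffI)
   fix u assume "u:{u:el Cau. EX s':el (cls s). EX t':el (cls t). nulI u (hS s' t')}"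
   then obtain s' t' where h: "u:el Cau" "s':el Cau" "null (%x. fs s' x - fs s x)" "t':el Cau" "null (%x. fs t' x - fs t x)"
    "nulI u (hS s' t')" using el_cls s by auto
   have "null (%x. fs u x - b (fs s' x) (fs t' x))" using h(6) nulI[OF sq(1)[OF h(1)] sq(1)[OF hC(1)[OF h(2,4)]]] hC(2)[OF h(2,4)] by simp
   from null_trans[OF this nb[OF sq(2)[OF h(2)] sq(2)[OF s(2)] h(3,5)]]
   show "u:el (cls (hS s t))" using el_cls[OF hC(1)[OF s]] hC(2)[OF s] h(1) by simp
  next
   fix u assume "u:el (cls (hS s t))"
   then have u: "u:el Cau" "nulI u (hS s t)" using el_cls[OF hC(1)[OF s]] nulI sq(1) hC(1)[OF s] by auto
   moreover have "s:el (cls s)" "t:el (cls t)" using el_cls s by simp_all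
   ultimately show "u:{u:el Cau. EX s':el (cls s). EX t':el (cls t). nulI u (hS s' t')}" by blast
  qed
  finally show "el (K (cls s) (cls t)) = el (cls (hS s t))" .
 qed
 have o: "opK h = lam (times KK KK) (%p. K (vfst p) (vsnd p))" unfolding opK_def K_def hS_def ..
 have e: "el (opK h) = (%p. pr p (K (vfst p) (vsnd p))) ` el (times KK KK)" unfolding o by (rule el_lam) (intro dK dfn)
 show it: "f:CC ==> g:CC ==> pr (pr (kp f) (kp g)) z:el (opK h) <-> z = kp (%x. b (f x) (g x))" for f g z
 proof -
  assume fg: "f:CC" "g:CC"
  then obtain s t where s: "s:el Cau" "t:el Cau" "f = fs s" "g = fs t" unfolding CC_def by auto
  have "pr (pr (kp f) (kp g)) z:el (opK h) <-> z = K (kp f) (kp g)" unfolding e using fg kp_KK by (auto simp: image_iff)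
  also have "K (kp f) (kp g) = kp (%x. b (f x) (g x))" using K[OF s(1,2)] kp[OF hC(1)[OF s(1,2)]] hC(2)[OF s(1,2)] kp s by simp
  finally show ?thesis .
 qed
 show "fnr (opK h) (times KK KK) KK"
  unfolding fnr_def
 proof (intro conjI ballI)
  show "EX! v. pr u v:el (opK h)" if "u:el (times KK KK)" for u using that it by (auto simp: el_KK)
  fix p assume p: "p:el (opK h)"
  then obtain u v where u: "p = pr u v" "u:el (times KK KK)" unfolding e by auto
  then obtain f g where fg: "f:CC" "g:CC" "u = pr (kp f) (kp g)" by (auto simp: el_KK)
  then have "v:el KK" using p u it C by simp
  then show "EX u:el (times KK KK). EX v:el KK. p = pr u v" using u by blast
 qed
qed

abbreviation "addK \<equiv> opK addc"
abbreviation "mulK \<equiv> opK mulc"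

lemma null_add: "null (%x. f' x - f x) ==> null (%x. g' x - g x) ==> null (%x. (f' x + g' x) - (f x + g x))"
 using nul_add[of at_inf "%x. f' x - f x" "%x. g' x - g x"] by (simp add: algebra_simps)

lemma null_mult: "cauf f' ==> cauf g ==> null (%x. f' x - f x) ==> null (%x. g' x - g x) ==> null (%x. f' x * g' x - f x * g x)"
 using nul_add[OF nul_mult[of at_inf f' "%x. g' x - g x"] nul_mult[of at_inf g "%x. f' x - f x"]] by (simp add: algebra_simps)

lemma CC_add [simp]: "f:CC ==> g:CC ==> (%x. f x + g x):CC"
 and add_iff: "f:CC ==> g:CC ==> pr (pr (kp f) (kp g)) z:el addK <-> z = kp (%x. f x + g x)"
 and fnr_addK: "fnr addK (times KK KK) KK"
proof -
 have d: "dff (%e. addc (e 0) (e (Suc 0)))" by (intro dfn)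
 note r = opK[OF d, of "(+)", OF conjI[OF addc] cau_add null_add]
 show "f:CC ==> g:CC ==> (%x. f x + g x):CC" by (rule r(1))
 show "f:CC ==> g:CC ==> pr (pr (kp f) (kp g)) z:el addK <-> z = kp (%x. f x + g x)" by (rule r(2))
 show "fnr addK (times KK KK) KK" by (rule r(3))
qed

lemma CC_mult [simp]: "f:CC ==> g:CC ==> (%x. f x * g x):CC"
 and mul_iff: "f:CC ==> g:CC ==> pr (pr (kp f) (kp g)) z:el mulK <-> z = kp (%x. f x * g x)"
 and fnr_mulK: "fnr mulK (times KK KK) KK"
proof -
 have d: "dff (%e. mulc (e 0) (e (Suc 0)))" by (intro dfn)
 note r = opK[OF d, of "(*)", OF conjI[OF mulc] cau_mult null_mult]
 show "f:CC ==> g:CC ==> (%x. f x * g x):CC" by (rule r(1))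
 show "f:CC ==> g:CC ==> pr (pr (kp f) (kp g)) z:el mulK <-> z = kp (%x. f x * g x)" by (rule r(2))
 show "fnr mulK (times KK KK) KK" by (rule r(3))
qed

lemma CC_const [simp]: "(%x. c):CC" and kp_const: "c':el CQ ==> kp (%x. vq c') = cls (lam om (%n. c'))"
proof -
 have k: "lam om (%n. c):el seqs" "fs (lam om (%n. c)) = (%x. vq c)" if "c:el CQ" for c
  using mk_seq[of "%n. c"] dff_const that by auto
 obtain d where d: "d:el CQ" "vq d = c" using vq_surj by blast
 show "(%x. c):CC" using seq_CC[OF k(1)[OF d(1)]] k(2)[OF d(1)] d(2) by simp
 show "c':el CQ ==> kp (%x. vq c') = cls (lam om (%n. c'))"
  using kp[of "lam om (%n. c')"] k[of c'] Cau by simp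
qed

lemma CC_neg [simp]: "f:CC ==> (%x. - f x):CC"
 using CC_mult[OF CC_const[of "-1"], of f] by simp

lemma CC_inverse: "f:CC ==> ~ null f ==> (%x. inverse (f x)):CC"
proof -
 assume f: "f:CC" "~ null f"
 then obtain s where s: "s:el seqs" "f = fs s" unfolding CC_def using Cau by auto
 let ?z = "natc zero" and ?o = "natc (succ zero)"
 have o: "?z:el CQ" "vq ?z = 0" "?o:el CQ" "vq ?o = 1"
  using natc[OF zero_omega] natc[OF succ_omega[OF zero_omega]] by (simp_all add: de iq_hom)
 \<comment> \<open>The codes of inverses, found by comparing the product with 1 in both directions,
   since different codes may stand for the same number. The value 0 has none, and then
   \<open>natc zero\<close> agrees with \<open>inverse 0 = 0\<close>.\<close>
 define T where "T c = set {d. d:el CQ & (~ ltc (mulc c d) ?o & ~ ltc ?o (mulc c d))}" for c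
 have T: "el (T c) = {d:el CQ. ~ ltc (mulc c d) ?o & ~ ltc ?o (mulc c d)}" for c
  unfolding T_def by (rule el_sep) (intro dfn)
 have dT: "dff (%e. T (e 0))" unfolding T_def by (intro dfn)
 obtain ch where ch: "!!y. y:el (img CQ T) ==> el y ~= {} ==> app ch y:el y" using choice_fun by blast
 define H where "H n = (if el (T (app s n)) <= el zero then ?z else app ch (T (app s n)))" for n
 have dH: "dff (%e. H (e 0))" unfolding H_def by (intro dfn dff_fun1[OF dT])
 have H: "H (nu x):el CQ & vq (H (nu x)) = inverse (f x)" for x
 proof (cases "f x = 0")
  case True
  then have "el (T (app s (nu x))) = {}" unfolding T using s o by (auto simp: ltc mulc fs_def)
  then show ?thesis unfolding H_def using o True by simp
 next
  case False
  obtain d where "d:el CQ" "vq d = inverse (f x)" using vq_surj by blast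
  then have ne: "el (T (app s (nu x))) ~= {}" unfolding T using s o False by (auto simp: ltc mulc fs_def)
  then have "app ch (T (app s (nu x))):el (T (app s (nu x)))" by (intro ch) (use s el_img[OF dT] in auto)
  then have h: "app ch (T (app s (nu x))):el CQ" "f x * vq (app ch (T (app s (nu x)))) = 1" unfolding T using s o
   by (auto simp: ltc mulc fs_def)
  then have "vq (app ch (T (app s (nu x)))) = inverse (f x)" using False by (metis inverse_unique)
  then show ?thesis unfolding H_def using ne h by simp
 qed
 have "fs (lam om H) = (%x. inverse (f x))" using mk_seq(2)[OF dH] H by auto
 then show ?thesis using seq_CC[OF mk_seq(1)[OF dH]] H cau_inverse[OF CC_cau[OF f(1)] f(2)] by metis
qed

lemma el_ltK: "el ltK = {p:el (times KK KK). EX s:el (vfst p). EX t:el (vsnd p). psvI s t}"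
 unfolding ltK_def by (rule el_sep) (intro dfn)

lemma lt_iff: "f:CC ==> g:CC ==> pr (kp f) (kp g):el ltK <-> posf (%x. g x - f x)"
proof -
 assume fg: "f:CC" "g:CC"
 then obtain s t where s: "s:el Cau" "t:el Cau" "f = fs s" "g = fs t" unfolding CC_def by auto
 have "pr (kp f) (kp g):el ltK <-> (EX s':el (cls s). EX t':el (cls t). psvI s' t')"
  unfolding el_ltK using fg kp_KK[OF fg(1)] kp_KK[OF fg(2)] s kp by auto
 also have "... <-> posf (%x. g x - f x)"
 proof
  assume "EX s':el (cls s). EX t':el (cls t). psvI s' t'"
  then obtain s' t' where h: "s':el Cau" "null (%x. fs s' x - fs s x)" "t':el Cau" "null (%x. fs t' x - fs t x)" "psvI s' t'"
   using el_cls s by auto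
  have "posf (%x. fs t' x - fs s' x)" using h psvI Cau by blast
  from psv_nul[OF psv_nul[OF this h(2)] null_sym[OF h(4)]] show "posf (%x. g x - f x)" using s by simp
 next
  assume "posf (%x. g x - f x)"
  then have "psvI s t" using psvI Cau s by blast
  moreover have "s:el (cls s)" "t:el (cls t)" using el_cls s by simp_all
  ultimately show "EX s':el (cls s). EX t':el (cls t). psvI s' t'" by blast
 qed
 finally show ?thesis .
qed

lemma posf_iff: "posf f ==> ~ null f" "posf f ==> ~ posf (%x. - f x)"
 using psv_not_nul[OF at_inf_bot] psv_add[of at_inf f "%x. - f x"] psv_not_nul[OF at_inf_bot, of "%x. 0"] by auto

lemma posf_one: "posf (%x. 1)"
 unfolding psv_def by (intro exI[of _ "1/2"]) auto

lemma ball_KK: "(ALL x:el KK. P x) <-> (ALL f:CC. P (kp f))" and bex_KK: "(EX x:el KK. P x) <-> (EX f:CC. P (kp f))"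
 unfolding el_KK by blast+

lemma abm_KK:
 assumes F: "fnr m (times KK KK) KK"
  and it: "!!f g z. f:CC ==> g:CC ==> pr (pr (kp f) (kp g)) z:el m <-> z = kp (%x. b (f x) (g x))"
  and cl: "!!f g. f:CC ==> g:CC ==> (%x. b (f x) (g x)):CC"
  and b: "!!x. b x c = x" "!!x y. b x y = b y x" "!!x y z. b (b x y) z = b x (b y z)"
 shows "abm KK m (kp (%x. c))"
 unfolding abm_def
proof (intro conjI ballI impI F)
 show "pr (pr x (kp (%x. c))) x:el m" if "x:el KK" for x using that it b(1) unfolding el_KK by auto
 show "pr (pr y x) z:el m" if h: "x:el KK" "y:el KK" "pr (pr x y) z:el m" for x y z
 proof -
  obtain f g where f: "f:CC" "g:CC" "x = kp f" "y = kp g" using h unfolding el_KK by blast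
  then have "z = kp (%x. b (f x) (g x))" using h it by simp
  also have "(%x. b (f x) (g x)) = (%x. b (g x) (f x))" by (rule ext, rule b(2))
  finally show ?thesis using it[OF f(2,1)] f by simp
 qed
 fix x y z u v r assume h: "x:el KK" "y:el KK" "z:el KK"
  "pr (pr x y) u:el m & pr (pr y z) v:el m & pr (pr u z) r:el m"
 then obtain f g k where f: "f:CC" "g:CC" "k:CC" "x = kp f" "y = kp g" "z = kp k" unfolding el_KK by blast
 have u: "u = kp (%x. b (f x) (g x))" using it[OF f(1,2)] h(4) f by blast
 have v: "v = kp (%x. b (g x) (k x))" using it[OF f(2,3)] h(4) f by blast
 have r: "r = kp (%x. b (b (f x) (g x)) (k x))" using it[OF cl[OF f(1,2)] f(3)] h(4) f u by blast
 show "pr (pr x v) r:el m" unfolding v f r using it[OF f(1) cl[OF f(2,3)]] b(3) by simp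
qed simp

lemma fld_KK: "fld KK addK mulK (kp (%x. 0)) (kp (%x. 1))"
proof -
 have a1: "kp (%x. 0) ~= kp (%x. 1)" using kp_eq[of "%x. 0" "%x. 1"] posf_iff(1)[OF posf_one] nul_neg[of at_inf "%x. - 1"] by auto
 have a2: "EX g:CC. pr (pr (kp f) (kp g)) (kp (%x. 0)):el addK" if "f:CC" for f
  using that by (intro bexI[of _ "%x. - f x"]) (simp_all add: add_iff)
 have a3: "EX g:CC. pr (pr (kp f) (kp g)) (kp (%x. 1)):el mulK" if f: "f:CC" "kp f ~= kp (%x. 0)" for f
 proof -
  have n: "~ null f" using f kp_eq[of f "%x. 0"] by simp
  then have i: "(%x. inverse (f x)):CC" using CC_inverse f(1) by blast
  have "null (%x. f x * inverse (f x) - 1)" using cau_inverse[OF CC_cau n] f(1) by blast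
  then have "kp (%x. f x * inverse (f x)) = kp (%x. 1)" using kp_eq[OF CC_mult[OF f(1) i] CC_const] by simp
  then show ?thesis using mul_iff[OF f(1) i] i by metis
 qed
 have a4: "abm KK addK (kp (%x. 0))"
  by (rule abm_KK[OF fnr_addK, of "(+)"]) (simp_all add: add_iff ac_simps)
 have a5: "abm KK mulK (kp (%x. 1))"
  by (rule abm_KK[OF fnr_mulK, of "(*)"]) (simp_all add: mul_iff ac_simps)
 have a6: "pr (pr u v) r:el addK" if h: "x:el KK" "y:el KK" "z:el KK"
   "pr (pr y z) s:el addK & pr (pr x y) u:el mulK & pr (pr x z) v:el mulK & pr (pr x s) r:el mulK" for x y z s u v r
 proof -
  obtain f g k where f: "f:CC" "g:CC" "k:CC" "x = kp f" "y = kp g" "z = kp k" using h(1-3) unfolding el_KK by blast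
  have u: "u = kp (%x. f x * g x)" using mul_iff[OF f(1,2)] h(4) f by blast
  have v: "v = kp (%x. f x * k x)" using mul_iff[OF f(1,3)] h(4) f by blast
  have s: "s = kp (%x. g x + k x)" using add_iff[OF f(2,3)] h(4) f by blast
  have r: "r = kp (%x. f x * (g x + k x))" using mul_iff[OF f(1) CC_add[OF f(2,3)]] h(4) f s by blast
  show ?thesis unfolding u v r using add_iff[OF CC_mult[OF f(1,2)] CC_mult[OF f(1,3)]] by (simp add: distrib_left)
 qed
 show ?thesis unfolding fld_def
 proof (intro conjI)
  show "ALL x:el KK. EX y:el KK. pr (pr x y) (kp (%x. 0)):el addK" unfolding ball_KK bex_KK using a2 by blast
  show "ALL x:el KK. x ~= kp (%x. 0) --> (EX y:el KK. pr (pr x y) (kp (%x. 1)):el mulK)" unfolding ball_KK bex_KK using a3 by blast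
 qed (rule a4, rule a5, rule a1, intro ballI impI, rule a6)
qed

lemma ofld_KK: "ofld KK addK mulK ltK"
 unfolding ofld_def
proof (intro exI conjI)
 show "fld KK addK mulK (kp (%x. 0)) (kp (%x. 1))" by (rule fld_KK)
 show "ALL p:el ltK. EX x:el KK. EX y:el KK. p = pr x y" unfolding el_ltK by auto
 show "ALL x:el KK. pr x x~:el ltK" unfolding ball_KK using posf_iff(1)[of "%x. 0"] by (auto simp: lt_iff)
 show "ALL x:el KK. ALL y:el KK. ALL z:el KK. pr x y:el ltK & pr y z:el ltK --> pr x z:el ltK"
  unfolding ball_KK
 proof (intro ballI impI)
  fix f g h assume c: "f:CC" "g:CC" "h:CC" "pr (kp f) (kp g):el ltK & pr (kp g) (kp h):el ltK"
  then show "pr (kp f) (kp h):el ltK" using psv_add[of at_inf "%x. g x - f x" "%x. h x - g x"] by (simp add: lt_iff)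
 qed
 show "ALL x:el KK. ALL y:el KK. pr x y:el ltK | x = y | pr y x:el ltK"
  unfolding ball_KK
 proof (intro ballI)
  fix f g assume c: "f:CC" "g:CC"
  have "cauf (%x. f x - g x)" using CC_cau[OF CC_add[OF c(1) CC_neg[OF c(2)]]] by simp
  from psv_trichotomy[OF this] show "pr (kp f) (kp g):el ltK | kp f = kp g | pr (kp g) (kp f):el ltK"
   using c by (auto simp: lt_iff kp_eq)
 qed
 show "ALL x:el KK. ALL y:el KK. ALL z:el KK. ALL u:el KK. ALL v:el KK.
   pr x y:el ltK & pr (pr x z) u:el addK & pr (pr y z) v:el addK --> pr u v:el ltK"
  unfolding ball_KK by (auto simp: add_iff lt_iff)
 show "ALL x:el KK. ALL y:el KK. ALL z:el KK. pr (kp (%x. 0)) x:el ltK & pr (kp (%x. 0)) y:el ltK &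
   pr (pr x y) z:el mulK --> pr (kp (%x. 0)) z:el ltK"
  unfolding ball_KK by (auto simp: mul_iff lt_iff intro: psv_mult)
qed

lemma small_q: "0 < e ==> EX N::inat. 1 / (iq N + 1) < (e::q)"
proof -
 assume e: "0 < e"
 obtain N :: inat where "1 / e <= iq N" using iq_arch by blast
 then have "1 / e < iq N + 1" by simp
 then show ?thesis using e pos1(1)[of N] by (intro exI[of _ N]) (simp add: field_simps)
qed

text \<open>Fix a rational \<open>l\<close> that is not an upper bound of \<open>S\<close>, and for
  each \<open>n\<close> take the least \<open>k\<close> such that \<open>l + k / (n + 1)\<close> is
  one. These rationals form a Cauchy sequence of the model, whose class is the supremum.\<close>

lemma complete_KK:
 assumes S: "el S <= el KK" "S ~= zero" and b: "ubd b S KK ltK"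
 shows "EX b. ubd b S KK ltK & (ALL c. ubd c S KK ltK --> pr b c:el ltK | b = c)"
proof -
 have tri: "~ posf (%x. f x - g x) <-> pr (kp f) (kp g):el ltK | kp f = kp g" if c: "f:CC" "g:CC" for f g
 proof -
  have "cauf (%x. f x - g x)" using CC_cau[OF CC_add[OF c(1) CC_neg[OF c(2)]]] by simp
  from psv_trichotomy[OF this] show ?thesis
   using c posf_iff[of "%x. f x - g x"] by (auto simp: lt_iff kp_eq)
 qed
 have ub: "ubd (kp g) S KK ltK <-> (ALL f:CC. kp f:el S --> ~ posf (%x. f x - g x))" if g: "g:CC" for g
 proof
  assume h: "ubd (kp g) S KK ltK"
  show "ALL f:CC. kp f:el S --> ~ posf (%x. f x - g x)"
  proof (intro ballI impI)
   fix f assume f: "f:CC" "kp f:el S"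
   then have "pr (kp f) (kp g):el ltK | kp f = kp g" using h unfolding ubd_def by blast
   then show "~ posf (%x. f x - g x)" using tri[OF f(1) g] by blast
  qed
 next
  assume h: "ALL f:CC. kp f:el S --> ~ posf (%x. f x - g x)"
  show "ubd (kp g) S KK ltK" unfolding ubd_def
  proof (intro conjI ballI)
   fix y assume y: "y:el S"
   then obtain f where f: "f:CC" "y = kp f" using S(1) unfolding el_KK by blast
   then show "pr y (kp g):el ltK | y = kp g" using h y tri[OF f(1) g] by blast
  qed (use g in simp)
 qed
 define UB where "UB y <-> (ALL f:CC. kp f:el S --> ~ posf (%x. f x - y))" for y
 have UBm: "y < x" if uv: "UB x" "~ UB y" for x y
 proof (rule ccontr)
  assume "~ y < x"
  obtain f where f: "f:CC" "kp f:el S" "posf (%x. f x - y)" using uv unfolding UB_def by blast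
  then obtain e where "0 < e" "\<forall>\<^sub>F n in at_inf. e < f n - y" unfolding psv_def by blast
  then have "\<forall>\<^sub>F n in at_inf. e < f n - x" using \<open>~ y < x\<close> by (auto elim: eventually_mono)
  then show False using uv(1) f \<open>0 < e\<close> unfolding UB_def psv_def by blast
 qed
 have bnd: "EX B. posf (%x. f x - (- B)) & posf (%x. B - f x)" if f: "f:CC" for f
 proof -
  obtain B where B: "\<forall>\<^sub>F n in at_inf. \<bar>f n\<bar> < B" using cau_bounded[OF CC_cau[OF f]] by blast
  have "\<forall>\<^sub>F n in at_inf. 1 < f n - (- (B + 1))" "\<forall>\<^sub>F n in at_inf. 1 < (B + 1) - f n"
   using B by (eventually_elim, simp add: abs_less_iff)+
  then show ?thesis unfolding psv_def using zero_less_one by blast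
 qed
 obtain g0 where g0: "g0:CC" "b = kp g0" using b unfolding ubd_def el_KK by blast
 obtain u where u: "posf (%x. u - g0 x)" using bnd[OF g0(1)] by blast
 have "UB u" unfolding UB_def
 proof (intro ballI impI notI)
  fix f assume f: "f:CC" "kp f:el S" "posf (%x. f x - u)"
  have "posf (%x. f x - g0 x)" using psv_add[OF f(3) u] by simp
  then show False using ub[OF g0(1)] b g0(2) f by blast
 qed
 obtain f0 where f0: "f0:CC" "kp f0:el S" using S zero_iff unfolding el_KK by blast
 obtain l where "posf (%x. f0 x - l)" using bnd[OF f0(1)] by blast
 then have l: "~ UB l" unfolding UB_def using f0 by blast
 define cC where "cC c = cls (lam om (%n. c))" for c
 have dcC: "dff s ==> dff (%e. cC (s e))" for s by (rule dff_fun1) (unfold cC_def, intro dfn)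
 define UI where "UI c <-> (ALL y:el S. pr y (cC c):el ltK | y = cC c)" for c
 have dUI: "dff s ==> dfn (%e. UI (s e))" for s by (rule dfn_rel1) (unfold UI_def, intro dfn dcC)
 have UI: "UI c <-> UB (vq c)" if "c:el CQ" for c
 proof -
  have c: "cC c = kp (%x. vq c)" unfolding cC_def using kp_const[OF that] by simp
  have "UI c <-> ubd (kp (%x. vq c)) S KK ltK" unfolding UI_def ubd_def c by simp
  then show ?thesis unfolding ub[OF CC_const] UB_def .
 qed
 obtain lc where lc: "lc:el CQ" "vq lc = l" using vq_surj by blast
 define r where "r n k = addc lc (mulc (natc k) (pr (succ zero) (pr zero n)))" for n k
 have dr: "dff s ==> dff t ==> dff (%e. r (s e) (t e))" for s t by (rule dff_fun2) (unfold r_def, intro dfn)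
 have r: "r n k:el CQ" "vq (r n k) = l + iq (de k) / (iq (de n) + 1)" if "n:el om" "k:el om" for n k
 proof -
  have "pr (succ zero) (pr zero n):el CQ" "vq (pr (succ zero) (pr zero n)) = 1 / (iq (de n) + 1)"
   using that unfolding CQ_def vq_def by (simp_all add: succ_omega de iq_hom)
  then show "r n k:el CQ" "vq (r n k) = l + iq (de k) / (iq (de n) + 1)"
   unfolding r_def using lc natc that by (simp_all add: addc mulc)
 qed
 \<comment> \<open>The set in question has exactly one element, which \<open>Uni\<close>
   extracts.\<close>
 define kn where "kn n = Uni (set {k. k:el om & (UI (r n k) & (ALL j:el k. ~ UI (r n j)))})" for n
 have dkn: "dff s ==> dff (%e. kn (s e))" for s by (rule dff_fun1) (unfold kn_def, intro dfn dUI dr)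
 have kn: "kn n:el om & UI (r n (kn n)) & (ALL j:el (kn n). ~ UI (r n j))" if n: "n:el om" for n
 proof -
  obtain k0 :: inat where "(u - l) * (iq (de n) + 1) <= iq k0" using iq_arch by blast
  then have "u <= l + iq k0 / (iq (de n) + 1)" using pos1(1)[of "de n"] by (simp add: field_simps)
  then have "UB (l + iq k0 / (iq (de n) + 1))" using UBm \<open>UB u\<close> by (meson not_le)
  then have k0: "UI (r n (nu k0))" using UI r[OF n] by simp
  have d: "dfn (%e. UI (r n (e 0)))" by (intro dUI dr dfn)
  obtain k where k: "Ord k" "UI (r n k)" "!!j. j:el k ==> ~ UI (r n j)" using Ord_least[OF d Ord_nat[OF nu_omega] k0] by blast
  have ko: "k:el om"
  proof (rule ccontr)
   assume "k~:el om"
   then have "nu k0:el k" using Ord_linear[OF k(1) Ord_omega] Ord_trans[OF k(1)] nu_omega by metis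
   then show False using k(3) k0 by blast
  qed
  have e: "el (set {k. k:el om & (UI (r n k) & (ALL j:el k. ~ UI (r n j)))}) =
   {k:el om. UI (r n k) & (ALL j:el k. ~ UI (r n j))}" by (rule el_sep) (intro dfn dUI dr)
  have "k' = k" if "k':el om" "UI (r n k')" "ALL j:el k'. ~ UI (r n j)" for k'
   using Ord_linear[OF Ord_nat[OF that(1)] k(1)] that k by blast
  then have "{k:el om. UI (r n k) & (ALL j:el k. ~ UI (r n j))} = {k}" using k ko by blast
  note e1 = trans[OF e this]
  have "kn n = k" unfolding kn_def by (rule el_ext) (simp only: el_Uni e1 image_insert image_empty Union_insert Union_empty Un_empty_right)
  then show ?thesis using k ko by blast
 qed
 define s where "s = lam om (%n. r n (kn n))"
 have ds: "dff (%e. r (e 0) (kn (e 0)))" by (intro dr dkn dfn)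
 have s: "s:el seqs" "fs s x = l + iq (de (kn (nu x))) / (iq x + 1)" for x
  unfolding s_def using mk_seq[OF ds] r kn by simp_all
 define F where "F = fs s"
 have F1: "UB (F x)" for x unfolding F_def s(2) using kn[OF nu_omega[of x]] UI r[OF nu_omega, of "kn (nu x)" x] by simp
 \<comment> \<open>By minimality of \<open>k\<close>, one step of width
   \<open>1 / (iq x + 1)\<close> downwards leaves the upper bounds. As every \<open>F y\<close> is
   an upper bound, it lies above the value so reached, which yields the Cauchy property.\<close>
 have F2: "~ UB (F x - 1 / (iq x + 1))" for x
 proof -
  have k: "kn (nu x):el om" "UI (r (nu x) (kn (nu x)))" "ALL j:el (kn (nu x)). ~ UI (r (nu x) j)" using kn[OF nu_omega] by blast+
  have "kn (nu x) ~= zero" using F1[of x] l unfolding F_def s(2) by (auto simp: de iq_hom)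
  then obtain j where j: "j:el om" "kn (nu x) = succ j" using nat_cases[OF k(1)] by blast
  then have "~ UB (vq (r (nu x) j))" using k(3) UI r[OF nu_omega j(1)] by simp
  then show ?thesis unfolding F_def s(2) j(2) using r(2)[OF nu_omega j(1)] j(1) by (simp add: de iq_hom add_divide_distrib)
 qed
 have F3: "F x - 1 / (iq x + 1) < F y" for x y using UBm F1 F2 by blast
 have F4: "\<bar>F (N + m) - F N\<bar> < 1 / (iq N + 1)" for N m
 proof -
  have "1 / (iq (N + m) + 1) <= 1 / (iq N + 1)" using iq_nonneg[of m] pos1(1)[of N] by (intro divide_left_mono) (auto simp: iq_hom add_pos_nonneg)
  then show ?thesis using F3[of N "N + m"] F3[of "N + m" N] unfolding abs_less_iff by linarith
 qed
 have F5: "\<forall>\<^sub>F x in at_inf. \<bar>F x - F N\<bar> < 1 / (iq N + 1)" for N unfolding at_inf using F4 by blast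
 have "cauf F" unfolding cau_def
 proof (intro allI impI)
  fix e :: q assume "0 < e"
  then obtain N :: inat where "1 / (iq N + 1) < e" using small_q by blast
  then have "\<forall>\<^sub>F x in at_inf. \<bar>F x - F N\<bar> < e" using F5[of N] by (auto elim: eventually_mono)
  then show "EX c. \<forall>\<^sub>F x in at_inf. \<bar>F x - c\<bar> < e" by blast
 qed
 then have FC: "F:CC" unfolding F_def using seq_CC s(1) by blast
 show ?thesis
 proof (intro exI[of _ "kp F"] conjI allI impI)
  show "ubd (kp F) S KK ltK" unfolding ub[OF FC]
  proof (intro ballI impI notI)
   fix f assume f: "f:CC" "kp f:el S" "posf (%x. f x - F x)"
   then obtain e where e: "0 < e" "\<forall>\<^sub>F x in at_inf. e < f x - F x" unfolding psv_def by blast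
   obtain N :: inat where N: "1 / (iq N + 1) < e / 2" using small_q half_gt_zero[OF e(1)] by blast
   have "\<forall>\<^sub>F x in at_inf. e / 2 < f x - F N" using e(2) F5[of N]
    by eventually_elim (use N in \<open>simp only: abs_less_iff, linarith\<close>)
   then have "posf (%x. f x - F N)" unfolding psv_def using half_gt_zero[OF e(1)] by blast
   then show False using F1 f unfolding UB_def by blast
  qed
  fix c assume c: "ubd c S KK ltK"
  then obtain g where g: "g:CC" "c = kp g" unfolding ubd_def el_KK by blast
  have "~ posf (%x. F x - g x)"
  proof
   assume "posf (%x. F x - g x)"
   then obtain e where e: "0 < e" "\<forall>\<^sub>F x in at_inf. e < F x - g x" unfolding psv_def by blast
   then have e3: "0 < e / 3" by simp
   obtain N :: inat where N: "1 / (iq N + 1) < e / 3" using small_q e3 by blast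
   let ?y = "F N - 1 / (iq N + 1)"
   obtain f where f: "f:CC" "kp f:el S" "posf (%x. f x - ?y)" using F2[of N] unfolding UB_def by blast
   have "\<forall>\<^sub>F x in at_inf. e / 3 < ?y - g x" using e(2) F5[of N]
    by eventually_elim (use N in \<open>simp only: abs_less_iff, linarith\<close>)
   then have "posf (%x. ?y - g x)" unfolding psv_def using e3 by blast
   then have "posf (%x. f x - g x)" using psv_add[OF f(3)] by fastforce
   then show False using c f ub[OF g(1)] g(2) by blast
  qed
  then show "pr (kp F) c:el ltK | kp F = c" using tri[OF FC g(1)] g(2) by blast
 qed
qed

lemma has_rls0: "has_rls E0"
proof -
 define cC where "cC c = cls (lam om (%n. c))" for c
 have dcC: "dff s ==> dff (%e. cC (s e))" for s by (rule dff_fun1) (unfold cC_def, intro dfn)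
 have d: "dff (%e. cC (natc (e 0)))" by (intro dcC dfn)
 define ph where "ph = lam om (%n. cC (natc n))"
 have ph: "app ph n = kp (%x. iq (de n))" if "n:el om" for n
  unfolding ph_def app_lam[OF d that] using kp_const[OF natc(1)[OF that]] natc(2)[OF that] unfolding cC_def by simp
 have "rls KK addK mulK ltK" unfolding rls_def using ofld_KK complete_KK by blast
 moreover have "ALL n:el om. app ph n:el KK" using ph by simp
 moreover have "ALL b:el KK. EX n:el om. pr b (app ph n):el ltK" unfolding ball_KK
 proof
  fix f assume f: "f:CC"
  obtain B where B: "\<forall>\<^sub>F n in at_inf. \<bar>f n\<bar> < B" using cau_bounded[OF CC_cau[OF f]] by blast
  obtain N :: inat where N: "B + 1 <= iq N" using iq_arch by blast
  have "\<forall>\<^sub>F n in at_inf. 1 < iq N - f n" using B by eventually_elim (use N in \<open>simp only: abs_less_iff, linarith\<close>)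
  then have "posf (%x. iq N - f x)" unfolding psv_def using zero_less_one by blast
  then show "EX n:el om. pr (kp f) (app ph n):el ltK"
   using ph[OF nu_omega[of N]] lt_iff[OF f CC_const] by (intro bexI[OF _ nu_omega[of N]]) simp
 qed
 ultimately show ?thesis unfolding has_rls_def by blast
qed

end

lemma has_rls: "zfc E ==> has_rls E"
proof (rule ccontr)
 assume "zfc E" "~ has_rls E"
 then have "EX E. zfc E & ~ has_rls E" by blast
 from someI_ex[OF this] have "zfc E0" "~ has_rls E0" unfolding E0_def by auto
 then show False using zfc0.has_rls0 unfolding zfc0_def by blast
qed

section \<open>Evaluating the statement\<close>

named_theorems bds

lemmas [bds] = bd_intros bd_intros2 bd_intros3 bd_sets

lemma [bds]: "bd (Suc n) (T n) ==> bd (Suc (Suc n)) (T (Suc n)) ==> bd n (fex1 T)"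
 unfolding fex1_def by (intro bds; simp)

lemma [bds]: "0 < n ==> bd n (is_un p x y)" "0 < n ==> bd n (is_int p x y)" "0 < n ==> bd n (is_diff p x y)"
 "0 < n ==> bd n (is_inductive x)" "0 < n ==> bd n (is_pair p x y)" "0 < n ==> bd n (is_ordinal x)"
 "0 < n ==> bd n (is_Vietoris_basic B Y C)" "0 < n ==> bd n (is_interval_topology K L M)"
 unfolding is_un_def is_int_def is_diff_def is_inductive_def is_pair_def is_ordinal_def is_Vietoris_basic_def
  is_interval_topology_def related_def by (intro bds; simp)+
lemma [bds]: "0 < n ==> bd n (is_omega x)" "0 < n ==> bd n (related p x y)" "0 < n ==> bd n (is_prod p x y)"
 "0 < n ==> bd n (is_rel p x y)" "0 < n ==> bd n (is_Psi_nhd N x m)" "0 < n ==> bd n (is_topology T X)" "0 < n ==> bd n (is_CL Y X T)"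
 unfolding is_omega_def related_def is_prod_def is_rel_def is_Psi_nhd_def is_topology_def is_CL_def by (intro bds; simp)+
lemma [bds]: "0 < n ==> bd n (is_fun p x y)" "0 < n ==> bd n (is_app2 f x y z)" "0 < n ==> bd n (is_Psi X T A)"
 unfolding is_fun_def is_app2_def is_Psi_def by (intro bds; simp)+
lemma [bds]: "0 < n ==> bd n (equipotent x y)" "0 < n ==> bd n (is_abelian_monoid K f e)" "0 < n ==> bd n (is_continuous f X T Y S)"
 unfolding equipotent_def is_bij_def is_abelian_monoid_def is_binop_def is_continuous_def by (intro bds; simp)+
lemma [bds]: "0 < n ==> bd n (is_finite x)" "0 < n ==> bd n (is_cardinal x)" "0 < n ==> bd n (is_ordered_field K a m l)"
 unfolding is_finite_def is_cardinal_def is_ordered_field_def is_field_def by (intro bds; simp)+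
lemma [bds]: "0 < n ==> bd n (has_card x y)" "0 < n ==> bd n (is_omega1 x)" "0 < n ==> bd n (is_reals K a m l)"
 "0 < n ==> bd n (is_AD A)" "0 < n ==> bd n (is_Vietoris S Y T)"
 unfolding has_card_def is_omega1_def is_reals_def is_upper_bound_def is_AD_def is_Vietoris_def by (intro bds; simp)+
lemma [bds]: "0 < n ==> bd n (is_continuum x)" "0 < n ==> bd n (is_MAD A)" "0 < n ==> bd n (CL_Psi_pseudocompact A)"
 unfolding is_continuum_def is_MAD_def CL_Psi_pseudocompact_def is_pseudocompact_def by (intro bds; simp)+

abbreviation main_sentence :: form where
 "main_sentence \<equiv> (\<^bold>\<exists>\<omega>\<^sub>1 \<cc>.
   is_omega1 \<omega>\<^sub>1 \<^bold>\<and> is_continuum \<cc> \<^bold>\<and> \<omega>\<^sub>1 \<^bold>\<in> \<cc> \<^bold>\<and>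
   (\<^bold>\<exists>A\<^sub>0 A\<^sub>1. is_MAD A\<^sub>0 \<^bold>\<and> has_card A\<^sub>0 \<omega>\<^sub>1 \<^bold>\<and> is_MAD A\<^sub>1 \<^bold>\<and> has_card A\<^sub>1 \<cc> \<^bold>\<and>
    CL_Psi_pseudocompact A\<^sub>0 \<^bold>\<and> \<^bold>\<not> CL_Psi_pseudocompact A\<^sub>1))"

lemma main_closed: "fv (sentence main_sentence) = {}"
proof -
 have "bd 0 main_sentence" by (intro bds; simp)
 then show ?thesis unfolding bd_def sentence_def by simp
qed

context zfc
begin

section \<open>The meaning of the formulas in a model\<close>

abbreviation H :: "form => nat => (nat => 'm) => bool" where "H \<equiv> hold E (=) zero"

lemma ext_iff: "p = q <-> (ALL z. z:el p <-> z:el q)"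
 by (auto intro: el_ext)

declare hold_sets [simp del] hold_inductive [simp del] E_elts [simp]

lemma [simp]:
 "x < n ==> y < n ==> H (x \<^bold>\<subseteq> y) n v <-> el (v x) <= el (v y)"
 "x < n ==> H (is_empty x) n v <-> v x = zero"
 "p < n ==> x < n ==> y < n ==> H (is_upair p x y) n v <-> v p = dbl (v x) (v y)"
 "p < n ==> x < n ==> y < n ==> H (is_un p x y) n v <-> v p = un (v x) (v y)"
 "p < n ==> x < n ==> y < n ==> H (is_int p x y) n v <-> v p = vint (v x) (v y)"
 "p < n ==> x < n ==> y < n ==> H (is_diff p x y) n v <-> v p = vmin (v x) (v y)"
 "p < n ==> x < n ==> H (is_Union p x) n v <-> v p = Uni (v x)"
 "p < n ==> x < n ==> H (is_Pow p x) n v <-> v p = pw (v x)"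
 "p < n ==> x < n ==> H (is_succ p x) n v <-> v p = succ (v x)"
 by (auto simp: hold_sets ext_iff[of "v p"] ext_iff[of "v x" zero])

lemma [simp]: "w < n ==> H (is_inductive w) n v <-> ind (v w)"
 unfolding is_inductive_def ind_def by auto

lemma [simp]: "w < n ==> H (is_omega w) n v <-> v w = om"
proof -
 have o: "ind om" "ind u ==> el om <= el u" for u unfolding el_omega ind_def by auto
 assume "w < n"
 then have "H (is_omega w) n v <-> ind (v w) & (ALL u. ind u --> el (v w) <= el u)" by (simp add: is_omega_def)
 also have "... <-> v w = om"
 proof
  assume "ind (v w) & (ALL u. ind u --> el (v w) <= el u)"
  then show "v w = om" by (intro el_ext equalityI o(2)) (use o(1) in auto)
 qed (use o in auto)
 finally show ?thesis .
qed

lemma [simp]: "H (fex1 T) n v <-> (EX x. H (T n) (Suc n) (v(n := x)) &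
  (ALL y. H (T (Suc n)) (Suc (Suc n)) (v(n := x, Suc n := y)) --> y = x))"
 unfolding fex1_def by simp

lemma [simp]: "p < n ==> x < n ==> y < n ==> H (is_pair p x y) n v <-> v p = pr (v x) (v y)"
 unfolding is_pair_def pr_def by simp

lemma [simp]: "r < n ==> x < n ==> y < n ==> H (related r x y) n v <-> pr (v x) (v y):el (v r)"
 unfolding related_def by simp

lemma [simp]: "p < n ==> x < n ==> y < n ==> H (is_prod p x y) n v <-> v p = times (v x) (v y)"
 unfolding is_prod_def by (auto simp: ext_iff[of "v p"])

lemma [simp]: "p < n ==> x < n ==> y < n ==> H (is_rel p x y) n v <-> (ALL p:el (v p). EX a:el (v x). EX b:el (v y). p = pr a b)"
 unfolding is_rel_def by auto

lemma [simp]: "p < n ==> x < n ==> y < n ==> H (is_fun p x y) n v <-> fnr (v p) (v x) (v y)"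
 unfolding is_fun_def fnr_def Ex1_def by auto

lemma fnr_app: "fnr f x y ==> u:el x ==> pr u v:el f <-> v = app f u"
proof -
 assume f: "fnr f x y" and u: "u:el x"
 then obtain w where w: "pr u w:el f" "!!w'. pr u w':el f ==> w' = w" unfolding fnr_def by blast
 then have "app f u = w" by (intro app_eq) blast
 then show ?thesis using w by blast
qed

lemma fnr_in: "fnr f x y ==> u:el x ==> app f u:el y"
proof -
 assume f: "fnr f x y" and u: "u:el x"
 then have "pr u (app f u):el f" using fnr_app by blast
 then obtain u' v where "v:el y" "pr u (app f u) = pr u' v" using f unfolding fnr_def by blast
 then show ?thesis by auto
qed

lemma fnr_lam: "dff (%e. F (e 0)) ==> (!!u. u:el x ==> F u:el y) ==> fnr (lam x F) x y"
 unfolding fnr_def by (auto simp: el_lam)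

lemma [simp]: "x < n ==> y < n ==> H (equipotent x y) n v <-> eqp (v x) (v y)"
proof -
 have "(EX f. fnr f x y & (ALL b:el y. EX! a. pr a b:el f)) <-> eqp x y" for x y
 proof
  assume "EX f. fnr f x y & (ALL b:el y. EX! a. pr a b:el f)"
  then obtain f where f: "fnr f x y" "ALL b:el y. EX! a. pr a b:el f" by blast
  show "eqp x y"
  proof (rule eqpI[of "app f"])
   show "app f u:el y" if "u:el x" for u using fnr_in f(1) that .
   show "u = v" if h: "u:el x" "v:el x" "app f u = app f v" for u v
    using fnr_app[OF f(1) h(1), of "app f u"] fnr_app[OF f(1) h(2), of "app f u"] f(2) fnr_in[OF f(1) h(1)] h(3) by blast
   show "EX u:el x. v = app f u" if v: "v:el y" for v
   proof -
    obtain u where u: "pr u v:el f" using f(2) v by blast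
    then have "u:el x" using f(1) unfolding fnr_def by fastforce
    then show ?thesis using fnr_app[OF f(1)] u by blast
   qed
  qed (intro dfn)
 next
  assume "eqp x y"
  then obtain g where g: "!!u. u:el x ==> app g u:el y" "!!u v. u:el x ==> v:el x ==> app g u = app g v ==> u = v"
   "!!v. v:el y ==> EX u:el x. v = app g u" unfolding eqp_def inj_fun_def by blast
  have d: "dff (%e. app g (e 0))" by (intro dfn)
  have "fnr (lam x (app g)) x y" by (rule fnr_lam[OF d g(1)])
  moreover have "EX! a. pr a b:el (lam x (app g))" if "b:el y" for b
   using g(2) g(3)[OF that] unfolding el_lam[OF d] by auto
  ultimately show "EX f. fnr f x y & (ALL b:el y. EX! a. pr a b:el f)" by blast
 qed
 note r = this
 assume "x < n" "y < n"
 then have "H (equipotent x y) n v <-> (EX f. fnr f (v x) (v y) & (ALL b:el (v y). EX! a. pr a b:el f))"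
  unfolding equipotent_def is_bij_def Ex1_def Ball_def by simp
 then show ?thesis unfolding r .
qed

lemma [simp]: "x < n ==> H (is_finite x) n v <-> fin (v x)"
proof -
 assume "x < n"
 then have "H (is_finite x) n v <-> (EX m. m:el om & eqp m (v x))" unfolding is_finite_def by simp
 then show ?thesis using fin_eqp_nat eqp_nat_fin by blast
qed

definition card where "card k <-> Ord k & (ALL a:el k. ~ eqp a k)"

lemma [simp]: "a < n ==> H (is_ordinal a) n v <-> Ord (v a)"
proof -
 have "(ALL x:el a. el x <= el a) & (ALL x:el a. ALL y:el a. x:el y | x = y | y:el x) <-> Ord a" for a
 proof
  assume h: "(ALL x:el a. el x <= el a) & (ALL x:el a. ALL y:el a. x:el y | x = y | y:el x)"
  have "z:el x" if "x:el a" "y:el x" "z:el y" for x y z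
  proof (rule ccontr)
   assume n: "z~:el x"
   have xyz: "x:el a" "y:el x" "z:el y" by fact+
   then have "y:el a" using conjunct1[OF h] by blast
   then have "z:el a" using conjunct1[OF h] xyz by blast
   then have "x:el z | x = z | z:el x" using conjunct2[OF h] xyz(1) by blast
   then consider "z = x" | "x:el z" using n by auto
   then show False
   proof cases
    case 1 then show False using that mem_asym by blast
   next
    case 2
    \<comment> \<open>A cycle of three memberships, excluded by Foundation for the set of its
      elements.\<close>
    let ?t = "ins x (dbl y z)"
    obtain u where "u:el ?t" "el ?t Int el u = {}" using foundation[of ?t] by auto
    then show False using 2 that by auto
   qed
  qed
  then show "Ord a" unfolding Ord_def trans_def using h by blast
 next
  assume a: "Ord a"
  then show "(ALL x:el a. el x <= el a) & (ALL x:el a. ALL y:el a. x:el y | x = y | y:el x)"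
   using Ord_linear Ord_mem[OF a] Ord_trans[OF a] by blast
 qed
 note r = this
 assume "a < n"
 then have "H (is_ordinal a) n v <-> (ALL x:el (v a). el x <= el (v a)) &
  (ALL x:el (v a). ALL y:el (v a). x:el y | x = y | y:el x)"
  unfolding is_ordinal_def Ball_def by simp
 then show ?thesis unfolding r .
qed

lemma [simp]: "k < n ==> H (is_cardinal k) n v <-> card (v k)"
 unfolding is_cardinal_def card_def by auto

lemma [simp]: "x < n ==> k < n ==> H (has_card x k) n v <-> card (v k) & eqp (v x) (v k)"
 unfolding has_card_def by simp

lemma [simp]: "k < n ==> H (is_omega1 k) n v <-> card (v k) & om:el (v k) &
  (ALL l. card l & om:el l --> el (v k) <= el l)"
 unfolding is_omega1_def by simp

lemma [simp]: "c < n ==> H (is_continuum c) n v <-> card (v c) & eqp (pw om) (v c)"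
 unfolding is_continuum_def by simp

lemma [simp]: "f < n ==> x < n ==> y < n ==> z < n ==> H (is_app2 f x y z) n v <-> pr (pr (v x) (v y)) (v z):el (v f)"
 unfolding is_app2_def by simp

lemma [simp]: "K < n ==> f < n ==> e < n ==> H (is_abelian_monoid K f e) n v <-> abm (v K) (v f) (v e)"
 unfolding is_abelian_monoid_def is_binop_def abm_def Ball_def by simp

lemma [simp]: "K < n ==> a < n ==> m < n ==> z < n ==> u < n ==> H (is_field K a m z u) n v <-> fld (v K) (v a) (v m) (v z) (v u)"
 unfolding is_field_def fld_def Ball_def Bex_def by simp

lemma [simp]: "K < n ==> a < n ==> m < n ==> l < n ==> H (is_ordered_field K a m l) n v <-> ofld (v K) (v a) (v m) (v l)"
 unfolding is_ordered_field_def ofld_def Ball_def by (simp add: Ball_def Bex_def)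

lemma [simp]: "b < n ==> S < n ==> K < n ==> l < n ==> H (is_upper_bound b S K l) n v <-> ubd (v b) (v S) (v K) (v l)"
 unfolding is_upper_bound_def ubd_def Ball_def by simp

lemma [simp]: "K < n ==> a < n ==> m < n ==> l < n ==> H (is_reals K a m l) n v <-> rls (v K) (v a) (v m) (v l)"
 unfolding is_reals_def rls_def by simp

definition "itv S K lt <-> (ALL V. V:el S <-> el V <= el K & (ALL x:el V. EX a:el K. EX b:el K. pr a x:el lt & pr x b:el lt &
  (ALL y:el K. pr a y:el lt & pr y b:el lt --> y:el V)))"

definition "cts f X T Y S <-> fnr f X Y & (ALL V:el S. EX U:el T. ALL x. x:el U <-> x:el X & (EX y:el V. pr x y:el f))"

definition "pseudo X T <-> (ALL K add mul lt S f. rls K add mul lt & itv S K lt & cts f X T K S -->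
  (EX a:el K. EX b:el K. ALL x:el X. ALL y:el K. pr x y:el f --> pr a y:el lt & pr y b:el lt))"

lemma [simp]: "X < n ==> T < n ==> H (is_pseudocompact X T) n v <-> pseudo (v X) (v T)"
proof -
 have [simp]: "S < n ==> K < n ==> l < n ==> H (is_interval_topology S K l) n v <-> itv (v S) (v K) (v l)" for S K l n v
  unfolding is_interval_topology_def itv_def Ball_def Bex_def by simp
 have [simp]: "f < n ==> X < n ==> T < n ==> Y < n ==> S < n ==> H (is_continuous f X T Y S) n v <-> cts (v f) (v X) (v T) (v Y) (v S)" for f X T Y S n v
  unfolding is_continuous_def cts_def Ball_def Bex_def by simp
 show "X < n ==> T < n ==> H (is_pseudocompact X T) n v <-> pseudo (v X) (v T)"
  unfolding is_pseudocompact_def pseudo_def Ball_def Bex_def by simp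
qed

lemma [simp]: "A < n ==> H (is_AD A) n v <-> ad (v A)"
 unfolding is_AD_def ad_def Ball_def by simp

text \<open>The formula compares \<open>A\<close> with larger families, \<open>mad\<close> with
  single infinite sets: a further member of a larger family would be almost disjoint from every
  member of \<open>A\<close>.\<close>

lemma H_MAD: "A < n ==> mad (v A) ==> H (is_MAD A) n v"
proof -
 assume n: "A < n" and m: "mad (v A)"
 have "B = v A" if B: "ad B" "el (v A) <= el B" for B
 proof (rule el_ext)
  have "x:el (v A)" if x: "x:el B" for x
  proof (rule ccontr)
   assume nx: "x~:el (v A)"
   have "el x <= el om" "~ fin x" using B(1) x unfolding ad_def by blast+
   then obtain y where y: "y:el (v A)" "~ fin (vint x y)" using m unfolding mad_def by blast
   then have "x ~= y" "y:el B" using nx B(2) by blast+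
   then show False using B(1) x y(2) unfolding ad_def by blast
  qed
  then show "el B = el (v A)" using B(2) by blast
 qed
 then show ?thesis unfolding is_MAD_def using n m unfolding mad_def by simp
qed

definition "vieS A = set {W. W:el (pw (psiCL A)) & (ALL F:el W. EX C. fin C & el C <= el (psiT A) & vie F C &
  (ALL F':el (psiCL A). vie F' C --> F':el W))}"

lemma el_vieS: "W:el (vieS A) <-> el W <= el (psiCL A) & (ALL F:el W. EX C. fin C & el C <= el (psiT A) & vie F C &
  (ALL F':el (psiCL A). vie F' C --> F':el W))"
proof -
 have "el (vieS A) = {W:el (pw (psiCL A)). ALL F:el W. EX C. fin C & el C <= el (psiT A) & vie F C &
  (ALL F':el (psiCL A). vie F' C --> F':el W)}" unfolding vieS_def by (rule el_sep) (intro dfn)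
 then show ?thesis by simp
qed

definition "topo T X <-> (ALL U:el T. el U <= el X) & zero:el T & X:el T & (ALL U:el T. ALL V:el T. vint U V:el T) &
  (ALL S. el S <= el T --> Uni S:el T)"

definition "isPsi X T A <-> X = un A om & topo T X & om:el T & (ALL n:el om. dbl n n:el T) &
  (ALL x:el A. (ALL n:el om. un (dbl x x) (vmin x n):el T) &
   (ALL U:el T. x:el U --> (EX n:el om. el (un (dbl x x) (vmin x n)) <= el U)))"

definition "isCL Y X T <-> (ALL F. F:el Y <-> el F <= el X & F ~= zero & vmin X F:el T)"

definition "isV S Y T <-> (ALL W. W:el S <-> el W <= el Y & (ALL F:el W. EX C B. el C <= el T & C ~= zero & fin C &
  (ALL F'. F':el B <-> F':el Y & vie F' C) & F:el B & el B <= el W))"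

lemma H_CL_Psi0: "A < n ==> H (CL_Psi_pseudocompact A) n v <-> (EX X T Y S. isPsi X T (v A) & isCL Y X T & isV S Y T & pseudo Y S)"
proof -
 have [simp]: "T < n ==> X < n ==> H (is_topology T X) n v <-> topo (v T) (v X)" for T X n v
  unfolding is_topology_def topo_def Ball_def Bex_def by simp
 have [simp]: "N < n ==> x < n ==> m < n ==> H (is_Psi_nhd N x m) n v <-> v N = un (dbl (v x) (v x)) (vmin (v x) (v m))" for N x m n v
  unfolding is_Psi_nhd_def by simp
 have [simp]: "X < n ==> T < n ==> A < n ==> H (is_Psi X T A) n v <-> isPsi (v X) (v T) (v A)" for X T A n v
  unfolding is_Psi_def isPsi_def Ball_def Bex_def by (simp del: el_un)
 have [simp]: "Y < n ==> X < n ==> T < n ==> H (is_CL Y X T) n v <-> isCL (v Y) (v X) (v T)" for Y X T n v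
  unfolding is_CL_def isCL_def by simp
 have [simp]: "B < n ==> Y < n ==> C < n ==> H (is_Vietoris_basic B Y C) n v <-> (ALL F'. F':el (v B) <-> F':el (v Y) & vie F' (v C))" for B Y C n v
  unfolding is_Vietoris_basic_def vie_def Ball_def Bex_def by (simp del: el_Uni)
 have [simp]: "S < n ==> Y < n ==> T < n ==> H (is_Vietoris S Y T) n v <-> isV (v S) (v Y) (v T)" for S Y T n v
  unfolding is_Vietoris_def isV_def Ball_def by simp
 show "A < n ==> H (CL_Psi_pseudocompact A) n v <-> (EX X T Y S. isPsi X T (v A) & isCL Y X T & isV S Y T & pseudo Y S)"
  unfolding CL_Psi_pseudocompact_def by simp
qed

lemma topo_psiT: "ad A ==> isPsi (un A om) (psiT A) A"
proof -
 assume A: "ad A"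
 have Ao: "x~:el om" "el x <= el om" if "x:el A" for x using ad_not_nat[OF A that] A that unfolding ad_def by blast+
 have "topo (psiT A) (un A om)" unfolding topo_def
 proof (intro conjI ballI allI impI)
  show "U:el (psiT A) ==> el U <= el (un A om)" for U unfolding psiT by simp
  show "zero:el (psiT A)" unfolding psiT by simp
  show "un A om:el (psiT A)" unfolding psiT using Ao(2) by (auto intro!: bexI[OF _ zero_omega])
  show "vint U V:el (psiT A)" if U: "U:el (psiT A)" "V:el (psiT A)" for U V
   unfolding psiT
  proof (intro conjI ballI impI)
   show "el (vint U V) <= el A Un el om" using U unfolding psiT by auto
   fix x assume x: "x:el A" "x:el (vint U V)"
   then have "EX n:el om. el x - el n <= el U" "EX n:el om. el x - el n <= el V"
    using U unfolding psiT by auto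
   then obtain m n where "m:el om" "el x - el m <= el U" "n:el om" "el x - el n <= el V" by blast
   then show "EX n:el om. el x - el n <= el (vint U V)" using un_nat by (intro bexI[of _ "un m n"]) auto
  qed
  show "Uni S:el (psiT A)" if S: "el S <= el (psiT A)" for S
   unfolding psiT
  proof (intro conjI ballI impI)
   show "el (Uni S) <= el A Un el om" using S unfolding el_Uni by (auto dest!: subsetD simp: psiT)
   fix x assume x: "x:el A" "x:el (Uni S)"
   then obtain U where U: "U:el S" "x:el U" by auto
   then obtain n where "n:el om" "el x - el n <= el U" using S x(1) unfolding psiT by (meson psiT subsetD)
   then show "EX n:el om. el x - el n <= el (Uni S)" using U(1) by auto
  qed
 qed
 moreover have "un (dbl x x) (vmin x n):el (psiT A)" if x: "x:el A" "n:el om" for x n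
  unfolding psiT
 proof (intro conjI ballI impI)
  show "el (un (dbl x x) (vmin x n)) <= el A Un el om" using x Ao(2)[OF x(1)] by auto
  fix y assume "y:el A" "y:el (un (dbl x x) (vmin x n))"
  then have "y = x" using Ao(1)[of y] Ao(2)[OF x(1)] by auto
  then show "EX n':el om. el y - el n' <= el (un (dbl x x) (vmin x n))" using x(2) by auto
 qed
 moreover have "EX n:el om. el (un (dbl x x) (vmin x n)) <= el U" if "x:el A" "U:el (psiT A)" "x:el U" for x U
  using that unfolding psiT by auto
 moreover have "U:el (psiT A)" if "el U <= el om" for U unfolding psiT using that Ao(1) by blast
 ultimately show ?thesis unfolding isPsi_def by simp
qed

text \<open>The sets in \<open>psiT A\<close> are unions of singletons of numbers and basic
  neighbourhoods, all of which belong to \<open>T\<close>; so the local conditions leave no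
  freedom.\<close>

lemma isPsi_unique: "ad A ==> isPsi X T A ==> X = un A om & T = psiT A"
proof -
 assume A: "ad A" and h: "isPsi X T A"
 then have X: "X = un A om" unfolding isPsi_def by blast
 have T: "topo T X" "!!n. n:el om ==> dbl n n:el T" "!!x n. x:el A ==> n:el om ==> un (dbl x x) (vmin x n):el T"
  "!!x U. x:el A ==> U:el T ==> x:el U ==> EX n:el om. el (un (dbl x x) (vmin x n)) <= el U"
  using h unfolding isPsi_def by blast+
 have "U:el T <-> U:el (psiT A)" for U
 proof
  assume U: "U:el T"
  then show "U:el (psiT A)" unfolding psiT
  proof (intro conjI ballI impI)
   show "el U <= el A Un el om" using T(1) U X unfolding topo_def by auto
   show "EX n:el om. el x - el n <= el U" if "x:el A" "x:el U" for x using T(4)[OF that(1) U that(2)] by auto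
  qed
 next
  assume U: "U:el (psiT A)"
  obtain S where S: "el S = {V:el T. el V <= el U}" by (erule sep_ex) (intro dfn)
  have "EX V:el S. x:el V" if x: "x:el U" for x
  proof (cases "x:el om")
   case True
   then show ?thesis using T(2) x unfolding S by (intro bexI[of _ "dbl x x"]) auto
  next
   case False
   then have "x:el A" using U x unfolding psiT by blast
   moreover from this obtain n where "n:el om" "el x - el n <= el U" using U x unfolding psiT by blast
   ultimately show ?thesis using T(3)[of x n] x unfolding S by (intro bexI[of _ "un (dbl x x) (vmin x n)"]) auto
  qed
  then have "el (Uni S) = el U" using S by auto
  then have "Uni S = U" by (rule el_ext)
  moreover have "Uni S:el T" using T(1) S unfolding topo_def by blast
  ultimately show "U:el T" by simp
 qed
 then show ?thesis using X ext_iff by blast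
qed

text \<open>The space, the hyperspace and their topologies exist and are determined by
  \<open>A\<close>. So the existential quantifiers in \<open>CL_Psi_pseudocompact\<close> have the
  intended effect under negation, too.\<close>

lemma H_CL_Psi: "A < n ==> ad (v A) ==> H (CL_Psi_pseudocompact A) n v <-> pseudo (psiCL (v A)) (vieS (v A))"
proof -
 assume n: "A < n" and a: "ad (v A)"
 let ?A = "v A"
 have CL: "isCL Y (un ?A om) (psiT ?A) <-> Y = psiCL ?A" for Y
 proof -
  have "el (psiCL ?A) = {F:el (pw (un ?A om)). F ~= zero & vmin (un ?A om) F:el (psiT ?A)}"
   unfolding psiCL_def by (rule el_sep) (intro dfn)
  then have "F:el (psiCL ?A) <-> el F <= el (un ?A om) & F ~= zero & vmin (un ?A om) F:el (psiT ?A)" for F by simp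
  then show ?thesis unfolding isCL_def ext_iff[of Y] by blast
 qed
 have V: "isV S (psiCL ?A) (psiT ?A) <-> S = vieS ?A" for S
 proof -
  have eq: "(EX C B. el C <= el (psiT ?A) & C ~= zero & fin C & (ALL F'. F':el B <-> F':el (psiCL ?A) & vie F' C) &
    F:el B & el B <= el W) <->
   (EX C. fin C & el C <= el (psiT ?A) & vie F C & (ALL F':el (psiCL ?A). vie F' C --> F':el W))"
   if F: "F:el (psiCL ?A)" for F W
  proof
   assume "EX C. fin C & el C <= el (psiT ?A) & vie F C & (ALL F':el (psiCL ?A). vie F' C --> F':el W)"
   then obtain C where C: "fin C" "el C <= el (psiT ?A)" "vie F C" "ALL F':el (psiCL ?A). vie F' C --> F':el W" by blast
   have "C ~= zero"
   proof
    assume "C = zero"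
    then have "el F = {}" using C(3) unfolding vie_def by simp
    then show False using F zero_iff unfolding psiCL by blast
   qed
   moreover have e: "el (set {F'. F':el (psiCL ?A) & vie F' C}) = {F':el (psiCL ?A). vie F' C}"
    by (rule el_sep) (intro dfn)
   ultimately show "EX C B. el C <= el (psiT ?A) & C ~= zero & fin C & (ALL F'. F':el B <-> F':el (psiCL ?A) & vie F' C) &
    F:el B & el B <= el W"
    by (rule_tac exI[of _ C], rule_tac exI[of _ "set {F'. F':el (psiCL ?A) & vie F' C}"]) (unfold e, use C F in auto)
  qed blast
  have "(el W <= el (psiCL ?A) & (ALL F:el W. EX C B. el C <= el (psiT ?A) & C ~= zero & fin C &
   (ALL F'. F':el B <-> F':el (psiCL ?A) & vie F' C) & F:el B & el B <= el W)) <-> W:el (vieS ?A)" for W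
   unfolding el_vieS by (rule conj_cong[OF HOL.refl], rule ball_cong[OF HOL.refl], rule eq) blast
  then have "isV S (psiCL ?A) (psiT ?A) <-> (ALL W. W:el S <-> W:el (vieS ?A))"
   unfolding isV_def by simp
  then show ?thesis using ext_iff by blast
 qed
 show ?thesis unfolding H_CL_Psi0[where v = v, OF n] using isPsi_unique[OF a] topo_psiT[OF a] CL V by metis
qed

text \<open>An ordered field has no extremal elements, by translation along a positive or a negative
  element; \<open>bounded_above\<close> asks for this.\<close>

lemma ofld_order:
 assumes "ofld K add mul lt"
 shows "ALL x:el K. EX y:el K. pr x y:el lt" "ALL x:el K. EX y:el K. pr y x:el lt" "el K ~= {}"
proof -
 obtain zer one where f: "fld K add mul zer one" and lin: "ALL x:el K. ALL y:el K. pr x y:el lt | x = y | pr y x:el lt"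
  and mono: "ALL x:el K. ALL y:el K. ALL z:el K. ALL u:el K. ALL v:el K.
   pr x y:el lt & pr (pr x z) u:el add & pr (pr y z) v:el add --> pr u v:el lt"
  using assms unfolding ofld_def by blast
 have zo: "zer:el K" "one:el K" "zer ~= one" using f unfolding fld_def abm_def by blast+
 have am: "abm K add zer" using f unfolding fld_def by blast
 have z: "pr (pr x zer) x:el add" "pr (pr zer x) x:el add" if "x:el K" for x
  using am that unfolding abm_def by blast+
 have inv: "EX y:el K. pr (pr x y) zer:el add" if "x:el K" for x using f that unfolding fld_def by blast
 have tot: "EX s:el K. pr (pr x y) s:el add" if h: "x:el K" "y:el K" for x y
 proof -
  have F: "fnr add (times K K) K" using am unfolding abm_def by blast
  have p: "pr x y:el (times K K)" using h by simp
  show ?thesis using fnr_app[OF F p] fnr_in[OF F p] by blast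
 qed
 have "EX u:el K. pr zer u:el lt"
 proof (cases "pr zer one:el lt")
  case False
  then have h: "pr one zer:el lt" using lin zo by blast
  obtain y where y: "y:el K" "pr (pr one y) zer:el add" using inv zo by blast
  then have "pr zer y:el lt" using mono h zo z by blast
  then show ?thesis using y by blast
 qed (use zo in blast)
 then obtain u where u: "u:el K" "pr zer u:el lt" by blast
 obtain m where m: "m:el K" "pr (pr u m) zer:el add" using inv u by blast
 have ml: "pr m zer:el lt" using mono u m zo z by blast
 show "ALL x:el K. EX y:el K. pr x y:el lt"
 proof
  fix x assume x: "x:el K"
  obtain s where s: "s:el K" "pr (pr u x) s:el add" using tot u x by blast
  then have "pr x s:el lt" using mono u x zo z by blast
  then show "EX y:el K. pr x y:el lt" using s by blast
 qed
 show "ALL x:el K. EX y:el K. pr y x:el lt"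
 proof
  fix x assume x: "x:el K"
  obtain s where s: "s:el K" "pr (pr m x) s:el add" using tot m x by blast
  then have "pr s x:el lt" using mono m ml x zo z by blast
  then show "EX y:el K. pr y x:el lt" using s by blast
 qed
 show "el K ~= {}" using zo by blast
qed

declare E_elts [simp del]

end

context gext
begin

text \<open>\<open>bounded_above\<close> is applied to the order of the field and to its
  reverse.\<close>

lemma pseudo_A0: "pseudo (psiCL A0) (vieS A0)"
 unfolding pseudo_def
proof (intro allI impI, elim conjE)
 fix K add mul lt S f assume r: "rls K add mul lt" and S: "itv S K lt" and c: "cts f (psiCL A0) (vieS A0) K S"
 have o: "ofld K add mul lt" using r unfolding rls_def by blast
 note ord = ofld_order[OF o]
 have tr: "pr x z:el lt" if "x:el K" "y:el K" "z:el K" "pr x y:el lt" "pr y z:el lt" for x y z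
  using o that unfolding ofld_def by blast
 have irr: "pr x x~:el lt" if "x:el K" for x using o that unfolding ofld_def by blast
 have lin: "pr x y:el lt | x = y | pr y x:el lt" if "x:el K" "y:el K" for x y
  using o that unfolding ofld_def by blast
 have F: "fnr f (psiCL A0) K" using c unfolding cts_def by blast
 have cont: "EX C. fin C & el C <= el (psiT A0) & vie X C &
   (ALL F':el (psiCL A0). vie F' C --> pr a (app f F'):el lt & pr (app f F') b:el lt)"
  if h: "X:el (psiCL A0)" "a:el K" "b:el K" "pr a (app f X):el lt" "pr (app f X) b:el lt" for X a b
 proof -
  obtain V where V: "el V = {y:el K. pr a y:el lt & pr y b:el lt}" by (erule sep_ex) (intro dfn)
  have "V:el S" using S h(2,3) V unfolding itv_def by auto
  then obtain U where U: "U:el (vieS A0)" "!!x. x:el U <-> x:el (psiCL A0) & (EX y:el V. pr x y:el f)"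
   using c unfolding cts_def by blast
  have U2: "x:el U <-> x:el (psiCL A0) & app f x:el V" for x using U(2)[of x] fnr_app[OF F, of x] by auto
  have "X:el U" unfolding U2 V using h fnr_in[OF F] by blast
  then obtain C where "fin C" "el C <= el (psiT A0)" "vie X C" "ALL F':el (psiCL A0). vie F' C --> F':el U"
   using U(1) unfolding el_vieS by blast
  then show ?thesis using U2 V by blast
 qed
 have "EX b:el K. ALL X:el (psiCL A0). pr (app f X) b:el lt"
 proof (rule bounded_above[OF ad_A0 accumulation, of "%x y. pr x y:el lt" K f])
  show "dfn (%e. pr (e 0) (e (Suc 0)):el lt)" by (intro dfn)
 qed (use ord in \<open>auto intro: tr fnr_in[OF F] cont dest: irr lin\<close>)
 then obtain b where b: "b:el K" "ALL X:el (psiCL A0). pr (app f X) b:el lt" by blast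
 have "EX a:el K. ALL X:el (psiCL A0). pr a (app f X):el lt"
 proof (rule bounded_above[OF ad_A0 accumulation, of "%x y. pr y x:el lt" K f])
  show "dfn (%e. pr (e (Suc 0)) (e 0):el lt)" by (intro dfn)
  show "EX C. fin C & el C <= el (psiT A0) & vie X C &
   (ALL F':el (psiCL A0). vie F' C --> pr (app f F') a:el lt & pr b (app f F'):el lt)"
   if "X:el (psiCL A0)" "a:el K" "b:el K" "pr (app f X) a:el lt" "pr b (app f X):el lt" for X a b
   using cont[OF that(1,3,2,5,4)] by blast
 qed (use ord in \<open>auto intro: tr fnr_in[OF F] dest: irr lin\<close>)
 then obtain a where a: "a:el K" "ALL X:el (psiCL A0). pr a (app f X):el lt" by blast
 show "EX a:el K. EX b:el K. ALL x:el (psiCL A0). ALL y:el K. pr x y:el f --> pr a y:el lt & pr y b:el lt"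
  by (rule bexI[OF _ a(1)], rule bexI[OF _ b(1)]) (use a(2) b(2) fnr_app[OF F] in auto)
qed

text \<open>The function is locally constant, so the preimage of any subset of \<open>K\<close> is
  open; its values at the levels are the terms of the unbounded sequence.\<close>

lemma not_pseudo_A1:
 assumes r: "rls K add mul lt" and ph: "ALL n:el om. app ph n:el K"
  and unb: "ALL b:el K. EX n:el om. pr b (app ph n):el lt"
 shows "~ pseudo (psiCL A1) (vieS A1)"
proof
 assume p: "pseudo (psiCL A1) (vieS A1)"
 have o: "ofld K add mul lt" using r unfolding rls_def by blast
 have tr: "pr x z:el lt" if "x:el K" "y:el K" "z:el K" "pr x y:el lt" "pr y z:el lt" for x y z
  using o that unfolding ofld_def by blast
 have irr: "pr x x~:el lt" if "x:el K" for x using o that unfolding ofld_def by blast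
 obtain f where f: "!!n. n:el om ==> app f (lv n) = app ph n"
  "!!F. F:el (psiCL A1) ==> app f F:el K"
  "!!F. F:el (psiCL A1) ==> EX C. fin C & el C <= el (psiT A1) & vie F C &
   (ALL F':el (psiCL A1). vie F' C --> app f F' = app f F)"
  "el f = (%F. pr F (app f F)) ` el (psiCL A1)"
  using locally_constant[of "app ph zero" K ph] ph by auto
 define S where "S = set {V. V:el (pw K) & (ALL x:el V. EX a:el K. EX b:el K. pr a x:el lt & pr x b:el lt &
  (ALL y:el K. pr a y:el lt & pr y b:el lt --> y:el V))}"
 have "el S = {V:el (pw K). ALL x:el V. EX a:el K. EX b:el K. pr a x:el lt & pr x b:el lt &
  (ALL y:el K. pr a y:el lt & pr y b:el lt --> y:el V)}" unfolding S_def by (rule el_sep) (intro dfn)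
 then have S: "itv S K lt" unfolding itv_def by simp
 have F: "fnr f (psiCL A1) K" unfolding fnr_def using f(2,4) by auto
 have "cts f (psiCL A1) (vieS A1) K S" unfolding cts_def
 proof (intro conjI ballI F)
  fix V
  obtain U where U: "el U = {x:el (psiCL A1). app f x:el V}" by (erule sep_ex) (intro dfn)
  have "EX C. fin C & el C <= el (psiT A1) & vie X C & (ALL F':el (psiCL A1). vie F' C --> F':el U)" if X: "X:el U" for X
  proof -
   have "X:el (psiCL A1)" using X U by blast
   then obtain C where "fin C" "el C <= el (psiT A1)" "vie X C" "ALL F':el (psiCL A1). vie F' C --> app f F' = app f X"
    using f(3) by blast
   moreover have "app f X:el V" using X U by blast
   ultimately have "ALL F':el (psiCL A1). vie F' C --> F':el U" using U by auto
   then show ?thesis using \<open>fin C\<close> \<open>el C <= el (psiT A1)\<close> \<open>vie X C\<close> by blast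
  qed
  then have "U:el (vieS A1)" unfolding el_vieS using U by blast
  moreover have "x:el U <-> x:el (psiCL A1) & (EX y:el V. pr x y:el f)" for x
   unfolding U using fnr_app[OF F, of x] by auto
  ultimately show "EX U:el (vieS A1). ALL x. x:el U <-> x:el (psiCL A1) & (EX y:el V. pr x y:el f)" by blast
 qed
 then obtain a b where b: "b:el K" "ALL x:el (psiCL A1). ALL y:el K. pr x y:el f --> pr a y:el lt & pr y b:el lt"
  using p r S unfolding pseudo_def by blast
 obtain n where n: "n:el om" "pr b (app ph n):el lt" using unb b(1) by blast
 have "pr (lv n) (app ph n):el f" using fnr_app[OF F lv_CL[OF n(1)]] f(1)[OF n(1)] by simp
 then have "pr (app ph n) b:el lt" using b(2) lv_CL[OF n(1)] ph n(1) by blast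
 then show False using tr[OF b(1) _ b(1) n(2)] irr[OF b(1)] ph n(1) by blast
qed

text \<open>All members of \<open>w\<close> are countable, so a cardinal above \<open>om\<close> and
  below \<open>w\<close> would be equipotent with \<open>om\<close>.\<close>

lemma card_w: "card w" "om:el w" "card l ==> om:el l ==> el w <= el l"
proof -
 show "card w" unfolding card_def using w lep_trans[OF eqp_lep[OF eqp_sym]] by blast
 have "~ el w <= el om" using w(2) lep_subset by blast
 then have "w~:el om" "w ~= om" using Ord_subset[OF w(1) Ord_omega] by auto
 then show "om:el w" using Ord_linear[OF w(1) Ord_omega] by blast
 assume l: "card l" "om:el l"
 show "el w <= el l"
 proof (rule ccontr)
  assume "~ el w <= el l"
  then have "l:el w" using Ord_linear[OF w(1), of l] Ord_subset[OF w(1), of l] l(1) unfolding card_def by blast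
  then have "cnt l" by (rule w(3))
  moreover have "lep om l" using Ord_trans l unfolding card_def by (intro lep_subset) blast
  ultimately have "eqp om l" by (intro cantor_bernstein)
  then show False using l unfolding card_def by blast
 qed
qed

lemma main:
 assumes "rls K add mul lt" "ALL n:el om. app ph n:el K" "ALL b:el K. EX n:el om. pr b (app ph n):el lt"
 shows "H main_sentence 0 v"
proof -
 obtain c where c: "Ord c" "eqp (pw om) c" "ALL a:el c. ~ eqp a c" using ex_cardinal by blast
 have "w:el c"
 proof (rule ccontr)
  assume "w~:el c"
  then have "el c <= el w" using Ord_linear[OF w(1) c(1)] Ord_subset[OF c(1) w(1)] by blast
  then show False using continuum_big lep_trans[OF eqp_lep[OF c(2)] lep_subset] by blast
 qed
 moreover have "card c" unfolding card_def using c by blast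
 moreover have "eqp A0 w" using eqp_trans[OF eqp_sym[OF A0_J] Jw] .
 moreover have "eqp A1 c" using eqp_trans[OF A1_pw c(2)] .
 moreover have "ad A0" "ad A1" using mad_A0 mad_A1 unfolding mad_def by blast+
 ultimately have facts: "w:el c" "card c" "eqp A0 w" "eqp A1 c" "ad A0" "ad A1" by blast+
 show ?thesis
 proof (simp only: hold_simps2 hold_simps(4), rule exI[of _ w], rule exI[of _ c], intro conjI;
   (rule exI[of _ A0], rule exI[of _ A1], intro conjI)?)
 qed (use facts card_w c(2) pseudo_A0 not_pseudo_A1[OF assms] in \<open>simp add: H_CL_Psi H_MAD mad_A0 mad_A1 E_elts\<close>)+
qed

end

section \<open>The generic family in the extension\<close>

lemma (in zfc) lep_surj: "lep x y ==> EX f. el x <= app f ` el y"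
proof -
 assume "lep x y"
 then obtain f where f: "inj_fun f x y" unfolding lep_def by blast
 define g where "g m = Uni (set {u. u:el x & app f u = m})" for m
 have "el (set {u. u:el x & app f u = m}) = {u:el x. app f u = m}" for m
  by (rule el_sep) (intro dfn)
 then have g: "g (app f u) = u" if "u:el x" for u
  using that f unfolding g_def inj_fun_def by (intro el_ext) auto
 have dg: "dff (%e. g (e 0))" unfolding g_def by (intro dfn)
 have "u:app (lam y g) ` el y" if "u:el x" for u
  using g[OF that] app_lam[OF dg, of "app f u" y] f that unfolding inj_fun_def by (intro image_eqI[of _ _ "app f u"]) auto
 then show ?thesis by blast
qed

context ext
begin

text \<open>By \<open>covering\<close>, a map of the extension has only countably many possible
  values at each point of \<open>C\<close>, so \<open>times C om\<close> bounds its range in the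
  ground model.\<close>

lemma no_collapse:
 assumes f: "N.el (i D) <= N.app f ` N.el (i C)" shows "lep D (times C om)"
proof (cases "el D = {}")
 case False
 then obtain x0 where x0: "x0:el D" by blast
 \<comment> \<open>Values outside \<open>i D\<close> are replaced by a fixed element, as
   \<open>covering\<close> asks for a map into \<open>i D\<close>.\<close>
 define g where "g = N.lam (i C) (%t. if N.app f t:N.el (i D) then N.app f t else i x0)"
 have dg: "N.dff (%e. if N.app f (e 0):N.el (i D) then N.app f (e 0) else i x0)" by (intro N.dfn)
 have g: "N.app g (i c) = (if N.app f (i c):N.el (i D) then N.app f (i c) else i x0)" if "c:el C" for c
  unfolding g_def using N.app_lam[OF dg, of "i c" "i C"] that by simp
 have gD: "N.app g (i c):i ` el D" if "c:el C" for c using g[OF that] x0 by auto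
 obtain h where h: "!!c. c:el C ==> cnt (app h c) & el (app h c) <= el D & N.app g (i c):i ` el (app h c)"
  by (rule covering[OF ccc gD]) blast+
 have dh: "dff (%e. app h (e 0))" by (intro dfn)
 have "x:el (Uni (img C (app h)))" if x: "x:el D" for x
 proof -
  have "i x:N.app f ` N.el (i C)" using f x by auto
  then obtain c where c: "c:el C" "i x = N.app f (i c)" by auto
  have "N.app g (i c) = (if i x:N.el (i D) then i x else i x0)" unfolding c(2) by (rule g[OF c(1)])
  then have "N.app g (i c) = i x" using x by simp
  then have "x:el (app h c)" using h[OF c(1)] by auto
  then show ?thesis using c(1) by (auto simp: el_img[OF dh])
 qed
 then have "lep D (Uni (img C (app h)))" by (intro lep_subset) blast
 moreover have "lep (Uni (img C (app h))) (times (img C (app h)) om)"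
  by (rule lep_Uni) (use h in \<open>auto simp: el_img[OF dh]\<close>)
 moreover have "lep (times (img C (app h)) om) (times C om)"
  by (rule lep_times[OF lep_img[OF dh] lep_subset]) simp
 ultimately show ?thesis using lep_trans by blast
qed (auto intro: lep_subset)

lemma i_eqp: "lep x y ==> lep y x ==> N.eqp (i x) (i y)"
 by (intro N.cantor_bernstein i_lep)

text \<open>A copy of \<open>om1\<close> inside the larger set \<open>II\<close>, by means of
  singletons; only these Cohen indices serve for guessing.\<close>

definition I0 :: nat where
 "I0 = img om1 (%x. pr (succ zero) (dbl (pr (pr x zero) zero) (pr (pr x zero) zero)))"

lemma el_I0: "el I0 = (%x. pr (succ zero) (dbl (pr (pr x zero) zero) (pr (pr x zero) zero))) ` el om1"
 unfolding I0_def by (rule el_img) (intro dfn)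

lemma I0_II: "el I0 <= el II"
 unfolding el_I0 II_def by auto

lemma II_JJ: "el II Int el JJ = {}"
 using succ_neq_zero[of zero] unfolding II_def JJ_def by (auto dest: sym)

definition aN :: nat where "aN = N.lam (i LL) AN"

lemma aN: "c:el LL ==> N.app aN (i c) = AN (i c)"
proof -
 have "N.dff (%e. AN (e 0))" by (intro N.dfn)
 from N.app_lam[OF this, of "i c" "i LL"] show "c:el LL ==> N.app aN (i c) = AN (i c)" unfolding aN_def by simp
qed

lemma AN_cases: "x:N.el (AN b) ==> EX k:el om. x = i k"
 unfolding el_AN N_omega by blast

text \<open>A condition can be lengthened by one and the new number put into the set at
  \<open>c\<close> alone, which respects almost disjointness.\<close>

lemma AN_inf: "c:el LL ==> n:el om ==> EX k. k:el om & k~:el n & i k:N.el (AN (i c))"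
proof -
 assume c: "c:el LL" and n: "n:el om"
 obtain v where v: "v:G" using G_ne by blast
 have "EX s:G. s <| v & (EX k. k:el om & k~:el n & pr c k:el (pa s))"
 proof (rule generic[OF _ v])
  fix r assume r: "r <| v"
  have "el (dbl c c) <= el LL" using c by simp
  from extend[OF ple_D(1)[OF r] fin_dbl this n] obtain t where t: "t <| r" "c:el (pF t)" "el n <= el (pn t)" by auto
  have tP: "t:el PP" by (rule ple_D(1)[OF t(1)])
  define u where "u = pr (succ (pn t)) (pr (pF t) (ins (pr c (pn t)) (pa t)))"
  have a: "el (pa t) <= el (times (pF t) (pn t))" using tP unfolding PP_iff by auto
  have uP: "u:el PP" unfolding u_def
  proof (rule PP_I[OF succ_omega[OF PP_D(1)[OF tP]] PP_D(2)[OF tP] PP_D(3)[OF tP]])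
   show "el (ins (pr c (pn t)) (pa t)) <= el (times (pF t) (succ (pn t)))" using a t(2) by auto
  qed
  have us: "pn u = succ (pn t)" "pF u = pF t" "pa u = ins (pr c (pn t)) (pa t)" unfolding u_def by simp_all
  have "u <| t"
  proof (rule pleI[OF uP tP]; unfold us)
   show "pr b k:el (ins (pr c (pn t)) (pa t)) <-> pr b k:el (pa t)" if "k:el (pn t)" for b k
    using that mem_irrefl[of "pn t"] by auto
   show "k:el (pn t)" if "b ~= d" "pr b k:el (ins (pr c (pn t)) (pa t))" "pr d k:el (ins (pr c (pn t)) (pa t))" for b d k
    using that PP_D(4)[OF tP] by auto
  qed auto
  moreover have "pn t~:el n" using t(3) mem_irrefl by blast
  ultimately show "EX s. s <| r & (EX k. k:el om & k~:el n & pr c k:el (pa s))"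
   using ple_trans[OF _ t(1)] PP_D(1)[OF tP] us(3) by (intro exI[of _ u] conjI[OF _ exI[of _ "pn t"]]) simp_all
 qed (intro dfn)
 then show ?thesis using AN_iff by blast
qed

lemma gext_EN: "gext EN (i om1) (i JJ) (i I0) (i LL) aN"
proof (intro gext.intro zfc_EN gext_axioms.intro)
 have LJ: "el JJ <= el LL" "el II <= el LL" unfolding LL_def by auto
 show "N.Ord (i om1)" by (rule i_Ord[OF om1(1)])
 show "N.lep x N.om" if "x:N.el (i om1)" for x using that i_lep om1(3) by (auto simp flip: i_omega)
 show "~ N.lep (i om1) N.om"
 proof
  assume "N.lep (i om1) N.om"
  then obtain f where "N.el (i om1) <= N.app f ` N.el (i om)" using N.lep_surj i_omega by metis
  then have "lep om1 (times om om)" by (rule no_collapse)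
  then show False using om1(2) lep_trans cnt_omega_times by blast
 qed
 show "N.eqp (i JJ) (i om1)"
 proof (rule i_eqp)
  show "lep JJ om1" by (rule lepI[of vsnd]) (intro dfn, auto simp: JJ_def)
  show "lep om1 JJ" by (rule lepI[of "pr zero"]) (intro dfn, auto simp: JJ_def)
 qed
 show "N.eqp (i I0) (i om1)"
 proof (rule i_eqp)
  have d: "dff (%e. pr (succ zero) (dbl (pr (pr (e 0) zero) zero) (pr (pr (e 0) zero) zero)))" by (intro dfn)
  show "lep I0 om1" unfolding I0_def by (rule lep_img[OF d])
  show "lep om1 I0"
  proof (rule lepI[OF d])
   show "u = v" if "pr (succ zero) (dbl (pr (pr u zero) zero) (pr (pr u zero) zero)) =
    pr (succ zero) (dbl (pr (pr v zero) zero) (pr (pr v zero) zero))" for u v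
   proof -
    have "el (dbl (pr (pr u zero) zero) (pr (pr u zero) zero)) = el (dbl (pr (pr v zero) zero) (pr (pr v zero) zero))"
     using that by simp
    then show ?thesis by simp
   qed
  qed (auto simp: el_I0)
 qed
 show "N.el (i JJ) <= N.el (i LL)" "N.el (i I0) <= N.el (i LL)" using LJ I0_II by auto
 show "N.el (i I0) Int N.el (i JJ) = {}" using I0_II II_JJ by auto
 show "N.el (N.app aN c) <= N.el N.om" if "c:N.el (i LL)" for c using that aN by (auto simp: el_AN)
 show "~ N.fin (N.app aN c)" if cJ: "c:N.el (i JJ)" for c
 proof -
  obtain c0 where c: "c = i c0" "c0:el LL" using cJ LJ by auto
  show ?thesis unfolding c(1) aN[OF c(2)]
  proof (rule N.unbounded_infinite)
   fix n assume "n:N.el N.om"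
   then obtain n0 where n: "n = i n0" "n0:el om" unfolding N_omega by blast
   obtain k where "k~:el n0" "i k:N.el (AN (i c0))" using AN_inf[OF c(2) n(2)] by blast
   then show "EX m:N.el (AN (i c0)). m~:N.el n" unfolding n(1) by (intro bexI[of _ "i k"]) simp_all
  qed (auto simp: el_AN)
 qed
 show "N.fin (N.vint (N.app aN b) (N.app aN c))" if bcJ: "b:N.el (i JJ)" "c:N.el (i JJ)" "b ~= c" for b c
 proof -
  obtain b0 c0 where bc: "b = i b0" "c = i c0" "b0:el JJ" "c0:el JJ" "b0 ~= c0" using bcJ by auto
  obtain n where n: "n:el om" "ALL k. i k:N.el (AN (i b0)) --> i k:N.el (AN (i c0)) --> k:el n" using N_AD[OF bc(3-5)] by blast
  have e: "N.app aN b = AN (i b0)" "N.app aN c = AN (i c0)" using bc aN LJ by auto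
  have "N.el (N.vint (N.app aN b) (N.app aN c)) <= N.el (i n)" unfolding e using n(2) AN_cases by fastforce
  then show ?thesis using N.fin_subset[OF i_fin[OF fin_nat[OF n(1)]]] by blast
 qed
 show "~ N.lep (i LL) (N.times (i om1) N.om)"
 proof
  assume "N.lep (i LL) (N.times (i om1) N.om)"
  then have "N.lep (i LL) (i (times om1 om))" by (simp only: i_times i_omega)
  then obtain f where "N.el (i LL) <= N.app f ` N.el (i (times om1 om))" using N.lep_surj by blast
  then have "lep LL (times (times om1 om) om)" by (rule no_collapse)
  moreover have "lep (pw (times (times om1 om) om)) LL"
   by (rule lepI[of "pr (succ zero)"]) (intro dfn, auto simp: LL_def II_def)
  ultimately show False using cantor lep_trans by blast
 qed
 fix D av
 assume D: "N.el D <= N.el (N.times N.om (N.Fin N.om))"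
  and dense: "!!e m s. e:N.el (N.Fin (i JJ)) ==> m:N.el N.om ==> N.el s <= N.el m ==>
    EX m' s'. N.pr m' s':N.el D & N.el m <= N.el m' & N.el s' <= N.el m' & N.el s' Int N.el m = N.el s &
     (av --> (ALL b:N.el e. ALL k:N.el s'. k~:N.el m --> k~:N.el (N.app aN b)))"
 have Dc: "EX m s. d = i (pr m s) & m:el om & s:el (Fin om)" if "d:N.el D" for d
 proof -
  have "d:N.el (i (times om (Fin om)))" using D that by (auto simp only: i_times i_omega i_Fin)
  then show ?thesis by auto
 qed
 \<comment> \<open>The codes in \<open>Gen\<close> carry a finite set of indices to be avoided; here
   it may be any such set, combined with any element of \<open>D\<close>.\<close>
 define D3 where "D3 = N.times (i (Fin JJ)) D"
 have D3: "i (pr e (pr m s)):N.el D3 <-> e:el (Fin JJ) & i (pr m s):N.el D" for e m s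
  unfolding D3_def i_pr[of e] by (simp del: el_Fin)
 have D3C: "N.el D3 <= i ` el CC"
 proof
  fix x assume "x:N.el D3"
  then obtain e d where x: "x = N.pr (i e) d" "e:el (Fin JJ)" "d:N.el D" unfolding D3_def by (auto simp del: el_Fin)
  then obtain m s where "d = i (pr m s)" "m:el om" "s:el (Fin om)" using Dc by blast
  then have "x = i (pr e (pr m s))" "pr e (pr m s):el CC" using x unfolding CC_def by (simp_all add: i_pr)
  then show "x:i ` el CC" by blast
 qed
 obtain S where S: "cnt S" "!!c. c:el LL ==> c~:el S ==> (c:el JJ --> av) ==>
  EX e m s. i (pr e (pr m s)):N.el D3 & m:el om & el s <= el m & (ALL k:el m. i k:N.el (AN (i c)) <-> k:el s)"
 proof (rule Gen[OF D3C, of av])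
  fix e m s assume h: "e:el (Fin JJ)" "m:el om" "el s <= el m"
  have h': "i e:N.el (N.Fin (i JJ))" "i m:N.el N.om" "N.el (i s) <= N.el (i m)"
   using h unfolding N_Fin N_omega by auto
  obtain m1 s1 where "N.pr m1 s1:N.el D" and r: "N.el (i m) <= N.el m1" "N.el s1 <= N.el m1"
   "N.el s1 Int N.el (i m) = N.el (i s)"
   "av --> (ALL b:N.el (i e). ALL k:N.el s1. k~:N.el (i m) --> k~:N.el (N.app aN b))" using dense[OF h'] by blast
  moreover from this(1) obtain m' s' where ms: "m1 = i m'" "s1 = i s'" using Dc by (metis i_pr N.pr_inject)
  ultimately have d: "i (pr m' s'):N.el D" by (simp add: i_pr)
  have "el s' Int el m = el s"
  proof (intro set_eqI iffI)
   fix k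
   have "i k:N.el (i s') Int N.el (i m) <-> i k:N.el (i s)" using r(3) ms by simp
   then show "k:el s' Int el m ==> k:el s" "k:el s ==> k:el s' Int el m" by auto
  qed
  moreover have "el m <= el m'" "el s' <= el m'" using r(1,2) ms by auto
  moreover have "av --> (ALL b:el e. ALL k:el s'. k~:el m --> i k~:N.el (AN (i b)))"
  proof (intro impI ballI)
   fix b k assume "av" "b:el e" "k:el s'" "k~:el m"
   then have "i k~:N.el (N.app aN (i b))" using r(4) ms by auto
   moreover have "b:el LL" using \<open>b:el e\<close> h(1) LJ by auto
   ultimately show "i k~:N.el (AN (i b))" using aN by simp
  qed
  ultimately show "EX e' m' s'. i (pr e' (pr m' s')):N.el D3 & el e <= el e' & el m <= el m' & el s' <= el m' &
    el s' Int el m = el s & (av --> (ALL b:el e. ALL k:el s'. k~:el m --> i k~:N.el (AN (i b))))"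
   using D3 d h(1) by (intro exI[of _ e] exI[of _ m'] exI[of _ s'] conjI) simp_all
 qed blast
 show "EX S. N.lep S N.om & (ALL c:N.el (i LL). c~:N.el S --> (c:N.el (i JJ) --> av) -->
    (EX m s. N.pr m s:N.el D & m:N.el N.om & N.vint (N.app aN c) m = s))"
 proof (rule exI[of _ "i S"], intro conjI ballI impI)
  show "N.lep (i S) N.om" using i_lep[OF S(1)] by (simp add: i_omega)
  fix c assume "c:N.el (i LL)" "c~:N.el (i S)" "c:N.el (i JJ) --> av"
  then obtain c0 where c: "c = i c0" "c0:el LL" "c0~:el S" "c0:el JJ --> av" by auto
  obtain e m s where r: "i (pr e (pr m s)):N.el D3" "m:el om" "el s <= el m"
   "ALL k:el m. i k:N.el (AN (i c0)) <-> k:el s" using S(2)[OF c(2-4)] by blast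
  have "N.pr (i m) (i s):N.el D" using r(1) D3 by (simp add: i_pr)
  moreover have "i m:N.el N.om" using r(2) unfolding N_omega by blast
  moreover have "N.vint (N.app aN c) (i m) = i s"
   unfolding c(1) aN[OF c(2)] by (rule N.el_ext) (use r(3,4) in auto)
  ultimately show "EX m s. N.pr m s:N.el D & m:N.el N.om & N.vint (N.app aN c) m = s" by blast
 qed
qed

end

text \<open>The iterated singletons of the empty set show that the congruence of the Henkin model
  has infinitely many classes, so the quotient can be placed on \<open>nat\<close>.\<close>

lemma zfc_exists:
 assumes "consistent ZFC"
 shows "EX E :: nat => nat => bool. zfc E"
proof -
 obtain E Q :: "nat => nat => bool" where Q: "equivp Q"
  and cong: "!!x x' y y'. Q x x' ==> Q y y' ==> E x y = E x' y'" and sat: "!!q e. q:ZFC ==> satq E Q q e"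
  by (rule completeness[OF assms ZFC_closed]) blast+
 have "ALL x y. EX p. ALL z. E z p <-> Q z x | Q z y"
  using sat[of "sentence pairing" undefined] by (simp add: ZFC_def satq_pairing)
 then have "EX p. ALL z. E z p <-> Q z x" for x by meson
 then obtain s where s: "!!x z. E z (s x) <-> Q z x" by metis
 obtain e0 where e0: "!!z. ~ E z e0" using sat[of "sentence infinity" undefined] by (auto simp: ZFC_def satq_infinity)
 have refl: "Q x x" for x using Q by (rule equivp_reflp)
 have sym: "Q x y ==> Q y x" for x y using Q by (rule equivp_symp)
 define f where "f n = (s ^^ n) e0" for n
 have ne: "~ Q (f m) (f n)" if "m < n" for m n
  using that
 proof (induction m arbitrary: n)
  case 0
  then obtain k where "n = Suc k" by (cases n) auto
  then have "E (f k) (f n)" unfolding f_def by (simp add: s refl)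
  then show ?case using e0 cong[OF refl sym] by (auto simp: f_def)
 next
  case (Suc m)
  then obtain k where k: "n = Suc k" "m < k" by (cases n) auto
  show ?case
  proof
   assume "Q (f (Suc m)) (f n)"
   then have "E (f m) (f (Suc m)) = E (f m) (f n)" using cong refl by blast
   then have "Q (f m) (f k)" unfolding k f_def by (simp add: s refl)
   then show False using Suc.IH k(2) by blast
  qed
 qed
 have "inj (%n. Q (f n))"
 proof (rule injI)
  fix m n assume "Q (f m) = Q (f n)"
  then have "Q (f m) (f n)" "Q (f n) (f m)" using refl by metis+
  then show "m = n" using ne by (metis linorder_neqE_nat)
 qed
 then have "infinite (range (%n. Q (f n)))" by (rule range_inj_infinite)
 then have "infinite (range Q)" by (rule infinite_super[rotated]) auto
 then obtain g :: "nat => nat" where g: "surj g" "!!x y. g x = g y <-> Q x y" using nat_quotient[OF Q] by blast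
 define E' where "E' x y = E (inv g x) (inv g y)" for x y
 have E': "E' (g x) (g y) = E x y" for x y
 proof -
  have "Q (inv g (g x)) x" for x using g by (metis surj_f_inv_f)
  then show ?thesis unfolding E'_def using cong by blast
 qed
 have "zfc E'"
 proof
  fix q and e :: "nat => nat" assume q: "q:ZFC"
  have "e = g o (inv g o e)" by (rule ext) (simp add: surj_f_inv_f[OF g(1)])
  then show "sat E' q e" using sat[OF q, of "inv g o e"] satq_quotient[of g Q E' E, OF g E', of q "inv g o e"] by simp
 qed
 then show ?thesis by blast
qed

theorem corollary4p2:
 assumes "consistent ZFC"
 shows "consistent (insert (sentence (\<^bold>\<exists>\<omega>\<^sub>1 \<cc>.
   is_omega1 \<omega>\<^sub>1 \<^bold>\<and> is_continuum \<cc> \<^bold>\<and> \<omega>\<^sub>1 \<^bold>\<in> \<cc> \<^bold>\<and>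
   (\<^bold>\<exists>A\<^sub>0 A\<^sub>1. is_MAD A\<^sub>0 \<^bold>\<and> has_card A\<^sub>0 \<omega>\<^sub>1 \<^bold>\<and> is_MAD A\<^sub>1 \<^bold>\<and> has_card A\<^sub>1 \<cc> \<^bold>\<and>
    CL_Psi_pseudocompact A\<^sub>0 \<^bold>\<and> \<^bold>\<not> CL_Psi_pseudocompact A\<^sub>1))) ZFC)"
proof -
 obtain E :: "nat => nat => bool" where E: "zfc E" using zfc_exists[OF assms] by blast
 then obtain G where "forcing E (zfc.PP E) (zfc.LE E) G" by (rule forcing_exists)
 then interpret ext E G by (rule ext.intro)
 obtain K add mul lt ph where r: "N.rls K add mul lt" "ALL n:N.el N.om. N.app ph n:N.el K"
  "ALL b:N.el K. EX n:N.el N.om. N.pr b (N.app ph n):N.el lt"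
  using has_rls[OF zfc_EN] unfolding has_rls_def by blast
 have "N.H main_sentence 0 v" for v using gext.main[OF gext_EN r] .
 then have "sat EN (sentence main_sentence) e" for e
  by (subst satq_sentence[OF main_closed, where v = "%_. 0" and d = N.zero])
 then show ?thesis using N.ZFC by (intro consistentI[of _ EN]) blast
qed

end
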